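(* Let $(X_t)_{t\ge 0}$ be a symmetric $\mathbb R^d$-valued Lévy process as in the context, let $V$ be an $X$-Kato class potential such that $\lambda_0=\inf\operatorname{Spec}H$ is an isolated eigenvalue of $H=-L+V$, let $\varphi_0$ be the corresponding ground state, and let $\widetilde X$ be the corresponding ground state-transformed process with path measure $\widetilde{\mathbb P}$. Then for every non-decreasing function $\tau:[0,\infty)\to(0,\infty)$, $$\widetilde{\mathbb P}\big(|\widetilde X_n|\ge \tau(n)\ \text{for infinitely many } n\in\mathbb N\big)=\begin{cases}0 & \text{if } I_{\varphi_0}(1,\tau)<\infty,\\ 1 & \text{if } I_{\varphi_0}(1,\tau)=\infty,\end{cases}$$ where, for $c>0$, $$I_{\varphi_0}(c,\tau)=\int_1^\infty dr\int_{|x|\ge\tau(r)}\varphi_0^2(cx)\,dx .$$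
   Context: Lévy process: $d\ge1$; $(X_t)_{t\ge0}$ is an $\mathbb R^d$-valued Lévy process ($\mathbb P^x,\mathbb E^x$: law and expectation when started at $x$) with $\mathbb E^0[e^{i\xi\cdot X_t}]=e^{-t\psi(\xi)}$, $\psi(\xi)=A\xi\cdot\xi+\int_{\mathbb R^d}(1-\cos(\xi\cdot z))\,\nu(dz)$, where $A$ is a symmetric non-negative definite $d\times d$ matrix and $\nu$ is a symmetric Lévy measure with $\nu(\mathbb R^d\setminus\{0\})=\infty$ and $\nu(dx)=\nu(x)dx$ with density $\nu(x)>0$. Its $L^2(\mathbb R^d)$-generator $L$ is given by $\widehat{Lf}=-\psi\widehat f$. Potential: a Borel function $V:\mathbb R^d\to\mathbb R$ is of $X$-Kato class if $V_-\in\mathcal K^X$ and $V_+1_C\in\mathcal K^X$ for every compact $C\subset\mathbb R^d$, where $h\in\mathcal K^X$ means $\lim_{t\downarrow0}\sup_{x\in\mathbb R^d}\mathbb E^x\big[\int_0^t|h(X_s)|ds\big]=0$. The operators $T_tf(x)=\mathbb E^x[e^{-\int_0^tV(X_s)ds}f(X_t)]$ form a strongly continuous symmetric semigroup on $L^2(\mathbb R^d)$, and $H=-L+V$ (form sum) is the self-adjoint operator, bounded from below, with $T_t=e^{-tH}$. Ground state: when $\lambda_0=\inf\operatorname{Spec}H\in\mathbb R$ is an isolated eigenvalue of $H$, $\varphi_0$ denotes its unique strictly positive eigenfunction with $\|\varphi_0\|_{L^2}=1$. Ground state-transformed (GST) process: $\widetilde T_tf=\frac{e^{\lambda_0t}}{\varphi_0}T_t(\varphi_0f)$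 is a Markov semigroup on $L^2(\mathbb R^d,\varphi_0^2dx)$. The GST process $(\widetilde X_t)_{t\in\mathbb R}$ is the associated stationary càdlàg Markov process on two-sided càdlàg path space; $\widetilde{\mathbb P}^x$ is its law with $\widetilde X_0=x$, and its path measure is $\widetilde{\mathbb P}(\cdot)=\int_{\mathbb R^d}\widetilde{\mathbb P}^x(\cdot)\varphi_0^2(x)dx$. Thus for $t_0\le\dots\le t_n$, $\mathbb E_{\widetilde{\mathbb P}}[\prod_{j=0}^nf_j(\widetilde X_{t_j})]=(f_0,\widetilde T_{t_1-t_0}f_1\cdots\widetilde T_{t_n-t_{n-1}}f_n)_{L^2(\mathbb R^d,\varphi_0^2dx)}$ for $f_0,f_n\in L^2(\mathbb R^d,\varphi_0^2dx)$ and bounded $f_1,\dots,f_{n-1}$. *)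

theory Defs
  imports "HOL-Probability.Probability"
begin

text \<open>
  Euclidean space is \<^typ>\<open>real ^ 'n\<close>, where the finite index type \<^typ>\<open>'n\<close> plays the role of
  \<open>{1..d}\<close>. A process is a map \<open>X :: real \<Rightarrow> 'w \<Rightarrow> 'a\<close> on a probability space \<open>M\<close>.
\<close>

definition cadlag_on :: "real set \<Rightarrow> (real \<Rightarrow> 'a::topological_space) \<Rightarrow> bool" where
  "cadlag_on S w \<longleftrightarrow>
     (\<forall>t\<in>S. continuous (at t within (S \<inter> {t..})) w \<and>
            (\<exists>l. (w \<longlongrightarrow> l) (at t within (S \<inter> {..<t}))))"

subsection \<open>Levy processes\<close>

definition symmetric_levy_measure :: "'a::euclidean_space measure \<Rightarrow> bool" where
  "symmetric_levy_measure \<nu> \<longleftrightarrow>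
     sets \<nu> = sets borel \<and> emeasure \<nu> {0} = 0 \<and>
     (\<integral>\<^sup>+z. ennreal (min 1 ((norm z)\<^sup>2)) \<partial>\<nu>) < \<infinity> \<and>
     distr \<nu> borel uminus = \<nu>"

definition levy_exponent :: "real ^ 'n ^ 'n \<Rightarrow> (real ^ 'n) measure \<Rightarrow> real ^ 'n \<Rightarrow> real" where
  "levy_exponent A \<nu> \<xi> = (A *v \<xi>) \<bullet> \<xi> + (\<integral>z. (1 - cos (\<xi> \<bullet> z)) \<partial>\<nu>)"

text \<open>
  The process started at the origin, with time set \<open>[0,\<infinity>)\<close>; values of \<open>X t\<close> for \<open>t < 0\<close> are
  irrelevant. The process started at \<open>x\<close> is \<open>x + X\<close>, so that an expectation of \<open>F(X)\<close> under
  the law with starting point \<open>x\<close> is written below as the expectation of \<open>F(x + X)\<close>.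
\<close>
definition levy_process :: "'w measure \<Rightarrow> (real \<Rightarrow> 'w \<Rightarrow> 'a::euclidean_space) \<Rightarrow> bool" where
  "levy_process M X \<longleftrightarrow>
     prob_space M \<and>
     (\<forall>t\<ge>0. X t \<in> borel_measurable M) \<and>
     (AE w in M. X 0 w = 0) \<and>
     (\<forall>(n::nat) (t::nat \<Rightarrow> real). 0 \<le> t 0 \<longrightarrow> (\<forall>i<n. t i \<le> t (Suc i)) \<longrightarrow>
        prob_space.indep_vars M (\<lambda>_. borel) (\<lambda>i w. X (t (Suc i)) w - X (t i) w) {..<n}) \<and>
     (\<forall>s t. 0 \<le> s \<longrightarrow> s \<le> t \<longrightarrow>
        distr M borel (\<lambda>w. X t w - X s w) = distr M borel (X (t - s))) \<and>
     (\<forall>w\<in>space M. cadlag_on {0..} (\<lambda>t. X t w))"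

definition has_levy_exponent ::
    "'w measure \<Rightarrow> (real \<Rightarrow> 'w \<Rightarrow> 'a::euclidean_space) \<Rightarrow> ('a \<Rightarrow> real) \<Rightarrow> bool" where
  "has_levy_exponent M X \<psi> \<longleftrightarrow>
     (\<forall>t\<ge>0. \<forall>\<xi>. (\<integral>w. exp (\<i> * complex_of_real (\<xi> \<bullet> X t w)) \<partial>M)
                  = complex_of_real (exp (- t * \<psi> \<xi>)))"

subsection \<open>Kato class\<close>

definition kato_class ::
    "'w measure \<Rightarrow> (real \<Rightarrow> 'w \<Rightarrow> 'a::euclidean_space) \<Rightarrow> ('a \<Rightarrow> real) set" where
  "kato_class M X =
     {h \<in> borel_measurable borel.
        ((\<lambda>t. SUP x. \<integral>\<^sup>+w. (\<integral>\<^sup>+s\<in>{0..t}. ennreal \<bar>h (x + X s w)\<bar> \<partial>lborel) \<partial>M) \<longlongrightarrow> 0)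
          (at_right 0)}"

definition X_kato_potential ::
    "'w measure \<Rightarrow> (real \<Rightarrow> 'w \<Rightarrow> 'a::euclidean_space) \<Rightarrow> ('a \<Rightarrow> real) \<Rightarrow> bool" where
  "X_kato_potential M X V \<longleftrightarrow>
     V \<in> borel_measurable borel \<and>
     (\<lambda>x. max (- V x) 0) \<in> kato_class M X \<and>
     (\<forall>C. compact C \<longrightarrow> (\<lambda>x. max (V x) 0 * indicator C x) \<in> kato_class M X)"

subsection \<open>Feynman--Kac semigroup and Schroedinger operator\<close>

text \<open>
  Elements of \<open>L2\<close> are represented by functions, with equality almost everywhere always
  spelled out.
\<close>
definition L2 :: "'a measure \<Rightarrow> ('a \<Rightarrow> 'b::{real_normed_vector, second_countable_topology}) set"
  where "L2 N = {f \<in> borel_measurable N. integrable N (\<lambda>x. (norm (f x))\<^sup>2)}"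

definition L2_norm :: "'a measure \<Rightarrow> ('a \<Rightarrow> 'b::{real_normed_vector, second_countable_topology}) \<Rightarrow> real"
  where "L2_norm N f = sqrt (\<integral>x. (norm (f x))\<^sup>2 \<partial>N)"

definition feynman_kac ::
    "'w measure \<Rightarrow> (real \<Rightarrow> 'w \<Rightarrow> 'a::euclidean_space) \<Rightarrow> ('a \<Rightarrow> real) \<Rightarrow> real \<Rightarrow>
     ('a \<Rightarrow> 'b::{banach, second_countable_topology}) \<Rightarrow> 'a \<Rightarrow> 'b" where
  "feynman_kac M X V t f x =
     (\<integral>w. exp (- (LINT s:{0..t}|lborel. V (x + X s w))) *\<^sub>R f (x + X t w) \<partial>M)"

text \<open>
  The graph of the operator \<open>H\<close> on the complex space \<open>L2\<close> with \<open>T\<^sub>t = exp (- t H)\<close>, where \<open>T\<^sub>t\<close> is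
  the Feynman--Kac semigroup: this identity says that \<open>- H\<close> is the generator of \<open>T\<^sub>t\<close>, that is,
  \<open>H f = lim (f - T\<^sub>t f) / t\<close> in \<open>L2\<close> as \<open>t\<close> decreases to \<open>0\<close>, with domain all \<open>f\<close> for which the limit
  exists. The squared distance is an extended nonnegative integral, so that convergence cannot
  hold merely because an integral is undefined.
\<close>
definition schroedinger_op ::
    "'w measure \<Rightarrow> (real \<Rightarrow> 'w \<Rightarrow> 'a::euclidean_space) \<Rightarrow> ('a \<Rightarrow> real) \<Rightarrow>
     ('a \<Rightarrow> complex) \<Rightarrow> ('a \<Rightarrow> complex) \<Rightarrow> bool" where
  "schroedinger_op M X V f g \<longleftrightarrow>
     f \<in> L2 lborel \<and> g \<in> L2 lborel \<and>
     ((\<lambda>t. \<integral>\<^sup>+x. ennreal ((norm ((1 / t) *\<^sub>R (f x - feynman_kac M X V t f x) - g x))\<^sup>2) \<partial>lborel)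
        \<longlongrightarrow> 0) (at_right 0)"

text \<open>
  For an operator given by its graph, \<open>z\<close> is in the resolvent set if \<open>H - z\<close> is a bijection from
  the domain onto \<open>L2\<close> with bounded inverse; injectivity is contained in the norm bound.
\<close>
definition resolvent_set ::
    "(('a::euclidean_space \<Rightarrow> complex) \<Rightarrow> ('a \<Rightarrow> complex) \<Rightarrow> bool) \<Rightarrow> complex set" where
  "resolvent_set H =
     {z. (\<forall>g \<in> L2 lborel. \<exists>f h. H f h \<and> (AE x in lborel. h x - z * f x = g x)) \<and>
         (\<exists>C. \<forall>f h. H f h \<longrightarrow> L2_norm lborel f \<le> C * L2_norm lborel (\<lambda>x. h x - z * f x))}"

definition spectrum ::
    "(('a::euclidean_space \<Rightarrow> complex) \<Rightarrow> ('a \<Rightarrow> complex) \<Rightarrow> bool) \<Rightarrow> complex set" where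
  "spectrum H = - resolvent_set H"

definition eigenfunction ::
    "(('a::euclidean_space \<Rightarrow> complex) \<Rightarrow> ('a \<Rightarrow> complex) \<Rightarrow> bool) \<Rightarrow> complex \<Rightarrow> ('a \<Rightarrow> complex) \<Rightarrow> bool" where
  "eigenfunction H z f \<longleftrightarrow> H f (\<lambda>x. z * f x) \<and> \<not> (AE x in lborel. f x = 0)"

definition isolated_eigenvalue ::
    "(('a::euclidean_space \<Rightarrow> complex) \<Rightarrow> ('a \<Rightarrow> complex) \<Rightarrow> bool) \<Rightarrow> complex \<Rightarrow> bool" where
  "isolated_eigenvalue H z \<longleftrightarrow> z isolated_in spectrum H \<and> (\<exists>f. eigenfunction H z f)"

definition ground_state ::
    "(('a::euclidean_space \<Rightarrow> complex) \<Rightarrow> ('a \<Rightarrow> complex) \<Rightarrow> bool) \<Rightarrow> real \<Rightarrow> ('a \<Rightarrow> real) \<Rightarrow> bool" where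
  "ground_state H lam0 \<phi> \<longleftrightarrow>
     eigenfunction H (complex_of_real lam0) (\<lambda>x. complex_of_real (\<phi> x)) \<and>
     \<phi> \<in> borel_measurable borel \<and> (\<forall>x. 0 < \<phi> x) \<and> L2_norm lborel \<phi> = 1"

subsection \<open>Ground state-transformed process\<close>

definition gs_measure :: "('a::euclidean_space \<Rightarrow> real) \<Rightarrow> 'a measure" where
  "gs_measure \<phi> = density lborel (\<lambda>x. ennreal ((\<phi> x)\<^sup>2))"

definition gst_semigroup ::
    "'w measure \<Rightarrow> (real \<Rightarrow> 'w \<Rightarrow> 'a::euclidean_space) \<Rightarrow> ('a \<Rightarrow> real) \<Rightarrow> real \<Rightarrow> ('a \<Rightarrow> real) \<Rightarrow>
     real \<Rightarrow> ('a \<Rightarrow> real) \<Rightarrow> 'a \<Rightarrow> real" where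
  "gst_semigroup M X V lam0 \<phi> t f x =
     exp (lam0 * t) / \<phi> x * feynman_kac M X V t (\<lambda>y. \<phi> y * f y) x"

text \<open>
  Two-sided path space with the sigma-algebra generated by the coordinate maps.
\<close>
definition cadlag_space :: "(real \<Rightarrow> 'a::euclidean_space) measure" where
  "cadlag_space = restrict_space (\<Pi>\<^sub>M t\<in>UNIV. borel) {w. cadlag_on UNIV w}"

definition path_measure ::
    "('a::euclidean_space \<Rightarrow> real) \<Rightarrow> ('a \<Rightarrow> (real \<Rightarrow> 'a) measure) \<Rightarrow> (real \<Rightarrow> 'a) measure" where
  "path_measure \<phi> P = gs_measure \<phi> \<bind> P"

text \<open>
  \<open>nested T t f n\<close> is the function
  \<open>f\<^sub>0 \<cdot> T (t\<^sub>1 - t\<^sub>0) (f\<^sub>1 \<cdot> T (t\<^sub>2 - t\<^sub>1) (f\<^sub>2 \<cdot> \<dots> T (t\<^sub>n - t\<^sub>n\<^sub>-\<^sub>1) f\<^sub>n))\<close>.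
\<close>
primrec nested ::
    "(real \<Rightarrow> ('a \<Rightarrow> real) \<Rightarrow> 'a \<Rightarrow> real) \<Rightarrow> (nat \<Rightarrow> real) \<Rightarrow> (nat \<Rightarrow> 'a \<Rightarrow> real) \<Rightarrow> nat \<Rightarrow> 'a \<Rightarrow> real"
  where
    "nested T t f 0 = f 0"
  | "nested T t f (Suc n) =
       (\<lambda>x. f 0 x * T (t 1 - t 0) (nested T (\<lambda>i. t (Suc i)) (\<lambda>i. f (Suc i)) n) x)"

text \<open>
  \<open>P x\<close> is the law on path space of the process at \<open>x\<close> at time \<open>0\<close>. Stationarity and the Markov
  property under the path measure are contained in the formula for the finite-dimensional
  distributions.
\<close>
definition gst_process ::
    "'w measure \<Rightarrow> (real \<Rightarrow> 'w \<Rightarrow> 'a::euclidean_space) \<Rightarrow> ('a \<Rightarrow> real) \<Rightarrow> real \<Rightarrow> ('a \<Rightarrow> real) \<Rightarrow>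
     ('a \<Rightarrow> (real \<Rightarrow> 'a) measure) \<Rightarrow> bool" where
  "gst_process M X V lam0 \<phi> P \<longleftrightarrow>
     P \<in> measurable borel (prob_algebra cadlag_space) \<and>
     (\<forall>x. AE w in P x. w 0 = x) \<and>
     (\<forall>(n::nat) (t::nat \<Rightarrow> real) (f::nat \<Rightarrow> 'a \<Rightarrow> real).
        (\<forall>i<n. t i \<le> t (Suc i)) \<longrightarrow>
        (\<forall>j\<le>n. f j \<in> borel_measurable borel) \<longrightarrow>
        f 0 \<in> L2 (gs_measure \<phi>) \<longrightarrow> f n \<in> L2 (gs_measure \<phi>) \<longrightarrow>
        (\<forall>j. 0 < j \<and> j < n \<longrightarrow> bounded (range (f j))) \<longrightarrow>
        (\<integral>w. (\<Prod>j\<le>n. f j (w (t j))) \<partial>path_measure \<phi> P)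
          = (\<integral>x. nested (gst_semigroup M X V lam0 \<phi>) t f n x \<partial>gs_measure \<phi>))"

subsection \<open>Integral test\<close>

definition integral_test ::
    "('a::euclidean_space \<Rightarrow> real) \<Rightarrow> real \<Rightarrow> (real \<Rightarrow> real) \<Rightarrow> ennreal" where
  "integral_test \<phi> c \<tau> =
     (\<integral>\<^sup>+r\<in>{1..}. (\<integral>\<^sup>+x\<in>{x. \<tau> r \<le> norm x}. ennreal ((\<phi> (c *\<^sub>R x))\<^sup>2) \<partial>lborel) \<partial>lborel)"

end

theory Submission
  imports Defs
begin

text \<open>
  Write \<open>\<mu> = \<phi>\<^sub>0\<^sup>2 dx\<close> and \<open>A\<^sub>n = {|X\<^sub>n| \<ge> \<tau>(n)}\<close> for the events of the transformed process. The
  process is stationary with marginal \<open>\<mu>\<close>, so that \<open>P(A\<^sub>n) = \<mu>{|x| \<ge> \<tau>(n)}\<close>, and since \<open>\<tau>\<close> is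
  non-decreasing the integral test compares \<open>I(1,\<tau>)\<close> with the series of these probabilities (lemma
  \<open>integral_test_iff\<close>). If the series converges, the first Borel--Cantelli lemma gives probability
  0. If it diverges, the events need not be independent, but their correlations decay exponentially,
  and Chebyshev's inequality for the number of occurrences gives probability 1 (lemma
  \<open>borel_cantelli_decaying_correlations\<close>).

  Decay of correlations means that \<open>|(T\<^sub>n a, b)| \<le> r\<^sup>n \<parallel>a\<parallel> \<parallel>b\<parallel>\<close> for some \<open>r < 1\<close> and all \<open>b\<close>
  orthogonal to 1, where \<open>T\<close> is the transformed semigroup on \<open>L\<^sup>2(\<mu>)\<close> (theorem \<open>spectral_gap\<close>).
  Multiplication by \<open>\<phi>\<^sub>0\<close> carries the generator \<open>G\<close> of \<open>T\<close> (with \<open>T\<^sub>t = e\<^sup>-\<^sup>t\<^sup>G\<close>) to \<open>H - \<lambda>\<^sub>0\<close>, so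
  the isolation of \<open>\<lambda>\<^sub>0\<close> puts an interval \<open>(0, \<epsilon>)\<close> into the resolvent set of \<open>G\<close>. The gap is derived
  from this interval without a spectral theorem. With \<open>l = \<epsilon>/2\<close> the resolvent at \<open>l\<close> has norm at
  most \<open>1/l\<close> (lemma \<open>resolvent_norm_bound\<close>), that is \<open>\<parallel>Gf\<parallel>\<^sup>2 \<ge> 2l (Gf, f)\<close>; hence \<open>t \<mapsto> (T\<^sub>t f, Gf)\<close>,
  whose derivative is \<open>-(T\<^sub>t Gf, Gf)\<close>, decays like \<open>e\<^sup>-\<^sup>2\<^sup>l\<^sup>t\<close> (lemma \<open>gen_decay\<close>). So \<open>T\<^sub>n f\<close>
  converges exponentially fast to an invariant function. Invariant functions are constant, so the
  limit vanishes for \<open>f\<close> orthogonal to 1, and log-convexity of \<open>t \<mapsto> (T\<^sub>t f, f)\<close> turns decay with a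
  constant depending on \<open>f\<close> into the uniform bound.

  Two properties of the Levy process enter. First, \<open>T\<close> is symmetric on \<open>L\<^sup>2(\<mu>)\<close>: the path reversed
  at time \<open>t\<close> has the same finite-dimensional distributions, and these determine the joint law of
  the Feynman--Kac weight and the endpoint, through the moments of integrals of nonnegative
  functions along the path (lemma \<open>same_fdd_feynman_kac_weight\<close>, theorem \<open>feynman_kac_symmetric\<close>).
  Second, \<open>T\<close> is irreducible: a level set of an invariant function is a set \<open>A\<close> that almost every
  path started in it never leaves at integer times, because the weights are strictly positive. For a
  Levy process such a set is null or conull (lemma \<open>levy_no_invariant_set\<close>). In Fourier variables
  the probability of passing from \<open>S\<close> to \<open>S'\<close> is a regularized integral of \<open>e\<^sup>-\<^sup>n\<^sup>\<psi> \<Theta>\<close>, where \<open>\<Theta>\<close> is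
  positive near the origin; as \<open>\<psi>\<close> vanishes only at the origin, and is bounded away from 0 off every
  ball since \<open>\<nu>\<close> has a positive density, the contribution near the origin dominates for large \<open>n\<close>.
\<close>

section \<open>Inner products and one-sided derivatives\<close>

definition ip :: "'a measure \<Rightarrow> ('a \<Rightarrow> real) \<Rightarrow> ('a \<Rightarrow> real) \<Rightarrow> real" where
  "ip N f g = (\<integral>x. f x * g x \<partial>N)"

lemma L2_real_iff:
  fixes f :: "'a \<Rightarrow> real"
  shows "f \<in> L2 N \<longleftrightarrow> f \<in> borel_measurable N \<and> integrable N (\<lambda>x. (f x)\<^sup>2)"
  by (simp add: L2_def)

lemma integrable_mult_L2:
  fixes f g :: "'a \<Rightarrow> real"
  assumes "f \<in> L2 N" "g \<in> L2 N"
  shows "integrable N (\<lambda>x. f x * g x)"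
proof (rule Bochner_Integration.integrable_bound)
  show "integrable N (\<lambda>x. (f x)\<^sup>2 + (g x)\<^sup>2)" using assms by (auto simp: L2_real_iff)
  show "(\<lambda>x. f x * g x) \<in> borel_measurable N" using assms by (auto simp: L2_real_iff)
  show "AE x in N. norm (f x * g x) \<le> norm ((f x)\<^sup>2 + (g x)\<^sup>2)"
  proof (rule AE_I2)
    fix x
    have "0 \<le> (\<bar>f x\<bar> - \<bar>g x\<bar>)\<^sup>2" by simp
    then have "2 * (\<bar>f x\<bar> * \<bar>g x\<bar>) \<le> (f x)\<^sup>2 + (g x)\<^sup>2" by (simp add: power2_diff)
    moreover have "0 \<le> \<bar>f x\<bar> * \<bar>g x\<bar>" by simp
    ultimately have "\<bar>f x\<bar> * \<bar>g x\<bar> \<le> (f x)\<^sup>2 + (g x)\<^sup>2" by linarith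
    then show "norm (f x * g x) \<le> norm ((f x)\<^sup>2 + (g x)\<^sup>2)" by (simp add: abs_mult)
  qed
qed

lemma L2_lincomb:
  fixes f g :: "'a \<Rightarrow> real"
  assumes "f \<in> L2 N" "g \<in> L2 N"
  shows "(\<lambda>x. a * f x + b * g x) \<in> L2 N"
proof -
  have "integrable N (\<lambda>x. a\<^sup>2 * (f x)\<^sup>2 + b\<^sup>2 * (g x)\<^sup>2 + 2 * a * b * (f x * g x))"
    using assms integrable_mult_L2[OF assms] by (auto simp: L2_real_iff)
  moreover have "(\<lambda>x. a\<^sup>2 * (f x)\<^sup>2 + b\<^sup>2 * (g x)\<^sup>2 + 2 * a * b * (f x * g x)) = (\<lambda>x. (a * f x + b * g x)\<^sup>2)"
    by (auto simp: power2_eq_square algebra_simps)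
  ultimately show ?thesis using assms by (auto simp: L2_real_iff)
qed

lemma ip_commute: "ip N f g = ip N g f"
  by (simp add: ip_def mult.commute)

lemma ip_nonneg: "0 \<le> ip N f f"
  by (auto simp: ip_def intro!: integral_nonneg_AE)

lemma ip_lincomb_left:
  assumes "f \<in> L2 N" "g \<in> L2 N" "k \<in> L2 N"
  shows "ip N (\<lambda>x. a * f x + b * g x) k = a * ip N f k + b * ip N g k"
proof -
  have "ip N (\<lambda>x. a * f x + b * g x) k = (\<integral>x. a * (f x * k x) + b * (g x * k x) \<partial>N)"
    by (simp add: ip_def algebra_simps)
  also have "\<dots> = a * ip N f k + b * ip N g k"
    using integrable_mult_L2[OF assms(1,3)] integrable_mult_L2[OF assms(2,3)]
    by (simp add: ip_def)
  finally show ?thesis .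
qed

lemma ip_lincomb_right:
  assumes "f \<in> L2 N" "g \<in> L2 N" "k \<in> L2 N"
  shows "ip N k (\<lambda>x. a * f x + b * g x) = a * ip N k f + b * ip N k g"
  using ip_lincomb_left[OF assms] by (simp add: ip_commute)

lemma ip_lincomb_self:
  assumes "f \<in> L2 N" "g \<in> L2 N"
  shows "ip N (\<lambda>x. a * f x + b * g x) (\<lambda>x. a * f x + b * g x)
       = a\<^sup>2 * ip N f f + 2 * a * b * ip N f g + b\<^sup>2 * ip N g g"
  using assms
  by (simp add: ip_lincomb_left ip_lincomb_right L2_lincomb ip_commute[of N g f]
      power2_eq_square algebra_simps)

lemma ip_Cauchy_Schwarz:
  assumes "f \<in> L2 N" "g \<in> L2 N"
  shows "(ip N f g)\<^sup>2 \<le> ip N f f * ip N g g"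
proof (cases "ip N g g = 0")
  case False
  define c where "c = ip N f g / ip N g g"
  have "0 \<le> ip N (\<lambda>x. 1 * f x + (- c) * g x) (\<lambda>x. 1 * f x + (- c) * g x)"
    by (rule ip_nonneg)
  also have "\<dots> = ip N f f - 2 * c * ip N f g + c\<^sup>2 * ip N g g"
    unfolding ip_lincomb_self[OF assms] by simp
  finally have "0 \<le> ip N f f - (ip N f g)\<^sup>2 / ip N g g"
    using False by (simp add: c_def power2_eq_square field_simps)
  then show ?thesis using False ip_nonneg[of N g] by (simp add: field_simps)
next
  case True
  have "0 \<le> ip N f f - 2 * c * ip N f g" for c
  proof -
    have "0 \<le> ip N (\<lambda>x. 1 * f x + (- c) * g x) (\<lambda>x. 1 * f x + (- c) * g x)"
      by (rule ip_nonneg)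
    also have "\<dots> = ip N f f - 2 * c * ip N f g"
      unfolding ip_lincomb_self[OF assms] using True by simp
    finally show ?thesis .
  qed
  from this[of "(ip N f f + 1) / (2 * ip N f g)"] have "ip N f g = 0"
    by (cases "ip N f g = 0") auto
  then show ?thesis using True by simp
qed

lemma ip_Cauchy_Schwarz_abs:
  assumes "f \<in> L2 N" "g \<in> L2 N"
  shows "\<bar>ip N f g\<bar> \<le> sqrt (ip N f f) * sqrt (ip N g g)"
  using real_sqrt_le_mono[OF ip_Cauchy_Schwarz[OF assms]] by (simp add: real_sqrt_mult)

lemma ip_lincomb_le:
  assumes "f \<in> L2 N" "g \<in> L2 N"
  shows "ip N (\<lambda>x. a * f x + b * g x) (\<lambda>x. a * f x + b * g x)
       \<le> 2 * a\<^sup>2 * ip N f f + 2 * b\<^sup>2 * ip N g g"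
proof -
  have "0 \<le> ip N (\<lambda>x. a * f x + (- b) * g x) (\<lambda>x. a * f x + (- b) * g x)"
    by (rule ip_nonneg)
  then show ?thesis unfolding ip_lincomb_self[OF assms] by (simp add: algebra_simps)
qed

text \<open>
  Elements of \<open>L\<^sup>2\<close> are represented by functions. Operator identities are therefore stated in weak
  form, tested against all of \<open>L\<^sup>2\<close>; this lemma converts a weak identity into an equality of norms.
\<close>
lemma ip_self_cong:
  assumes "f \<in> L2 N" "g \<in> L2 N" "\<And>k. k \<in> L2 N \<Longrightarrow> ip N f k = ip N g k"
  shows "ip N f f = ip N g g"
  using assms(3)[OF assms(1)] assms(3)[OF assms(2)] by (simp add: ip_commute)

text \<open>
  The functions \<open>t \<mapsto> (T\<^sub>t f, k)\<close> below come with right derivatives only. Allowing a slope \<open>c > 0\<close>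
  for slack, the set of times satisfying the bound is closed and can be extended to the right from
  any of its points; letting \<open>c\<close> tend to 0 gives the claim.
\<close>
lemma right_deriv_nonpos_imp_le:
  fixes F :: "real \<Rightarrow> real"
  assumes ab: "a \<le> b" and cont: "continuous_on {a..b} F"
    and der: "\<And>t. a \<le> t \<Longrightarrow> t < b \<Longrightarrow> \<exists>d\<le>0. (F has_real_derivative d) (at_right t)"
  shows "F b \<le> F a"
proof (rule field_le_epsilon)
  fix e :: real assume e: "0 < e"
  define c where "c = e / (b - a + 1)"
  have c: "c > 0" using e ab by (simp add: c_def)
  define S where "S = {t\<in>{a..b}. F t \<le> F a + c * (t - a)}"
  have "\<forall>t\<in>{a..b}. t \<in> S"
  proof (rule ccontr)
    assume "\<not> ?thesis"
    then obtain t0 where t0: "t0 \<in> {a..b}" "t0 \<notin> S" by auto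
    define U where "U = {t\<in>{a..t0}. F t \<le> F a + c * (t - a)}"
    have "closed U"
    proof -
      have "continuous_on {a..t0} F" using cont t0(1) by (auto intro: continuous_on_subset)
      then have "closed {t\<in>{a..t0}. F t - (F a + c * (t - a)) \<le> 0}"
        by (intro continuous_on_closed_Collect_le continuous_intros) auto
      then show ?thesis by (simp add: U_def)
    qed
    moreover have "bounded U" by (rule bounded_subset[of "{a..t0}"]) (auto simp: U_def)
    ultimately have "compact U" by (simp add: compact_eq_bounded_closed)
    moreover have "a \<in> U" using t0 by (simp add: U_def)
    \<comment> \<open>The last time before \<open>t0\<close> at which the bound holds; the right derivative there pushes
      the bound further, a contradiction.\<close>
    ultimately obtain u where u: "u \<in> U" "\<And>t. t \<in> U \<Longrightarrow> t \<le> u"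
      using compact_attains_sup[of U] by auto
    have ut: "u < t0" using u(1) t0 by (cases "u = t0") (auto simp: U_def S_def)
    have "a \<le> u" "u < b" using u ut t0 by (auto simp: U_def)
    from der[OF this] obtain d where d: "d \<le> 0" "((\<lambda>y. (F y - F u) / (y - u)) \<longlongrightarrow> d) (at_right u)"
      unfolding has_field_derivative_iff by blast
    have "d < c" using d(1) c by simp
    then have "eventually (\<lambda>y. (F y - F u) / (y - u) < c) (at_right u)"
      by (rule order_tendstoD(2)[OF d(2)])
    moreover have "eventually (\<lambda>y. y \<in> {u<..<t0}) (at_right u)"
      by (rule eventually_at_right_real) (use ut in simp)
    ultimately have "eventually (\<lambda>y. (F y - F u) / (y - u) < c \<and> y \<in> {u<..<t0}) (at_right u)"
      by (rule eventually_conj)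
    then obtain y where y: "(F y - F u) / (y - u) < c" "u < y" "y < t0"
      using eventually_happens'[OF trivial_limit_at_right_real] by (metis (no_types, lifting) greaterThanLessThan_iff)
    define s where "s = y - u"
    have s: "s > 0" "s < t0 - u" "F (u + s) < F u + c * s" using y by (auto simp: s_def field_simps)
    then have "u + s \<in> U" using u(1) s by (auto simp: U_def algebra_simps)
    from u(2)[OF this] s show False by simp
  qed
  then have "F b \<le> F a + c * (b - a)" using ab by (auto simp: S_def)
  also have "c * (b - a) \<le> e" using e ab by (simp add: c_def field_simps)
  finally show "F b \<le> F a + e" by simp
qed

section \<open>Symmetric contraction semigroups and their generators\<close>

text \<open>
  Semigroup law, linearity and \<open>T\<^sub>0 = 1\<close> are required in weak form only, since a concrete \<open>T t f\<close>
  given by an integral is determined, and behaves well, only almost everywhere.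
\<close>
locale symmetric_semigroup = prob_space N for N :: "'a measure" +
  fixes T :: "real \<Rightarrow> ('a \<Rightarrow> real) \<Rightarrow> 'a \<Rightarrow> real"
  assumes T_L2: "0 \<le> t \<Longrightarrow> f \<in> L2 N \<Longrightarrow> T t f \<in> L2 N"
    and T_sym: "0 \<le> t \<Longrightarrow> f \<in> L2 N \<Longrightarrow> g \<in> L2 N \<Longrightarrow> ip N (T t f) g = ip N f (T t g)"
    and T_add: "0 \<le> s \<Longrightarrow> 0 \<le> t \<Longrightarrow> f \<in> L2 N \<Longrightarrow> g \<in> L2 N \<Longrightarrow>
                  ip N (T s (T t f)) g = ip N (T (s + t) f) g"
    and T_lincomb: "0 \<le> t \<Longrightarrow> f \<in> L2 N \<Longrightarrow> g \<in> L2 N \<Longrightarrow> k \<in> L2 N \<Longrightarrow>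
                  ip N (T t (\<lambda>x. a * f x + b * g x)) k = a * ip N (T t f) k + b * ip N (T t g) k"
    and T_0: "f \<in> L2 N \<Longrightarrow> g \<in> L2 N \<Longrightarrow> ip N (T 0 f) g = ip N f g"
    and T_contr: "0 \<le> t \<Longrightarrow> f \<in> L2 N \<Longrightarrow> ip N (T t f) (T t f) \<le> ip N f f"
begin

definition q :: "real \<Rightarrow> ('a \<Rightarrow> real) \<Rightarrow> ('a \<Rightarrow> real) \<Rightarrow> real" where
  "q t f g = ip N (T t f) g"

lemma q_commute: "0 \<le> t \<Longrightarrow> f \<in> L2 N \<Longrightarrow> g \<in> L2 N \<Longrightarrow> q t f g = q t g f"
  by (metis q_def T_sym ip_commute)

lemma q_0: "f \<in> L2 N \<Longrightarrow> g \<in> L2 N \<Longrightarrow> q 0 f g = ip N f g"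
  by (simp add: q_def T_0)

lemma ip_T_T:
  assumes "0 \<le> s" "0 \<le> t" "f \<in> L2 N" "g \<in> L2 N"
  shows "ip N (T s f) (T t g) = q (s + t) f g"
  using assms T_add[of t s f g] T_sym[of t "T s f" g]
  by (simp add: q_def T_L2 add.commute)

lemma q_T:
  assumes "0 \<le> r" "0 \<le> s" "0 \<le> t" "f \<in> L2 N" "g \<in> L2 N"
  shows "q r (T s f) (T t g) = q (r + s + t) f g"
proof -
  have "q r (T s f) (T t g) = ip N (T (r + s) f) (T t g)"
    using assms by (simp add: q_def T_add T_L2)
  then show ?thesis using assms by (simp add: ip_T_T)
qed

lemma q_lincomb_left:
  "0 \<le> t \<Longrightarrow> f \<in> L2 N \<Longrightarrow> g \<in> L2 N \<Longrightarrow> k \<in> L2 N \<Longrightarrow>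
    q t (\<lambda>x. a * f x + b * g x) k = a * q t f k + b * q t g k"
  by (simp add: q_def T_lincomb)

lemma q_lincomb_right:
  "0 \<le> t \<Longrightarrow> f \<in> L2 N \<Longrightarrow> g \<in> L2 N \<Longrightarrow> k \<in> L2 N \<Longrightarrow>
    q t k (\<lambda>x. a * f x + b * g x) = a * q t k f + b * q t k g"
  by (simp add: q_def ip_lincomb_right T_L2)

lemma q_self_half:
  assumes "0 \<le> t" "f \<in> L2 N"
  shows "q t f f = ip N (T (t / 2) f) (T (t / 2) f)"
  using assms by (simp add: ip_T_T)

lemma q_self_nonneg: "0 \<le> t \<Longrightarrow> f \<in> L2 N \<Longrightarrow> 0 \<le> q t f f"
  by (simp add: q_self_half ip_nonneg)

lemma q_self_antimono:
  assumes "0 \<le> s" "s \<le> t" "f \<in> L2 N"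
  shows "q t f f \<le> q s f f"
proof -
  have "2 * ((t - s) / 2) + s = t" by (simp add: field_simps)
  then have "q t f f = q (2 * ((t - s) / 2) + s) f f" by simp
  also have "\<dots> = ip N (T ((t - s) / 2) (T (s / 2) f)) (T ((t - s) / 2) (T (s / 2) f))"
    using assms by (simp add: ip_T_T T_L2 q_T field_simps)
  also have "\<dots> \<le> ip N (T (s / 2) f) (T (s / 2) f)"
    using assms by (intro T_contr T_L2) auto
  also have "\<dots> = q s f f" using assms by (simp add: ip_T_T)
  finally show ?thesis .
qed

text \<open>
  Cauchy--Schwarz applied to \<open>(T\<^sub>t f, f)\<close>. Iterating it along \<open>t, 2t, 4t, \<dots>\<close> removes constants from
  exponential bounds on \<open>(T\<^sub>t f, f)\<close>.
\<close>
lemma q_self_log_convex: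
  assumes "0 \<le> t" "f \<in> L2 N"
  shows "(q t f f)\<^sup>2 \<le> ip N f f * q (2 * t) f f"
proof -
  have "ip N (T t f) (T t f) = q (2 * t) f f" using ip_T_T[of t t f f] assms by (simp only: mult_2)
  moreover have "ip N (T t f) f = q t f f" by (simp add: q_def)
  ultimately show ?thesis
    using ip_Cauchy_Schwarz[OF T_L2[OF assms] assms(2)] by (simp add: mult.commute)
qed

lemma q_diff_bound:
  assumes "0 \<le> t" "0 \<le> s" "f \<in> L2 N" "g \<in> L2 N"
  shows "\<bar>q t f g - q (t + s) f g\<bar> \<le> sqrt (ip N g g) * sqrt (ip N f f - 2 * q s f f + q (2 * s) f f)"
proof -
  let ?d = "\<lambda>x. 1 * f x + (- 1) * T s f x"
  have d: "?d \<in> L2 N" using assms by (intro L2_lincomb T_L2) auto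
  have "q t f g - q (t + s) f g = ip N (T t g) ?d"
    using assms q_T[of 0 t s g f] q_commute[of t f g] q_commute[of "t + s" f g]
    by (simp only: ip_lincomb_right T_L2 ip_T_T) (simp add: q_def)
  moreover have "\<bar>ip N (T t g) ?d\<bar> \<le> sqrt (ip N (T t g) (T t g)) * sqrt (ip N ?d ?d)"
    by (rule ip_Cauchy_Schwarz_abs[OF T_L2[OF assms(1,4)] d])
  moreover have "sqrt (ip N (T t g) (T t g)) * sqrt (ip N ?d ?d) \<le> sqrt (ip N g g) * sqrt (ip N ?d ?d)"
    by (rule mult_right_mono[OF real_sqrt_le_mono[OF T_contr[OF assms(1,4)]]]) (simp add: ip_nonneg)
  moreover have "ip N ?d ?d = ip N f f - 2 * q s f f + q (2 * s) f f"
  proof -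
    have "ip N (T s f) (T s f) = q (2 * s) f f"
      using ip_T_T[OF assms(2,2,3,3)] by (simp only: mult_2)
    moreover have "ip N f (T s f) = q s f f" by (simp only: q_def ip_commute)
    ultimately show ?thesis
      unfolding ip_lincomb_self[OF assms(3) T_L2[OF assms(2,3)]] by simp
  qed
  ultimately show ?thesis by simp
qed

text \<open>
  The graph of the nonnegative operator \<open>G\<close> with \<open>T\<^sub>t = e\<^sup>-\<^sup>t\<^sup>G\<close>, that is, of minus the
  \<open>L\<^sup>2\<close>-generator.
\<close>
definition gen :: "('a \<Rightarrow> real) \<Rightarrow> ('a \<Rightarrow> real) \<Rightarrow> bool" where
  "gen f h \<longleftrightarrow> f \<in> L2 N \<and> h \<in> L2 N \<and>
     ((\<lambda>s. ip N (\<lambda>x. (f x - T s f x) / s - h x) (\<lambda>x. (f x - T s f x) / s - h x)) \<longlongrightarrow> 0) (at_right 0)"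

lemma diff_quot_L2:
  assumes "0 < s" "f \<in> L2 N" "h \<in> L2 N"
  shows "(\<lambda>x. (f x - T s f x) / s - h x) \<in> L2 N"
proof -
  have "(\<lambda>x. 1 * (inverse s * f x + (- inverse s) * T s f x) + (- 1) * h x) \<in> L2 N"
    using assms by (intro L2_lincomb T_L2) auto
  moreover have "(\<lambda>x. 1 * (inverse s * f x + (- inverse s) * T s f x) + (- 1) * h x) =
      (\<lambda>x. (f x - T s f x) / s - h x)"
    by (auto simp: divide_inverse algebra_simps)
  ultimately show ?thesis by simp
qed

lemma ip_diff_quot:
  assumes "0 < s" "f \<in> L2 N" "h \<in> L2 N" "k \<in> L2 N"
  shows "ip N (\<lambda>x. (f x - T s f x) / s - h x) k = (ip N f k - q s f k) / s - ip N h k"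
proof -
  have eq: "(\<lambda>x. (f x - T s f x) / s - h x) =
     (\<lambda>x. 1 * (inverse s * f x + (- inverse s) * T s f x) + (- 1) * h x)"
    by (auto simp: divide_inverse algebra_simps)
  show ?thesis
    unfolding eq using assms
    by (simp only: ip_lincomb_left L2_lincomb T_L2 less_imp_le) (simp add: q_def field_simps)
qed

lemma gen_L2: "gen f h \<Longrightarrow> f \<in> L2 N" "gen f h \<Longrightarrow> h \<in> L2 N"
  by (auto simp: gen_def)

lemma gen_tendsto:
  assumes g: "gen f h" and k: "k \<in> L2 N" and t: "0 \<le> t"
  shows "((\<lambda>s. (q (t + s) f k - q t f k) / s) \<longlongrightarrow> - q t h k) (at_right 0)"
proof -
  note L = gen_L2[OF g]
  let ?r = "\<lambda>s x. (f x - T s f x) / s - h x"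
  have "((\<lambda>s. ip N (?r s) (T t k)) \<longlongrightarrow> 0) (at_right 0)"
  proof (rule Lim_null_comparison)
    show "eventually (\<lambda>s. norm (ip N (?r s) (T t k)) \<le>
       sqrt (ip N (?r s) (?r s)) * sqrt (ip N (T t k) (T t k))) (at_right 0)"
      using eventually_at_right_less[of 0]
    proof eventually_elim
      case (elim s)
      then show ?case using L k t
        by (simp only: real_norm_def) (intro ip_Cauchy_Schwarz_abs diff_quot_L2 T_L2; simp)
    qed
    have "((\<lambda>s. sqrt (ip N (?r s) (?r s)) * sqrt (ip N (T t k) (T t k)))
          \<longlongrightarrow> sqrt 0 * sqrt (ip N (T t k) (T t k))) (at_right 0)"
      using g by (intro tendsto_intros) (auto simp: gen_def)
    then show "((\<lambda>s. sqrt (ip N (?r s) (?r s)) * sqrt (ip N (T t k) (T t k))) \<longlongrightarrow> 0) (at_right 0)"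
      by simp
  qed
  then have "((\<lambda>s. - (ip N (?r s) (T t k)) - q t h k) \<longlongrightarrow> - 0 - q t h k) (at_right 0)"
    by (intro tendsto_intros)
  moreover have "eventually (\<lambda>s. - (ip N (?r s) (T t k)) - q t h k = (q (t + s) f k - q t f k) / s) (at_right 0)"
    using eventually_at_right_less[of 0]
  proof eventually_elim
    case (elim s)
    have "ip N f (T t k) = q t f k" "ip N h (T t k) = q t h k"
      using T_sym[of t] L k t by (auto simp: q_def)
    moreover have "q s f (T t k) = q (t + s) f k"
      using ip_T_T[of s t f k] L k t elim by (simp add: q_def add.commute)
    ultimately show ?case
      using elim L k t by (simp add: ip_diff_quot T_L2) (simp add: field_simps)
  qed
  ultimately have "((\<lambda>s. (q (t + s) f k - q t f k) / s) \<longlongrightarrow> - 0 - q t h k) (at_right 0)"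
    by (rule Lim_transform_eventually)
  then show ?thesis by simp
qed

lemma gen_right_deriv:
  assumes g: "gen f h" and k: "k \<in> L2 N" and t: "0 \<le> t"
  shows "((\<lambda>t. q t f k) has_real_derivative - q t h k) (at_right t)"
  unfolding has_field_derivative_iff
  by (subst at_right_to_0) (use gen_tendsto[OF assms] in \<open>simp add: filterlim_filtermap add.commute\<close>)

lemma gen_symmetric:
  assumes "gen f h" "gen f' h'"
  shows "ip N h f' = ip N f h'"
proof -
  note L = gen_L2[OF assms(1)] gen_L2[OF assms(2)]
  have "((\<lambda>s. (q (0 + s) f f' - q 0 f f') / s) \<longlongrightarrow> - q 0 h f') (at_right 0)"
    by (rule gen_tendsto) (use assms L in auto)
  moreover have "((\<lambda>s. (q (0 + s) f f' - q 0 f f') / s) \<longlongrightarrow> - q 0 h' f) (at_right 0)"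
  proof (rule Lim_transform_eventually)
    show "((\<lambda>s. (q (0 + s) f' f - q 0 f' f) / s) \<longlongrightarrow> - q 0 h' f) (at_right 0)"
      by (rule gen_tendsto) (use assms L in auto)
    show "eventually (\<lambda>s. (q (0 + s) f' f - q 0 f' f) / s = (q (0 + s) f f' - q 0 f f') / s) (at_right 0)"
    using eventually_at_right_less[of 0]
    by eventually_elim (use L in \<open>simp add: q_commute[of _ f' f]\<close>)
  qed
  ultimately have "- q 0 h f' = - q 0 h' f"
    by (rule tendsto_unique[OF trivial_limit_at_right_real])
  then show ?thesis using L by (simp add: q_0 ip_commute)
qed

lemma gen_lincomb:
  assumes "gen f h" "gen f' h'"
  shows "gen (\<lambda>x. a * f x + b * f' x) (\<lambda>x. a * h x + b * h' x)"
proof -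
  note L = gen_L2[OF assms(1)] gen_L2[OF assms(2)]
  let ?f = "\<lambda>x. a * f x + b * f' x" and ?h = "\<lambda>x. a * h x + b * h' x"
  let ?r = "\<lambda>f h s x. (f x - T s f x) / s - h x"
  have L': "?f \<in> L2 N" "?h \<in> L2 N" using L by (auto intro: L2_lincomb)
  have "((\<lambda>s. ip N (?r ?f ?h s) (?r ?f ?h s)) \<longlongrightarrow> 0) (at_right 0)"
  proof (rule Lim_null_comparison)
    show "eventually (\<lambda>s. norm (ip N (?r ?f ?h s) (?r ?f ?h s)) \<le>
        2 * a\<^sup>2 * ip N (?r f h s) (?r f h s) + 2 * b\<^sup>2 * ip N (?r f' h' s) (?r f' h' s)) (at_right 0)"
      using eventually_at_right_less[of 0]
    proof eventually_elim
      case (elim s)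
      let ?l = "\<lambda>x. a * ?r f h s x + b * ?r f' h' s x"
      have rL: "?r f h s \<in> L2 N" "?r f' h' s \<in> L2 N" "?r ?f ?h s \<in> L2 N"
        using elim L L' by (auto intro: diff_quot_L2)
      have "ip N (?r ?f ?h s) (?r ?f ?h s) = ip N ?l ?l"
      proof (rule ip_self_cong)
        fix k :: "'a \<Rightarrow> real" assume k: "k \<in> L2 N"
        have "ip N (?r ?f ?h s) k = (ip N ?f k - q s ?f k) / s - ip N ?h k"
          by (rule ip_diff_quot) (use elim L' k in auto)
        also have "\<dots> = a * ip N (?r f h s) k + b * ip N (?r f' h' s) k"
          using elim L k
          by (simp add: ip_diff_quot ip_lincomb_left q_lincomb_left) (simp add: field_simps)
        also have "\<dots> = ip N ?l k" using rL k by (simp only: ip_lincomb_left)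
        finally show "ip N (?r ?f ?h s) k = ip N ?l k" .
      qed (use rL in \<open>auto intro: L2_lincomb\<close>)
      also have "\<dots> \<le> 2 * a\<^sup>2 * ip N (?r f h s) (?r f h s) + 2 * b\<^sup>2 * ip N (?r f' h' s) (?r f' h' s)"
        by (rule ip_lincomb_le) (use rL in auto)
      finally show ?case using ip_nonneg[of N "?r ?f ?h s"] by simp
    qed
    have "((\<lambda>s. 2 * a\<^sup>2 * ip N (?r f h s) (?r f h s) + 2 * b\<^sup>2 * ip N (?r f' h' s) (?r f' h' s))
       \<longlongrightarrow> 2 * a\<^sup>2 * 0 + 2 * b\<^sup>2 * 0) (at_right 0)"
      using assms by (intro tendsto_intros) (auto simp: gen_def)
    then show "((\<lambda>s. 2 * a\<^sup>2 * ip N (?r f h s) (?r f h s) + 2 * b\<^sup>2 * ip N (?r f' h' s) (?r f' h' s))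
       \<longlongrightarrow> 0) (at_right 0)" by simp
  qed
  then show ?thesis using L' by (simp add: gen_def)
qed

text \<open>
  \<open>T\<^sub>t\<close> commutes with \<open>T\<^sub>s\<close> and is a contraction, so it maps the error of the difference quotient of
  \<open>f\<close> to that of \<open>T\<^sub>t f\<close> without increasing its norm.
\<close>
lemma gen_T:
  assumes g: "gen f h" and t: "0 \<le> t"
  shows "gen (T t f) (T t h)"
proof -
  note L = gen_L2[OF g]
  let ?r = "\<lambda>f h s x. (f x - T s f x) / s - h x"
  have L': "T t f \<in> L2 N" "T t h \<in> L2 N" using L t by (auto intro: T_L2)
  have "((\<lambda>s. ip N (?r (T t f) (T t h) s) (?r (T t f) (T t h) s)) \<longlongrightarrow> 0) (at_right 0)"
  proof (rule Lim_null_comparison)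
    show "eventually (\<lambda>s. norm (ip N (?r (T t f) (T t h) s) (?r (T t f) (T t h) s)) \<le>
        ip N (?r f h s) (?r f h s)) (at_right 0)"
      using eventually_at_right_less[of 0]
    proof eventually_elim
      case (elim s)
      have rL: "?r f h s \<in> L2 N" "?r (T t f) (T t h) s \<in> L2 N"
        using elim L L' by (auto intro: diff_quot_L2)
      have "ip N (?r (T t f) (T t h) s) (?r (T t f) (T t h) s) = ip N (T t (?r f h s)) (T t (?r f h s))"
      proof (rule ip_self_cong)
        fix k :: "'a \<Rightarrow> real" assume k: "k \<in> L2 N"
        have "ip N (?r (T t f) (T t h) s) k = (ip N (T t f) k - q s (T t f) k) / s - ip N (T t h) k"
          by (rule ip_diff_quot) (use elim L' k in auto)
        also have "\<dots> = (ip N f (T t k) - q s f (T t k)) / s - ip N h (T t k)"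
          using elim L k t T_sym[of t f k] T_sym[of t h k] T_add[of s t f k] ip_T_T[of s t f k]
          by (simp add: q_def)
        also have "\<dots> = ip N (?r f h s) (T t k)"
          using elim L k t by (simp only: ip_diff_quot T_L2)
        also have "\<dots> = ip N (T t (?r f h s)) k"
          using rL k t by (simp only: T_sym)
        finally show "ip N (?r (T t f) (T t h) s) k = ip N (T t (?r f h s)) k" .
      qed (use rL t in \<open>auto intro: T_L2\<close>)
      also have "\<dots> \<le> ip N (?r f h s) (?r f h s)"
        using rL t by (intro T_contr)
      finally show ?case using ip_nonneg[of N "?r (T t f) (T t h) s"] by simp
    qed
    show "((\<lambda>s. ip N (?r f h s) (?r f h s)) \<longlongrightarrow> 0) (at_right 0)"
      using g by (simp add: gen_def)
  qed
  then show ?thesis using L' by (simp add: gen_def)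
qed

text \<open>
  Right differentiability gives \<open>(T\<^sub>s f, f) \<rightarrow> (f, f)\<close>, hence \<open>\<parallel>f - T\<^sub>s f\<parallel> \<rightarrow> 0\<close>, and this modulus of
  continuity is uniform in \<open>t\<close>.
\<close>
lemma continuous_on_q_gen:
  assumes g: "gen f h" and k: "k \<in> L2 N"
  shows "continuous_on {0..} (\<lambda>t. q t f k)"
proof -
  note L = gen_L2[OF g]
  have lim_q: "((\<lambda>s. q s f f) \<longlongrightarrow> ip N f f) (at_right 0)"
  proof -
    have "((\<lambda>s. s * ((q (0 + s) f f - q 0 f f) / s) + q 0 f f) \<longlongrightarrow> 0 * (- q 0 h f) + q 0 f f) (at_right 0)"
      using gen_tendsto[OF g L(1), of 0] by (intro tendsto_intros) auto
    moreover have "eventually (\<lambda>s. s * ((q (0 + s) f f - q 0 f f) / s) + q 0 f f = q s f f) (at_right 0)"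
      using eventually_at_right_less[of 0] by eventually_elim auto
    ultimately have "((\<lambda>s. q s f f) \<longlongrightarrow> 0 * (- q 0 h f) + q 0 f f) (at_right 0)"
      by (rule Lim_transform_eventually)
    then show ?thesis using L by (simp add: q_0)
  qed
  define m where "m s = sqrt (ip N k k) * sqrt (ip N f f - 2 * q s f f + q (2 * s) f f)" for s
  have "filterlim (\<lambda>s::real. 2 * s) (at_right 0) (at_right 0)"
    by (intro filterlim_at_withinI)
       (auto intro!: tendsto_eq_intros eventually_mono[OF eventually_at_right_less[of 0]])
  from filterlim_compose[OF lim_q this]
  have "(m \<longlongrightarrow> sqrt (ip N k k) * sqrt (ip N f f - 2 * ip N f f + ip N f f)) (at_right 0)"
    unfolding m_def using lim_q by (intro tendsto_intros)
  then have m: "(m \<longlongrightarrow> 0) (at_right 0)" by simp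
  show ?thesis unfolding continuous_on_iff
  proof (intro ballI allI impI)
    fix t e :: real assume t: "t \<in> {0..}" and e: "0 < e"
    from order_tendstoD(2)[OF m e] obtain d where d: "d > 0" "\<And>s. 0 < s \<Longrightarrow> s < d \<Longrightarrow> m s < e"
      unfolding eventually_at_right_field by auto
    have *: "\<bar>q a f k - q b f k\<bar> < e" if "0 \<le> a" "a < b" "b < a + d" for a b
      using q_diff_bound[of a "b - a" f k] d(2)[of "b - a"] that L k by (simp add: m_def)
    show "\<exists>d>0. \<forall>x'\<in>{0..}. dist x' t < d \<longrightarrow> dist (q x' f k) (q t f k) < e"
    proof (intro exI[of _ d] conjI ballI impI d(1))
      fix x assume x: "x \<in> {0..}" "dist x t < d"
      consider "x = t" | "x < t" | "t < x" by linarith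
      then show "dist (q x f k) (q t f k) < e"
        by cases (use *[of x t] *[of t x] x t e in \<open>auto simp: dist_real_def abs_minus_commute\<close>)
    qed
  qed
qed

end
section \<open>Exponential decay from a resolvent interval\<close>

context symmetric_semigroup begin

text \<open>
  The value \<open>(G - p) f\<close>, given \<open>h = G f\<close>.
\<close>
definition shift :: "real \<Rightarrow> ('a \<Rightarrow> real) \<Rightarrow> ('a \<Rightarrow> real) \<Rightarrow> 'a \<Rightarrow> real" where
  "shift p f h = (\<lambda>x. 1 * h x + (- p) * f x)"

lemma shift_L2: "gen f h \<Longrightarrow> shift p f h \<in> L2 N"
  unfolding shift_def by (intro L2_lincomb gen_L2)

lemma ip_shift: "gen f h \<Longrightarrow> k \<in> L2 N \<Longrightarrow> ip N (shift p f h) k = ip N h k - p * ip N f k"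
  unfolding shift_def by (simp only: ip_lincomb_left gen_L2)

text \<open>
  For a self-adjoint operator the resolvent \<open>R = (G - l)\<^sup>-\<^sup>1\<close> has norm 1 over the distance from \<open>l\<close>
  to the spectrum. Here the spectrum does not meet \<open>(0, 2l)\<close>. The elementary argument: let \<open>s = \<parallel>R\<parallel>\<close>
  and take an almost maximizing \<open>f = R g\<close> with \<open>\<parallel>g\<parallel> \<le> 1\<close>. By symmetry \<open>R\<^sup>2 g - s\<^sup>2 g\<close> is small. It
  factors as \<open>(R - s)(R + s) g\<close>, and \<open>R \<minusplus> s\<close> is a multiple of \<open>R (G - p)\<close> with \<open>p = l \<plusminus> 1/s\<close>. If
  \<open>s > 1/l\<close>, both values of \<open>p\<close> lie in \<open>(0, 2l)\<close>, where \<open>G - p\<close> is bounded below, so that \<open>f\<close> itself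
  must be small.
\<close>
lemma resolvent_norm_bound:
  assumes l: "0 < l"
    and surj: "\<And>g. g \<in> L2 N \<Longrightarrow> \<exists>f h. gen f h \<and> (\<forall>k\<in>L2 N. ip N (shift l f h) k = ip N g k)"
    and bdd: "\<And>p. 0 < p \<Longrightarrow> p < 2 * l \<Longrightarrow>
        \<exists>C. \<forall>f h. gen f h \<longrightarrow> ip N f f \<le> C * ip N (shift p f h) (shift p f h)"
    and fh: "gen f h"
  shows "l\<^sup>2 * ip N f f \<le> ip N (shift l f h) (shift l f h)"
proof -
  define S where "S = {ip N f f |f h. gen f h \<and> ip N (shift l f h) (shift l f h) \<le> 1}"
  obtain C where C: "\<And>f h. gen f h \<Longrightarrow> ip N f f \<le> C * ip N (shift l f h) (shift l f h)"
    using bdd[of l] l by auto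
  have "bdd_above S"
  proof (rule bdd_aboveI)
    fix y assume "y \<in> S"
    then obtain f h where fh: "gen f h" "ip N (shift l f h) (shift l f h) \<le> 1" "y = ip N f f"
      by (auto simp: S_def)
    have "y \<le> C * ip N (shift l f h) (shift l f h)" using C fh by simp
    also have "\<dots> \<le> \<bar>C\<bar> * 1" using fh(2) ip_nonneg[of N "shift l f h"]
      by (intro mult_mono) auto
    finally show "y \<le> \<bar>C\<bar>" by simp
  qed
  then have S_upper: "ip N f f \<le> Sup S" if "gen f h" "ip N (shift l f h) (shift l f h) \<le> 1" for f h
    using that by (intro cSup_upper) (auto simp: S_def)
  \<comment> \<open>The multiplier 0 only serves to write a scalar multiple as a linear combination of two
    functions.\<close>
  have scaled: "ip N f f \<le> Sup S * ip N (shift l f h) (shift l f h)" if g: "gen f h" for f h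
  proof (cases "ip N (shift l f h) (shift l f h) = 0")
    case True
    then show ?thesis using C[OF g] by simp
  next
    case False
    define r where "r = sqrt (ip N (shift l f h) (shift l f h))"
    have r: "r > 0" "r\<^sup>2 = ip N (shift l f h) (shift l f h)"
      using False ip_nonneg[of N "shift l f h"] by (auto simp: r_def)
    let ?f = "\<lambda>x. inverse r * f x + 0 * f x" and ?h = "\<lambda>x. inverse r * h x + 0 * h x"
    have g': "gen ?f ?h" by (rule gen_lincomb[OF g g])
    have "shift l ?f ?h = (\<lambda>x. inverse r * shift l f h x + 0 * shift l f h x)"
      by (auto simp: shift_def algebra_simps)
    then have "ip N (shift l ?f ?h) (shift l ?f ?h) = (inverse r)\<^sup>2 * ip N (shift l f h) (shift l f h)"
      using ip_lincomb_self[OF shift_L2[OF g, of l] shift_L2[OF g, of l], of "inverse r" 0] by simp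
    also have "\<dots> = 1" using r False by (simp add: power_inverse)
    finally have "ip N ?f ?f \<le> Sup S" by (intro S_upper[OF g']) simp
    moreover have "ip N ?f ?f = (inverse r)\<^sup>2 * ip N f f"
      unfolding ip_lincomb_self[OF gen_L2(1)[OF g] gen_L2(1)[OF g]] by simp
    ultimately have "r\<^sup>2 * ((inverse r)\<^sup>2 * ip N f f) \<le> r\<^sup>2 * Sup S"
      by (intro mult_left_mono) auto
    moreover have "r\<^sup>2 * ((inverse r)\<^sup>2 * ip N f f) = ip N f f"
      using r(1) by (simp add: power_inverse)
    ultimately show ?thesis unfolding r(2) by (simp only: mult.commute)
  qed
  have Sne: "S \<noteq> {}"
  proof -
    have "gen (\<lambda>x. 0 * f x + 0 * f x) (\<lambda>x. 0 * h x + 0 * h x)" by (rule gen_lincomb[OF fh fh])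
    then show ?thesis unfolding S_def by (auto simp: shift_def ip_def intro!: exI)
  qed
  have "Sup S \<le> 1 / l\<^sup>2"
  proof (rule ccontr)
    assume "\<not> ?thesis"
    then have big: "1 / l\<^sup>2 < Sup S" by simp
    define s where "s = sqrt (Sup S)"
    have "0 < Sup S" using big l by (meson less_trans zero_less_divide_1_iff zero_less_power)
    then have s: "0 < s" "s\<^sup>2 = Sup S" by (auto simp: s_def)
    have "(1 / l)\<^sup>2 < s\<^sup>2" using big s by (simp add: power_divide)
    then have sl: "1 / l < s" using s l by (meson less_imp_le power_less_imp_less_base)
    then have sl': "1 / s < l" using s l by (simp add: field_simps)
    define p q where "p = l + 1 / s" and "q = l - 1 / s"
    have pq: "0 < p" "p < 2 * l" "0 < q" "q < 2 * l" using sl' l divide_pos_pos[OF zero_less_one s(1)] unfolding p_def q_def by linarith+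
    obtain Cp where Cp: "\<And>f h. gen f h \<Longrightarrow> ip N f f \<le> Cp * ip N (shift p f h) (shift p f h)"
      using bdd[OF pq(1,2)] by auto
    obtain Cq where Cq: "\<And>f h. gen f h \<Longrightarrow> ip N f f \<le> Cq * ip N (shift q f h) (shift q f h)"
      using bdd[OF pq(3,4)] by auto
    define K where "K = \<bar>Cq\<bar> / s\<^sup>2 * (2 / s\<^sup>2 * (\<bar>Cp\<bar> / s\<^sup>2 + 1))"
    have K: "0 \<le> K" by (simp add: K_def)
    \<comment> \<open>The estimates at the end give \<open>\<parallel>f\<parallel>\<^sup>2 \<le> K (s\<^sup>4 - s\<^sup>2 \<parallel>f\<parallel>\<^sup>2)\<close>; solved for \<open>\<parallel>f\<parallel>\<^sup>2\<close> this
      says \<open>\<parallel>f\<parallel>\<^sup>2 \<le> y\<close>, and \<open>y\<close> is strictly below the supremum \<open>s\<^sup>2\<close>.\<close>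
    define y where "y = K * s^4 / (1 + K * s\<^sup>2)"
    have den: "0 < 1 + K * s\<^sup>2" using K by (simp add: add_pos_nonneg)
    have "K * s^4 < s\<^sup>2 * (1 + K * s\<^sup>2)" using s(1) by (simp add: power4_eq_xxxx power2_eq_square algebra_simps)
    then have "y < Sup S" using den s by (simp add: y_def field_simps)
    then obtain y' where "y' \<in> S" "y < y'" using less_cSup_iff[OF Sne \<open>bdd_above S\<close>] by auto
    then obtain f h where g: "gen f h" and le1: "ip N (shift l f h) (shift l f h) \<le> 1" and yf: "y < ip N f f"
      by (auto simp: S_def)
    note L = gen_L2[OF g]
    \<comment> \<open>\<open>f2 = R f = R\<^sup>2 g0\<close> with \<open>g0 = (G - l) f\<close>.\<close>
    obtain f2 h2 where g2: "gen f2 h2" and eq2: "\<And>k. k \<in> L2 N \<Longrightarrow> ip N (shift l f2 h2) k = ip N f k"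
      using surj[OF L(1)] by auto
    note L2 = gen_L2[OF g2]
    define g0 where "g0 = shift l f h"
    have g0L: "g0 \<in> L2 N" using g by (simp add: g0_def shift_L2)
    have h2k: "ip N h2 k = ip N f k + l * ip N f2 k" if "k \<in> L2 N" for k
      using eq2[OF that] ip_shift[OF g2 that, of l] by simp
    have hk: "ip N h k = ip N g0 k + l * ip N f k" if "k \<in> L2 N" for k
      using ip_shift[OF g that, of l] by (simp add: g0_def)
    have f2g0: "ip N f2 g0 = ip N f f"
      using gen_symmetric[OF g2 g] h2k[OF L(1)] hk[OF L2(1)] by (simp add: ip_commute)
    have f2f2: "ip N f2 f2 \<le> s\<^sup>2 * ip N f f"
    proof -
      have "ip N (shift l f2 h2) (shift l f2 h2) = ip N f f"
        by (rule ip_self_cong) (use shift_L2[OF g2] L eq2 in auto)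
      then show ?thesis using scaled[OF g2] s by simp
    qed
    \<comment> \<open>\<open>k = (R\<^sup>2 - s\<^sup>2) g0\<close>. Expanding the square and moving one factor \<open>R\<close> to the other side
      bounds \<open>\<parallel>k\<parallel>\<^sup>2\<close> by \<open>s\<^sup>4 - s\<^sup>2 \<parallel>f\<parallel>\<^sup>2\<close>.\<close>
    define k where "k = (\<lambda>x. 1 * f2 x + (- (s\<^sup>2)) * g0 x)"
    have kL: "k \<in> L2 N" unfolding k_def by (intro L2_lincomb L2 g0L)
    have "ip N k k = ip N f2 f2 - 2 * s\<^sup>2 * ip N f f + s^4 * ip N g0 g0"
      unfolding k_def ip_lincomb_self[OF L2(1) g0L] f2g0 by simp
    also have "\<dots> \<le> s\<^sup>2 * ip N f f - 2 * s\<^sup>2 * ip N f f + s^4 * 1"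
      using f2f2 le1 by (intro add_mono diff_mono mult_left_mono) (auto simp: g0_def)
    finally have kk: "ip N k k \<le> s^4 - s\<^sup>2 * ip N f f" by (simp add: algebra_simps)
    \<comment> \<open>\<open>u = R (R + s) g0\<close> satisfies \<open>(G - p) u = - k / s\<close>, so \<open>u\<close> is small.\<close>
    define u hu where "u = (\<lambda>x. 1 * f2 x + s * f x)" and "hu = (\<lambda>x. 1 * h2 x + s * h x)"
    have gu: "gen u hu" unfolding u_def hu_def by (rule gen_lincomb[OF g2 g])
    have uL: "u \<in> L2 N" using gen_L2[OF gu] by simp
    have "ip N (shift p u hu) (shift p u hu) = ip N (\<lambda>x. (- inverse s) * k x + 0 * k x) (\<lambda>x. (- inverse s) * k x + 0 * k x)"
    proof (rule ip_self_cong)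
      fix m :: "'a \<Rightarrow> real" assume m: "m \<in> L2 N"
      have "ip N (shift p u hu) m = (ip N h2 m + s * ip N h m) - p * (ip N f2 m + s * ip N f m)"
        unfolding ip_shift[OF gu m] unfolding u_def hu_def using L L2 m by (simp only: ip_lincomb_left) simp
      also have "\<dots> = s * ip N g0 m - ip N f2 m / s"
        using s by (simp add: h2k[OF m] hk[OF m] p_def field_simps)
      also have "\<dots> = (- inverse s) * ip N k m"
        unfolding k_def ip_lincomb_left[OF L2(1) g0L m] using s by (simp add: field_simps power2_eq_square)
      also have "\<dots> = ip N (\<lambda>x. (- inverse s) * k x + 0 * k x) m"
        by (simp only: ip_lincomb_left[OF kL kL m])
      finally show "ip N (shift p u hu) m = ip N (\<lambda>x. (- inverse s) * k x + 0 * k x) m" .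
    qed (rule shift_L2[OF gu] L2_lincomb[OF kL kL])+
    also have "\<dots> = ip N k k / s\<^sup>2"
      unfolding ip_lincomb_self[OF kL kL] by (simp add: power_inverse field_simps)
    finally have "ip N u u \<le> Cp * (ip N k k / s\<^sup>2)" using Cp[OF gu] by simp
    also have "\<dots> \<le> \<bar>Cp\<bar> * (ip N k k / s\<^sup>2)" using ip_nonneg[of N k] by (intro mult_right_mono) auto
    finally have uu: "ip N u u \<le> \<bar>Cp\<bar> / s\<^sup>2 * ip N k k" by simp
    \<comment> \<open>\<open>e = (R + s) g0 = (u - k) / s\<close> and \<open>(G - q) f = e / s\<close>, so \<open>f\<close> is small.\<close>
    define e where "e = (\<lambda>x. 1 * f x + s * g0 x)"
    have eL: "e \<in> L2 N" unfolding e_def by (intro L2_lincomb L g0L)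
    have "e = (\<lambda>x. inverse s * u x + (- inverse s) * k x)"
      using s(1) by (auto simp: e_def u_def k_def field_simps power2_eq_square)
    then have "ip N e e \<le> 2 * (inverse s)\<^sup>2 * ip N u u + 2 * (inverse s)\<^sup>2 * ip N k k"
      using ip_lincomb_le[OF uL kL, of "inverse s" "- inverse s"] by simp
    also have "\<dots> \<le> 2 * (inverse s)\<^sup>2 * (\<bar>Cp\<bar> / s\<^sup>2 * ip N k k) + 2 * (inverse s)\<^sup>2 * ip N k k"
      using uu by (intro add_mono mult_left_mono) auto
    also have "\<dots> = 2 / s\<^sup>2 * (\<bar>Cp\<bar> / s\<^sup>2 + 1) * ip N k k"
      by (simp add: power_inverse divide_inverse algebra_simps)
    finally have ee: "ip N e e \<le> 2 / s\<^sup>2 * (\<bar>Cp\<bar> / s\<^sup>2 + 1) * ip N k k" .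
    have "shift q f h = (\<lambda>x. inverse s * e x + 0 * e x)"
      using s(1) by (auto simp: shift_def e_def g0_def q_def field_simps)
    then have "ip N (shift q f h) (shift q f h) = ip N e e / s\<^sup>2"
      using ip_lincomb_self[OF eL eL, of "inverse s" 0] by (simp add: power_inverse field_simps)
    then have "ip N f f \<le> Cq * (ip N e e / s\<^sup>2)" using Cq[OF g] by simp
    also have "\<dots> \<le> \<bar>Cq\<bar> * (ip N e e / s\<^sup>2)" using ip_nonneg[of N e] by (intro mult_right_mono) auto
    also have "\<dots> = \<bar>Cq\<bar> / s\<^sup>2 * ip N e e" by simp
    also have "\<dots> \<le> \<bar>Cq\<bar> / s\<^sup>2 * (2 / s\<^sup>2 * (\<bar>Cp\<bar> / s\<^sup>2 + 1) * ip N k k)"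
      using ee by (intro mult_left_mono) auto
    also have "\<dots> = K * ip N k k" by (simp add: K_def)
    also have "\<dots> \<le> K * (s^4 - s\<^sup>2 * ip N f f)" using kk K by (rule mult_left_mono)
    finally have "ip N f f * (1 + K * s\<^sup>2) \<le> K * s^4" by (simp add: algebra_simps)
    then have "ip N f f \<le> y" using den by (simp add: y_def field_simps)
    then show False using yf by simp
  qed
  then have "Sup S * ip N (shift l f h) (shift l f h) \<le> 1 / l\<^sup>2 * ip N (shift l f h) (shift l f h)"
    by (rule mult_right_mono) (rule ip_nonneg)
  with scaled[OF fh] have "ip N f f \<le> 1 / l\<^sup>2 * ip N (shift l f h) (shift l f h)" by simp
  then show ?thesis using l by (simp add: field_simps)
qed

text \<open>
  Expanding the hypothesis gives \<open>2l (Gf, f) \<le> \<parallel>Gf\<parallel>\<^sup>2\<close>, also for \<open>T\<^bsub>t/2\<^esub> f\<close> in place of \<open>f\<close>. So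
  \<open>D(t) = (T\<^sub>t f, Gf)\<close> satisfies \<open>D' = -(T\<^sub>t Gf, Gf) \<le> -2l D\<close> and decays like \<open>e\<^sup>-\<^sup>2\<^sup>l\<^sup>t\<close>. Both
  conclusions integrate this: \<open>-D'\<close> is non-increasing, hence at time \<open>t + 1\<close> at most its mean over
  \<open>[t, t + 1]\<close>, and \<open>-D\<close> is the derivative of \<open>t \<mapsto> (T\<^sub>t f, f)\<close>.
\<close>
lemma gen_decay:
  assumes l: "0 < l" and ineq: "\<And>f h. gen f h \<Longrightarrow> l\<^sup>2 * ip N f f \<le> ip N (shift l f h) (shift l f h)"
    and g: "gen f h" and t: "0 \<le> t"
  shows "q (t + 1) h h \<le> exp (- 2 * l * t) * q 0 f h"
    and "t \<le> u \<Longrightarrow> q t f f - q u f f \<le> q 0 f h / (2 * l) * exp (- 2 * l * t)"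
proof -
  note L = gen_L2[OF g]
  have ineq': "2 * l * q t f h \<le> q t h h" if t: "0 \<le> t" for t
  proof -
    have gt: "gen (T (t / 2) f) (T (t / 2) h)" by (rule gen_T) (use g t in auto)
    note Lt = gen_L2[OF gt]
    have "ip N (shift l (T (t / 2) f) (T (t / 2) h)) (shift l (T (t / 2) f) (T (t / 2) h))
       = q t h h - 2 * l * q t f h + l\<^sup>2 * q t f f"
      unfolding shift_def ip_lincomb_self[OF Lt(2,1)]
      using t L by (simp add: ip_T_T q_commute)
    moreover have "ip N (T (t / 2) f) (T (t / 2) f) = q t f f" using t L by (simp add: ip_T_T)
    ultimately show ?thesis using ineq[OF gt] by simp
  qed
  have cont: "continuous_on {a..b} (\<lambda>t. q t f k)" if "0 \<le> a" "k \<in> L2 N" for a b k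
    by (rule continuous_on_subset[OF continuous_on_q_gen[OF g that(2)]]) (use that in auto)
  have der: "((\<lambda>t. q t f h) has_real_derivative - q t h h) (at_right t)"
    "((\<lambda>t. q t f f) has_real_derivative - q t h f) (at_right t)" if "0 \<le> t" for t
    using gen_right_deriv[OF g] L that by auto
  have D: "q t f h \<le> exp (- 2 * l * t) * q 0 f h" if t: "0 \<le> t" for t
  proof -
    have "q t f h * exp (2 * l * t) \<le> q 0 f h * exp (2 * l * 0)"
    proof (rule right_deriv_nonpos_imp_le[OF t])
      show "continuous_on {0..t} (\<lambda>t. q t f h * exp (2 * l * t))"
        by (intro continuous_intros cont) (use L in auto)
      fix t :: real assume t: "0 \<le> t"
      have "((\<lambda>t. q t f h * exp (2 * l * t)) has_real_derivative
          (- q t h h) * exp (2 * l * t) + (2 * l * exp (2 * l * t)) * q t f h) (at_right t)"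
        using der(1)[OF t] by (auto intro!: derivative_eq_intros)
      moreover have "(- q t h h) * exp (2 * l * t) + (2 * l * exp (2 * l * t)) * q t f h
         = (2 * l * q t f h - q t h h) * exp (2 * l * t)" by (simp add: algebra_simps)
      moreover have "\<dots> \<le> 0" using ineq'[OF t] by (intro mult_nonpos_nonneg) auto
      ultimately show "\<exists>d\<le>0. ((\<lambda>t. q t f h * exp (2 * l * t)) has_real_derivative d) (at_right t)"
        by metis
    qed
    then have "q t f h * exp (2 * l * t) * exp (- 2 * l * t) \<le> q 0 f h * exp (- 2 * l * t)"
      by (intro mult_right_mono) auto
    then show ?thesis by (simp add: mult.assoc exp_add[symmetric]) (simp add: mult.commute)
  qed
  have Dpos: "0 \<le> q t f h" if t: "0 \<le> t" for t
  proof -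
    have "((\<lambda>s. (q (t + s) f f - q t f f) / s) \<longlongrightarrow> - q t h f) (at_right 0)"
      by (rule gen_tendsto[OF g L(1) t])
    moreover have "eventually (\<lambda>s. (q (t + s) f f - q t f f) / s \<le> 0) (at_right 0)"
      using eventually_at_right_less[of 0]
      by eventually_elim (use q_self_antimono[of t _ f] t L in \<open>auto intro!: divide_nonpos_pos\<close>)
    ultimately have "- q t h f \<le> 0"
      by (rule tendsto_upperbound) simp
    then show ?thesis using q_commute[OF t] L by simp
  qed
  let ?E = "\<lambda>r. q r f h + q (t + 1) h h * r"
  have "?E (t + 1) \<le> ?E t"
  proof (rule right_deriv_nonpos_imp_le[of t "t + 1" ?E])
    show "continuous_on {t..t + 1} (\<lambda>r. q r f h + q (t + 1) h h * r)"
      by (intro continuous_intros cont) (use L t in auto)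
    fix r assume r: "t \<le> r" "r < t + 1"
    have "((\<lambda>r. q r f h + q (t + 1) h h * r) has_real_derivative (- q r h h + q (t + 1) h h)) (at_right r)"
      using der(1)[of r] r t by (auto intro!: derivative_eq_intros)
    moreover have "- q r h h + q (t + 1) h h \<le> 0" using q_self_antimono[of r "t + 1" h] r t L by simp
    ultimately show "\<exists>d\<le>0. ((\<lambda>r. q r f h + q (t + 1) h h * r) has_real_derivative d) (at_right r)"
      by blast
  qed simp
  then show "q (t + 1) h h \<le> exp (- 2 * l * t) * q 0 f h"
    using D[OF t] Dpos[of "t + 1"] t by (simp add: algebra_simps)
  assume tu: "t \<le> u"
  let ?F = "\<lambda>r. - q r f f + q 0 f h / (2 * l) * exp (- 2 * l * r)"
  have "?F u \<le> ?F t"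
  proof (rule right_deriv_nonpos_imp_le[OF tu])
    show "continuous_on {t..u} ?F" by (intro continuous_intros cont) (use L t in auto)
    fix r assume r: "t \<le> r"
    have "(?F has_real_derivative (q r h f - q 0 f h * exp (- 2 * l * r))) (at_right r)"
      using der(2)[of r] r t l by (auto intro!: derivative_eq_intros)
    moreover have "q r h f - q 0 f h * exp (- 2 * l * r) \<le> 0"
      using D[of r] r t L q_commute[of r f h] by (simp add: mult.commute)
    ultimately show "\<exists>d\<le>0. (?F has_real_derivative d) (at_right r)" by blast
  qed
  moreover have "0 \<le> q 0 f h / (2 * l) * exp (- 2 * l * u)" using Dpos[of 0] l by simp
  ultimately show "q t f f - q u f f \<le> q 0 f h / (2 * l) * exp (- 2 * l * t)" by simp
qed

end
section \<open>Spectral gap of an irreducible symmetric semigroup\<close>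

context symmetric_semigroup begin

lemma L2_const: "(\<lambda>_. c :: real) \<in> L2 N"
  by (simp add: L2_real_iff)

lemma integral_abs_le_ip:
  assumes "d \<in> L2 N"
  shows "(\<integral>\<^sup>+x. ennreal \<bar>d x\<bar> \<partial>N) \<le> ennreal (sqrt (ip N d d))"
proof -
  have ad: "(\<lambda>x. \<bar>d x\<bar>) \<in> L2 N" using assms by (auto simp: L2_real_iff)
  have "integrable N (\<lambda>x. \<bar>d x\<bar> * 1)" by (rule integrable_mult_L2[OF ad L2_const])
  then have "(\<integral>\<^sup>+x. ennreal \<bar>d x\<bar> \<partial>N) = ennreal (ip N (\<lambda>x. \<bar>d x\<bar>) (\<lambda>_. 1))"
    by (simp add: ip_def nn_integral_eq_integral)
  also have "\<dots> \<le> ennreal (sqrt (ip N (\<lambda>x. \<bar>d x\<bar>) (\<lambda>x. \<bar>d x\<bar>)) * sqrt (ip N (\<lambda>_. 1) (\<lambda>_. 1)))"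
    using ip_Cauchy_Schwarz_abs[OF ad L2_const[of 1]] by (intro ennreal_leI) simp
  also have "ip N (\<lambda>_. 1) (\<lambda>_. 1) = 1" by (simp add: ip_def prob_space)
  also have "ip N (\<lambda>x. \<bar>d x\<bar>) (\<lambda>x. \<bar>d x\<bar>) = ip N d d" by (simp add: ip_def)
  finally show ?thesis by simp
qed

lemma nn_integral_square_eq_ip:
  assumes "d \<in> L2 N"
  shows "(\<integral>\<^sup>+x. ennreal ((d x)\<^sup>2) \<partial>N) = ennreal (ip N d d)"
  using assms by (simp add: ip_def L2_real_iff nn_integral_eq_integral power2_eq_square)

text \<open>
  Completeness of \<open>L\<^sup>2\<close> along a geometric sequence: the increments are summable in \<open>L\<^sup>1\<close>, so the
  sequence converges almost everywhere, and Fatou's lemma transfers the Cauchy bound to the limit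
  with the same rate.
\<close>
lemma rapidly_Cauchy_L2_limit:
  fixes u :: "nat \<Rightarrow> 'a \<Rightarrow> real"
  assumes u: "\<And>n. u n \<in> L2 N" and r: "0 < r" "r < 1"
    and cauchy: "\<And>n m. n \<le> m \<Longrightarrow>
       ip N (\<lambda>x. 1 * u n x + (- 1) * u m x) (\<lambda>x. 1 * u n x + (- 1) * u m x) \<le> K * (r ^ n)\<^sup>2"
  obtains v where "v \<in> L2 N"
    "\<And>n. ip N (\<lambda>x. 1 * u n x + (- 1) * v x) (\<lambda>x. 1 * u n x + (- 1) * v x) \<le> K * (r ^ n)\<^sup>2"
proof -
  let ?d = "\<lambda>n m x. 1 * u n x + (- 1) * u m x"
  have dL: "?d n m \<in> L2 N" for n m by (intro L2_lincomb u)
  have um[measurable]: "u n \<in> borel_measurable N" for n using u by (simp add: L2_real_iff)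
  have K: "0 \<le> K" using cauchy[of 0 0] ip_nonneg[of N "?d 0 0"] by simp
  have "(\<integral>\<^sup>+x. (\<Sum>n. ennreal \<bar>u n x - u (Suc n) x\<bar>) \<partial>N) = (\<Sum>n. \<integral>\<^sup>+x. ennreal \<bar>u n x - u (Suc n) x\<bar> \<partial>N)"
    by (intro nn_integral_suminf) simp
  also have "\<dots> \<le> (\<Sum>n. ennreal (sqrt K * r ^ n))"
  proof (intro suminf_le allI)
    fix n
    have "(\<integral>\<^sup>+x. ennreal \<bar>u n x - u (Suc n) x\<bar> \<partial>N) \<le> ennreal (sqrt (ip N (?d n (Suc n)) (?d n (Suc n))))"
      using integral_abs_le_ip[OF dL[of n "Suc n"]] by simp
    also have "\<dots> \<le> ennreal (sqrt (K * (r ^ n)\<^sup>2))"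
      by (intro ennreal_leI real_sqrt_le_mono cauchy) simp
    also have "\<dots> = ennreal (sqrt K * r ^ n)" using r by (simp add: real_sqrt_mult)
    finally show "(\<integral>\<^sup>+x. ennreal \<bar>u n x - u (Suc n) x\<bar> \<partial>N) \<le> ennreal (sqrt K * r ^ n)" .
  qed auto
  also have "\<dots> = ennreal (\<Sum>n. sqrt K * r ^ n)"
    using r K by (intro suminf_ennreal2 summable_mult summable_geometric) auto
  also have "\<dots> < \<infinity>" by simp
  finally have "(\<integral>\<^sup>+x. (\<Sum>n. ennreal \<bar>u n x - u (Suc n) x\<bar>) \<partial>N) \<noteq> \<infinity>" by simp
  then have "AE x in N. (\<Sum>n. ennreal \<bar>u n x - u (Suc n) x\<bar>) \<noteq> \<infinity>"
    by (intro nn_integral_noteq_infinite) simp_all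
  then have conv: "AE x in N. convergent (\<lambda>n. u n x)"
  proof eventually_elim
    case (elim x)
    then have "summable (\<lambda>n. norm (u (Suc n) x - u n x))"
      by (intro summable_suminf_not_top) (auto simp: abs_minus_commute)
    then have "summable (\<lambda>n. u (Suc n) x - u n x)" by (rule summable_norm_cancel)
    then have "convergent (\<lambda>n. (\<Sum>k<n. u (Suc k) x - u k x) + u 0 x)"
      unfolding summable_iff_convergent convergent_add_const_right_iff .
    moreover have "(\<lambda>n. (\<Sum>k<n. u (Suc k) x - u k x) + u 0 x) = (\<lambda>n. u n x)"
      using sum_lessThan_telescope[of "\<lambda>n. u n x"] by auto
    ultimately show ?case by simp
  qed
  define v where "v = (\<lambda>x. lim (\<lambda>n. u n x))"
  have v[measurable]: "v \<in> borel_measurable N" unfolding v_def by measurable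
  have lim: "AE x in N. (\<lambda>n. u n x) \<longlonglongrightarrow> v x"
    using conv by eventually_elim (simp add: v_def convergent_LIMSEQ_iff)
  have le: "(\<integral>\<^sup>+x. ennreal ((1 * u n x + (- 1) * v x)\<^sup>2) \<partial>N) \<le> ennreal (K * (r ^ n)\<^sup>2)" for n
  proof -
    have "(\<integral>\<^sup>+x. ennreal ((1 * u n x + (- 1) * v x)\<^sup>2) \<partial>N) = (\<integral>\<^sup>+x. liminf (\<lambda>m. ennreal ((?d n m x)\<^sup>2)) \<partial>N)"
    proof (rule nn_integral_cong_AE)
      show "AE x in N. ennreal ((1 * u n x + (- 1) * v x)\<^sup>2) = liminf (\<lambda>m. ennreal ((?d n m x)\<^sup>2))"
        using lim
      proof eventually_elim
        case (elim x)
        have "(\<lambda>m. ennreal ((?d n m x)\<^sup>2)) \<longlonglongrightarrow> ennreal ((1 * u n x + (- 1) * v x)\<^sup>2)"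
          by (intro tendsto_intros tendsto_ennrealI elim)
        then show ?case by (rule lim_imp_Liminf[OF trivial_limit_sequentially, symmetric])
      qed
    qed
    also have "\<dots> \<le> liminf (\<lambda>m. \<integral>\<^sup>+x. ennreal ((?d n m x)\<^sup>2) \<partial>N)"
      by (intro nn_integral_liminf) simp
    also have "\<dots> \<le> limsup (\<lambda>m. \<integral>\<^sup>+x. ennreal ((?d n m x)\<^sup>2) \<partial>N)"
      by (rule Liminf_le_Limsup) simp
    also have "\<dots> \<le> ennreal (K * (r ^ n)\<^sup>2)"
    proof (rule Limsup_bounded)
      show "\<forall>\<^sub>F m in sequentially. (\<integral>\<^sup>+x. ennreal ((?d n m x)\<^sup>2) \<partial>N) \<le> ennreal (K * (r ^ n)\<^sup>2)"
        using eventually_ge_at_top[of n]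
        by eventually_elim (use cauchy in \<open>simp only: nn_integral_square_eq_ip[OF dL] ennreal_leI\<close>)
    qed
    finally show ?thesis .
  qed
  have uv: "(\<lambda>x. 1 * u n x + (- 1) * v x) \<in> L2 N" for n
    unfolding L2_real_iff
  proof
    show "integrable N (\<lambda>x. (1 * u n x + (- 1) * v x)\<^sup>2)"
      by (rule integrableI_nonneg) (use le_less_trans[OF le[of n] ennreal_less_top] in auto)
  qed simp
  have "(\<lambda>x. 1 * u 0 x + (- 1) * (1 * u 0 x + (- 1) * v x)) \<in> L2 N" by (intro L2_lincomb u uv)
  then have "v \<in> L2 N" by simp
  moreover have "ip N (\<lambda>x. 1 * u n x + (- 1) * v x) (\<lambda>x. 1 * u n x + (- 1) * v x) \<le> K * (r ^ n)\<^sup>2" for n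
    using le[of n] K unfolding nn_integral_square_eq_ip[OF uv]
    by (simp only: ennreal_le_iff zero_le_power2 mult_nonneg_nonneg)
  ultimately show thesis by (rule that)
qed

text \<open>
  \<open>f \<mapsto> (f, f) - (T\<^sub>t f, f)\<close> is a nonnegative quadratic form, so the parallelogram law applies.
\<close>
lemma q_defect_lincomb_le:
  assumes "0 \<le> t" "f \<in> L2 N" "g \<in> L2 N"
  defines "m \<equiv> \<lambda>x. 1 * f x + (- 1) * g x"
  shows "ip N m m - q t m m \<le> 2 * (ip N f f - q t f f) + 2 * (ip N g g - q t g g)"
proof -
  have expand: "q t (\<lambda>x. 1 * f x + c * g x) (\<lambda>x. 1 * f x + c * g x) = q t f f + 2 * c * q t f g + c\<^sup>2 * q t g g" for c
    using assms(1-3) q_commute[OF assms(1-3)]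
    by (simp only: q_lincomb_left q_lincomb_right L2_lincomb) (simp add: power2_eq_square algebra_simps)
  let ?p = "\<lambda>x. 1 * f x + 1 * g x"
  have pL: "?p \<in> L2 N" by (intro L2_lincomb assms)
  have "q t ?p ?p \<le> ip N ?p ?p"
    using q_self_antimono[of 0 t ?p] assms pL by (simp add: q_0)
  then have "q t f f + 2 * q t f g + q t g g \<le> ip N f f + 2 * ip N f g + ip N g g"
    using expand[of 1] unfolding ip_lincomb_self[OF assms(2,3)] by simp
  then show ?thesis
    using expand[of "-1"] unfolding m_def ip_lincomb_self[OF assms(2,3)] by simp
qed

text \<open>
  The hypotheses say that \<open>(0, e)\<close> lies in the resolvent set of \<open>G\<close>, that constants are invariant
  and that all invariant functions are constant. For \<open>f\<close> in the domain and orthogonal to 1, lemma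
  \<open>gen_decay\<close> makes \<open>T\<^sub>n f\<close> a rapidly Cauchy sequence; its limit is invariant, hence constant, hence
  0. Any \<open>g\<close> orthogonal to 1 is \<open>Gf - l f\<close> for such an \<open>f\<close>, which gives \<open>\<parallel>T\<^sub>n g\<parallel>\<^sup>2 \<le> C r\<^sup>2\<^sup>n\<close> with
  \<open>C\<close> depending on \<open>g\<close>. Log-convexity replaces \<open>C\<close> by \<open>\<parallel>g\<parallel>\<^sup>2\<close>.
\<close>
theorem spectral_gap:
  assumes e: "0 < e"
    and surj: "\<And>p g. 0 < p \<Longrightarrow> p < e \<Longrightarrow> g \<in> L2 N \<Longrightarrow>
        \<exists>f h. gen f h \<and> (\<forall>k\<in>L2 N. ip N (shift p f h) k = ip N g k)"
    and bdd: "\<And>p. 0 < p \<Longrightarrow> p < e \<Longrightarrow>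
        \<exists>C. \<forall>f h. gen f h \<longrightarrow> ip N f f \<le> C * ip N (shift p f h) (shift p f h)"
    and T_one: "\<And>t f. 0 \<le> t \<Longrightarrow> f \<in> L2 N \<Longrightarrow> ip N (T t (\<lambda>_. 1)) f = ip N (\<lambda>_. 1) f"
    and irred: "\<And>f. f \<in> L2 N \<Longrightarrow> (\<And>n::nat. ip N (T n f) f = ip N f f) \<Longrightarrow> \<exists>c. AE x in N. f x = c"
  shows "\<exists>r. 0 < r \<and> r < 1 \<and> (\<forall>n::nat. \<forall>a\<in>L2 N. \<forall>b\<in>L2 N. ip N b (\<lambda>_. 1) = 0 \<longrightarrow>
           \<bar>ip N (T n a) b\<bar> \<le> r ^ n * sqrt (ip N a a) * sqrt (ip N b b))"
proof -
  define l where "l = e / 2"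
  have l: "0 < l" "l < e" "2 * l = e" using e by (auto simp: l_def)
  have ineq: "l\<^sup>2 * ip N f f \<le> ip N (shift l f h) (shift l f h)" if "gen f h" for f h
    by (rule resolvent_norm_bound[OF l(1)]) (use surj bdd l that in auto)
  have dec: "q (t + 1) h h \<le> exp (- 2 * l * t) * q 0 f h"
    "t \<le> u \<Longrightarrow> q t f f - q u f f \<le> q 0 f h / (2 * l) * exp (- 2 * l * t)"
    if "gen f h" "0 \<le> t" for f h t u
    using gen_decay[OF l(1) _ that] ineq by blast+
  define r where "r = exp (- 2 * l)"
  have r: "0 < r" "r < 1" using l by (auto simp: r_def)
  have r_pow: "exp (- 2 * l * real n) = r ^ n" for n
    by (simp add: r_def exp_of_nat_mult[symmetric] mult.commute)
  have q1: "q t f (\<lambda>_. 1) = ip N f (\<lambda>_. 1)" if "0 \<le> t" "f \<in> L2 N" for t f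
    using T_one[OF that] q_commute[OF that(1) L2_const that(2), of 1] by (simp add: q_def ip_commute)
  have gen1: "gen (\<lambda>_. 1) (\<lambda>_. 0)"
  proof -
    let ?r = "\<lambda>s x. (1 - T s (\<lambda>_. 1) x) / s - 0"
    have "ip N (?r s) (?r s) = 0" if s: "0 < s" for s
    proof -
      have "ip N (?r s) k = 0" if "k \<in> L2 N" for k
        using ip_diff_quot[OF s L2_const L2_const that, of 1 0] T_one[of s k] s that
        by (simp add: q_def) (simp add: ip_def)
      then show ?thesis using diff_quot_L2[OF s L2_const[of 1] L2_const[of 0]] by simp
    qed
    then have "eventually (\<lambda>s. ip N (?r s) (?r s) = 0) (at_right 0)"
      using eventually_at_right_less[of 0] by (rule eventually_mono[rotated]) simp
    then show ?thesis unfolding gen_def by (auto simp: L2_const intro: tendsto_eventually)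
  qed
  have f_decay: "q (2 * real n) f f \<le> q 0 f h / (2 * l) * (r ^ n)\<^sup>2"
    if g: "gen f h" and f1: "ip N f (\<lambda>_. 1) = 0" for f h n
  proof -
    note L = gen_L2[OF g]
    define K where "K = q 0 f h / (2 * l)"
    have dk: "q t f f - q u f f \<le> K * exp (- 2 * l * t)" if "0 \<le> t" "t \<le> u" for t u
      using dec(2)[OF g that] by (simp add: K_def)
    have K: "0 \<le> K" using dk[of 0 0] by simp
    have uL: "T (real n) f \<in> L2 N" for n by (intro T_L2 L) simp
    have cauchy: "ip N (\<lambda>x. 1 * T n f x + (- 1) * T m f x) (\<lambda>x. 1 * T n f x + (- 1) * T m f x) \<le> K * (r ^ n)\<^sup>2"
      if nm: "n \<le> m" for n m :: nat
    proof -
      have "ip N (\<lambda>x. 1 * T n f x + (- 1) * T m f x) (\<lambda>x. 1 * T n f x + (- 1) * T m f x)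
        = q (2 * real n) f f - 2 * q (real n + real m) f f + q (2 * real m) f f"
        unfolding ip_lincomb_self[OF uL uL] using L by (simp add: ip_T_T)
      also have "\<dots> \<le> q (2 * real n) f f - q (real n + real m) f f"
        using q_self_antimono[of "real n + real m" "2 * real m" f] nm L by simp
      also have "\<dots> \<le> K * exp (- 2 * l * (2 * real n))" using nm by (intro dk) auto
      also have "exp (- 2 * l * (2 * real n)) = (r ^ n)\<^sup>2"
        using r_pow[of "2 * n"] by (simp add: power_mult[symmetric] mult.commute)
      finally show ?thesis .
    qed
    obtain v where v: "v \<in> L2 N" and
      lim: "\<And>n. ip N (\<lambda>x. 1 * T (real n) f x + (- 1) * v x) (\<lambda>x. 1 * T (real n) f x + (- 1) * v x) \<le> K * (r ^ n)\<^sup>2"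
      using rapidly_Cauchy_L2_limit[of "\<lambda>n. T (real n) f", OF uL r cauchy] by blast
    define d where "d n = (\<lambda>x. 1 * T (real n) f x + (- 1) * v x)" for n
    have dL: "d n \<in> L2 N" for n unfolding d_def by (intro L2_lincomb uL v)
    have v_eq: "v = (\<lambda>x. 1 * T (real n) f x + (- 1) * d n x)" for n by (auto simp: d_def)
    have rlim: "(\<lambda>n. (r ^ n)\<^sup>2) \<longlonglongrightarrow> 0"
      using tendsto_power[OF LIMSEQ_realpow_zero[of r], of 2] r by simp
    \<comment> \<open>The limit \<open>v\<close> is invariant: its defect is bounded by the defects of \<open>T\<^sub>n f\<close> and of the
      small difference \<open>T\<^sub>n f - v\<close>.\<close>
    have "ip N (T m v) v = ip N v v" for m :: nat
    proof -
      have "ip N v v - q m v v \<le> 4 * K * (r ^ n)\<^sup>2" for n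
      proof -
        have "ip N v v - q m v v \<le> 2 * (ip N (T n f) (T n f) - q m (T n f) (T n f)) + 2 * (ip N (d n) (d n) - q m (d n) (d n))"
          using q_defect_lincomb_le[of m "T n f" "d n"] uL dL unfolding v_eq[of n, symmetric] by simp
        also have "ip N (T n f) (T n f) - q m (T n f) (T n f) = q (2 * real n) f f - q (2 * real n + m) f f"
          using L by (simp add: ip_T_T q_T algebra_simps)
        also have "\<dots> \<le> K * exp (- 2 * l * (2 * real n))" by (intro dk) auto
        also have "exp (- 2 * l * (2 * real n)) = (r ^ n)\<^sup>2"
          using r_pow[of "2 * n"] by (simp add: power_mult[symmetric] mult.commute)
        also have "ip N (d n) (d n) - q m (d n) (d n) \<le> K * (r ^ n)\<^sup>2"
          using lim[of n] q_self_nonneg[of m "d n"] dL by (simp add: d_def)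
        finally show ?thesis by simp
      qed
      moreover have "(\<lambda>n. 4 * K * (r ^ n)\<^sup>2) \<longlonglongrightarrow> 4 * K * 0" by (intro tendsto_intros rlim)
      ultimately have "ip N v v - q m v v \<le> 4 * K * 0"
        by (intro tendsto_lowerbound[of _ _ sequentially]) auto
      moreover have "q m v v \<le> ip N v v" using q_self_antimono[of 0 m v] v by (simp add: q_0)
      ultimately show ?thesis by (simp add: q_def)
    qed
    from irred[OF v this] obtain c where c: "AE x in N. v x = c" by blast
    have "ip N v (\<lambda>_. 1) = 0"
    proof -
      have b: "(ip N v (\<lambda>_. 1))\<^sup>2 \<le> K * (r ^ n)\<^sup>2" for n
      proof -
        have "ip N (T n f) (\<lambda>_. 1) = 0" using q1[of n f] f1 L by (simp add: q_def)
        then have "ip N (d n) (\<lambda>_. 1) = - ip N v (\<lambda>_. 1)"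
          unfolding d_def ip_lincomb_left[OF uL v L2_const] by simp
        then have "(ip N v (\<lambda>_. 1))\<^sup>2 = (ip N (d n) (\<lambda>_. 1))\<^sup>2" by simp
        also have "\<dots> \<le> ip N (d n) (d n) * ip N (\<lambda>_. 1) (\<lambda>_. 1)"
          by (rule ip_Cauchy_Schwarz[OF dL L2_const])
        also have "ip N (\<lambda>_. 1) (\<lambda>_. 1) = 1" by (simp add: ip_def prob_space)
        finally show ?thesis using lim[of n] by (simp add: d_def)
      qed
      have "(\<lambda>n. K * (r ^ n)\<^sup>2) \<longlonglongrightarrow> K * 0" by (intro tendsto_intros rlim)
      then have "(ip N v (\<lambda>_. 1))\<^sup>2 \<le> K * 0"
        by (rule tendsto_lowerbound) (use b in auto)
      then show ?thesis by simp
    qed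
    moreover have "ip N v (\<lambda>_. 1) = (\<integral>x. c \<partial>N)"
      unfolding ip_def using c v by (intro integral_cong_AE) (auto simp: L2_real_iff)
    ultimately have "c = 0" by (simp add: prob_space)
    then have v0: "AE x in N. v x = 0" using c by simp
    have "q (2 * real n) f f = ip N (T n f) (T n f)" using L by (simp add: ip_T_T)
    also have "\<dots> = ip N (d n) (d n)"
    proof -
      have [measurable]: "T (real n) f \<in> borel_measurable N" "v \<in> borel_measurable N"
        using uL[of n] v by (simp_all add: L2_real_iff)
      show ?thesis
        unfolding ip_def d_def by (rule integral_cong_AE) (use v0 in auto)
    qed
    finally show ?thesis using lim[of n] by (simp add: d_def K_def)
  qed
  have g_decay: "\<exists>C. \<forall>n\<ge>1. q (2 * real n) g g \<le> C * (r ^ n)\<^sup>2"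
    if g: "g \<in> L2 N" "ip N g (\<lambda>_. 1) = 0" for g
  proof -
    obtain f h where fh: "gen f h" and eq: "\<And>k. k \<in> L2 N \<Longrightarrow> ip N (shift l f h) k = ip N g k"
      using surj[OF l(1,2) g(1)] by blast
    note L = gen_L2[OF fh]
    \<comment> \<open>\<open>(Gf, 1) = (f, G1) = 0\<close>, so that \<open>f\<close> inherits orthogonality to 1 from \<open>g = Gf - l f\<close>.\<close>
    have "ip N h (\<lambda>_. 1) = 0" using gen_symmetric[OF fh gen1] by (simp add: ip_def)
    then have f1: "ip N f (\<lambda>_. 1) = 0"
      using eq[OF L2_const[of 1]] ip_shift[OF fh L2_const, of l 1] g l by simp
    let ?D = "q 0 f h"
    show ?thesis
    proof (intro exI[of _ "2 * (?D * exp (2 * l)) + 2 * l\<^sup>2 * (?D / (2 * l))"] allI impI)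
      fix n :: nat assume n: "1 \<le> n"
      have sL: "shift l f h \<in> L2 N" using fh by (rule shift_L2)
      have "q (2 * real n) g g = ip N (T n g) (T n g)" using g by (simp add: ip_T_T)
      also have "\<dots> = ip N (\<lambda>x. 1 * T n h x + (- l) * T n f x) (\<lambda>x. 1 * T n h x + (- l) * T n f x)"
      proof (rule ip_self_cong)
        fix k :: "'a \<Rightarrow> real" assume k: "k \<in> L2 N"
        have "ip N (T n g) k = ip N g (T n k)" using g k by (intro T_sym) auto
        also have "\<dots> = ip N (shift l f h) (T n k)" using eq[of "T n k"] k by (simp add: T_L2)
        also have "\<dots> = ip N h (T n k) - l * ip N f (T n k)" using k by (intro ip_shift fh T_L2) auto
        also have "\<dots> = ip N (T n h) k - l * ip N (T n f) k" using L k by (simp add: T_sym)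
        also have "\<dots> = ip N (\<lambda>x. 1 * T n h x + (- l) * T n f x) k"
          by (subst ip_lincomb_left) (use L k in \<open>auto intro: T_L2\<close>)
        finally show "ip N (T n g) k = ip N (\<lambda>x. 1 * T n h x + (- l) * T n f x) k" .
      next
        show "T n g \<in> L2 N" using g by (simp add: T_L2)
        show "(\<lambda>x. 1 * T n h x + (- l) * T n f x) \<in> L2 N" by (intro L2_lincomb T_L2 L) simp_all
      qed
      also have "\<dots> \<le> 2 * 1\<^sup>2 * ip N (T n h) (T n h) + 2 * (- l)\<^sup>2 * ip N (T n f) (T n f)"
        by (rule ip_lincomb_le) (use L in \<open>auto intro: T_L2\<close>)
      also have "\<dots> = 2 * q (2 * real n) h h + 2 * l\<^sup>2 * q (2 * real n) f f" using L by (simp add: ip_T_T)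
      also have "q (2 * real n) h h \<le> ?D * exp (2 * l) * (r ^ n)\<^sup>2"
      proof -
        \<comment> \<open>The decay of \<open>(T\<^sub>t Gf, Gf)\<close> is delayed by one unit of time, which is why \<open>n \<ge> 1\<close> is
          needed here.\<close>
        have "q (2 * real n) h h \<le> exp (- 2 * l * (2 * real n - 1)) * ?D"
          using dec(1)[OF fh, of "2 * real n - 1"] n by simp
        also have "exp (- 2 * l * (2 * real n - 1)) = exp (- 2 * l * real (2 * n)) * exp (2 * l)"
          by (simp add: exp_add[symmetric] algebra_simps)
        also have "exp (- 2 * l * real (2 * n)) = (r ^ n)\<^sup>2"
          unfolding r_pow by (metis power_mult mult.commute)
        finally show ?thesis by (simp add: mult_ac)
      qed
      also have "q (2 * real n) f f \<le> ?D / (2 * l) * (r ^ n)\<^sup>2" by (rule f_decay[OF fh f1])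
      finally show "q (2 * real n) g g \<le> (2 * (?D * exp (2 * l)) + 2 * l\<^sup>2 * (?D / (2 * l))) * (r ^ n)\<^sup>2"
        using l(1) by (simp add: algebra_simps mult_left_mono)
    qed
  qed
  have sharp: "q (2 * real n) g g \<le> ip N g g * (r ^ n)\<^sup>2"
    if g: "g \<in> L2 N" "ip N g (\<lambda>_. 1) = 0" for g n
  proof (cases "n = 0 \<or> ip N g g = 0")
    case True
    then show ?thesis
      using q_self_antimono[of 0 "2 * real n" g] g q_self_nonneg[of "2 * real n" g] by (auto simp: q_0)
  next
    case False
    then have n: "1 \<le> n" and v0: "0 < ip N g g" using ip_nonneg[of N g] by auto
    obtain C where C: "\<And>n. 1 \<le> n \<Longrightarrow> q (2 * real n) g g \<le> C * (r ^ n)\<^sup>2"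
      using g_decay[OF g] by blast
    \<comment> \<open>With this normalization log-convexity reads \<open>y k\<^sup>2 \<le> y (k + 1)\<close>. A ratio
      \<open>z = y 0 / r\<^sup>2\<^sup>n\<close> above 1 would make \<open>z ^ (2 ^ k)\<close> unbounded, although it is at most
      \<open>C / \<parallel>g\<parallel>\<^sup>2\<close>.\<close>
    define y where "y k = q (2 ^ k * (2 * real n)) g g / ip N g g" for k
    have y0: "0 \<le> y k" for k using g v0 by (simp add: y_def q_self_nonneg)
    have yy: "(y k)\<^sup>2 \<le> y (Suc k)" for k
      using q_self_log_convex[of "2 ^ k * (2 * real n)" g] g v0
      by (simp add: y_def power_divide power2_eq_square field_simps)
    have yk: "y 0 ^ (2 ^ k) \<le> y k" for k
    proof (induction k)
      case (Suc k)
      have "y 0 ^ (2 ^ Suc k) = (y 0 ^ (2 ^ k))\<^sup>2" by (simp add: power_mult[symmetric] mult.commute)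
      also have "\<dots> \<le> (y k)\<^sup>2" using Suc y0 by (intro power_mono) auto
      finally show ?case using yy[of k] by simp
    qed simp
    define z where "z = y 0 / (r ^ n)\<^sup>2"
    have zk: "z ^ (2 ^ k) \<le> C / ip N g g" for k
    proof -
      have "y k \<le> C * (r ^ (2 ^ k * n))\<^sup>2 / ip N g g"
        using C[of "2 ^ k * n"] n v0 by (simp add: y_def divide_right_mono mult_ac)
      with yk[of k] have "y 0 ^ (2 ^ k) \<le> C / ip N g g * (((r ^ n)\<^sup>2) ^ (2 ^ k))"
        by (simp add: power_mult[symmetric] mult_ac)
      then show ?thesis using r by (simp add: z_def power_divide field_simps)
    qed
    have "z \<le> 1"
    proof (rule ccontr)
      assume "\<not> z \<le> 1"
      then obtain j where j: "C / ip N g g < z ^ j" using real_arch_pow[of z] by auto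
      have "z ^ j \<le> z ^ (2 ^ j)" using \<open>\<not> z \<le> 1\<close> by (intro power_increasing) (auto intro: less_imp_le)
      then show False using zk[of j] j by simp
    qed
    then show ?thesis using v0 r by (simp add: z_def y_def field_simps)
  qed
  show ?thesis
  proof (intro exI[of _ r] conjI allI ballI impI r)
    fix n :: nat and a b :: "'a \<Rightarrow> real"
    assume a: "a \<in> L2 N" and b: "b \<in> L2 N" and b1: "ip N b (\<lambda>_. 1) = 0"
    have "\<bar>ip N (T n a) b\<bar> = \<bar>ip N a (T n b)\<bar>" using a b by (simp add: T_sym)
    also have "\<dots> \<le> sqrt (ip N a a) * sqrt (ip N (T n b) (T n b))"
      using a b by (intro ip_Cauchy_Schwarz_abs T_L2) auto
    also have "ip N (T n b) (T n b) = q (2 * real n) b b" using b by (simp add: ip_T_T)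
    also have "sqrt (ip N a a) * sqrt (q (2 * real n) b b) \<le> sqrt (ip N a a) * sqrt (ip N b b * (r ^ n)\<^sup>2)"
      using sharp[OF b b1, of n] ip_nonneg[of N a] by (intro mult_left_mono real_sqrt_le_mono) auto
    also have "\<dots> = r ^ n * sqrt (ip N a a) * sqrt (ip N b b)"
      using r by (simp add: real_sqrt_mult)
    finally show "\<bar>ip N (T n a) b\<bar> \<le> r ^ n * sqrt (ip N a a) * sqrt (ip N b b)" .
  qed
qed

end
section \<open>Borel--Cantelli under decaying correlations, and the integral test\<close>

lemma sum_power_dist_le:
  fixes r :: real
  assumes r: "0 < r" "r < 1"
  shows "(\<Sum>j\<in>{k..<m}. r ^ (if i \<le> j then j - i else i - j)) \<le> 2 / (1 - r)"
proof -
  have geo: "(\<Sum>j\<in>J. r ^ f j) \<le> 1 / (1 - r)" if J: "finite J" "inj_on f J" for J :: "nat set" and f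
  proof -
    have "(\<Sum>j\<in>J. r ^ f j) = (\<Sum>n\<in>f ` J. r ^ n)" using J by (simp add: sum.reindex)
    also have "\<dots> \<le> (\<Sum>n. r ^ n)" using r J by (intro sum_le_suminf summable_geometric) auto
    also have "\<dots> = 1 / (1 - r)" using r by (simp add: suminf_geometric)
    finally show ?thesis .
  qed
  have "(\<Sum>j\<in>{k..<m}. r ^ (if i \<le> j then j - i else i - j))
      = (\<Sum>j\<in>{k..<m} \<inter> {j. i \<le> j}. r ^ (j - i)) + (\<Sum>j\<in>{k..<m} \<inter> - {j. i \<le> j}. r ^ (i - j))"
    unfolding if_distrib[of "\<lambda>n. r ^ n"] by (rule sum.If_cases) simp
  also have "\<dots> \<le> 1 / (1 - r) + 1 / (1 - r)"
    by (intro add_mono geo) (auto simp: inj_on_def)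
  finally show ?thesis by simp
qed

text \<open>
  On the event that none of \<open>A k, \<dots>, A (N - 1)\<close> occurs, the centred count deviates from 0 by its
  full mean \<open>m N\<close>. Its variance is at most a constant times \<open>m N\<close>, because
  \<open>\<surd>p\<^sub>i \<surd>p\<^sub>j \<le> (p\<^sub>i + p\<^sub>j)/2\<close> and each row of \<open>r ^ |i - j|\<close> has bounded sum. By Chebyshev's
  inequality this event has probability at most a constant over \<open>m N\<close>, which tends to 0.
\<close>
lemma (in prob_space) borel_cantelli_decaying_correlations:
  fixes A :: "nat \<Rightarrow> 'a set"
  assumes A[measurable]: "\<And>n. A n \<in> events"
    and r: "0 < r" "r < 1"
    and corr: "\<And>i j. i \<le> j \<Longrightarrow>
      prob (A i \<inter> A j) - prob (A i) * prob (A j) \<le> r ^ (j - i) * sqrt (prob (A i)) * sqrt (prob (A j))"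
    and div: "\<not> summable (\<lambda>n. prob (A n))"
  shows "prob {x \<in> space M. \<exists>\<^sub>\<infinity>n. x \<in> A n} = 1"
proof -
  define d where "d i j = (if i \<le> j then j - i else i - j)" for i j :: nat
  define p where "p n = prob (A n)" for n
  have p0: "0 \<le> p n" for n by (simp add: p_def)
  have cov: "prob (A i \<inter> A j) - p i * p j \<le> r ^ d i j * ((p i + p j) / 2)" for i j
  proof -
    have "prob (A i \<inter> A j) - p i * p j \<le> r ^ d i j * (sqrt (p i) * sqrt (p j))"
      using corr[of i j] corr[of j i] by (auto simp: p_def d_def Int_commute mult_ac)
    also have "sqrt (p i) * sqrt (p j) \<le> (p i + p j) / 2"
      using arith_geo_mean_sqrt[OF p0[of i] p0[of j]] by (simp add: real_sqrt_mult)
    finally show ?thesis using r by (simp add: mult_left_mono)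
  qed
  have tail: "prob {x \<in> space M. \<forall>n\<ge>k. x \<notin> A n} = 0" (is "prob ?B = 0") for k
  proof (rule ccontr)
    assume nz: "prob ?B \<noteq> 0"
    define m where "m N = (\<Sum>i\<in>{k..<N}. p i)" for N
    have bound: "prob ?B * m N \<le> 2 / (1 - r)" for N
    proof (cases "m N = 0")
      case False
      then have mpos: "0 < m N" using p0 by (simp add: m_def sum_nonneg less_le)
      let ?I = "{k..<N}"
      let ?S = "\<lambda>x. \<Sum>i\<in>?I. (indicator (A i) x - p i)"
      have "?B \<in> events" by measurable
      have "prob ?B * (m N)\<^sup>2 = expectation (\<lambda>x. (m N)\<^sup>2 * indicator ?B x)" by simp
      also have "\<dots> \<le> expectation (\<lambda>x. (?S x)\<^sup>2)"
      proof (rule integral_mono)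
        show "integrable M (\<lambda>x. (?S x)\<^sup>2)"
        proof (rule integrable_const_bound[of _ "(\<Sum>i\<in>?I. 1 + p i)\<^sup>2"])
          have "\<bar>?S x\<bar> \<le> (\<Sum>i\<in>?I. 1 + p i)" for x
          proof (rule order_trans[OF sum_abs sum_mono])
            show "\<bar>indicator (A i) x - p i\<bar> \<le> 1 + p i" for i using p0[of i] by (auto simp: indicator_def)
          qed
          then show "AE x in M. norm ((?S x)\<^sup>2) \<le> (\<Sum>i\<in>?I. 1 + p i)\<^sup>2"
            by (auto simp: power2_eq_square[symmetric] intro!: AE_I2) (metis abs_ge_zero power2_abs power_mono)
        qed measurable
        show "integrable M (\<lambda>x. (m N)\<^sup>2 * indicator ?B x)"
          using \<open>?B \<in> events\<close> by (intro integrable_mult_right integrable_real_indicator) (auto simp: emeasure_eq_measure)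
        fix x assume "x \<in> space M"
        show "(m N)\<^sup>2 * indicator ?B x \<le> (?S x)\<^sup>2"
        proof (cases "x \<in> ?B")
          case True
          then have "?S x = - m N" unfolding m_def sum_negf[symmetric] by (intro sum.cong) auto
          then show ?thesis using True by simp
        qed simp
      qed
      also have "\<dots> = expectation (\<lambda>x. \<Sum>i\<in>?I. \<Sum>j\<in>?I. indicator (A i \<inter> A j) x - p j * indicator (A i) x - p i * indicator (A j) x + p i * p j)"
        by (intro Bochner_Integration.integral_cong refl)
          (auto simp: power2_eq_square sum_product indicator_def algebra_simps intro!: sum.cong)
      also have "\<dots> = (\<Sum>i\<in>?I. \<Sum>j\<in>?I. prob (A i \<inter> A j) - p i * p j)"
      proof -
        have "integrable M (indicat_real (A i))" "integrable M (indicat_real (A i \<inter> A j))" for i j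
          by (auto intro!: integrable_real_indicator simp: emeasure_eq_measure)
        then show ?thesis by (simp add: p_def prob_space mult.commute)
      qed
      also have "\<dots> \<le> (\<Sum>i\<in>?I. \<Sum>j\<in>?I. r ^ d i j * ((p i + p j) / 2))"
        by (intro sum_mono cov)
      also have "\<dots> = (\<Sum>i\<in>?I. \<Sum>j\<in>?I. r ^ d i j * p i)"
      proof -
        have "(\<Sum>i\<in>?I. \<Sum>j\<in>?I. r ^ d i j * p j) = (\<Sum>j\<in>?I. \<Sum>i\<in>?I. r ^ d i j * p j)" by (rule sum.swap)
        also have "\<dots> = (\<Sum>i\<in>?I. \<Sum>j\<in>?I. r ^ d i j * p i)"
          by (intro sum.cong refl) (auto simp: d_def)
        finally have "(\<Sum>i\<in>?I. \<Sum>j\<in>?I. r ^ d i j * p j) = (\<Sum>i\<in>?I. \<Sum>j\<in>?I. r ^ d i j * p i)" .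
        moreover have "(\<Sum>i\<in>?I. \<Sum>j\<in>?I. r ^ d i j * ((p i + p j) / 2))
           = ((\<Sum>i\<in>?I. \<Sum>j\<in>?I. r ^ d i j * p i) + (\<Sum>i\<in>?I. \<Sum>j\<in>?I. r ^ d i j * p j)) / 2"
          by (simp add: sum.distrib[symmetric] sum_divide_distrib algebra_simps)
        ultimately show ?thesis by simp
      qed
      also have "\<dots> \<le> (\<Sum>i\<in>?I. 2 / (1 - r) * p i)"
        unfolding sum_distrib_right[symmetric] d_def
        by (intro sum_mono mult_right_mono sum_power_dist_le r p0)
      also have "\<dots> = 2 / (1 - r) * m N" by (simp add: m_def sum_distrib_left)
      finally have "(prob ?B * m N) * m N \<le> 2 / (1 - r) * m N" by (simp add: power2_eq_square)
      then show ?thesis using mpos by (rule mult_right_le_imp_le)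
    qed (use r in simp)
    then have m_le: "m N \<le> 2 / (1 - r) / prob ?B" for N
    proof (subst pos_le_divide_eq)
      show "0 < prob ?B" using nz by (simp add: less_le)
    qed (simp add: mult.commute[of "m N"])
    have "summable (\<lambda>n. p (n + k))"
    proof (rule summableI_nonneg_bounded)
      fix n
      have "(\<Sum>i<n. p (i + k)) = m (n + k)"
        using sum.shift_bounds_nat_ivl[of p 0 k n] by (simp add: m_def atLeast0LessThan)
      then show "(\<Sum>i<n. p (i + k)) \<le> 2 / (1 - r) / prob ?B" using m_le by simp
    qed (rule p0)
    then have "summable p" by (simp add: summable_iff_shift)
    then show False using div by (simp add: p_def[abs_def])
  qed
  have "AE x in M. \<not> (\<forall>n\<ge>k. x \<notin> A n)" for k
    using tail[of k] by (intro AE_I[where N="{x \<in> space M. \<forall>n\<ge>k. x \<notin> A n}"]) (auto simp: emeasure_eq_measure)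
  then have "AE x in M. \<forall>k. \<not> (\<forall>n\<ge>k. x \<notin> A n)" by (simp add: AE_all_countable)
  then have "AE x in M. \<exists>\<^sub>\<infinity>n. x \<in> A n"
    by eventually_elim (auto simp: INFM_nat_le)
  moreover have "{x \<in> space M. \<exists>\<^sub>\<infinity>n. x \<in> A n} \<in> events" unfolding INFM_nat_le by measurable
  ultimately show ?thesis by (subst prob_Collect_eq_1) auto
qed

text \<open>
  Both sides are compared with step functions that are constant on the intervals \<open>[n, n + 1)\<close>.
\<close>
lemma nn_integral_antimono_less_top_iff:
  fixes g :: "real \<Rightarrow> ennreal"
  assumes anti: "\<And>r s. 1 \<le> r \<Longrightarrow> r \<le> s \<Longrightarrow> g s \<le> g r" and fin: "g 1 < \<infinity>"
  shows "(\<integral>\<^sup>+r\<in>{1..}. g r \<partial>lborel) < \<infinity> \<longleftrightarrow> (\<Sum>n. g (real (Suc n))) < \<infinity>"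
proof -
  let ?J = "\<lambda>n. {real (Suc n)..<real (Suc (Suc n))}"
  have step: "(\<integral>\<^sup>+r. (\<Sum>n. c n * indicator (?J n) r) \<partial>lborel) = (\<Sum>n. c n)" for c :: "nat \<Rightarrow> ennreal"
    by (subst nn_integral_suminf) (auto simp: nn_integral_cmult_indicator)
  \<comment> \<open>The intervals are indexed from 0 but start at 1, hence the shift by one.\<close>
  have pick: "(\<Sum>n. c n * indicator (?J n) r) = c (nat \<lfloor>r\<rfloor> - 1)" if "1 \<le> r" for c :: "nat \<Rightarrow> ennreal" and r
  proof -
    define a where "a = nat \<lfloor>r\<rfloor> - 1"
    have a: "real (Suc a) \<le> r" "r < real (Suc (Suc a))" using that unfolding a_def by linarith+
    have "(\<Sum>n. c n * indicator (?J n) r) = (\<Sum>n\<in>{a}. c n * indicator (?J n) r)"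
      by (rule suminf_finite) (use a in \<open>auto simp: indicator_def\<close>)
    also have "\<dots> = c a" using a by simp
    finally show ?thesis by (simp add: a_def)
  qed
  have fl: "real (Suc (nat \<lfloor>r\<rfloor> - 1)) \<le> r" "r \<le> real (Suc (Suc (nat \<lfloor>r\<rfloor> - 1)))" if "1 \<le> r" for r
    using that by linarith+
  have upper: "(\<integral>\<^sup>+r\<in>{1..}. g r \<partial>lborel) \<le> (\<Sum>n. g (real (Suc n)))"
    unfolding step[of "\<lambda>n. g (real (Suc n))", symmetric]
  proof (rule nn_integral_mono)
    fix r :: real
    show "g r * indicator {1..} r \<le> (\<Sum>n. g (real (Suc n)) * indicator (?J n) r)"
    proof (cases "1 \<le> r")
      case True
      then show ?thesis using anti[of "real (Suc (nat \<lfloor>r\<rfloor> - 1))" r] fl[OF True] by (simp add: pick del: of_nat_Suc)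
    qed simp
  qed
  have lower: "(\<Sum>n. g (real (Suc (Suc n)))) \<le> (\<integral>\<^sup>+r\<in>{1..}. g r \<partial>lborel)"
    unfolding step[of "\<lambda>n. g (real (Suc (Suc n)))", symmetric]
  proof (rule nn_integral_mono)
    fix r :: real
    show "(\<Sum>n. g (real (Suc (Suc n))) * indicator (?J n) r) \<le> g r * indicator {1..} r"
    proof (cases "1 \<le> r")
      case True
      then show ?thesis using anti[of r "real (Suc (Suc (nat \<lfloor>r\<rfloor> - 1)))"] fl[OF True] by (simp add: pick del: of_nat_Suc)
    next
      case False
      then have "r \<notin> ?J n" for n by auto
      then show ?thesis by simp
    qed
  qed
  have "(\<Sum>n. g (real (Suc n))) = g 1 + (\<Sum>n. g (real (Suc (Suc n))))"
    using suminf_offset[of "\<lambda>n. g (real (Suc n))" 1] by simp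
  moreover have "(\<Sum>n. g (real (Suc (Suc n)))) < \<infinity>" if "(\<integral>\<^sup>+r\<in>{1..}. g r \<partial>lborel) < \<infinity>"
    using lower that by (rule le_less_trans)
  moreover have "(\<integral>\<^sup>+r\<in>{1..}. g r \<partial>lborel) < \<infinity>" if "(\<Sum>n. g (real (Suc n))) < \<infinity>"
    using upper that by (rule le_less_trans)
  ultimately show ?thesis using fin by (metis ennreal_add_less_top infinity_ennreal_def)
qed
section \<open>Gaussian smoothing in Fourier variables\<close>

lemma integral_lborel_prod:
  fixes f :: "'a::euclidean_space \<Rightarrow> real \<Rightarrow> complex"
  assumes f: "\<And>b. b \<in> Basis \<Longrightarrow> integrable lborel (f b)"
  shows "(\<integral>x. (\<Prod>b\<in>Basis. f b (x \<bullet> b)) \<partial>lborel) = (\<Prod>b\<in>Basis. (\<integral>x. f b x \<partial>lborel))"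
proof -
  interpret product_sigma_finite "\<lambda>_::'a. lborel :: real measure" by standard
  have [measurable]: "b \<in> Basis \<Longrightarrow> f b \<in> borel_measurable borel" for b
    using borel_measurable_integrable[OF f] by simp
  have "(\<integral>x. (\<Prod>b\<in>Basis. f b (x \<bullet> b)) \<partial>lborel)
     = (\<integral>x. (\<Prod>b\<in>Basis. f b ((\<Sum>c\<in>Basis. x c *\<^sub>R c) \<bullet> b)) \<partial>(\<Pi>\<^sub>M b\<in>Basis. lborel))"
    by (subst lborel_eq) (simp add: integral_distr)
  also have "\<dots> = (\<integral>x. (\<Prod>b\<in>Basis. f b (x b)) \<partial>(\<Pi>\<^sub>M b\<in>(Basis::'a set). lborel))"
    by (intro Bochner_Integration.integral_cong prod.cong refl) (simp add: inner_sum_left inner_Basis if_distrib cong: if_cong)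
  also have "\<dots> = (\<Prod>b\<in>Basis. (\<integral>x. f b x \<partial>lborel))"
    by (rule product_integral_prod) (use f in auto)
  finally show ?thesis .
qed

definition gauss :: "'a::euclidean_space \<Rightarrow> real" where
  "gauss z = (\<Prod>b\<in>Basis. std_normal_density (z \<bullet> b))"

definition gauss_const :: "'a::euclidean_space itself \<Rightarrow> real" where
  "gauss_const _ = (1 / sqrt (2 * pi)) ^ DIM('a)"

lemma gauss_const_pos: "0 < gauss_const TYPE('a::euclidean_space)"
  by (simp add: gauss_const_def)

lemma gauss_eq: "gauss z = gauss_const TYPE('a) * exp (- (norm z)\<^sup>2 / 2)" for z :: "'a::euclidean_space"
proof -
  have "(norm z)\<^sup>2 = (\<Sum>b\<in>Basis. (z \<bullet> b)\<^sup>2)"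
    by (subst power2_norm_eq_inner) (subst euclidean_inner, simp add: power2_eq_square)
  then have "exp (- (norm z)\<^sup>2 / 2) = (\<Prod>b\<in>Basis. exp (- (z \<bullet> b)\<^sup>2 / 2))"
    by (simp add: exp_sum[symmetric] sum_negf sum_divide_distrib)
  then show ?thesis
    unfolding gauss_def gauss_const_def std_normal_density_def prod.distrib by simp
qed

lemma gauss_measurable[measurable]: "gauss \<in> borel_measurable borel"
  unfolding gauss_eq[abs_def] by measurable

lemma gauss_pos: "0 < gauss z" by (simp add: gauss_eq gauss_const_pos)

definition gauss_measure :: "'a::euclidean_space measure" where
  "gauss_measure = density lborel (\<lambda>z. ennreal (gauss z))"

lemma sets_gauss_measure[measurable_cong, simp]: "sets gauss_measure = sets borel"
  by (simp add: gauss_measure_def)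

lemma space_gauss_measure[simp]: "space gauss_measure = UNIV"
  by (simp add: gauss_measure_def)

lemma prob_space_gauss_measure: "prob_space (gauss_measure :: 'a::euclidean_space measure)"
proof
  have "emeasure gauss_measure (space (gauss_measure :: 'a measure)) = (\<integral>\<^sup>+z. ennreal (gauss (z::'a)) \<partial>lborel)"
    by (simp add: gauss_measure_def emeasure_density)
  also have "\<dots> = (\<integral>\<^sup>+z. (\<Prod>b\<in>(Basis::'a set). ennreal (std_normal_density (z \<bullet> b))) \<partial>lborel)"
    by (simp add: gauss_def prod_ennreal)
  also have "\<dots> = (\<Prod>b\<in>(Basis::'a set). \<integral>\<^sup>+x. ennreal (std_normal_density x) \<partial>lborel)"
    by (rule nn_integral_lborel_prod) auto
  also have "(\<integral>\<^sup>+x. ennreal (std_normal_density x) \<partial>lborel) = 1"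
    using prob_space.emeasure_space_1[OF prob_space_normal_density[of 1 0]] by (simp add: emeasure_density)
  finally show "emeasure gauss_measure (space (gauss_measure :: 'a measure)) = 1" by simp
qed

lemma integral_gauss_measure:
  fixes f :: "'a::euclidean_space \<Rightarrow> real"
  assumes [measurable]: "f \<in> borel_measurable borel"
  shows "(\<integral>x. f x \<partial>gauss_measure) = (\<integral>x. gauss x * f x \<partial>lborel)"
  unfolding gauss_measure_def by (subst integral_density) (auto simp: gauss_pos less_imp_le)

lemma gauss_measure_cos:
  "(\<integral>x. cos (x \<bullet> z) \<partial>gauss_measure) = exp (- (norm z)\<^sup>2 / 2)" for z :: "'a::euclidean_space"
proof -
  interpret G: prob_space "gauss_measure :: 'a measure" by (rule prob_space_gauss_measure)
  let ?f = "\<lambda>b x. complex_of_real (std_normal_density x) * exp (\<i> * complex_of_real ((z \<bullet> b) * x))"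
  have one: "integrable lborel (?f b) \<and> (\<integral>x. ?f b x \<partial>lborel) = complex_of_real (exp (- (z \<bullet> b)\<^sup>2 / 2))" for b
  proof
    interpret N: real_distribution std_normal_distribution by (rule real_dist_normal_dist)
    show "integrable lborel (?f b)"
      by (rule Bochner_Integration.integrable_bound[OF integrable_normal_density[of 1 0]]) (auto simp: norm_mult)
    have "char std_normal_distribution (z \<bullet> b) = (\<integral>x. ?f b x \<partial>lborel)"
      unfolding char_def by (subst integral_density) (auto simp: scaleR_conv_of_real)
    then show "(\<integral>x. ?f b x \<partial>lborel) = complex_of_real (exp (- (z \<bullet> b)\<^sup>2 / 2))"
      unfolding char_std_normal_distribution by simp
  qed
  have zz: "(norm z)\<^sup>2 = (\<Sum>b\<in>Basis. (z \<bullet> b)\<^sup>2)"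
    by (subst power2_norm_eq_inner) (subst euclidean_inner, simp add: power2_eq_square)
  have "(\<integral>x. (\<Prod>b\<in>Basis. ?f b (x \<bullet> b)) \<partial>lborel) = (\<Prod>b\<in>Basis. complex_of_real (exp (- (z \<bullet> b)\<^sup>2 / 2)))"
    using one by (subst integral_lborel_prod) auto
  also have "\<dots> = complex_of_real (exp (- (norm z)\<^sup>2 / 2))"
    by (simp add: zz exp_sum[symmetric] sum_negf sum_divide_distrib of_real_prod[symmetric] del: of_real_prod)
  also have "(\<lambda>x. \<Prod>b\<in>Basis. ?f b (x \<bullet> b)) = (\<lambda>x. gauss x *\<^sub>R exp (\<i> * complex_of_real (x \<bullet> z)))"
  proof
    fix x :: 'a
    have "x \<bullet> z = (\<Sum>b\<in>Basis. (z \<bullet> b) * (x \<bullet> b))" by (subst euclidean_inner) (simp add: mult.commute)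
    then show "(\<Prod>b\<in>Basis. ?f b (x \<bullet> b)) = gauss x *\<^sub>R exp (\<i> * complex_of_real (x \<bullet> z))"
      by (simp add: gauss_def prod.distrib scaleR_conv_of_real exp_sum[symmetric] sum_distrib_left)
  qed
  finally have "(\<integral>x. gauss x *\<^sub>R exp (\<i> * complex_of_real (x \<bullet> z)) \<partial>lborel) = complex_of_real (exp (- (norm z)\<^sup>2 / 2))" .
  then have *: "(\<integral>x. exp (\<i> * complex_of_real (x \<bullet> z)) \<partial>gauss_measure) = complex_of_real (exp (- (norm z)\<^sup>2 / 2))"
    unfolding gauss_measure_def by (subst integral_density) (auto simp: gauss_pos less_imp_le)
  have "integrable gauss_measure (\<lambda>x. exp (\<i> * complex_of_real (x \<bullet> z)))"
    by (rule G.integrable_const_bound[of _ 1]) auto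
  from integral_Re[OF this] * show ?thesis by (simp add: Re_exp)
qed

lemma integral_lborel_affine:
  fixes f :: "'a::euclidean_space \<Rightarrow> real"
  assumes [measurable]: "f \<in> borel_measurable borel" and s: "0 < s"
  shows "(\<integral>x. f x \<partial>lborel) = s ^ DIM('a) * (\<integral>x. f (t + s *\<^sub>R x) \<partial>lborel)"
proof -
  have "(\<integral>x. f x \<partial>lborel) = (\<integral>x. f x \<partial>density (distr lborel borel (\<lambda>x. t + s *\<^sub>R x)) (\<lambda>_. ennreal (s ^ DIM('a))))"
    using lborel_affine[of s t] s by simp
  also have "\<dots> = (\<integral>x. s ^ DIM('a) * f x \<partial>distr lborel borel (\<lambda>x. t + s *\<^sub>R x))"
    using s by (subst integral_density) auto
  also have "\<dots> = (\<integral>x. s ^ DIM('a) * f (t + s *\<^sub>R x) \<partial>lborel)"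
    by (subst integral_distr) auto
  finally show ?thesis by simp
qed

lemma integrable_bounded_times:
  fixes g k :: "'a \<Rightarrow> real"
  assumes k: "integrable M k" and [measurable]: "g \<in> borel_measurable M" and g: "\<And>x. \<bar>g x\<bar> \<le> B"
  shows "integrable M (\<lambda>x. g x * k x)"
proof (rule Bochner_Integration.integrable_bound)
  show "integrable M (\<lambda>x. B * k x)" using k by simp
  show "(\<lambda>x. g x * k x) \<in> borel_measurable M" using k by auto
  have "\<bar>g x * k x\<bar> \<le> \<bar>B * k x\<bar>" for x
    using g[of x] by (auto simp: abs_mult intro!: mult_right_mono)
  then show "AE x in M. norm (g x * k x) \<le> norm (B * k x)" by simp
qed

lemma prob_fubini_bounded_kernel:
  fixes k :: "'b \<Rightarrow> real" and g :: "'a \<Rightarrow> 'b \<Rightarrow> real"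
  assumes "prob_space M" "sigma_finite_measure N" and k: "integrable N k"
    and [measurable]: "(\<lambda>(x, y). g x y) \<in> borel_measurable (M \<Otimes>\<^sub>M N)" and g: "\<And>x y. \<bar>g x y\<bar> \<le> B"
  shows "(\<integral>x. (\<integral>y. g x y * k y \<partial>N) \<partial>M) = (\<integral>y. (\<integral>x. g x y \<partial>M) * k y \<partial>N)"
proof -
  interpret M: prob_space M by fact
  interpret N: sigma_finite_measure N by fact
  interpret p: pair_sigma_finite M N ..
  have [measurable]: "k \<in> borel_measurable N" using k by auto
  have "integrable (M \<Otimes>\<^sub>M N) (\<lambda>p. k (snd p))"
    by (rule p.Fubini_integrable) (use k in \<open>auto intro: M.integrable_const\<close>)
  then have "integrable (M \<Otimes>\<^sub>M N) (\<lambda>p. (case p of (x, y) \<Rightarrow> g x y) * k (snd p))"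
    by (rule integrable_bounded_times[where B=B]) (use g in auto)
  then have "integrable (M \<Otimes>\<^sub>M N) (\<lambda>(x, y). g x y * k y)" by (simp add: case_prod_beta')
  from p.Fubini_integral[OF this] show ?thesis by simp
qed

text \<open>
  The Gaussian density is, up to a constant, its own Fourier transform. Two applications of Fubini's
  theorem turn the Gaussian average of \<open>k\<close> around a \<open>\<mu>\<close>-distributed point into an integral of the
  product of the two cosine transforms, with the factor \<open>gauss (s *\<^sub>R \<eta>)\<close> securing absolute
  convergence. The hypothesis on \<open>\<phi>\<close> says that \<open>\<mu>\<close> has the real characteristic function \<open>\<phi>\<close>:
  expanding the cosine of the difference, the sine part vanishes.
\<close>
lemma gauss_smoothing_fourier:
  fixes \<mu> :: "'a::euclidean_space measure" and k :: "'a \<Rightarrow> real" and \<phi> :: "'a \<Rightarrow> real"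
  assumes "prob_space \<mu>" and s\<mu>[measurable_cong]: "sets \<mu> = sets borel"
    and \<phi>: "\<And>\<xi> y. (\<integral>x. cos (\<xi> \<bullet> (y - x)) \<partial>\<mu>) = \<phi> \<xi> * cos (\<xi> \<bullet> y)"
    and k: "integrable lborel k" and s: "0 < s"
  shows "(\<integral>x. (\<integral>u. k (x + s *\<^sub>R u) \<partial>gauss_measure) \<partial>\<mu>)
    = gauss_const TYPE('a) * (\<integral>\<eta>. gauss (s *\<^sub>R \<eta>) * (\<phi> \<eta> * (\<integral>y. cos (\<eta> \<bullet> y) * k y \<partial>lborel)) \<partial>lborel)"
proof -
  interpret \<mu>: prob_space \<mu> by fact
  interpret G: prob_space "gauss_measure :: 'a measure" by (rule prob_space_gauss_measure)
  define c where "c = gauss_const TYPE('a)"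
  have c: "0 < c" unfolding c_def by (rule gauss_const_pos)
  let ?d = "DIM('a)"
  have [measurable]: "k \<in> borel_measurable borel" using k by auto
  have \<phi>_eq: "\<phi> \<xi> = (\<integral>x. cos (\<xi> \<bullet> (0 - x)) \<partial>\<mu>)" for \<xi> using \<phi>[of \<xi> 0] by simp
  have [measurable]: "\<phi> \<in> borel_measurable borel" unfolding \<phi>_eq by measurable
  have \<phi>1: "\<bar>\<phi> \<xi>\<bar> \<le> 1" for \<xi>
  proof -
    have "\<bar>\<phi> \<xi>\<bar> \<le> (\<integral>x. \<bar>cos (\<xi> \<bullet> (0 - x))\<bar> \<partial>\<mu>)"
      unfolding \<phi>_eq by (rule integral_abs_bound)
    also have "\<dots> \<le> (\<integral>x. 1 \<partial>\<mu>)"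
      by (intro integral_mono \<mu>.integrable_const_bound[of _ 1]) auto
    finally show ?thesis by (simp add: \<mu>.prob_space)
  qed
  have gle: "\<bar>gauss v\<bar> \<le> c" for v :: 'a
  proof -
    have "exp (- (norm v)\<^sup>2 / 2) \<le> 1" by simp
    then have "c * exp (- (norm v)\<^sup>2 / 2) \<le> c * 1" using c by (intro mult_left_mono) auto
    then show ?thesis using gauss_pos[of v] by (simp add: gauss_eq c_def)
  qed
  have step1: "(\<integral>u. k (x + s *\<^sub>R u) \<partial>gauss_measure) = (\<integral>y. inverse (s ^ ?d) * gauss (inverse s *\<^sub>R (y - x)) * k y \<partial>lborel)" for x
  proof -
    have "(\<integral>y. inverse (s ^ ?d) * gauss (inverse s *\<^sub>R (y - x)) * k y \<partial>lborel)
      = s ^ ?d * (\<integral>u. inverse (s ^ ?d) * gauss (inverse s *\<^sub>R ((x + s *\<^sub>R u) - x)) * k (x + s *\<^sub>R u) \<partial>lborel)"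
      by (rule integral_lborel_affine) (use s in measurable)
    also have "\<dots> = (\<integral>u. gauss u * k (x + s *\<^sub>R u) \<partial>lborel)"
      using s by (simp add: mult.assoc)
    also have "\<dots> = (\<integral>u. k (x + s *\<^sub>R u) \<partial>gauss_measure)"
      by (rule integral_gauss_measure[symmetric]) measurable
    finally show ?thesis by simp
  qed
  have step2: "(\<integral>x. inverse (s ^ ?d) * gauss (inverse s *\<^sub>R (y - x)) \<partial>\<mu>)
     = inverse (s ^ ?d) * c * (\<integral>\<xi>. \<phi> (inverse s *\<^sub>R \<xi>) * cos ((inverse s *\<^sub>R \<xi>) \<bullet> y) \<partial>gauss_measure)" for y
  proof -
    interpret p: pair_prob_space \<mu> "gauss_measure :: 'a measure" ..
    have "(\<integral>x. inverse (s ^ ?d) * gauss (inverse s *\<^sub>R (y - x)) \<partial>\<mu>)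
       = (\<integral>x. inverse (s ^ ?d) * c * (\<integral>\<xi>. cos ((inverse s *\<^sub>R \<xi>) \<bullet> (y - x)) \<partial>gauss_measure) \<partial>\<mu>)"
      using gauss_measure_cos[of "inverse s *\<^sub>R (y - _)"]
      by (simp add: gauss_eq c_def mult.assoc)
    also have "\<dots> = inverse (s ^ ?d) * c * (\<integral>x. (\<integral>\<xi>. cos ((inverse s *\<^sub>R \<xi>) \<bullet> (y - x)) \<partial>gauss_measure) \<partial>\<mu>)"
      by simp
    also have "(\<integral>x. (\<integral>\<xi>. cos ((inverse s *\<^sub>R \<xi>) \<bullet> (y - x)) \<partial>gauss_measure) \<partial>\<mu>)
       = (\<integral>\<xi>. (\<integral>x. cos ((inverse s *\<^sub>R \<xi>) \<bullet> (y - x)) \<partial>\<mu>) \<partial>gauss_measure)"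
      by (rule p.Fubini_integral[symmetric], rule p.integrable_const_bound[of _ 1]) auto
    finally show ?thesis by (simp only: \<phi>)
  qed
  have "(\<integral>x. (\<integral>u. k (x + s *\<^sub>R u) \<partial>gauss_measure) \<partial>\<mu>)
      = (\<integral>y. (\<integral>x. inverse (s ^ ?d) * gauss (inverse s *\<^sub>R (y - x)) \<partial>\<mu>) * k y \<partial>lborel)"
    unfolding step1
  proof (rule prob_fubini_bounded_kernel[OF \<mu>.prob_space_axioms _ k, of _ "inverse (s ^ ?d) * c"])
    show "\<bar>inverse (s ^ ?d) * gauss (inverse s *\<^sub>R (y - x))\<bar> \<le> inverse (s ^ ?d) * c" for x y :: 'a
      using s gle by (simp add: abs_mult)
  qed (auto intro: lborel.sigma_finite_measure_axioms)
  also have "\<dots> = inverse (s ^ ?d) * c * (\<integral>y. (\<integral>\<xi>. \<phi> (inverse s *\<^sub>R \<xi>) * cos ((inverse s *\<^sub>R \<xi>) \<bullet> y) \<partial>gauss_measure) * k y \<partial>lborel)"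
    unfolding step2 by (simp add: mult.assoc)
  also have "(\<integral>y. (\<integral>\<xi>. \<phi> (inverse s *\<^sub>R \<xi>) * cos ((inverse s *\<^sub>R \<xi>) \<bullet> y) \<partial>gauss_measure) * k y \<partial>lborel)
      = (\<integral>\<xi>. (\<integral>y. (\<phi> (inverse s *\<^sub>R \<xi>) * cos ((inverse s *\<^sub>R \<xi>) \<bullet> y)) * k y \<partial>lborel) \<partial>gauss_measure)"
  proof (rule prob_fubini_bounded_kernel[OF G.prob_space_axioms _ k, of _ 1, symmetric])
    show "\<bar>\<phi> (inverse s *\<^sub>R \<xi>) * cos ((inverse s *\<^sub>R \<xi>) \<bullet> y)\<bar> \<le> 1" for \<xi> y :: 'a
      unfolding abs_mult by (intro mult_le_one \<phi>1) auto
  qed (auto intro: lborel.sigma_finite_measure_axioms)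
  also have "\<dots> = (\<integral>\<xi>. gauss \<xi> * (\<integral>y. (\<phi> (inverse s *\<^sub>R \<xi>) * cos ((inverse s *\<^sub>R \<xi>) \<bullet> y)) * k y \<partial>lborel) \<partial>lborel)"
    by (rule integral_gauss_measure) measurable
  also have "\<dots> = s ^ ?d * (\<integral>\<eta>. gauss (0 + s *\<^sub>R \<eta>) * (\<integral>y. (\<phi> (inverse s *\<^sub>R (0 + s *\<^sub>R \<eta>)) * cos ((inverse s *\<^sub>R (0 + s *\<^sub>R \<eta>)) \<bullet> y)) * k y \<partial>lborel) \<partial>lborel)"
    by (rule integral_lborel_affine) (use s in measurable)
  also have "inverse (s ^ ?d) * c * \<dots> = c * (\<integral>\<eta>. gauss (s *\<^sub>R \<eta>) * (\<phi> \<eta> * (\<integral>y. cos (\<eta> \<bullet> y) * k y \<partial>lborel)) \<partial>lborel)"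
    using s by (simp add: mult.assoc)
  finally show ?thesis by (simp add: c_def)
qed

lemma gauss_smoothing_limit:
  fixes \<mu> :: "'a::euclidean_space measure" and k :: "'a \<Rightarrow> real"
  assumes "prob_space \<mu>" and s\<mu>[measurable_cong]: "sets \<mu> = sets borel"
    and k: "continuous_on UNIV k" and B: "\<And>x. \<bar>k x\<bar> \<le> B"
  shows "(\<lambda>i. (\<integral>x. (\<integral>u. k (x + (1 / real (Suc i)) *\<^sub>R u) \<partial>gauss_measure) \<partial>\<mu>)) \<longlonglongrightarrow> (\<integral>x. k x \<partial>\<mu>)"
proof -
  interpret \<mu>: prob_space \<mu> by fact
  interpret G: prob_space "gauss_measure :: 'a measure" by (rule prob_space_gauss_measure)
  have [measurable]: "k \<in> borel_measurable borel" using k by (rule borel_measurable_continuous_onI)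
  have inner: "(\<lambda>i. (\<integral>u. k (x + (1 / real (Suc i)) *\<^sub>R u) \<partial>gauss_measure)) \<longlonglongrightarrow> (\<integral>u. k x \<partial>(gauss_measure :: 'a measure))" for x
  proof (rule integral_dominated_convergence[where w="\<lambda>_. B"])
    show "AE u in gauss_measure. (\<lambda>i. k (x + (1 / real (Suc i)) *\<^sub>R u)) \<longlonglongrightarrow> k x"
    proof (rule AE_I2)
      fix u :: 'a
      have "(\<lambda>i. x + (1 / real (Suc i)) *\<^sub>R u) \<longlonglongrightarrow> x + 0 *\<^sub>R u"
        by (intro tendsto_intros LIMSEQ_Suc[OF lim_1_over_n])
      then have "(\<lambda>i. x + (1 / real (Suc i)) *\<^sub>R u) \<longlonglongrightarrow> x" by simp
      moreover have "isCont k x" using k by (simp add: continuous_on_eq_continuous_at)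
      ultimately show "(\<lambda>i. k (x + (1 / real (Suc i)) *\<^sub>R u)) \<longlonglongrightarrow> k x" by (rule isCont_tendsto_compose[rotated])
    qed
  qed (use B in auto)
  have "(\<lambda>i. (\<integral>x. (\<integral>u. k (x + (1 / real (Suc i)) *\<^sub>R u) \<partial>gauss_measure) \<partial>\<mu>)) \<longlonglongrightarrow> (\<integral>x. (\<integral>u. k x \<partial>(gauss_measure :: 'a measure)) \<partial>\<mu>)"
  proof (rule integral_dominated_convergence[where w="\<lambda>_. B"])
    show "AE x in \<mu>. norm (\<integral>u. k (x + (1 / real (Suc i)) *\<^sub>R u) \<partial>gauss_measure) \<le> B" for i
    proof (rule AE_I2)
      fix x
      have "norm (\<integral>u. k (x + (1 / real (Suc i)) *\<^sub>R u) \<partial>gauss_measure) \<le> (\<integral>u. norm (k (x + (1 / real (Suc i)) *\<^sub>R u)) \<partial>gauss_measure)"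
        by (rule integral_norm_bound)
      also have "\<dots> \<le> (\<integral>u. B \<partial>(gauss_measure :: 'a measure))"
        by (intro integral_mono G.integrable_const_bound[of _ B])
          (use B order_trans[OF abs_ge_zero B[of 0]] in auto)
      finally show "norm (\<integral>u. k (x + (1 / real (Suc i)) *\<^sub>R u) \<partial>gauss_measure) \<le> B"
        using G.prob_space by simp
    qed
    show "AE x in \<mu>. (\<lambda>i. (\<integral>u. k (x + (1 / real (Suc i)) *\<^sub>R u) \<partial>gauss_measure)) \<longlonglongrightarrow> (\<integral>u. k x \<partial>(gauss_measure :: 'a measure))"
      using inner by simp
  qed auto
  then show ?thesis using G.prob_space by simp
qed

lemma integrable_indicator_bounded:
  fixes S :: "'a::euclidean_space set"
  assumes "bounded S" "S \<in> sets borel"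
  shows "integrable lborel (indicator S :: 'a \<Rightarrow> real)"
  using assms emeasure_bounded_finite[OF assms(1)] by (intro integrable_real_indicator) auto

text \<open>
  By Gaussian smoothing the integrals of bounded continuous Lebesgue-integrable functions agree.
  Such functions approximate the indicators of bounded open sets from below, and these sets generate
  the Borel sets and are closed under intersection.
\<close>
lemma measure_eq_of_cos_transform_eq:
  fixes \<mu> \<nu> :: "'a::euclidean_space measure"
  assumes \<mu>: "prob_space \<mu>" "sets \<mu> = sets borel" "\<And>\<xi> y. (\<integral>x. cos (\<xi> \<bullet> (y - x)) \<partial>\<mu>) = \<phi> \<xi> * cos (\<xi> \<bullet> y)"
    and \<nu>: "prob_space \<nu>" "sets \<nu> = sets borel" "\<And>\<xi> y. (\<integral>x. cos (\<xi> \<bullet> (y - x)) \<partial>\<nu>) = \<phi> \<xi> * cos (\<xi> \<bullet> y)"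
  shows "\<mu> = \<nu>"
proof -
  interpret \<mu>: prob_space \<mu> by fact
  interpret \<nu>: prob_space \<nu> by fact
  have cont: "(\<integral>x. k x \<partial>\<mu>) = (\<integral>x. k x \<partial>\<nu>)"
    if k: "continuous_on UNIV k" "\<And>x. \<bar>k x\<bar> \<le> B" "integrable lborel k" for k :: "'a \<Rightarrow> real" and B
  proof (rule LIMSEQ_unique)
    show "(\<lambda>i. (\<integral>x. (\<integral>u. k (x + (1 / real (Suc i)) *\<^sub>R u) \<partial>gauss_measure) \<partial>\<mu>)) \<longlonglongrightarrow> (\<integral>x. k x \<partial>\<mu>)"
      by (rule gauss_smoothing_limit[OF \<mu>(1,2) k(1,2)])
    have "(\<integral>x. (\<integral>u. k (x + (1 / real (Suc i)) *\<^sub>R u) \<partial>gauss_measure) \<partial>\<mu>) = (\<integral>x. (\<integral>u. k (x + (1 / real (Suc i)) *\<^sub>R u) \<partial>gauss_measure) \<partial>\<nu>)" for i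
      using gauss_smoothing_fourier[OF \<mu> k(3), of "1 / real (Suc i)"] gauss_smoothing_fourier[OF \<nu> k(3), of "1 / real (Suc i)"]
      by simp
    then show "(\<lambda>i. (\<integral>x. (\<integral>u. k (x + (1 / real (Suc i)) *\<^sub>R u) \<partial>gauss_measure) \<partial>\<mu>)) \<longlonglongrightarrow> (\<integral>x. k x \<partial>\<nu>)"
      using gauss_smoothing_limit[OF \<nu>(1,2) k(1,2)] by simp
  qed
  have opn: "emeasure \<mu> U = emeasure \<nu> U" if U: "open U" "bounded U" for U
  proof -
    define k where "k m x = min 1 (real m * infdist x (- U))" for m and x :: 'a
    have ne: "- U \<noteq> {}" using U(2) not_bounded_UNIV by (metis Compl_empty_eq double_complement)
    have k_cont: "continuous_on UNIV (k m)" for m unfolding k_def by (intro continuous_intros)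
    have k01: "\<bar>k m x\<bar> \<le> 1" for m x by (auto simp: k_def infdist_nonneg)
    have [measurable]: "k m \<in> borel_measurable borel" for m using k_cont by (rule borel_measurable_continuous_onI)
    have [measurable]: "U \<in> sets borel" using U by simp
    have k0: "k m x = 0" if "x \<notin> U" for m x using that by (simp add: k_def)
    have k_int: "integrable lborel (k m)" for m
    proof (rule Bochner_Integration.integrable_bound)
      show "integrable lborel (indicator U :: 'a \<Rightarrow> real)"
        using U by (intro integrable_indicator_bounded) auto
      show "AE x in lborel. norm (k m x) \<le> norm (indicator U x :: real)"
        using k01 k0 by (auto simp: indicator_def)
    qed simp
    have k_lim: "(\<lambda>m. k m x) \<longlonglongrightarrow> indicator U x" for x
    proof (cases "x \<in> U")
      case True
      then have pos: "0 < infdist x (- U)"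
        using U ne by (metis ComplD closed_Compl in_closed_iff_infdist_zero infdist_nonneg less_eq_real_def)
      obtain n where n: "1 / infdist x (- U) < real n" using reals_Archimedean2 by blast
      have "eventually (\<lambda>m. k m x = 1) sequentially"
        using eventually_ge_at_top[of n]
      proof eventually_elim
        case (elim m)
        then have "1 / infdist x (- U) \<le> real m" using n by simp
        then show ?case using pos by (simp add: k_def field_simps min_def)
      qed
      then show ?thesis using True by (simp add: tendsto_eventually)
    qed (simp add: k0)
    have lim: "(\<lambda>m. \<integral>x. k m x \<partial>\<rho>) \<longlonglongrightarrow> (\<integral>x. indicator U x \<partial>\<rho>)"
      if "prob_space \<rho>" "sets \<rho> = sets borel" for \<rho>
    proof -
      interpret prob_space \<rho> by fact
      have [measurable_cong]: "sets \<rho> = sets borel" by fact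
      show ?thesis
        by (rule integral_dominated_convergence[where w="\<lambda>_. 1"]) (use k_lim k01 in auto)
    qed
    have "(\<integral>x. indicator U x \<partial>\<mu>) = (\<integral>x. indicator U x \<partial>\<nu> :: real)"
      using lim[OF \<mu>(1,2)] lim[OF \<nu>(1,2)] cont[OF k_cont k01 k_int] by (intro LIMSEQ_unique) auto
    then have "measure \<mu> U = measure \<nu> U"
      using \<mu>(2) \<nu>(2) by (simp add: sets_eq_imp_space_eq[of _ borel])
    then show ?thesis by (simp add: \<mu>.emeasure_eq_measure \<nu>.emeasure_eq_measure)
  qed
  show ?thesis
  proof (rule measure_eqI_generator_eq[where E="{U. open U \<and> bounded U}" and \<Omega>=UNIV and A="\<lambda>n. ball 0 (real n)"])
    show "Int_stable {U::'a set. open U \<and> bounded U}" by (auto simp: Int_stable_def)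
    have "sigma_sets UNIV {U::'a set. open U \<and> bounded U} = sigma_sets UNIV {U. open U}"
    proof (rule sigma_sets_eqI)
      fix U :: "'a set" assume "U \<in> {U. open U}"
      then have "\<And>n. U \<inter> ball 0 (real n) \<in> {U. open U \<and> bounded U}" by auto
      then have "(\<Union>n. U \<inter> ball 0 (real n)) \<in> sigma_sets UNIV {U. open U \<and> bounded U}"
        by (intro sigma_sets.Union sigma_sets.Basic)
      moreover have "(\<Union>n. U \<inter> ball 0 (real n)) = U" using reals_Archimedean2 by auto
      ultimately show "U \<in> sigma_sets UNIV {U. open U \<and> bounded U}" by simp
    qed auto
    then have "sets borel = sigma_sets UNIV {U::'a set. open U \<and> bounded U}"
      by (simp add: borel_def)
    then show "sets \<mu> = sigma_sets UNIV {U. open U \<and> bounded U}" "sets \<nu> = sigma_sets UNIV {U. open U \<and> bounded U}"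
      using \<mu> \<nu> by auto
    show "(\<Union>n. ball (0::'a) (real n)) = UNIV" using reals_Archimedean2 by auto
  qed (use opn \<mu>.emeasure_finite in auto)
qed

section \<open>Overlap of a set with translates of another\<close>

text \<open>
  The volume of the points of \<open>S\<close> that the translation by \<open>v\<close> moves into \<open>S'\<close>. Its integral against
  the law of a random displacement is the mass that starts in \<open>S\<close> and arrives in \<open>S'\<close>.
\<close>
definition overlap :: "'a::euclidean_space set \<Rightarrow> 'a set \<Rightarrow> 'a \<Rightarrow> real" where
  "overlap S S' v = measure lborel (S \<inter> {x. x + v \<in> S'})"

lemma integral_lborel_translate:
  fixes f :: "'a::euclidean_space \<Rightarrow> real"
  assumes "f \<in> borel_measurable borel"
  shows "(\<integral>x. f (x + v) \<partial>lborel) = (\<integral>x. f x \<partial>lborel)"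
  using integral_lborel_affine[OF assms, of 1 v] by (simp add: add.commute)

lemma overlap_integral:
  assumes [measurable]: "S \<in> sets borel" "S' \<in> sets borel"
  shows "overlap S S' v = (\<integral>x. indicator S x * indicator S' (x + v) \<partial>lborel)"
proof -
  have "(\<lambda>x. indicator S x * indicator S' (x + v) :: real) = indicator (S \<inter> {x. x + v \<in> S'})"
    by (auto simp: indicator_def)
  then show ?thesis by (simp add: overlap_def)
qed

text \<open>
  Squeeze \<open>S\<close> between a compact set \<open>K\<close> and an open set \<open>U\<close> of almost the same volume. A small
  translation keeps \<open>K\<close> inside \<open>U\<close>, so the part of \<open>S\<close> that leaves \<open>S\<close> is contained in \<open>S - K\<close> and a
  translate of \<open>U - S\<close>.
\<close>
lemma overlap_self_tendsto:
  fixes S :: "'a::euclidean_space set"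
  assumes S[measurable]: "S \<in> sets borel" and b: "bounded S"
  shows "(overlap S S \<longlongrightarrow> measure lborel S) (at 0)"
proof (rule tendstoI)
  fix e :: real assume e: "0 < e"
  have fin: "emeasure lborel A < \<infinity>" if "A \<subseteq> S" for A
    using emeasure_bounded_finite[OF bounded_subset[OF b that]] .
  obtain U where U: "open U" "S \<subseteq> U" "emeasure lborel (U - S) < ennreal (e / 4)"
    using outer_regular_lborel[OF S, of "e / 4"] e by auto
  obtain V where V: "open V" "- S \<subseteq> V" "emeasure lborel (V - - S) < ennreal (e / 4)"
    using outer_regular_lborel[of "- S" "e / 4"] e S by auto
  define K where "K = - V"
  have K: "closed K" "K \<subseteq> S" "emeasure lborel (S - K) < ennreal (e / 4)"
    using V by (auto simp: K_def closed_Compl Diff_eq Int_commute)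
  have cK: "compact K" using K b by (meson bounded_subset compact_eq_bounded_closed)
  have [measurable]: "U \<in> sets borel" "K \<in> sets borel" using U K by auto
  have "\<exists>d>0. \<forall>x\<in>K. ball x d \<subseteq> U"
  proof -
    obtain d where "d > 0" "(\<Union>x\<in>K. ball x d) \<subseteq> U"
      using compact_subset_open_imp_ball_epsilon_subset[OF cK U(1)] K(2) U(2) by blast
    then show ?thesis by blast
  qed
  then obtain d where d: "d > 0" "\<And>x. x \<in> K \<Longrightarrow> ball x d \<subseteq> U" by auto
  show "eventually (\<lambda>v. dist (overlap S S v) (measure lborel S) < e) (at 0)"
    unfolding eventually_at
  proof (intro exI[of _ d] conjI ballI impI d(1))
    fix v :: 'a assume "v \<noteq> 0 \<and> dist v 0 < d"
    then have v: "norm v < d" by simp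
    let ?O = "S \<inter> {x. x + v \<in> S}"
    have [measurable]: "?O \<in> sets borel" by measurable
    have sub: "S - ?O \<subseteq> (S - K) \<union> {x. x + v \<in> U - S}"
    proof
      fix x assume x: "x \<in> S - ?O"
      show "x \<in> (S - K) \<union> {x. x + v \<in> U - S}"
      proof (cases "x \<in> K")
        case True
        then have "x + v \<in> U" using d(2)[OF True] v by (auto simp: dist_norm)
        then show ?thesis using x by auto
      qed (use x in auto)
    qed
    have "emeasure lborel {x. x + v \<in> U - S} = emeasure lborel (U - S)"
    proof -
      have "emeasure lborel (U - S) = emeasure (distr lborel borel ((+) v)) (U - S)"
        by (simp add: lborel_distr_plus)
      also have "\<dots> = emeasure lborel ((+) v -` (U - S) \<inter> space lborel)" by (rule emeasure_distr) auto
      also have "(+) v -` (U - S) \<inter> space lborel = {x. x + v \<in> U - S}" by (auto simp: add.commute)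
      finally show ?thesis by simp
    qed
    then have "emeasure lborel (S - ?O) \<le> emeasure lborel (S - K) + emeasure lborel (U - S)"
      using emeasure_mono[OF sub, of lborel] emeasure_subadditive[of "S - K" lborel "{x. x + v \<in> U - S}"]
      by (auto intro: order_trans)
    also have "\<dots> < ennreal (e / 4) + ennreal (e / 4)"
      using K(3) U(3) by (intro add_strict_mono)
    also have "\<dots> = ennreal (e / 2)" using e by (simp add: ennreal_plus[symmetric] del: ennreal_plus)
    finally have "emeasure lborel (S - ?O) < ennreal (e / 2)" .
    then have "measure lborel (S - ?O) < e"
      using e fin[of "S - ?O"] by (subst (asm) emeasure_eq_ennreal_measure) (auto simp: ennreal_less_iff)
    moreover have "measure lborel (S - ?O) = measure lborel S - measure lborel ?O"
      using fin[of S] by (intro measure_Diff) auto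
    moreover have "measure lborel ?O \<le> measure lborel S"
      using fin[of S] by (intro measure_mono_fmeasurable) (auto simp: fmeasurable_def)
    ultimately show "dist (overlap S S v) (measure lborel S) < e"
      by (simp add: overlap_def dist_real_def)
  qed
qed

lemma translation_difference_integral:
  fixes S :: "'a::euclidean_space set"
  assumes [measurable]: "S \<in> sets borel" and b: "bounded S"
  shows "(\<integral>x. \<bar>indicator S (x + u) - indicator S x\<bar> \<partial>lborel) = 2 * (measure lborel S - overlap S S u)"
    and "integrable lborel (\<lambda>x. indicator S x * (indicator S (x + u) :: real))"
    and "integrable lborel (\<lambda>x. indicator S (x + u) :: real)"
proof -
  note I = integrable_indicator_bounded[OF b assms(1)]
  have eqs: "(\<lambda>x. indicator S (x + u) :: real) = indicator ((\<lambda>x. x + u) -` S)" for u by (auto simp: indicator_def)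
  have bs: "bounded ((\<lambda>x. x + u) -` S)" for u
  proof -
    have "(\<lambda>x. x + u) -` S = (\<lambda>x. x - u) ` S" by (auto simp: image_iff intro!: bexI[of _ "_ + u"])
    then show ?thesis using b bounded_translation_minus by metis
  qed
  show I2: "integrable lborel (\<lambda>x. indicator S (x + u) :: real)"
    unfolding eqs using measurable_sets[of "\<lambda>x. x + u" borel borel S]
    by (intro integrable_indicator_bounded[OF bs]) simp
  show I3: "integrable lborel (\<lambda>x. indicator S x * (indicator S (x + u) :: real))"
    by (rule integrable_bounded_times[OF I2, of _ 1]) (auto simp: indicator_def)
  have "(\<integral>x. \<bar>indicator S (x + u) - indicator S x\<bar> \<partial>lborel)
     = (\<integral>x. indicator S (x + u) + indicator S x - 2 * (indicator S x * indicator S (x + u) :: real) \<partial>lborel)"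
    by (intro Bochner_Integration.integral_cong refl) (auto simp: indicator_def)
  also have "\<dots> = (\<integral>x. indicator S (x + u) \<partial>lborel) + measure lborel S - 2 * overlap S S u"
    using I I2 I3 by (simp add: overlap_integral)
  also have "(\<integral>x. indicator S (x + u) \<partial>lborel) = (\<integral>x. indicator S x \<partial>lborel :: real)"
    by (rule integral_lborel_translate) simp
  finally show "(\<integral>x. \<bar>indicator S (x + u) - indicator S x\<bar> \<partial>lborel) = 2 * (measure lborel S - overlap S S u)" by simp
qed

text \<open>
  The increments of the overlap are bounded by the \<open>L\<^sup>1\<close> distance between the indicator of \<open>S'\<close> and
  its translate, which tends to 0 with the translation.
\<close>
lemma overlap_continuous:
  fixes S S' :: "'a::euclidean_space set"
  assumes [measurable]: "S \<in> sets borel" "S' \<in> sets borel" and b: "bounded S" "bounded S'"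
  shows "continuous_on UNIV (overlap S S')"
  unfolding continuous_on_eq_continuous_at[OF open_UNIV] isCont_def
proof
  fix v :: 'a
  have le: "\<bar>overlap S S' (v + u) - overlap S S' v\<bar> \<le> 2 * (measure lborel S' - overlap S' S' u)" for u
  proof -
    have I: "integrable lborel (\<lambda>x. indicator S x * (indicator S' (x + w) :: real))" for w
      by (subst mult.commute, rule integrable_bounded_times[OF integrable_indicator_bounded[OF b(1)], of _ 1]) (auto simp: indicator_def)
    have J: "integrable lborel (\<lambda>x. \<bar>indicator S' (x + v + u) - (indicator S' (x + v) :: real)\<bar>)"
      using translation_difference_integral(3)[OF assms(2) b(2)]
      by (intro integrable_abs Bochner_Integration.integrable_diff) (auto simp: add.assoc)
    have "\<bar>overlap S S' (v + u) - overlap S S' v\<bar> = \<bar>\<integral>x. indicator S x * indicator S' (x + (v + u)) - indicator S x * indicator S' (x + v) \<partial>lborel\<bar>"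
      using I by (simp add: overlap_integral)
    also have "\<dots> \<le> (\<integral>x. \<bar>indicator S x * indicator S' (x + (v + u)) - indicator S x * indicator S' (x + v)\<bar> \<partial>lborel)"
      by (rule integral_abs_bound)
    also have "\<dots> \<le> (\<integral>x. \<bar>indicator S' (x + v + u) - indicator S' (x + v)\<bar> \<partial>lborel)"
      by (intro integral_mono integrable_abs Bochner_Integration.integrable_diff I J) (auto simp: indicator_def add.assoc)
    also have "\<dots> = (\<integral>x. \<bar>indicator S' (x + u) - indicator S' x\<bar> \<partial>lborel)"
      by (rule integral_lborel_translate[of "\<lambda>x. \<bar>indicator S' (x + u) - indicator S' x\<bar>" v]) simp
    also have "\<dots> = 2 * (measure lborel S' - overlap S' S' u)" by (rule translation_difference_integral) (use b in auto)
    finally show ?thesis .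
  qed
  have "((\<lambda>u. 2 * (measure lborel S' - overlap S' S' u)) \<longlongrightarrow> 2 * (measure lborel S' - measure lborel S')) (at 0)"
    by (intro tendsto_intros overlap_self_tendsto) (use b in auto)
  then have "((\<lambda>u. 2 * (measure lborel S' - overlap S' S' u)) \<longlongrightarrow> 0) (at 0)" by simp
  from Lim_null_comparison[OF always_eventually this, of "\<lambda>u. overlap S S' (v + u) - overlap S S' v"] le
  have "((\<lambda>u. overlap S S' (v + u) - overlap S S' v) \<longlongrightarrow> 0) (at 0)" by simp
  then show "(overlap S S' \<longlongrightarrow> overlap S S' v) (at v)"
    by (simp add: LIM_zero_iff LIM_offset_zero_iff[of v])
qed
section \<open>Overlaps charged by a convolution semigroup\<close>

lemma integrable_lborel_affine:
  fixes f :: "'a::euclidean_space \<Rightarrow> real"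
  assumes f: "integrable lborel f" and s: "0 < s"
  shows "integrable lborel (\<lambda>x. f (t + s *\<^sub>R x))"
proof -
  have [measurable]: "f \<in> borel_measurable borel" using f by auto
  have "integrable (density (distr lborel borel (\<lambda>x. t + s *\<^sub>R x)) (\<lambda>_. ennreal (s ^ DIM('a)))) f"
    using f lborel_affine[of s t] s by simp
  then have "integrable (distr lborel borel (\<lambda>x. t + s *\<^sub>R x)) (\<lambda>x. s ^ DIM('a) * f x)"
    using s by (subst (asm) integrable_density) auto
  then have "integrable lborel (\<lambda>x. s ^ DIM('a) * f (t + s *\<^sub>R x))"
    by (subst (asm) integrable_distr_eq) auto
  then show ?thesis using s by simp
qed

lemma integrable_gauss_scaled: "0 < s \<Longrightarrow> integrable lborel (\<lambda>x::'a::euclidean_space. gauss (s *\<^sub>R x))"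
proof -
  assume s: "0 < s"
  interpret G: prob_space "gauss_measure :: 'a measure" by (rule prob_space_gauss_measure)
  have "integrable gauss_measure (\<lambda>_::'a. 1::real)" by simp
  then have "integrable lborel (\<lambda>x::'a. gauss x * 1)"
    unfolding gauss_measure_def by (subst (asm) integrable_density) (auto simp: gauss_pos less_imp_le)
  then show ?thesis using integrable_lborel_affine[of gauss s 0] s by simp
qed

definition cos_transform :: "'a::euclidean_space set \<Rightarrow> 'a \<Rightarrow> real" where
  "cos_transform S \<xi> = (\<integral>x. cos (\<xi> \<bullet> x) * indicator S x \<partial>lborel)"

definition sin_transform :: "'a::euclidean_space set \<Rightarrow> 'a \<Rightarrow> real" where
  "sin_transform S \<xi> = (\<integral>x. sin (\<xi> \<bullet> x) * indicator S x \<partial>lborel)"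

lemma trig_coeff_integrable:
  fixes S :: "'a::euclidean_space set"
  assumes "bounded S" "S \<in> sets borel"
  shows "integrable lborel (\<lambda>x. cos (\<xi> \<bullet> x) * indicator S x)"
    and "integrable lborel (\<lambda>x. sin (\<xi> \<bullet> x) * indicator S x)"
  by (rule integrable_bounded_times[OF integrable_indicator_bounded[OF assms], of _ 1]; simp)+

lemma overlap_bounds:
  fixes S S' :: "'a::euclidean_space set"
  assumes "bounded S" "S \<in> sets borel"
  shows "0 \<le> overlap S S' v" "overlap S S' v \<le> measure lborel S"
proof -
  have "S \<in> fmeasurable lborel"
    using assms emeasure_bounded_finite[OF assms(1)] by (simp add: fmeasurable_def)
  moreover have "overlap S S' v = measure lborel (S \<inter> {x. x + v \<in> S'})" by (simp add: overlap_def)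
  ultimately show "overlap S S' v \<le> measure lborel S"
    unfolding overlap_def
    by (cases "S \<inter> {x. x + v \<in> S'} \<in> sets lborel")
      (auto intro: measure_mono_fmeasurable simp: measure_notin_sets)
qed (simp add: overlap_def)

text \<open>
  The overlap is a convolution of two indicators, one of them reflected; this is the real part of
  the product of the Fourier transform of \<open>S'\<close> with the conjugate of that of \<open>S\<close>.
\<close>
lemma overlap_fourier:
  fixes S S' :: "'a::euclidean_space set"
  assumes S[measurable]: "S \<in> sets borel" "S' \<in> sets borel" and b: "bounded S" "bounded S'"
  shows "(\<integral>y. cos (\<eta> \<bullet> y) * overlap S S' y \<partial>lborel)
       = cos_transform S \<eta> * cos_transform S' \<eta> + sin_transform S \<eta> * sin_transform S' \<eta>"
proof -
  let ?F = "\<lambda>x y. cos (\<eta> \<bullet> y) * (indicator S x * indicator S' (x + y)) :: real"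
  have I': "integrable lborel (\<lambda>y. indicator S' (x + y) :: real)" for x
    using integrable_lborel_affine[OF integrable_indicator_bounded[OF b(2) S(2)], of 1 x] by simp
  have int: "integrable (lborel \<Otimes>\<^sub>M lborel) (\<lambda>(x, y). ?F x y)"
  proof (rule lborel_pair.Fubini_integrable)
    show "(\<lambda>(x, y). ?F x y) \<in> borel_measurable (lborel \<Otimes>\<^sub>M lborel)" by measurable
    have y_int: "integrable lborel (\<lambda>y. ?F x y)" for x
    proof -
      have "integrable lborel (\<lambda>y. (cos (\<eta> \<bullet> y) * indicator S x) * (indicator S' (x + y) :: real))"
        by (rule integrable_bounded_times[OF I', of _ 1]) (auto simp: indicator_def)
      then show ?thesis by (simp add: mult.assoc)
    qed
    then show "AE x in lborel. integrable lborel (\<lambda>y. case (x, y) of (x, y) \<Rightarrow> ?F x y)" by simp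
    show "integrable lborel (\<lambda>x. \<integral>y. norm (case (x, y) of (x, y) \<Rightarrow> ?F x y) \<partial>lborel)"
    proof (rule Bochner_Integration.integrable_bound)
      show "integrable lborel (\<lambda>x. measure lborel S' * indicator S x :: real)"
        using integrable_indicator_bounded[OF b(1) S(1)] by simp
      have "norm (\<integral>y. norm (?F x y) \<partial>lborel) \<le> norm (measure lborel S' * indicator S x)" for x
      proof -
        have "(\<integral>y. norm (?F x y) \<partial>lborel) \<le> (\<integral>y. indicator S x * indicator S' (x + y) \<partial>lborel)"
          by (intro integral_mono integrable_norm y_int integrable_mult_right I') (auto simp: indicator_def)
        also have "\<dots> = indicator S x * (\<integral>y. indicator S' (y + x) \<partial>lborel)" by (simp add: add.commute)
        also have "(\<integral>y. indicator S' (y + x) \<partial>lborel) = (\<integral>y. indicator S' y \<partial>lborel :: real)"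
          by (rule integral_lborel_translate) simp
        finally show ?thesis by (simp add: mult.commute)
      qed
      then show "AE x in lborel. norm (\<integral>y. norm (case (x, y) of (x, y) \<Rightarrow> ?F x y) \<partial>lborel) \<le> norm (measure lborel S' * indicator S x)"
        by simp
    qed measurable
  qed
  have "(\<integral>y. cos (\<eta> \<bullet> y) * overlap S S' y \<partial>lborel) = (\<integral>y. (\<integral>x. ?F x y \<partial>lborel) \<partial>lborel)"
    by (simp add: overlap_integral)
  also have "\<dots> = (\<integral>x. (\<integral>y. ?F x y \<partial>lborel) \<partial>lborel)"
    by (rule lborel_pair.Fubini_integral) (use int in simp)
  also have "\<dots> = (\<integral>x. (cos (\<eta> \<bullet> x) * indicator S x) * cos_transform S' \<eta> + (sin (\<eta> \<bullet> x) * indicator S x) * sin_transform S' \<eta> \<partial>lborel)"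
  proof (rule Bochner_Integration.integral_cong[OF refl])
    fix x :: 'a
    have "(\<integral>y. ?F x y \<partial>lborel) = indicator S x * (\<integral>y. cos (\<eta> \<bullet> ((y + x) - x)) * indicator S' (y + x) \<partial>lborel)"
      by (simp add: mult.left_commute add.commute)
    also have "(\<integral>y. cos (\<eta> \<bullet> ((y + x) - x)) * indicator S' (y + x) \<partial>lborel) = (\<integral>z. cos (\<eta> \<bullet> (z - x)) * indicator S' z \<partial>lborel)"
      by (rule integral_lborel_translate[of "\<lambda>z. cos (\<eta> \<bullet> (z - x)) * indicator S' z"]) measurable
    also have "\<dots> = (\<integral>z. cos (\<eta> \<bullet> x) * (cos (\<eta> \<bullet> z) * indicator S' z) + sin (\<eta> \<bullet> x) * (sin (\<eta> \<bullet> z) * indicator S' z) \<partial>lborel)"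
      by (simp add: inner_diff_right cos_diff algebra_simps)
    also have "\<dots> = cos (\<eta> \<bullet> x) * cos_transform S' \<eta> + sin (\<eta> \<bullet> x) * sin_transform S' \<eta>"
      using trig_coeff_integrable[OF b(2) S(2)] by (simp add: cos_transform_def sin_transform_def)
    finally show "(\<integral>y. ?F x y \<partial>lborel) = (cos (\<eta> \<bullet> x) * indicator S x) * cos_transform S' \<eta> + (sin (\<eta> \<bullet> x) * indicator S x) * sin_transform S' \<eta>"
      by (simp add: algebra_simps)
  qed
  also have "\<dots> = cos_transform S \<eta> * cos_transform S' \<eta> + sin_transform S \<eta> * sin_transform S' \<eta>"
    using trig_coeff_integrable[OF b(1) S(1)] by (simp add: cos_transform_def sin_transform_def)
  finally show ?thesis .
qed

lemma integrable_overlap: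
  fixes S S' :: "'a::euclidean_space set"
  assumes [measurable]: "S \<in> sets borel" "S' \<in> sets borel" and b: "S \<subseteq> ball 0 r" "S' \<subseteq> ball 0 r"
  shows "integrable lborel (overlap S S')" and "overlap S S' y \<noteq> 0 \<Longrightarrow> norm y \<le> 2 * r"
proof -
  have bb: "bounded S" "bounded S'" using b by (auto intro: bounded_subset[OF bounded_ball])
  have supp: "norm y \<le> 2 * r" if "overlap S S' y \<noteq> 0" for y
  proof -
    have "S \<inter> {x. x + y \<in> S'} \<noteq> {}" using that by (auto simp: overlap_def)
    then obtain x where "x \<in> S" "x + y \<in> S'" by auto
    then have "norm x < r" "norm (x + y) < r" using b by auto
    then show ?thesis using norm_triangle_ineq4[of "x + y" x] by simp
  qed
  then show "overlap S S' y \<noteq> 0 \<Longrightarrow> norm y \<le> 2 * r" .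
  have [measurable]: "overlap S S' \<in> borel_measurable borel"
    using overlap_continuous[OF assms(1,2) bb] by (rule borel_measurable_continuous_onI)
  show "integrable lborel (overlap S S')"
  proof (rule Bochner_Integration.integrable_bound)
    show "integrable lborel (\<lambda>y. measure lborel S * indicator (cball (0::'a) (2 * r)) y :: real)"
      by (intro integrable_mult_right integrable_indicator_bounded) auto
    have "norm (overlap S S' y) \<le> norm (measure lborel S * indicator (cball (0::'a) (2 * r)) y)" for y
      using supp[of y] overlap_bounds[OF bb(1) assms(1), of S' y] by (cases "overlap S S' y = 0") auto
    then show "AE y in lborel. norm (overlap S S' y) \<le> norm (measure lborel S * indicator (cball (0::'a) (2 * r)) y)"
      by simp
  qed simp
qed

text \<open>
  A quantitative Riemann--Lebesgue lemma: the translation by \<open>\<pi> \<xi> / |\<xi>|\<^sup>2\<close> reverses the sign of the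
  cosine, so twice the transform is an integral against the difference of two translates of the
  indicator.
\<close>
lemma abs_cos_transform_le:
  fixes S :: "'a::euclidean_space set"
  assumes S[measurable]: "S \<in> sets borel" and b: "bounded S" and \<xi>: "\<xi> \<noteq> 0"
  shows "\<bar>cos_transform S \<xi>\<bar> \<le> measure lborel S - overlap S S ((pi / (norm \<xi>)\<^sup>2) *\<^sub>R \<xi>)"
proof -
  let ?u = "(pi / (norm \<xi>)\<^sup>2) *\<^sub>R \<xi>"
  have shift: "cos (\<xi> \<bullet> (x + ?u)) = - cos (\<xi> \<bullet> x)" for x
    using \<xi> by (simp add: inner_add_right power2_norm_eq_inner)
  have I: "integrable lborel (\<lambda>x. cos (\<xi> \<bullet> x) * (indicator S (x + ?u) :: real))"
    by (rule integrable_bounded_times[OF translation_difference_integral(3)[OF S b], of _ 1]) auto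
  have "cos_transform S \<xi> = (\<integral>x. cos (\<xi> \<bullet> (x + ?u)) * indicator S (x + ?u) \<partial>lborel)"
    unfolding cos_transform_def
    by (rule integral_lborel_translate[of "\<lambda>x. cos (\<xi> \<bullet> x) * indicator S x", symmetric]) measurable
  also have "\<dots> = - (\<integral>x. cos (\<xi> \<bullet> x) * indicator S (x + ?u) \<partial>lborel)" by (simp add: shift)
  finally have "2 * cos_transform S \<xi> = (\<integral>x. cos (\<xi> \<bullet> x) * indicator S x \<partial>lborel) - (\<integral>x. cos (\<xi> \<bullet> x) * indicator S (x + ?u) \<partial>lborel)"
    by (simp add: cos_transform_def)
  also have "\<dots> = (\<integral>x. cos (\<xi> \<bullet> x) * indicator S x - cos (\<xi> \<bullet> x) * indicator S (x + ?u) \<partial>lborel)"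
    using trig_coeff_integrable(1)[OF b S] I by simp
  also have "\<bar>\<dots>\<bar> \<le> (\<integral>x. \<bar>cos (\<xi> \<bullet> x) * indicator S x - cos (\<xi> \<bullet> x) * indicator S (x + ?u)\<bar> \<partial>lborel)"
    by (rule integral_abs_bound)
  also have "\<dots> \<le> (\<integral>x. \<bar>indicator S (x + ?u) - indicator S x\<bar> \<partial>lborel)"
    by (intro integral_mono integrable_abs Bochner_Integration.integrable_diff trig_coeff_integrable(1)[OF b S] I
        translation_difference_integral(3)[OF S b] integrable_indicator_bounded[OF b S])
      (auto simp: indicator_def)
  also have "\<dots> = 2 * (measure lborel S - overlap S S ?u)"
    by (rule translation_difference_integral[OF S b])
  finally show ?thesis by simp
qed

lemma cos_transform_continuous:
  fixes S :: "'a::euclidean_space set"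
  assumes S[measurable]: "S \<in> sets borel" and b: "bounded S"
  shows "continuous_on UNIV (cos_transform S)"
proof (rule continuous_on_sequentiallyI)
  fix u and a :: 'a assume u: "u \<longlonglongrightarrow> a"
  show "(\<lambda>n. cos_transform S (u n)) \<longlonglongrightarrow> cos_transform S a"
    unfolding cos_transform_def
  proof (rule integral_dominated_convergence[where w="indicator S"])
    show "integrable lborel (indicator S :: 'a \<Rightarrow> real)" by (rule integrable_indicator_bounded[OF b S])
    show "AE x in lborel. (\<lambda>i. cos (u i \<bullet> x) * indicator S x) \<longlonglongrightarrow> cos (a \<bullet> x) * (indicator S x :: real)"
      by (intro AE_I2 tendsto_intros u)
  qed (auto simp: indicator_def)
qed

text \<open>
  Equality would force \<open>S\<close> into the countable union of the hyperplanes on which the cosine equals 1.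
\<close>
lemma cos_transform_less:
  fixes S :: "'a::euclidean_space set"
  assumes S[measurable]: "S \<in> sets borel" and b: "bounded S" and pos: "0 < measure lborel S" and \<xi>: "\<xi> \<noteq> 0"
  shows "cos_transform S \<xi> < measure lborel S"
proof -
  let ?f = "\<lambda>x. (1 - cos (\<xi> \<bullet> x)) * indicator S x :: real"
  have f0: "0 \<le> ?f x" for x by (auto simp: indicator_def)
  have If: "integrable lborel ?f"
    using trig_coeff_integrable(1)[OF b S] integrable_indicator_bounded[OF b S] by (simp add: left_diff_distrib)
  have eq: "(\<integral>x. ?f x \<partial>lborel) = measure lborel S - cos_transform S \<xi>"
    using trig_coeff_integrable(1)[OF b S] integrable_indicator_bounded[OF b S]
    by (simp add: left_diff_distrib cos_transform_def)
  have "(\<integral>x. ?f x \<partial>lborel) \<noteq> 0"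
  proof
    assume "(\<integral>x. ?f x \<partial>lborel) = 0"
    then have ae: "AE x in lborel. ?f x = 0"
      using integral_nonneg_eq_0_iff_AE[OF If] f0 by simp
    let ?H = "\<lambda>k::int. {x. \<xi> \<bullet> x = of_int k * (2 * pi)}"
    have "AE x in lborel. x \<notin> ?H k" for k
    proof -
      have "negligible (?H k)" using \<xi> by (intro negligible_hyperplane) auto
      then have "?H k \<in> null_sets (completion lborel)" by (simp add: negligible_iff_null_sets)
      moreover have "?H k \<in> sets lborel" by measurable
      ultimately have "?H k \<in> null_sets lborel" by (simp add: null_sets_completion_iff)
      then show ?thesis by (rule AE_not_in)
    qed
    then have "AE x in lborel. \<forall>k. x \<notin> ?H k" by (simp add: AE_all_countable)
    with ae have "AE x in lborel. x \<notin> S"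
    proof eventually_elim
      case (elim x)
      then have "cos (\<xi> \<bullet> x) \<noteq> 1" by (auto simp: cos_one_2pi_int)
      then show ?case using elim(1) by auto
    qed
    then have "emeasure lborel S = 0" by (subst (asm) AE_iff_measurable[of S]) auto
    then show False using pos by (simp add: measure_def)
  qed
  moreover have "0 \<le> (\<integral>x. ?f x \<partial>lborel)" by (intro integral_nonneg_AE AE_I2 f0)
  ultimately show ?thesis using eq by simp
qed

text \<open>
  For large \<open>\<xi>\<close> the Riemann--Lebesgue bound applies; on the remaining compact shell the strict
  inequality of lemma \<open>cos_transform_less\<close> is uniform by continuity.
\<close>
lemma cos_transform_gap:
  fixes S :: "'a::euclidean_space set"
  assumes S[measurable]: "S \<in> sets borel" and b: "bounded S" and pos: "0 < measure lborel S" and \<delta>: "0 < \<delta>"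
  shows "\<exists>\<kappa>>0. \<forall>\<xi>. \<delta> \<le> norm \<xi> \<longrightarrow> \<kappa> \<le> measure lborel S - cos_transform S \<xi>"
proof -
  let ?m = "measure lborel S"
  have "eventually (\<lambda>v. ?m / 2 < overlap S S v) (at 0)"
    by (rule order_tendstoD(1)[OF overlap_self_tendsto[OF S b]]) (use pos in simp)
  then obtain d where d: "d > 0" "\<And>v. v \<noteq> 0 \<Longrightarrow> norm v < d \<Longrightarrow> ?m / 2 < overlap S S v"
    unfolding eventually_at by auto
  define R where "R = pi / d"
  have far: "?m / 2 \<le> ?m - cos_transform S \<xi>" if \<xi>: "\<xi> \<noteq> 0" "R < norm \<xi>" for \<xi>
  proof -
    let ?u = "(pi / (norm \<xi>)\<^sup>2) *\<^sub>R \<xi>"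
    have "norm ?u = pi / norm \<xi>" using \<xi> by (simp add: power2_eq_square)
    also have "\<dots> < d" using \<xi> d(1) by (simp add: R_def field_simps)
    finally have "?m / 2 < overlap S S ?u" using \<xi> by (intro d(2)) auto
    then show ?thesis using abs_cos_transform_le[OF S b \<xi>(1)] by simp
  qed
  let ?A = "cball (0::'a) R - ball 0 \<delta>"
  show ?thesis
  proof (cases "?A = {}")
    case True
    have "?m / 2 \<le> ?m - cos_transform S \<xi>" if "\<delta> \<le> norm \<xi>" for \<xi>
    proof (rule far)
      show "\<xi> \<noteq> 0" using that \<delta> by auto
      have "\<xi> \<notin> cball 0 R - ball 0 \<delta>" using True by blast
      then show "R < norm \<xi>" using that by simp
    qed
    then show ?thesis using pos by (intro exI[of _ "?m / 2"]) auto
  next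
    case False
    have "compact ?A" by (intro compact_diff) auto
    moreover have "continuous_on ?A (\<lambda>\<xi>. ?m - cos_transform S \<xi>)"
      by (intro continuous_intros continuous_on_subset[OF cos_transform_continuous[OF S b]]) auto
    ultimately obtain \<xi>0 where \<xi>0: "\<xi>0 \<in> ?A" "\<And>\<xi>. \<xi> \<in> ?A \<Longrightarrow> ?m - cos_transform S \<xi>0 \<le> ?m - cos_transform S \<xi>"
      using continuous_attains_inf[OF _ False] by blast
    have "\<xi>0 \<noteq> 0"
    proof
      assume "\<xi>0 = 0"
      then show False using \<xi>0(1) \<delta> by simp
    qed
    then have p0: "0 < ?m - cos_transform S \<xi>0" using cos_transform_less[OF S b pos, of \<xi>0] \<xi>0(1) \<delta> by auto
    show ?thesis
    proof (intro exI[of _ "min (?m / 2) (?m - cos_transform S \<xi>0)"] conjI allI impI)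
      show "0 < min (?m / 2) (?m - cos_transform S \<xi>0)" using p0 pos by simp
      fix \<xi> :: 'a assume \<xi>: "\<delta> \<le> norm \<xi>"
      then have "\<xi> \<noteq> 0" using \<delta> by auto
      then show "min (?m / 2) (?m - cos_transform S \<xi>0) \<le> ?m - cos_transform S \<xi>"
        using far[of \<xi>] \<xi>0(2)[of \<xi>] \<xi> by (cases "R < norm \<xi>") auto
    qed
  qed
qed

text \<open>
  A Laplace principle. Let \<open>\<Theta>\<close> be the cosine transform of the overlap. After Gaussian smoothing with
  parameter \<open>s\<close>, the integral of the overlap against \<open>\<mu> n\<close> is \<open>\<integral> gauss (s \<eta>) e\<^sup>-\<^sup>n\<^sup>\<psi>\<^sup>(\<^sup>\<eta>\<^sup>) \<Theta>(\<eta>) d\<eta>\<close>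
  up to a constant. Near the origin \<open>\<Theta> \<ge> \<theta> > 0\<close>, and on a smaller ball \<open>\<psi> \<le> \<kappa>/2\<close>, which contributes
  at least a multiple of \<open>e\<^sup>-\<^sup>n\<^sup>\<kappa>\<^sup>/\<^sup>2\<close>. Away from the origin \<open>\<psi> \<ge> \<kappa>\<close>, and the remaining integral of
  \<open>|\<Theta>|\<close> is bounded uniformly in \<open>s\<close>, so that its contribution is at most a multiple of \<open>e\<^sup>-\<^sup>n\<^sup>\<kappa>\<close>. If
  all the overlap integrals vanished, letting first \<open>s\<close> tend to 0 and then \<open>n\<close> to infinity would be
  contradictory.
\<close>
lemma overlap_charged:
  fixes \<mu> :: "nat \<Rightarrow> 'a::euclidean_space measure" and \<psi> :: "'a \<Rightarrow> real"
  assumes \<mu>: "\<And>n. prob_space (\<mu> n)" "\<And>n. sets (\<mu> n) = sets borel"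
    and tr: "\<And>n \<xi> y. (\<integral>x. cos (\<xi> \<bullet> (y - x)) \<partial>\<mu> n) = exp (- real n * \<psi> \<xi>) * cos (\<xi> \<bullet> y)"
    and gap: "\<And>\<delta>. 0 < \<delta> \<Longrightarrow> \<exists>\<kappa>>0. \<forall>\<xi>. \<delta> \<le> norm \<xi> \<longrightarrow> \<kappa> \<le> \<psi> \<xi>"
    and \<psi>0: "(\<psi> \<longlongrightarrow> 0) (at 0)" "\<psi> 0 = 0"
    and S[measurable]: "S \<in> sets borel" "S' \<in> sets borel" and b: "bounded S" "bounded S'"
    and pos: "0 < measure lborel S" "0 < measure lborel S'"
  shows "\<exists>n. (\<integral>x. overlap S S' x \<partial>\<mu> n) \<noteq> 0"
proof (rule ccontr)
  assume "\<not> ?thesis"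
  then have zero: "(\<integral>x. overlap S S' x \<partial>\<mu> n) = 0" for n by simp
  define c where "c = gauss_const TYPE('a)"
  have c: "0 < c" by (simp add: c_def gauss_const_pos)
  obtain r where r: "0 < r" "S \<subseteq> ball 0 r" "S' \<subseteq> ball 0 r"
  proof -
    obtain r1 r2 where "S \<subseteq> ball 0 r1" "S' \<subseteq> ball 0 r2" using b bounded_subset_ballD by metis
    then show ?thesis by (intro that[of "max 1 (max r1 r2)"]) auto
  qed
  define \<Theta> where "\<Theta> \<eta> = cos_transform S \<eta> * cos_transform S' \<eta> + sin_transform S \<eta> * sin_transform S' \<eta>" for \<eta>
  \<comment> \<open>The squared modulus of the Fourier transform of the indicator of \<open>A\<close>.\<close>
  define E where "E A \<eta> = (cos_transform A \<eta>)\<^sup>2 + (sin_transform A \<eta>)\<^sup>2" for A :: "'a set" and \<eta>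
  have \<Theta>_eq: "(\<integral>y. cos (\<eta> \<bullet> y) * overlap S S' y \<partial>lborel) = \<Theta> \<eta>" for \<eta>
    unfolding \<Theta>_def by (rule overlap_fourier[OF S b])
  have E_eq: "(\<integral>y. cos (\<eta> \<bullet> y) * overlap A A y \<partial>lborel) = E A \<eta>" if "A \<in> sets borel" "bounded A" for A \<eta>
    using overlap_fourier[OF that(1,1,2,2)] by (simp add: E_def power2_eq_square)
  have \<Theta>_le: "\<bar>\<Theta> \<eta>\<bar> \<le> (E S \<eta> + E S' \<eta>) / 2" for \<eta>
  proof -
    have "\<bar>x * y\<bar> \<le> (x\<^sup>2 + y\<^sup>2) / 2" for x y :: real
      using sum_squares_bound[of "\<bar>x\<bar>" "\<bar>y\<bar>"] by (simp add: abs_mult)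
    from add_mono[OF this[of "cos_transform S \<eta>" "cos_transform S' \<eta>"] this[of "sin_transform S \<eta>" "sin_transform S' \<eta>"]]
    show ?thesis unfolding \<Theta>_def E_def
      by (intro order_trans[OF abs_triangle_ineq]) (simp add: add_divide_distrib)
  qed
  have E_int: "integrable lborel (\<lambda>\<eta>. gauss (s *\<^sub>R \<eta>) * E A \<eta>)"
    and E_bd: "c * (\<integral>\<eta>. gauss (s *\<^sub>R \<eta>) * E A \<eta> \<partial>lborel) \<le> measure lborel A"
    if A[measurable]: "A \<in> sets borel" and bA: "A \<subseteq> ball 0 r" and s: "0 < s" for A s
  proof -
    have bdA: "bounded A" using bA bounded_subset[OF bounded_ball] by auto
    have iA: "integrable lborel (overlap A A)" by (rule integrable_overlap[OF A A bA bA])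
    have [measurable]: "overlap A A \<in> borel_measurable borel" using iA by auto
    have "E A \<eta> \<le> (\<integral>y. overlap A A y \<partial>lborel)" for \<eta>
      unfolding E_eq[OF A bdA, symmetric]
      by (intro integral_mono iA integrable_bounded_times[of _ _ _ 1])
        (auto simp: overlap_bounds[OF bdA A] mult_left_le_one_le intro: order_trans[OF mult_right_mono[of _ 1]])
    then have Eb: "\<bar>E A \<eta>\<bar> \<le> (\<integral>y. overlap A A y \<partial>lborel)" for \<eta> by (simp add: E_def)
    have [measurable]: "E A \<in> borel_measurable borel" unfolding E_eq[OF A bdA, symmetric] by measurable
    show "integrable lborel (\<lambda>\<eta>. gauss (s *\<^sub>R \<eta>) * E A \<eta>)"
      by (subst mult.commute, rule integrable_bounded_times[OF integrable_gauss_scaled[OF s]]) (use Eb in auto)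
    interpret G: prob_space "gauss_measure :: 'a measure" by (rule prob_space_gauss_measure)
    \<comment> \<open>Smoothing the point mass at 0 evaluates the Gaussian integral of \<open>E A\<close> as an average of
      the overlap of \<open>A\<close> with itself, which is at most the volume of \<open>A\<close>. The bound does not
      depend on \<open>s\<close>.\<close>
    have ps: "prob_space (return borel (0::'a))" by (rule prob_space_return) simp
    have "(\<integral>x. (\<integral>u. overlap A A (x + s *\<^sub>R u) \<partial>gauss_measure) \<partial>return borel 0)
       = gauss_const TYPE('a) * (\<integral>\<eta>. gauss (s *\<^sub>R \<eta>) * (1 * (\<integral>y. cos (\<eta> \<bullet> y) * overlap A A y \<partial>lborel)) \<partial>lborel)"
      by (rule gauss_smoothing_fourier[OF ps _ _ iA s]) (auto simp: integral_return)
    then have "c * (\<integral>\<eta>. gauss (s *\<^sub>R \<eta>) * E A \<eta> \<partial>lborel) = (\<integral>x. (\<integral>u. overlap A A (x + s *\<^sub>R u) \<partial>gauss_measure) \<partial>return borel 0)"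
      by (simp add: c_def E_eq[OF A bdA])
    also have "\<dots> = (\<integral>u. overlap A A (s *\<^sub>R u) \<partial>gauss_measure)"
      by (subst integral_return) auto
    also have "\<dots> \<le> (\<integral>u. measure lborel A \<partial>(gauss_measure :: 'a measure))"
      by (intro integral_mono G.integrable_const_bound[of _ "measure lborel A"])
        (auto simp: overlap_bounds[OF bdA A])
    finally show "c * (\<integral>\<eta>. gauss (s *\<^sub>R \<eta>) * E A \<eta> \<partial>lborel) \<le> measure lborel A"
      using G.prob_space by simp
  qed
  define \<theta> where "\<theta> = measure lborel S * measure lborel S' / 2"
  have \<theta>: "0 < \<theta>" using pos by (simp add: \<theta>_def)
  \<comment> \<open>The overlap lives on \<open>|y| \<le> 2r\<close>, so \<open>|\<eta>| \<le> \<delta>\<close> gives \<open>|\<eta> \<bullet> y| \<le> 1 \<le> \<pi>/3\<close> and a cosine of at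
    least 1/2.\<close>
  define \<delta> where "\<delta> = 1 / (2 * r)"
  have \<delta>: "0 < \<delta>" using r by (simp add: \<delta>_def)
  note iSS' = integrable_overlap[OF S r(2,3)]
  have \<Theta>_near: "\<theta> \<le> \<Theta> \<eta>" if \<eta>: "norm \<eta> \<le> \<delta>" for \<eta>
  proof -
    have "(\<integral>y. overlap S S' y \<partial>lborel) = measure lborel S * measure lborel S'"
      using \<Theta>_eq[of 0] by (simp add: \<Theta>_def cos_transform_def sin_transform_def)
    then have "\<theta> = (\<integral>y. 1 / 2 * overlap S S' y \<partial>lborel)" by (simp add: \<theta>_def)
    also have "\<dots> \<le> (\<integral>y. cos (\<eta> \<bullet> y) * overlap S S' y \<partial>lborel)"
    proof (intro integral_mono integrable_mult_right iSS' integrable_bounded_times[of _ _ _ 1])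
      fix y :: 'a
      show "1 / 2 * overlap S S' y \<le> cos (\<eta> \<bullet> y) * overlap S S' y"
      proof (cases "overlap S S' y = 0")
        case False
        then have "norm y \<le> 2 * r" by (rule iSS')
        then have "norm \<eta> * norm y \<le> \<delta> * (2 * r)" using \<eta> \<delta> by (intro mult_mono) auto
        then have "\<bar>\<eta> \<bullet> y\<bar> \<le> 1" using Cauchy_Schwarz_ineq2[of \<eta> y] r by (simp add: \<delta>_def)
        then have "\<bar>\<eta> \<bullet> y\<bar> \<le> pi / 3" using pi_gt3 by simp
        then have "cos (pi / 3) \<le> cos \<bar>\<eta> \<bullet> y\<bar>"
          by (intro cos_monotone_0_pi_le) (use pi_gt_zero in auto)
        then have "1 / 2 \<le> cos (\<eta> \<bullet> y)" by (simp add: cos_60)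
        then show ?thesis using overlap_bounds(1)[OF b(1) S(1)] by (intro mult_right_mono)
      qed simp
    qed auto
    finally show ?thesis unfolding \<Theta>_eq .
  qed
  obtain \<kappa> where \<kappa>: "0 < \<kappa>" "\<And>\<xi>. \<delta> \<le> norm \<xi> \<Longrightarrow> \<kappa> \<le> \<psi> \<xi>" using gap[OF \<delta>] by blast
  have "eventually (\<lambda>\<xi>. \<psi> \<xi> < \<kappa> / 2) (at 0)"
    by (rule order_tendstoD(2)[OF \<psi>0(1)]) (use \<kappa> in simp)
  then obtain d where d: "0 < d" "\<And>\<xi>. \<xi> \<noteq> 0 \<Longrightarrow> norm \<xi> < d \<Longrightarrow> \<psi> \<xi> < \<kappa> / 2"
    unfolding eventually_at by auto
  define \<delta>' where "\<delta>' = min d \<delta>"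
  have \<delta>': "0 < \<delta>'" "\<delta>' \<le> \<delta>" using d \<delta> by (auto simp: \<delta>'_def)
  have near: "\<psi> \<xi> \<le> \<kappa> / 2" if "norm \<xi> < \<delta>'" for \<xi>
    using d(2)[of \<xi>] that \<psi>0(2) \<kappa> by (cases "\<xi> = 0") (auto simp: \<delta>'_def)
  define G where "G = (\<integral>\<eta>. gauss \<eta> * indicator (ball (0::'a) \<delta>') \<eta> \<partial>lborel)"
  have G_int: "integrable lborel (\<lambda>\<eta>. gauss (s *\<^sub>R \<eta>) * indicator (ball (0::'a) \<delta>') \<eta> :: real)" if "0 < s" for s
    by (subst mult.commute, rule integrable_bounded_times[OF integrable_gauss_scaled[OF that], of _ 1])
      (simp_all add: indicator_def)
  have G: "0 < G"
  proof -
    have "G \<noteq> 0"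
    proof
      assume "G = 0"
      then have "AE \<eta> in lborel. gauss \<eta> * indicator (ball (0::'a) \<delta>') \<eta> = (0::real)"
        unfolding G_def using integral_nonneg_eq_0_iff_AE[OF G_int[of 1]] by (auto simp: gauss_pos less_imp_le)
      then have "AE \<eta> in lborel. \<eta> \<notin> ball (0::'a) \<delta>'"
      proof eventually_elim
        case (elim \<eta>)
        then show ?case using gauss_pos[of \<eta>] by (simp add: indicator_def split: if_splits)
      qed
      then have "emeasure lborel (ball (0::'a) \<delta>') = 0" by (subst (asm) AE_iff_measurable[of "ball 0 \<delta>'"]) auto
      moreover have "0 < measure lborel (ball (0::'a) \<delta>')"
        using content_ball_pos[OF \<delta>'(1), of "0::'a"] by simp
      ultimately show False by (simp add: measure_def)
    qed
    moreover have "0 \<le> G" unfolding G_def by (intro integral_nonneg_AE) (auto simp: gauss_pos less_imp_le)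
    ultimately show ?thesis by simp
  qed
  define Mc where "Mc = (measure lborel S + measure lborel S') / 2"
  have main: "c * (\<theta> * exp (- real n * (\<kappa> / 2))) * G - exp (- real n * \<kappa>) * Mc \<le> (\<integral>x. (\<integral>u. overlap S S' (x + s *\<^sub>R u) \<partial>gauss_measure) \<partial>\<mu> n)"
    if s: "0 < s" "s \<le> 1" for s n
  proof -
    let ?w = "\<lambda>\<eta>. exp (- real n * \<psi> \<eta>)"
    \<comment> \<open>A lower bound for \<open>e\<^sup>-\<^sup>n\<^sup>\<psi> \<Theta>\<close>: the gain on the small ball minus the loss outside the
      ball of radius \<open>\<delta>\<close>.\<close>
    define L where "L \<eta> = (\<theta> * exp (- real n * (\<kappa> / 2))) * indicator (ball (0::'a) \<delta>') \<eta> - exp (- real n * \<kappa>) * ((E S \<eta> + E S' \<eta>) / 2)" for \<eta>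
    have gm: "gauss \<eta> \<le> gauss (s *\<^sub>R \<eta>)" for \<eta> :: 'a
    proof -
      have "(norm (s *\<^sub>R \<eta>))\<^sup>2 \<le> (norm \<eta>)\<^sup>2" using s by (intro power_mono) (auto simp: mult_left_le_one_le)
      then show ?thesis unfolding gauss_eq using gauss_const_pos[where 'a='a] by (intro mult_left_mono) auto
    qed
    have Epos: "0 \<le> E A \<eta>" for A \<eta> by (simp add: E_def)
    have L_le: "L \<eta> \<le> ?w \<eta> * \<Theta> \<eta>" for \<eta>
    proof (cases "norm \<eta> < \<delta>")
      case True
      have "L \<eta> \<le> (\<theta> * exp (- real n * (\<kappa> / 2))) * indicator (ball (0::'a) \<delta>') \<eta>"
        unfolding L_def using Epos[of S \<eta>] Epos[of S' \<eta>] by simp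
      also have "\<dots> \<le> ?w \<eta> * \<Theta> \<eta>"
      proof (cases "norm \<eta> < \<delta>'")
        case True
        have "exp (- real n * (\<kappa> / 2)) * \<theta> \<le> ?w \<eta> * \<Theta> \<eta>"
          using mult_left_mono[OF near[OF True], of "real n"] \<Theta>_near[of \<eta>] \<open>norm \<eta> < \<delta>\<close> \<theta> by (intro mult_mono) (auto intro: mult_left_mono)
        then show ?thesis using True by (simp add: mult.commute)
      next
        case False
        then show ?thesis using \<Theta>_near[of \<eta>] \<open>norm \<eta> < \<delta>\<close> \<theta> by simp
      qed
      finally show ?thesis .
    next
      case False
      then have "?w \<eta> \<le> exp (- real n * \<kappa>)" using mult_left_mono[OF \<kappa>(2)[of \<eta>], of "real n"] by auto
      then have "?w \<eta> * \<bar>\<Theta> \<eta>\<bar> \<le> exp (- real n * \<kappa>) * ((E S \<eta> + E S' \<eta>) / 2)"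
        using \<Theta>_le[of \<eta>] by (intro mult_mono) auto
      moreover have "- (?w \<eta> * \<bar>\<Theta> \<eta>\<bar>) \<le> ?w \<eta> * \<Theta> \<eta>"
        by (smt (verit) exp_gt_zero mult_left_mono mult_minus_right)
      moreover have "\<eta> \<notin> ball 0 \<delta>'" using False \<delta>' by auto
      ultimately show ?thesis by (simp add: L_def)
    qed
    have iE: "integrable lborel (\<lambda>\<eta>. gauss (s *\<^sub>R \<eta>) * E S \<eta>)" "integrable lborel (\<lambda>\<eta>. gauss (s *\<^sub>R \<eta>) * E S' \<eta>)"
      using E_int S r s by auto
    have L_exp: "gauss (s *\<^sub>R \<eta>) * L \<eta> = (\<theta> * exp (- real n * (\<kappa> / 2))) * (gauss (s *\<^sub>R \<eta>) * indicator (ball (0::'a) \<delta>') \<eta>)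
        - exp (- real n * \<kappa>) / 2 * (gauss (s *\<^sub>R \<eta>) * E S \<eta>) - exp (- real n * \<kappa>) / 2 * (gauss (s *\<^sub>R \<eta>) * E S' \<eta>)" for \<eta>
      by (simp add: L_def field_simps)
    have L_int: "integrable lborel (\<lambda>\<eta>. gauss (s *\<^sub>R \<eta>) * L \<eta>)"
      unfolding L_exp using iE G_int[OF s(1)] by (intro Bochner_Integration.integrable_diff integrable_mult_right)
    have \<psi>m: "(\<lambda>\<eta>. ?w \<eta>) \<in> borel_measurable borel"
    proof -
      interpret prob_space "\<mu> n" by (rule \<mu>)
      have [measurable_cong]: "sets (\<mu> n) = sets borel" by (rule \<mu>)
      have "?w \<eta> = (\<integral>x. cos (\<eta> \<bullet> (0 - x)) \<partial>\<mu> n)" for \<eta> using tr[of n \<eta> 0] by simp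
      then show ?thesis by simp measurable
    qed
    note \<psi>m[measurable]
    have \<Theta>m[measurable]: "\<Theta> \<in> borel_measurable borel"
    proof -
      have [measurable]: "overlap S S' \<in> borel_measurable borel" using iSS' by auto
      show ?thesis unfolding \<Theta>_eq[symmetric] by measurable
    qed
    have w1: "?w \<eta> \<le> 1" for \<eta>
    proof -
      interpret prob_space "\<mu> n" by (rule \<mu>)
      have [measurable_cong]: "sets (\<mu> n) = sets borel" by (rule \<mu>)
      have "?w \<eta> = (\<integral>x. cos (\<eta> \<bullet> (0 - x)) \<partial>\<mu> n)" using tr[of n \<eta> 0] by simp
      also have "\<dots> \<le> (\<integral>x. 1 \<partial>\<mu> n)" by (intro integral_mono integrable_const_bound[of _ 1]) auto
      finally show ?thesis using prob_space by simp
    qed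
    have W_int: "integrable lborel (\<lambda>\<eta>. gauss (s *\<^sub>R \<eta>) * (?w \<eta> * \<Theta> \<eta>))"
    proof (rule Bochner_Integration.integrable_bound)
      show "integrable lborel (\<lambda>\<eta>. (gauss (s *\<^sub>R \<eta>) * E S \<eta> + gauss (s *\<^sub>R \<eta>) * E S' \<eta>) / 2)" using iE by simp
      have "norm (gauss (s *\<^sub>R \<eta>) * (?w \<eta> * \<Theta> \<eta>)) \<le> norm ((gauss (s *\<^sub>R \<eta>) * E S \<eta> + gauss (s *\<^sub>R \<eta>) * E S' \<eta>) / 2)" for \<eta>
      proof -
        have "?w \<eta> * \<bar>\<Theta> \<eta>\<bar> \<le> 1 * ((E S \<eta> + E S' \<eta>) / 2)" using w1 \<Theta>_le by (intro mult_mono) auto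
        then have "gauss (s *\<^sub>R \<eta>) * (?w \<eta> * \<bar>\<Theta> \<eta>\<bar>) \<le> gauss (s *\<^sub>R \<eta>) * ((E S \<eta> + E S' \<eta>) / 2)"
          using gauss_pos[of "s *\<^sub>R \<eta>"] by (intro mult_left_mono) auto
        then show ?thesis using gauss_pos[of "s *\<^sub>R \<eta>"] Epos[of S \<eta>] Epos[of S' \<eta>]
          by (simp add: abs_mult distrib_left)
      qed
      then show "AE \<eta> in lborel. norm (gauss (s *\<^sub>R \<eta>) * (?w \<eta> * \<Theta> \<eta>)) \<le> norm ((gauss (s *\<^sub>R \<eta>) * E S \<eta> + gauss (s *\<^sub>R \<eta>) * E S' \<eta>) / 2)"
        by simp
    qed measurable
    have "c * (\<theta> * exp (- real n * (\<kappa> / 2))) * G - exp (- real n * \<kappa>) * Mc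
       \<le> c * ((\<theta> * exp (- real n * (\<kappa> / 2))) * (\<integral>\<eta>. gauss (s *\<^sub>R \<eta>) * indicator (ball (0::'a) \<delta>') \<eta> \<partial>lborel)
         - exp (- real n * \<kappa>) / 2 * (\<integral>\<eta>. gauss (s *\<^sub>R \<eta>) * E S \<eta> \<partial>lborel) - exp (- real n * \<kappa>) / 2 * (\<integral>\<eta>. gauss (s *\<^sub>R \<eta>) * E S' \<eta> \<partial>lborel))"
    proof -
      have "G \<le> (\<integral>\<eta>. gauss (s *\<^sub>R \<eta>) * indicator (ball (0::'a) \<delta>') \<eta> \<partial>lborel)"
        unfolding G_def using G_int[of 1] G_int[OF s(1)] gm by (intro integral_mono) (auto intro: mult_right_mono)
      then have "c * (\<theta> * exp (- real n * (\<kappa> / 2))) * G \<le> c * (\<theta> * exp (- real n * (\<kappa> / 2))) * (\<integral>\<eta>. gauss (s *\<^sub>R \<eta>) * indicator (ball (0::'a) \<delta>') \<eta> \<partial>lborel)"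
        using c \<theta> by (intro mult_left_mono) auto
      moreover have "exp (- real n * \<kappa>) / 2 * (c * (\<integral>\<eta>. gauss (s *\<^sub>R \<eta>) * E S \<eta> \<partial>lborel)) \<le> exp (- real n * \<kappa>) / 2 * measure lborel S"
        using E_bd[OF S(1) r(2) s(1)] by (intro mult_left_mono) auto
      moreover have "exp (- real n * \<kappa>) / 2 * (c * (\<integral>\<eta>. gauss (s *\<^sub>R \<eta>) * E S' \<eta> \<partial>lborel)) \<le> exp (- real n * \<kappa>) / 2 * measure lborel S'"
        using E_bd[OF S(2) r(3) s(1)] by (intro mult_left_mono) auto
      moreover have "exp (- real n * \<kappa>) * Mc = exp (- real n * \<kappa>) / 2 * measure lborel S + exp (- real n * \<kappa>) / 2 * measure lborel S'"
        by (simp add: Mc_def field_simps)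
      moreover have "c * (K * I0 - e * I1 - e * I2) = c * K * I0 - e * (c * I1) - e * (c * I2)" for K I0 I1 I2 e
        by (simp add: algebra_simps)
      ultimately show ?thesis by (simp only:)
    qed
    also have "\<dots> = c * (\<integral>\<eta>. gauss (s *\<^sub>R \<eta>) * L \<eta> \<partial>lborel)"
      unfolding L_exp using iE G_int[OF s(1)] by simp
    also have "\<dots> \<le> c * (\<integral>\<eta>. gauss (s *\<^sub>R \<eta>) * (?w \<eta> * \<Theta> \<eta>) \<partial>lborel)"
      using c L_le by (intro mult_left_mono integral_mono L_int W_int) (auto intro: less_imp_le[OF gauss_pos])
    also have "\<dots> = (\<integral>x. (\<integral>u. overlap S S' (x + s *\<^sub>R u) \<partial>gauss_measure) \<partial>\<mu> n)"
      using gauss_smoothing_fourier[OF \<mu>(1) \<mu>(2) tr iSS'(1) s(1), of n] by (simp add: c_def \<Theta>_eq)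
    finally show ?thesis .
  qed
  have bound: "c * \<theta> * G \<le> exp (- (\<kappa> / 2)) ^ n * Mc" for n
  proof -
    have "(\<lambda>i. (\<integral>x. (\<integral>u. overlap S S' (x + (1 / real (Suc i)) *\<^sub>R u) \<partial>gauss_measure) \<partial>\<mu> n)) \<longlonglongrightarrow> (\<integral>x. overlap S S' x \<partial>\<mu> n)"
      by (rule gauss_smoothing_limit[OF \<mu> overlap_continuous[OF S b], where B="measure lborel S"])
        (simp add: overlap_bounds[OF b(1) S(1)])
    then have "c * (\<theta> * exp (- real n * (\<kappa> / 2))) * G - exp (- real n * \<kappa>) * Mc \<le> 0"
      unfolding zero by (rule tendsto_lowerbound) (intro always_eventually allI main, auto)
    then have "exp (- real n * (\<kappa> / 2)) * (c * \<theta> * G) \<le> exp (- real n * (\<kappa> / 2)) * (exp (- real n * (\<kappa> / 2)) * Mc)"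
      by (simp add: mult.assoc[symmetric] exp_add[symmetric]) (simp add: mult_ac)
    then have "c * \<theta> * G \<le> exp (- real n * (\<kappa> / 2)) * Mc" by simp
    also have "exp (- real n * (\<kappa> / 2)) = exp (- (\<kappa> / 2)) ^ n" by (simp add: exp_of_nat_mult[symmetric])
    finally show ?thesis .
  qed
  have "(\<lambda>n. exp (- (\<kappa> / 2)) ^ n * Mc) \<longlonglongrightarrow> 0 * Mc"
    by (intro tendsto_intros LIMSEQ_realpow_zero) (use \<kappa> in auto)
  then have "c * \<theta> * G \<le> 0 * Mc" by (rule tendsto_lowerbound) (use bound in auto)
  then show False using c \<theta> G by (simp add: mult_le_0_iff)
qed
section \<open>Time reversal of processes with stationary independent increments\<close>

text \<open>
  A right-continuous path is the limit of its values at the next strictly later point of the grid of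
  mesh \<open>1/(n + 1)\<close>, and the gridded process is jointly measurable, having countably many time
  values. Time is cut off at 0 to obtain a map on the whole line.
\<close>
lemma right_continuous_process_measurable:
  fixes X :: "real \<Rightarrow> 'w \<Rightarrow> 'a::euclidean_space"
  assumes X: "\<And>t. 0 \<le> t \<Longrightarrow> X t \<in> borel_measurable M"
    and rc: "\<And>w t. w \<in> space M \<Longrightarrow> 0 \<le> t \<Longrightarrow> continuous (at t within {t..}) (\<lambda>s. X s w)"
  shows "(\<lambda>(s, w). X (max 0 s) w) \<in> borel_measurable (borel \<Otimes>\<^sub>M M)"
proof -
  define a where "a n s = (real_of_int \<lfloor>real (Suc n) * max 0 s\<rfloor> + 1) / real (Suc n)" for n s
  have a_gt: "max 0 s < a n s" and a_le: "a n s \<le> max 0 s + 1 / real (Suc n)" for n s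
  proof -
    have "real (Suc n) * max 0 s < real_of_int \<lfloor>real (Suc n) * max 0 s\<rfloor> + 1" by linarith
    then have "real (Suc n) * max 0 s / real (Suc n) < a n s" unfolding a_def by (rule divide_strict_right_mono) simp
    then show "max 0 s < a n s" by simp
    have "real_of_int \<lfloor>real (Suc n) * max 0 s\<rfloor> + 1 \<le> real (Suc n) * max 0 s + 1" by linarith
    then have "a n s \<le> (real (Suc n) * max 0 s + 1) / real (Suc n)" unfolding a_def by (rule divide_right_mono) simp
    then show "a n s \<le> max 0 s + 1 / real (Suc n)" by (simp add: add_divide_distrib)
  qed
  show ?thesis
  proof (rule borel_measurable_LIMSEQ_metric[where f="\<lambda>n (s, w). X (max 0 (a n s)) w"])
    show "(\<lambda>(s, w). X (max 0 (a n s)) w) \<in> borel_measurable (borel \<Otimes>\<^sub>M M)" for n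
    proof -
      have "(\<lambda>p. X (max 0 ((real_of_int \<lfloor>real (Suc n) * max 0 (fst p)\<rfloor> + 1) / real (Suc n))) (snd p)) \<in> borel_measurable (borel \<Otimes>\<^sub>M M)"
      proof (rule measurable_compose_countable[where f="\<lambda>i p. X (max 0 ((real_of_int i + 1) / real (Suc n))) (snd p)"
            and g="\<lambda>p. \<lfloor>real (Suc n) * max 0 (fst p)\<rfloor>"])
        fix i :: int
        have [measurable]: "X (max 0 ((real_of_int i + 1) / real (Suc n))) \<in> borel_measurable M" by (rule X) simp
        show "(\<lambda>p. X (max 0 ((real_of_int i + 1) / real (Suc n))) (snd p)) \<in> borel_measurable (borel \<Otimes>\<^sub>M M)" by measurable
      next
        show "(\<lambda>p. \<lfloor>real (Suc n) * max 0 (fst p)\<rfloor>) \<in> borel \<Otimes>\<^sub>M M \<rightarrow>\<^sub>M count_space UNIV" by measurable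
      qed
      then show ?thesis by (simp add: a_def case_prod_beta')
    qed
    fix p :: "real \<times> 'w" assume "p \<in> space (borel \<Otimes>\<^sub>M M)"
    then obtain s w where p: "p = (s, w)" "w \<in> space M" by (cases p) (auto simp: space_pair_measure)
    have "(\<lambda>n. a n s) \<longlonglongrightarrow> max 0 s"
    proof (rule tendsto_sandwich[of "\<lambda>_. max 0 s" _ _ "\<lambda>n. max 0 s + 1 / real (Suc n)"])
      have "(\<lambda>n. max 0 s + 1 / real (Suc n)) \<longlonglongrightarrow> max 0 s + 0"
        by (intro tendsto_intros LIMSEQ_Suc[OF lim_1_over_n])
      then show "(\<lambda>n. max 0 s + 1 / real (Suc n)) \<longlonglongrightarrow> max 0 s" by simp
    qed (intro always_eventually allI less_imp_le[OF a_gt] a_le tendsto_const)+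
    then have "(\<lambda>n. X (a n s) w) \<longlonglongrightarrow> X (max 0 s) w"
      using rc[OF p(2), of "max 0 s"] a_gt
      unfolding continuous_within_sequentially by (auto simp: less_imp_le comp_def)
    moreover have "max 0 (a n s) = a n s" for n using a_gt[of s n] by simp
    ultimately show "(\<lambda>n. case p of (s, w) \<Rightarrow> X (max 0 (a n s)) w) \<longlonglongrightarrow> (case p of (s, w) \<Rightarrow> X (max 0 s) w)"
      by (simp add: p)
  qed
qed

lemma (in prob_space) indep_vars_reindex_bij:
  assumes ind: "indep_vars M' Z I" and f: "bij_betw f J I"
  shows "indep_vars (\<lambda>j. M' (f j)) (\<lambda>j. Z (f j)) J"
proof -
  let ?F = "\<lambda>i. {Z i -` A \<inter> space M |A. A \<in> sets (M' i)}"
  have rv: "\<forall>i\<in>I. random_variable (M' i) (Z i)" and isets: "indep_sets ?F I"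
    using ind by (auto simp: indep_vars_def2)
  have fI: "f j \<in> I" if "j \<in> J" for j using f that by (auto simp: bij_betw_def)
  have "indep_sets (\<lambda>j. ?F (f j)) J"
    unfolding indep_sets_def
  proof (intro conjI ballI allI impI)
    show "?F (f j) \<subseteq> events" if "j \<in> J" for j
      using isets fI[OF that] unfolding indep_sets_def by blast
    fix K A assume K: "K \<subseteq> J" "K \<noteq> {}" "finite K" and A: "A \<in> (\<Pi> j\<in>K. ?F (f j))"
    let ?g = "the_inv_into J f"
    have inj: "inj_on f J" using f by (simp add: bij_betw_def)
    then have g: "?g (f j) = j" if "j \<in> K" for j using that K by (auto simp: the_inv_into_f_f)
    have "prob (\<Inter>i\<in>f ` K. A (?g i)) = (\<Prod>i\<in>f ` K. prob (A (?g i)))"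
    proof -
      have "f ` K \<subseteq> I" "f ` K \<noteq> {}" "finite (f ` K)" using K fI by auto
      moreover have "(\<lambda>i. A (?g i)) \<in> Pi (f ` K) ?F" using A g by (auto simp: Pi_def)
      ultimately show ?thesis using isets unfolding indep_sets_def by blast
    qed
    moreover have "(\<Inter>i\<in>f ` K. A (?g i)) = (\<Inter>j\<in>K. A j)" using g by auto
    moreover have "(\<Prod>i\<in>f ` K. prob (A (?g i))) = (\<Prod>j\<in>K. prob (A j))"
      using inj_on_subset[OF inj K(1)] g by (simp add: prod.reindex)
    ultimately show "prob (\<Inter>j\<in>K. A j) = (\<Prod>j\<in>K. prob (A j))" by simp
  qed
  then show ?thesis using rv fI by (auto simp: indep_vars_def2)
qed

text \<open>
  Equality of the finite-dimensional distributions on \<open>[0, t]\<close>, in the form in which it is used for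
  moments: the times need be neither ordered nor distinct.
\<close>
definition same_fdd :: "'w measure \<Rightarrow> real \<Rightarrow> (real \<Rightarrow> 'w \<Rightarrow> 'a::euclidean_space) \<Rightarrow> (real \<Rightarrow> 'w \<Rightarrow> 'a) \<Rightarrow> bool" where
  "same_fdd M t X Y \<longleftrightarrow>
    (\<forall>(k::nat) s (f :: nat \<Rightarrow> 'a \<Rightarrow> ennreal). (\<forall>i<k. 0 \<le> s i \<and> s i \<le> t) \<longrightarrow> (\<forall>i<k. f i \<in> borel_measurable borel) \<longrightarrow>
      (\<integral>\<^sup>+w. (\<Prod>i<k. f i (X (s i) w)) \<partial>M) = (\<integral>\<^sup>+w. (\<Prod>i<k. f i (Y (s i) w)) \<partial>M))"

text \<open>
  Independent increments, stationary with increment laws \<open>Q\<close>, on the time interval \<open>[0, t]\<close>. No path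
  regularity is included, so that the notion is stable under time reversal, which destroys right
  continuity.
\<close>
definition additive_on :: "'w measure \<Rightarrow> real \<Rightarrow> (real \<Rightarrow> 'w \<Rightarrow> 'a::euclidean_space) \<Rightarrow> (real \<Rightarrow> 'a measure) \<Rightarrow> bool" where
  "additive_on M t X Q \<longleftrightarrow>
    (\<forall>s. 0 \<le> s \<longrightarrow> s \<le> t \<longrightarrow> X s \<in> borel_measurable M) \<and> (AE w in M. X 0 w = 0) \<and>
    (\<forall>(n::nat) (\<tau>::nat \<Rightarrow> real). 0 \<le> \<tau> 0 \<longrightarrow> \<tau> n \<le> t \<longrightarrow> (\<forall>i<n. \<tau> i \<le> \<tau> (Suc i)) \<longrightarrow>
        prob_space.indep_vars M (\<lambda>_. borel) (\<lambda>i w. X (\<tau> (Suc i)) w - X (\<tau> i) w) {..<n}) \<and>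
    (\<forall>s u. 0 \<le> s \<longrightarrow> s \<le> u \<longrightarrow> u \<le> t \<longrightarrow> distr M borel (\<lambda>w. X u w - X s w) = Q (u - s))"

text \<open>
  Along a grid starting at time 0, the values of the process are partial sums of independent
  increments with laws given by \<open>Q\<close>.
\<close>
lemma additive_fdd:
  fixes f :: "nat \<Rightarrow> 'a::euclidean_space \<Rightarrow> ennreal"
  assumes "prob_space M" and X: "additive_on M t X Q"
    and n: "0 < n" and \<tau>: "\<tau> 0 = 0" "\<tau> n \<le> t" "\<And>i. i < n \<Longrightarrow> \<tau> i \<le> \<tau> (Suc i)"
    and j: "\<And>i. i < k \<Longrightarrow> j i \<le> n" and s: "\<And>i. i < k \<Longrightarrow> s i = \<tau> (j i)"
    and f: "\<And>i. i < k \<Longrightarrow> f i \<in> borel_measurable borel"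
  shows "(\<integral>\<^sup>+w. (\<Prod>i<k. f i (X (s i) w)) \<partial>M)
       = (\<integral>\<^sup>+d. (\<Prod>i<k. f i (\<Sum>m<j i. d m)) \<partial>(\<Pi>\<^sub>M m\<in>{..<n}. Q (\<tau> (Suc m) - \<tau> m)))"
proof -
  interpret prob_space M by fact
  let ?D = "\<lambda>m w. X (\<tau> (Suc m)) w - X (\<tau> m) w"
  have mono: "\<tau> a \<le> \<tau> b" if "a \<le> b" "b \<le> n" for a b
    using that by (induction b rule: dec_induct) (use \<tau>(3) in \<open>auto intro: order_trans\<close>)
  have \<tau>_range: "0 \<le> \<tau> m" "\<tau> m \<le> t" if "m \<le> n" for m
    using mono[of 0 m] mono[of m n] that \<tau> by auto
  have Xm: "X (\<tau> m) \<in> borel_measurable M" if "m \<le> n" for m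
    using X \<tau>_range[OF that] by (auto simp: additive_on_def)
  have Dm: "?D m \<in> borel_measurable M" if "m \<in> {..<n}" for m
    using Xm[of m] Xm[of "Suc m"] that by auto
  have ind: "indep_vars (\<lambda>_. borel) ?D {..<n}"
    using X \<tau> unfolding additive_on_def by auto
  have law: "distr M borel (?D m) = Q (\<tau> (Suc m) - \<tau> m)" if "m < n" for m
    using X \<tau>_range[of m] \<tau>_range[of "Suc m"] \<tau>(3)[OF that] that unfolding additive_on_def by auto
  have eq: "distr M (\<Pi>\<^sub>M m\<in>{..<n}. borel) (\<lambda>w. \<lambda>m\<in>{..<n}. ?D m w) = (\<Pi>\<^sub>M m\<in>{..<n}. Q (\<tau> (Suc m) - \<tau> m))"
  proof -
    have "distr M (\<Pi>\<^sub>M m\<in>{..<n}. borel) (\<lambda>w. \<lambda>m\<in>{..<n}. ?D m w) = (\<Pi>\<^sub>M m\<in>{..<n}. distr M borel (?D m))"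
      using indep_vars_iff_distr_eq_PiM'[where I="{..<n}" and M'="\<lambda>_. borel" and X="?D"] ind n Dm by auto
    also have "\<dots> = (\<Pi>\<^sub>M m\<in>{..<n}. Q (\<tau> (Suc m) - \<tau> m))" by (intro PiM_cong) (auto simp: law)
    finally show ?thesis .
  qed
  have Dmeas: "(\<lambda>w. \<lambda>m\<in>{..<n}. ?D m w) \<in> measurable M (\<Pi>\<^sub>M m\<in>{..<n}. borel)"
    by (intro measurable_restrict Dm)
  have fm: "(\<lambda>d. \<Prod>i<k. f i (\<Sum>m<j i. d m)) \<in> borel_measurable (\<Pi>\<^sub>M m\<in>{..<n}. borel)"
  proof (intro borel_measurable_prod_ennreal)
    fix i assume i: "i \<in> {..<k}"
    have "(\<lambda>d. \<Sum>m<j i. d m) \<in> (\<Pi>\<^sub>M m\<in>{..<n}. borel) \<rightarrow>\<^sub>M (borel :: 'a measure)"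
      using j[of i] i by (intro borel_measurable_sum measurable_component_singleton) auto
    then show "(\<lambda>d. f i (\<Sum>m<j i. d m)) \<in> borel_measurable (\<Pi>\<^sub>M m\<in>{..<n}. borel)"
      using f[of i] i by (auto intro: measurable_compose)
  qed
  have "(\<integral>\<^sup>+w. (\<Prod>i<k. f i (X (s i) w)) \<partial>M) = (\<integral>\<^sup>+w. (\<Prod>i<k. f i (\<Sum>m<j i. (\<lambda>m\<in>{..<n}. ?D m w) m)) \<partial>M)"
  proof (rule nn_integral_cong_AE)
    have "AE w in M. X 0 w = 0" using X by (auto simp: additive_on_def)
    then show "AE w in M. (\<Prod>i<k. f i (X (s i) w)) = (\<Prod>i<k. f i (\<Sum>m<j i. (\<lambda>m\<in>{..<n}. ?D m w) m))"
    proof eventually_elim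
      case (elim w)
      show ?case
      proof (intro prod.cong refl)
        fix i assume "i \<in> {..<k}"
        then have i: "i < k" by simp
        have "(\<Sum>m<j i. (\<lambda>m\<in>{..<n}. ?D m w) m) = (\<Sum>m<j i. ?D m w)"
          using j[OF i] by (intro sum.cong) auto
        also have "\<dots> = X (\<tau> (j i)) w - X (\<tau> 0) w" by (rule sum_lessThan_telescope)
        finally show "f i (X (s i) w) = f i (\<Sum>m<j i. (\<lambda>m\<in>{..<n}. ?D m w) m)"
          using elim s[OF i] \<tau>(1) by simp
      qed
    qed
  qed
  also have "\<dots> = (\<integral>\<^sup>+d. (\<Prod>i<k. f i (\<Sum>m<j i. d m)) \<partial>distr M (\<Pi>\<^sub>M m\<in>{..<n}. borel) (\<lambda>w. \<lambda>m\<in>{..<n}. ?D m w))"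
    by (rule nn_integral_distr[OF Dmeas, symmetric]) (simp add: fm)
  finally show ?thesis by (simp only: eq)
qed

text \<open>
  All the times involved are placed on a common sorted grid, where both sides are given by the same
  integral against a product of increment laws.
\<close>
lemma additive_same_fdd:
  assumes M: "prob_space M" and X: "additive_on M t X Q" and Y: "additive_on M t Y Q" and t: "0 \<le> t"
  shows "same_fdd M t X Y"
  unfolding same_fdd_def
proof (intro allI impI)
  fix k :: nat and s and f :: "nat \<Rightarrow> 'b \<Rightarrow> ennreal"
  assume s: "\<forall>i<k. 0 \<le> s i \<and> s i \<le> t" and f: "\<forall>i<k. f i \<in> borel_measurable borel"
  define ts where "ts = sorted_list_of_set (insert 0 (s ` {..<k}))"
  define n where "n = length ts"
  \<comment> \<open>The last grid point is repeated, so that there are \<open>n\<close> increments for \<open>n\<close> grid points and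
    at least one increment even if 0 is the only grid point.\<close>
  define \<tau> where "\<tau> m = ts ! min m (n - 1)" for m
  have set_ts: "set ts = insert 0 (s ` {..<k})"
    by (simp only: ts_def set_sorted_list_of_set finite_insert finite_imageI finite_lessThan)
  have sorted_ts: "sorted ts" unfolding ts_def by (rule sorted_sorted_list_of_set)
  have n: "0 < n" using set_ts by (cases ts) (auto simp: n_def)
  have idx: "min m (n - 1) < length ts" for m using n unfolding n_def by arith
  have mem: "\<tau> m \<in> set ts" for m unfolding \<tau>_def by (rule nth_mem[OF idx])
  have \<tau>_mono: "\<tau> i \<le> \<tau> (Suc i)" for i
    unfolding \<tau>_def by (intro sorted_nth_mono[OF sorted_ts] idx) auto
  have \<tau>_t: "\<tau> m \<le> t" for m using mem[of m] s t by (auto simp: set_ts)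
  have ex: "\<exists>j\<le>n. x = \<tau> j" if x: "x \<in> set ts" for x
  proof -
    obtain j where "j < n" "x = ts ! j" using iffD1[OF in_set_conv_nth x] unfolding n_def by blast
    then show ?thesis by (intro exI[of _ j]) (auto simp: \<tau>_def min_def)
  qed
  have "\<tau> 0 = 0"
  proof -
    obtain j where j: "0 = \<tau> j" using ex[of 0] set_ts by auto
    have "\<tau> 0 \<le> \<tau> j" using lift_Suc_mono_le[of \<tau> 0 j] \<tau>_mono by simp
    moreover have "0 \<le> \<tau> 0" using mem[of 0] s by (auto simp: set_ts)
    ultimately show ?thesis using j by simp
  qed
  moreover have "\<forall>i. \<exists>j. i < k \<longrightarrow> j \<le> n \<and> s i = \<tau> j" using ex set_ts by auto
  then obtain j where j: "\<And>i. i < k \<Longrightarrow> j i \<le> n \<and> s i = \<tau> (j i)" by metis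
  ultimately show "(\<integral>\<^sup>+w. (\<Prod>i<k. f i (X (s i) w)) \<partial>M) = (\<integral>\<^sup>+w. (\<Prod>i<k. f i (Y (s i) w)) \<partial>M)"
    using additive_fdd[OF M X n, of \<tau> k j s f] additive_fdd[OF M Y n, of \<tau> k j s f] \<tau>_t \<tau>_mono f by simp
qed

text \<open>
  The increments of the reversed process are the negatives of increments of \<open>X\<close> over the reflected
  time intervals, taken in the opposite order.
\<close>
lemma time_reversal_additive:
  assumes M: "prob_space M" and X: "additive_on M t X Q" and t: "0 \<le> t"
    and sym: "\<And>r. 0 \<le> r \<Longrightarrow> r \<le> t \<Longrightarrow> distr (Q r) borel uminus = Q r"
  shows "additive_on M t (\<lambda>s w. X (t - s) w - X t w) Q"
  unfolding additive_on_def
proof (intro conjI allI impI)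
  interpret prob_space M by fact
  have Xm: "X s \<in> borel_measurable M" if "0 \<le> s" "s \<le> t" for s using X that by (auto simp: additive_on_def)
  show "(\<lambda>w. X (t - s) w - X t w) \<in> borel_measurable M" if "0 \<le> s" "s \<le> t" for s
    using Xm[of "t - s"] Xm[of t] that t by auto
  show "AE w in M. X (t - 0) w - X t w = 0" by simp
  show "distr M borel (\<lambda>w. (X (t - u) w - X t w) - (X (t - s) w - X t w)) = Q (u - s)"
    if su: "0 \<le> s" "s \<le> u" "u \<le> t" for s u
  proof -
    have [measurable]: "X (t - s) \<in> borel_measurable M" "X (t - u) \<in> borel_measurable M" using Xm su by auto
    have "distr M borel (\<lambda>w. (X (t - u) w - X t w) - (X (t - s) w - X t w))
       = distr M borel (\<lambda>w. - (X (t - s) w - X (t - u) w))" by (simp add: algebra_simps)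
    also have "\<dots> = distr (distr M borel (\<lambda>w. X (t - s) w - X (t - u) w)) borel uminus"
      by (subst distr_distr) (auto simp: comp_def)
    also have "distr M borel (\<lambda>w. X (t - s) w - X (t - u) w) = Q ((t - s) - (t - u))"
      using X su unfolding additive_on_def by auto
    also have "distr \<dots> borel uminus = Q ((t - s) - (t - u))" using su by (intro sym) auto
    finally show ?thesis by simp
  qed
  fix n :: nat and \<tau> :: "nat \<Rightarrow> real"
  assume \<tau>: "0 \<le> \<tau> 0" "\<tau> n \<le> t" "\<forall>i<n. \<tau> i \<le> \<tau> (Suc i)"
  define \<sigma> where "\<sigma> m = t - \<tau> (n - m)" for m
  have mono: "\<tau> a \<le> \<tau> b" if "a \<le> b" "b \<le> n" for a b
    using that by (induction b rule: dec_induct) (use \<tau>(3) in \<open>auto intro: order_trans\<close>)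
  have "indep_vars (\<lambda>_. borel) (\<lambda>i w. X (\<sigma> (Suc i)) w - X (\<sigma> i) w) {..<n}"
  proof -
    have "0 \<le> \<sigma> 0" "\<sigma> n \<le> t" using \<tau> by (auto simp: \<sigma>_def)
    moreover have "\<forall>i<n. \<sigma> i \<le> \<sigma> (Suc i)" unfolding \<sigma>_def by (auto intro!: mono)
    ultimately show ?thesis using X unfolding additive_on_def by auto
  qed
  moreover have "bij_betw (\<lambda>i. n - Suc i) {..<n} {..<n}"
    by (rule bij_betw_byWitness[of _ "\<lambda>i. n - Suc i"]) auto
  ultimately have "indep_vars (\<lambda>_. borel) (\<lambda>i w. X (\<sigma> (Suc (n - Suc i))) w - X (\<sigma> (n - Suc i)) w) {..<n}"
    by (rule indep_vars_reindex_bij[where M'="\<lambda>_. borel"])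
  then have "indep_vars (\<lambda>_. borel) (\<lambda>i w. - (X (\<sigma> (Suc (n - Suc i))) w - X (\<sigma> (n - Suc i)) w)) {..<n}"
    by (rule indep_vars_compose2) auto
  then show "indep_vars (\<lambda>_. borel) (\<lambda>i w. (X (t - \<tau> (Suc i)) w - X t w) - (X (t - \<tau> i) w - X t w)) {..<n}"
    by (rule iffD1[OF indep_vars_cong, rotated -1]) (auto simp: \<sigma>_def Suc_diff_Suc)
qed

lemma levy_additive_on:
  assumes X: "levy_process M X"
  shows "additive_on M t X (\<lambda>r. distr M borel (X r))"
  using X unfolding levy_process_def additive_on_def by auto
section \<open>Feynman--Kac weights and finite-dimensional distributions\<close>

definition occ :: "(real \<Rightarrow> 'w \<Rightarrow> 'a::euclidean_space) \<Rightarrow> real \<Rightarrow> ('a \<Rightarrow> real) \<Rightarrow> 'w \<Rightarrow> ennreal" where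
  "occ X t W w = (\<integral>\<^sup>+s\<in>{0..t}. ennreal (W (X s w)) \<partial>lborel)"

definition exp_neg :: "ennreal \<Rightarrow> real" where
  "exp_neg x = (if x = \<infinity> then 0 else exp (- enn2real x))"

lemma exp_neg_bounds: "0 \<le> exp_neg x" "exp_neg x \<le> 1"
  by (auto simp: exp_neg_def)

lemma exp_neg_eq_0_iff: "exp_neg x = 0 \<longleftrightarrow> x = \<infinity>"
  by (simp add: exp_neg_def)

lemma exp_neg_add: "exp_neg (x + y) = exp_neg x * exp_neg y"
proof (cases "x = \<infinity> \<or> y = \<infinity>")
  case False
  then have "enn2real (x + y) = enn2real x + enn2real y" by (intro enn2real_plus) (auto simp: less_top)
  then show ?thesis using False by (simp add: exp_neg_def exp_add[symmetric] ennreal_add_eq_top)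
qed (auto simp: exp_neg_def)

lemma exp_neg_of_nat_mult: "exp_neg (of_nat k * x) = exp_neg x ^ k"
  by (induction k) (auto simp: distrib_right exp_neg_add, simp add: exp_neg_def)

lemma exp_neg_measurable[measurable]: "exp_neg \<in> borel_measurable borel"
  unfolding exp_neg_def by measurable

lemma exp_neg_tendsto:
  assumes f: "incseq f" and lim: "(SUP n. f n) = x" and fin: "\<And>n. f n \<noteq> \<infinity>"
  shows "(\<lambda>n. exp_neg (f n)) \<longlonglongrightarrow> exp_neg x"
proof -
  have l: "f \<longlonglongrightarrow> x" using LIMSEQ_SUP[OF f] lim by simp
  show ?thesis
  proof (cases "x = \<infinity>")
    case False
    then have x: "ennreal (enn2real x) = x" by (simp add: less_top)
    have "(\<lambda>n. enn2real (f n)) \<longlonglongrightarrow> enn2real x"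
      by (rule tendsto_enn2real) (simp_all only: x l enn2real_nonneg)
    then have "(\<lambda>n. exp (- enn2real (f n))) \<longlonglongrightarrow> exp (- enn2real x)"
      by (rule tendsto_exp[OF tendsto_minus])
    then show ?thesis using False fin by (simp add: exp_neg_def)
  next
    case True
    have "filterlim (\<lambda>n. enn2real (f n)) at_top sequentially"
      unfolding filterlim_at_top
    proof
      fix Z :: real
      have "eventually (\<lambda>n. ennreal Z < f n) sequentially"
        using l True by (intro order_tendstoD(1)[OF l]) auto
      then show "eventually (\<lambda>n. Z \<le> enn2real (f n)) sequentially"
      proof eventually_elim
        case (elim n)
        then have "ennreal Z \<le> ennreal (enn2real (f n))" using fin[of n] by (simp add: less_top)
        then show ?case by (rule iffD1[OF ennreal_le_iff[OF enn2real_nonneg]])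
      qed
    qed
    then have "(\<lambda>n. exp (- enn2real (f n))) \<longlonglongrightarrow> 0"
      by (intro filterlim_compose[OF exp_at_bot] filterlim_compose[OF filterlim_uminus_at_bot_at_top])
    then show ?thesis using True fin by (simp add: exp_neg_def)
  qed
qed

text \<open>
  The exponential series of a bounded variable may be integrated termwise.
\<close>
lemma expectation_exp_neg_eq_of_moments:
  assumes "prob_space M"
    and [measurable]: "I \<in> borel_measurable M" "J \<in> borel_measurable M" "F \<in> borel_measurable M" "G \<in> borel_measurable M"
    and I: "\<And>w. 0 \<le> I w" "\<And>w. I w \<le> c" and J: "\<And>w. 0 \<le> J w" "\<And>w. J w \<le> c"
    and F: "\<And>w. \<bar>F w\<bar> \<le> (1::real)" and G: "\<And>w. \<bar>G w\<bar> \<le> (1::real)"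
    and mom: "\<And>k::nat. (\<integral>w. I w ^ k * F w \<partial>M) = (\<integral>w. J w ^ k * G w \<partial>M)"
  shows "(\<integral>w. exp (- I w) * F w \<partial>M) = (\<integral>w. exp (- J w) * G w \<partial>M)"
proof -
  interpret prob_space M by fact
  have c: "0 \<le> c" using I[of undefined] by simp
  have sums: "(\<lambda>k. (- 1) ^ k / fact k * (\<integral>w. I w ^ k * F w \<partial>M)) sums (\<integral>w. exp (- I w) * F w \<partial>M)"
    if [measurable]: "I \<in> borel_measurable M" "F \<in> borel_measurable M"
      and I: "\<And>w. 0 \<le> I w" "\<And>w. I w \<le> c" and F: "\<And>w. \<bar>F w\<bar> \<le> (1::real)" for I F
  proof -
    have bnd: "\<bar>I w ^ k * F w\<bar> \<le> c ^ k" for k w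
      using power_mono[OF I(2,1), of w k] F[of w] I(1)[of w] c
      by (auto simp: abs_mult intro: order_trans[OF mult_mono[of _ "c ^ k" _ 1]])
    have int: "integrable M (\<lambda>w. (- 1) ^ k / fact k * (I w ^ k * F w))" for k
      by (intro integrable_mult_right integrable_const_bound[of _ "c ^ k"]) (use bnd in auto)
    have "(\<lambda>k. \<integral>w. (- 1) ^ k / fact k * (I w ^ k * F w) \<partial>M) sums (\<integral>w. (\<Sum>k. (- 1) ^ k / fact k * (I w ^ k * F w)) \<partial>M)"
    proof (rule sums_integral[OF int])
      have le: "norm ((- 1) ^ k / fact k * (I w ^ k * F w)) \<le> c ^ k / fact k" for k w
        using bnd[of w k] by (simp add: abs_mult power_abs divide_right_mono)
      have sc: "summable (\<lambda>k. c ^ k / fact k)" using summable_exp[of c] by (simp add: divide_inverse mult.commute)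
      show "AE w in M. summable (\<lambda>k. norm ((- 1) ^ k / fact k * (I w ^ k * F w)))"
        by (intro AE_I2 summable_comparison_test[OF _ sc]) (use le in auto)
      show "summable (\<lambda>k. \<integral>w. norm ((- 1) ^ k / fact k * (I w ^ k * F w)) \<partial>M)"
      proof (rule summable_comparison_test[OF _ sc], intro exI allI impI)
        fix k
        have "(\<integral>w. norm ((- 1) ^ k / fact k * (I w ^ k * F w)) \<partial>M) \<le> (\<integral>w. c ^ k / fact k \<partial>M)"
          by (intro integral_mono integrable_norm int) (use le in auto)
        then show "norm (\<integral>w. norm ((- 1) ^ k / fact k * (I w ^ k * F w)) \<partial>M) \<le> c ^ k / fact k"
          by (simp add: prob_space integral_nonneg_AE)
      qed
    qed
    moreover have "(\<Sum>k. (- 1) ^ k / fact k * (I w ^ k * F w)) = exp (- I w) * F w" for w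
    proof -
      have "(\<lambda>k. (- I w) ^ k /\<^sub>R fact k) sums exp (- I w)" by (rule exp_converges)
      then have "(\<lambda>k. ((- I w) ^ k /\<^sub>R fact k) * F w) sums (exp (- I w) * F w)" by (rule sums_mult2)
      moreover have "((- I w) ^ k /\<^sub>R fact k) * F w = (- 1) ^ k / fact k * (I w ^ k * F w)" for k
        by (simp add: power_minus[of "I w"] divide_inverse)
      ultimately show ?thesis by (simp add: sums_iff)
    qed
    ultimately show ?thesis by simp
  qed
  have "(\<lambda>k. (- 1) ^ k / fact k * (\<integral>w. I w ^ k * F w \<partial>M)) sums (\<integral>w. exp (- I w) * F w \<partial>M)"
    by (rule sums) (use I F in auto)
  moreover have "(\<lambda>k. (- 1) ^ k / fact k * (\<integral>w. J w ^ k * G w \<partial>M)) sums (\<integral>w. exp (- J w) * G w \<partial>M)"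
    by (rule sums) (use J G in auto)
  ultimately show ?thesis using mom sums_unique2 by simp
qed

lemma occ_measurable:
  assumes X[measurable]: "(\<lambda>(s, w). X s w) \<in> borel_measurable (lborel \<Otimes>\<^sub>M M)"
    and [measurable]: "W \<in> borel_measurable borel"
  shows "occ X t W \<in> borel_measurable M"
  unfolding occ_def by measurable

text \<open>
  The \<open>k\<close>-th power of a time integral is a \<open>k\<close>-fold time integral, so Fubini's theorem expresses the
  moment through \<open>k\<close> times in \<open>[0, t]\<close> and the terminal time.
\<close>
lemma moments_as_product_integral:
  fixes X :: "real \<Rightarrow> 'w \<Rightarrow> 'a::euclidean_space"
  assumes "prob_space M" and X[measurable]: "(\<lambda>(s, w). X s w) \<in> borel_measurable (lborel \<Otimes>\<^sub>M M)"
    and [measurable]: "W \<in> borel_measurable borel" "f \<in> borel_measurable borel" and t: "0 \<le> t"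
  shows "(\<integral>\<^sup>+w. occ X t W w ^ k * f (X t w) \<partial>M)
    = (\<integral>\<^sup>+s. (\<integral>\<^sup>+w. (\<Prod>i<k. ennreal (W (X (s i) w)) * indicator {0..t} (s i)) * f (X t w) \<partial>M) \<partial>(\<Pi>\<^sub>M i\<in>{..<k}. lborel))"
proof -
  interpret prob_space M by fact
  interpret P: product_sigma_finite "\<lambda>_::nat. lborel :: real measure" by standard
  interpret F: finite_product_sigma_finite "\<lambda>_::nat. lborel :: real measure" "{..<k}" by standard simp
  interpret p: pair_sigma_finite M "\<Pi>\<^sub>M i\<in>{..<k}. (lborel :: real measure)" ..
  have Xs[measurable]: "X s \<in> borel_measurable M" for s
    using measurable_Pair2[OF X, of s] by simp
  let ?g = "\<lambda>w s. ennreal (W (X s w)) * indicator {0..t} s"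
  have "(\<integral>\<^sup>+w. occ X t W w ^ k * f (X t w) \<partial>M)
     = (\<integral>\<^sup>+w. (\<integral>\<^sup>+s. (\<Prod>i<k. ?g w (s i)) * f (X t w) \<partial>(\<Pi>\<^sub>M i\<in>{..<k}. lborel)) \<partial>M)"
  proof (rule nn_integral_cong)
    fix w assume w: "w \<in> space M"
    have Xw[measurable]: "(\<lambda>s. X s w) \<in> borel_measurable borel"
      using measurable_Pair1[OF X w] by simp
    have "occ X t W w ^ k = (\<Prod>i<k. \<integral>\<^sup>+s. ?g w s \<partial>lborel)" by (simp add: occ_def)
    also have "\<dots> = (\<integral>\<^sup>+s. (\<Prod>i<k. ?g w (s i)) \<partial>(\<Pi>\<^sub>M i\<in>{..<k}. lborel))"
      by (rule P.product_nn_integral_prod[symmetric]) auto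
    finally show "occ X t W w ^ k * f (X t w) = (\<integral>\<^sup>+s. (\<Prod>i<k. ?g w (s i)) * f (X t w) \<partial>(\<Pi>\<^sub>M i\<in>{..<k}. lborel))"
      by (simp add: nn_integral_multc)
  qed
  also have "\<dots> = (\<integral>\<^sup>+s. (\<integral>\<^sup>+w. (\<Prod>i<k. ?g w (s i)) * f (X t w) \<partial>M) \<partial>(\<Pi>\<^sub>M i\<in>{..<k}. lborel))"
  proof (rule p.Fubini'[symmetric])
    have "(\<lambda>(w, s). \<Prod>i<k. ?g w (s i)) \<in> borel_measurable (M \<Otimes>\<^sub>M (\<Pi>\<^sub>M i\<in>{..<k}. lborel))"
      unfolding case_prod_beta'
    proof (intro borel_measurable_prod_ennreal)
      fix i assume i: "i \<in> {..<k}"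
      have m1: "(\<lambda>p. snd p i) \<in> (M \<Otimes>\<^sub>M (\<Pi>\<^sub>M i\<in>{..<k}. lborel)) \<rightarrow>\<^sub>M (lborel :: real measure)"
        by (rule measurable_compose[OF measurable_snd measurable_component_singleton[OF i]])
      have "(\<lambda>p. (snd p i, fst p)) \<in> (M \<Otimes>\<^sub>M (\<Pi>\<^sub>M i\<in>{..<k}. lborel)) \<rightarrow>\<^sub>M ((lborel :: real measure) \<Otimes>\<^sub>M M)"
        by (rule measurable_Pair[OF m1 measurable_fst])
      from measurable_compose[OF this X] have m2: "(\<lambda>p. X (snd p i) (fst p)) \<in> borel_measurable (M \<Otimes>\<^sub>M (\<Pi>\<^sub>M i\<in>{..<k}. lborel))"
        by simp
      have "(\<lambda>p. ennreal (W (X (snd p i) (fst p)))) \<in> borel_measurable (M \<Otimes>\<^sub>M (\<Pi>\<^sub>M i\<in>{..<k}. lborel))"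
        by (rule measurable_compose[OF m2]) measurable
      moreover have "(\<lambda>p. indicator {0..t} (snd p i) :: ennreal) \<in> borel_measurable (M \<Otimes>\<^sub>M (\<Pi>\<^sub>M i\<in>{..<k}. lborel))"
        by (rule measurable_compose[OF m1]) measurable
      ultimately show "(\<lambda>p. ennreal (W (X (snd p i) (fst p))) * indicator {0..t} (snd p i)) \<in> borel_measurable (M \<Otimes>\<^sub>M (\<Pi>\<^sub>M i\<in>{..<k}. lborel))"
        by (rule borel_measurable_times_ennreal)
    qed
    then have [measurable]: "(\<lambda>p. \<Prod>i<k. ?g (fst p) (snd p i)) \<in> borel_measurable (M \<Otimes>\<^sub>M (\<Pi>\<^sub>M i\<in>{..<k}. lborel))"
      by (simp add: case_prod_beta')
    show "(\<lambda>(w, s). (\<Prod>i<k. ?g w (s i)) * f (X t w)) \<in> borel_measurable (M \<Otimes>\<^sub>M (\<Pi>\<^sub>M i\<in>{..<k}. lborel))"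
      unfolding case_prod_beta' by measurable
  qed
  finally show ?thesis .
qed

lemma same_fdd_moments:
  fixes X Y :: "real \<Rightarrow> 'w \<Rightarrow> 'a::euclidean_space"
  assumes M: "prob_space M" and XY: "same_fdd M t X Y"
    and X: "(\<lambda>(s, w). X s w) \<in> borel_measurable (lborel \<Otimes>\<^sub>M M)"
    and Y: "(\<lambda>(s, w). Y s w) \<in> borel_measurable (lborel \<Otimes>\<^sub>M M)"
    and W[measurable]: "W \<in> borel_measurable borel" and f[measurable]: "f \<in> borel_measurable borel" and t: "0 \<le> t"
  shows "(\<integral>\<^sup>+w. occ X t W w ^ k * f (X t w) \<partial>M) = (\<integral>\<^sup>+w. occ Y t W w ^ k * f (Y t w) \<partial>M)"
  unfolding moments_as_product_integral[OF M X W f t] moments_as_product_integral[OF M Y W f t]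
proof (rule nn_integral_cong)
  fix s :: "nat \<Rightarrow> real"
  show "(\<integral>\<^sup>+w. (\<Prod>i<k. ennreal (W (X (s i) w)) * indicator {0..t} (s i)) * f (X t w) \<partial>M)
      = (\<integral>\<^sup>+w. (\<Prod>i<k. ennreal (W (Y (s i) w)) * indicator {0..t} (s i)) * f (Y t w) \<partial>M)"
  proof (cases "\<forall>i<k. s i \<in> {0..t}")
    case True
    \<comment> \<open>The terminal factor is added as the factor with index \<open>k\<close> at time \<open>t\<close>.\<close>
    let ?s = "\<lambda>i. if i < k then s i else t" and ?f = "\<lambda>i x. if i < k then ennreal (W x) else f x"
    have H: "(\<integral>\<^sup>+w. (\<Prod>i<Suc k. ?f i (X (?s i) w)) \<partial>M) = (\<integral>\<^sup>+w. (\<Prod>i<Suc k. ?f i (Y (?s i) w)) \<partial>M)"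
      by (rule XY[unfolded same_fdd_def, rule_format, of "Suc k" ?s ?f]) (use True t in auto)
    have P: "(\<Prod>i<Suc k. ?f i (Z (?s i) w)) = (\<Prod>i<k. ennreal (W (Z (s i) w)) * indicator {0..t} (s i)) * f (Z t w)"
      for Z :: "real \<Rightarrow> 'w \<Rightarrow> 'a" and w
    proof -
      have "(\<Prod>i<k. ?f i (Z (?s i) w)) = (\<Prod>i<k. ennreal (W (Z (s i) w)) * indicator {0..t} (s i))"
        using True by (intro prod.cong) auto
      then show ?thesis by (subst prod.lessThan_Suc) simp
    qed
    show ?thesis using H unfolding P .
  next
    case False
    then obtain i where "i < k" "s i \<notin> {0..t}" by auto
    then have P0: "(\<Prod>i<k. ennreal (W (Z (s i) w)) * indicator {0..t} (s i)) = 0" for Z :: "real \<Rightarrow> 'w \<Rightarrow> 'a" and w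
      by (intro prod_zero) (auto intro!: bexI[of _ i])
    show ?thesis unfolding P0 by simp
  qed
qed

lemma process_section_measurable:
  assumes X: "(\<lambda>(s, w). X s w) \<in> borel_measurable (lborel \<Otimes>\<^sub>M M)"
  shows "X s \<in> borel_measurable M" and "w \<in> space M \<Longrightarrow> (\<lambda>s. X s w) \<in> borel_measurable borel"
  using measurable_Pair2[OF X, of s] measurable_Pair1[OF X, of w] by simp_all

lemma same_fdd_exp_neg_bounded:
  fixes X Y :: "real \<Rightarrow> 'w \<Rightarrow> 'a::euclidean_space"
  assumes M: "prob_space M" and XY: "same_fdd M t X Y"
    and X: "(\<lambda>(s, w). X s w) \<in> borel_measurable (lborel \<Otimes>\<^sub>M M)"
    and Y: "(\<lambda>(s, w). Y s w) \<in> borel_measurable (lborel \<Otimes>\<^sub>M M)"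
    and W[measurable]: "W \<in> borel_measurable borel" and Wb: "\<And>x. 0 \<le> W x" "\<And>x. W x \<le> m"
    and B[measurable]: "B \<in> sets borel" and t: "0 \<le> t"
  shows "(\<integral>w. exp_neg (occ X t W w) * indicator B (X t w) \<partial>M) = (\<integral>w. exp_neg (occ Y t W w) * indicator B (Y t w) \<partial>M)"
proof -
  have m: "0 \<le> m" using Wb[of 0] by linarith
  have le: "occ Z t W w \<le> ennreal (m * t)" for Z :: "real \<Rightarrow> 'w \<Rightarrow> 'a" and w
  proof -
    have "occ Z t W w \<le> (\<integral>\<^sup>+s. ennreal m * indicator {0..t} s \<partial>lborel)"
      unfolding occ_def by (intro nn_integral_mono mult_right_mono ennreal_leI Wb) simp
    also have "\<dots> = ennreal (m * t)" using m t by (simp add: nn_integral_cmult_indicator ennreal_mult)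
    finally show ?thesis .
  qed
  have fin: "occ Z t W w \<noteq> \<infinity>" for Z :: "real \<Rightarrow> 'w \<Rightarrow> 'a" and w
    using le_less_trans[OF le[of Z w] ennreal_less_top] by simp
  have eq: "exp_neg (occ Z t W w) = exp (- enn2real (occ Z t W w))" for Z :: "real \<Rightarrow> 'w \<Rightarrow> 'a" and w
    using fin by (simp add: exp_neg_def)
  have mom: "(\<integral>w. enn2real (occ Z t W w) ^ k * indicator B (Z t w) \<partial>M) = enn2real (\<integral>\<^sup>+w. occ Z t W w ^ k * indicator B (Z t w) \<partial>M)"
    if Z: "(\<lambda>(s, w). Z s w) \<in> borel_measurable (lborel \<Otimes>\<^sub>M M)" for Z :: "real \<Rightarrow> 'w \<Rightarrow> 'a" and k :: nat
  proof -
    have [measurable]: "occ Z t W \<in> borel_measurable M" "Z t \<in> borel_measurable M"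
      using occ_measurable[OF Z W] process_section_measurable[OF Z] by auto
    have "(\<integral>w. enn2real (occ Z t W w) ^ k * indicator B (Z t w) \<partial>M)
        = enn2real (\<integral>\<^sup>+w. ennreal (enn2real (occ Z t W w) ^ k * indicator B (Z t w)) \<partial>M)"
      by (rule integral_eq_nn_integral) auto
    also have "(\<integral>\<^sup>+w. ennreal (enn2real (occ Z t W w) ^ k * indicator B (Z t w)) \<partial>M) = (\<integral>\<^sup>+w. occ Z t W w ^ k * indicator B (Z t w) \<partial>M)"
    proof (rule nn_integral_cong)
      fix w
      have "ennreal (enn2real (occ Z t W w) ^ k) = occ Z t W w ^ k"
        using fin[of Z w] by (simp add: ennreal_power[symmetric] less_top)
      then show "ennreal (enn2real (occ Z t W w) ^ k * indicator B (Z t w)) = occ Z t W w ^ k * indicator B (Z t w)"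
        by (cases "Z t w \<in> B") auto
    qed
    finally show ?thesis .
  qed
  have [measurable]: "occ X t W \<in> borel_measurable M" "X t \<in> borel_measurable M" "occ Y t W \<in> borel_measurable M" "Y t \<in> borel_measurable M"
    using occ_measurable[OF X W] process_section_measurable[OF X] occ_measurable[OF Y W] process_section_measurable[OF Y] by auto
  have bd: "enn2real (occ Z t W w) \<le> m * t" for Z :: "real \<Rightarrow> 'w \<Rightarrow> 'a" and w
    using enn2real_mono[OF le[of Z w]] m t by simp
  show ?thesis
    unfolding eq
  proof (rule expectation_exp_neg_eq_of_moments[OF M, of _ _ _ _ "m * t"])
    show "(\<integral>w. enn2real (occ X t W w) ^ k * indicator B (X t w) \<partial>M) = (\<integral>w. enn2real (occ Y t W w) ^ k * indicator B (Y t w) \<partial>M)" for k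
      unfolding mom[OF X] mom[OF Y]
      using same_fdd_moments[OF M XY X Y W _ t, of "indicator B" k] by simp
  qed (use bd in \<open>auto simp: indicator_def\<close>)
qed

text \<open>
  Truncating \<open>W\<close> at height \<open>m\<close> reduces the claim to bounded \<open>W\<close>, where moments determine the
  expectation.
\<close>
lemma same_fdd_exp_neg:
  fixes X Y :: "real \<Rightarrow> 'w \<Rightarrow> 'a::euclidean_space"
  assumes M: "prob_space M" and XY: "same_fdd M t X Y"
    and X: "(\<lambda>(s, w). X s w) \<in> borel_measurable (lborel \<Otimes>\<^sub>M M)"
    and Y: "(\<lambda>(s, w). Y s w) \<in> borel_measurable (lborel \<Otimes>\<^sub>M M)"
    and W[measurable]: "W \<in> borel_measurable borel" and Wb: "\<And>x. 0 \<le> W x"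
    and B[measurable]: "B \<in> sets borel" and t: "0 \<le> t"
  shows "(\<integral>w. exp_neg (occ X t W w) * indicator B (X t w) \<partial>M) = (\<integral>w. exp_neg (occ Y t W w) * indicator B (Y t w) \<partial>M)"
proof -
  interpret prob_space M by fact
  let ?W = "\<lambda>m x. min (W x) (real m)"
  have lim: "(\<lambda>m. \<integral>w. exp_neg (occ Z t (?W m) w) * indicator B (Z t w) \<partial>M) \<longlonglongrightarrow> (\<integral>w. exp_neg (occ Z t W w) * indicator B (Z t w) \<partial>M)"
    if Z: "(\<lambda>(s, w). Z s w) \<in> borel_measurable (lborel \<Otimes>\<^sub>M M)" for Z :: "real \<Rightarrow> 'w \<Rightarrow> 'a"
  proof (rule integral_dominated_convergence[where w="\<lambda>_. 1"])
    have [measurable]: "occ Z t W \<in> borel_measurable M" "Z t \<in> borel_measurable M" "\<And>m. occ Z t (?W m) \<in> borel_measurable M"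
      using occ_measurable[OF Z] process_section_measurable[OF Z] by auto
    show "(\<lambda>w. exp_neg (occ Z t W w) * indicator B (Z t w)) \<in> borel_measurable M" by measurable
    show "(\<lambda>w. exp_neg (occ Z t (?W m) w) * indicator B (Z t w)) \<in> borel_measurable M" for m by measurable
    show "AE w in M. norm (exp_neg (occ Z t (?W m) w) * indicator B (Z t w)) \<le> 1" for m
      using exp_neg_bounds by (auto simp: indicator_def)
    show "AE w in M. (\<lambda>m. exp_neg (occ Z t (?W m) w) * indicator B (Z t w)) \<longlonglongrightarrow> exp_neg (occ Z t W w) * indicator B (Z t w)"
    proof (rule AE_I2)
      fix w assume w: "w \<in> space M"
      have [measurable]: "(\<lambda>s. Z s w) \<in> borel_measurable borel" by (rule process_section_measurable(2)[OF Z w])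
      have inc: "incseq (\<lambda>m s. ennreal (?W m (Z s w)) * indicator {0..t} s)"
        by (intro incseq_SucI le_funI mult_right_mono ennreal_leI) auto
      have sup: "(SUP m. ennreal (?W m x)) = ennreal (W x)" for x
      proof (rule antisym)
        obtain n where "W x \<le> real n" using real_arch_simple by blast
        then have "ennreal (W x) = ennreal (?W n x)" by simp
        then show "ennreal (W x) \<le> (SUP m. ennreal (?W m x))" by (simp only:) (rule SUP_upper, simp)
        show "(SUP m. ennreal (?W m x)) \<le> ennreal (W x)" by (intro SUP_least ennreal_leI) simp
      qed
      have "(\<lambda>m. exp_neg (occ Z t (?W m) w)) \<longlonglongrightarrow> exp_neg (occ Z t W w)"
      proof (rule exp_neg_tendsto)
        show "incseq (\<lambda>m. occ Z t (?W m) w)"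
          unfolding occ_def by (intro incseq_SucI nn_integral_mono mult_right_mono ennreal_leI) auto
        have "(SUP m. occ Z t (?W m) w) = (\<integral>\<^sup>+s. (SUP m. ennreal (?W m (Z s w)) * indicator {0..t} s) \<partial>lborel)"
          unfolding occ_def by (rule nn_integral_monotone_convergence_SUP[OF inc, symmetric]) simp
        also have "\<dots> = occ Z t W w"
          unfolding occ_def by (intro nn_integral_cong) (simp add: SUP_mult_right_ennreal[symmetric] sup)
        finally show "(SUP m. occ Z t (?W m) w) = occ Z t W w" .
        show "occ Z t (?W m) w \<noteq> \<infinity>" for m
        proof -
          have "occ Z t (?W m) w \<le> (\<integral>\<^sup>+s. ennreal m * indicator {0..t} s \<partial>lborel)"
            unfolding occ_def by (intro nn_integral_mono mult_right_mono ennreal_leI) auto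
          also have "\<dots> = ennreal (m * t)" using t by (simp add: nn_integral_cmult_indicator ennreal_mult)
          also have "\<dots> < \<infinity>" by simp
          finally show ?thesis by simp
        qed
      qed
      then show "(\<lambda>m. exp_neg (occ Z t (?W m) w) * indicator B (Z t w)) \<longlonglongrightarrow> exp_neg (occ Z t W w) * indicator B (Z t w)"
        by (rule tendsto_mult_right)
    qed
  qed simp
  have "(\<integral>w. exp_neg (occ X t (?W m) w) * indicator B (X t w) \<partial>M) = (\<integral>w. exp_neg (occ Y t (?W m) w) * indicator B (Y t w) \<partial>M)" for m
    by (rule same_fdd_exp_neg_bounded[OF M XY X Y, of _ "real m"]) (use Wb B t in auto)
  then show ?thesis using lim[OF X] lim[OF Y] LIMSEQ_unique by simp
qed

lemma binomial_expectation:
  fixes u g F :: "'w \<Rightarrow> real"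
  assumes "prob_space M" and [measurable]: "u \<in> borel_measurable M" "g \<in> borel_measurable M" "F \<in> borel_measurable M"
    and u: "\<And>w. 0 \<le> u w" "\<And>w. u w \<le> 1" and g: "\<And>w. 0 \<le> g w" "\<And>w. g w \<le> 1" and F: "\<And>w. 0 \<le> F w" "\<And>w. F w \<le> 1"
  shows "(\<integral>w. g w * (1 - u w) ^ k * F w \<partial>M) = (\<Sum>i\<le>k. of_nat (k choose i) * (- 1) ^ i * (\<integral>w. g w * u w ^ i * F w \<partial>M))"
proof -
  interpret prob_space M by fact
  have int: "integrable M (\<lambda>w. g w * u w ^ i * F w)" for i
    by (rule integrable_const_bound[of _ 1])
      (use u g F in \<open>auto simp: abs_mult power_abs intro!: mult_le_one power_le_one\<close>)
  have "g w * (1 - u w) ^ k * F w = (\<Sum>i\<le>k. of_nat (k choose i) * (- 1) ^ i * (g w * u w ^ i * F w))" for w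
  proof -
    have "(1 - u w) ^ k = (\<Sum>i\<le>k. of_nat (k choose i) * (- u w) ^ i)"
      using binomial_ring[of "- u w" 1 k] by simp
    then show ?thesis
      by (simp add: sum_distrib_left sum_distrib_right power_minus[of "u w"] mult_ac)
  qed
  then show ?thesis using int by simp
qed

text \<open>
  Let \<open>p\<close> and \<open>q\<close> be the exponentials of minus the integrals of \<open>V\<^sub>+\<close> and \<open>V\<^sub>-\<close> along the path. The
  integral of \<open>V\<close> exists iff \<open>p q \<noteq> 0\<close>; then the weight is \<open>p / q\<close>. Otherwise the Lebesgue integral
  is 0 by convention and the weight is 1. The expectations of \<open>p\<^sup>j q\<^sup>k\<close> on the event that the
  endpoint lies in \<open>B\<close> agree for both processes, since \<open>p\<^sup>j q\<^sup>k\<close> is the exponential of minus the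
  integral of \<open>j V\<^sub>+ + k V\<^sub>- \<ge> 0\<close>. The weight is recovered from these monomials by the nonnegative
  series \<open>p / q = \<Sum> (k + 1) p q (1 - q)\<^sup>k\<close> and \<open>1 = \<Sum> p q (1 - p q)\<^sup>k\<close>, both valid for \<open>p q \<noteq> 0\<close> and
  both with sum 0 for \<open>p q = 0\<close>.
\<close>
lemma same_fdd_feynman_kac_weight:
  fixes X Y :: "real \<Rightarrow> 'w \<Rightarrow> 'a::euclidean_space" and V :: "'a \<Rightarrow> real"
  assumes M: "prob_space M" and XY: "same_fdd M t X Y"
    and X: "(\<lambda>(s, w). X s w) \<in> borel_measurable (lborel \<Otimes>\<^sub>M M)"
    and Y: "(\<lambda>(s, w). Y s w) \<in> borel_measurable (lborel \<Otimes>\<^sub>M M)"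
    and V[measurable]: "V \<in> borel_measurable borel"
    and B[measurable]: "B \<in> sets borel" and t: "0 \<le> t"
  shows "(\<integral>\<^sup>+w. ennreal (exp (- (LINT s:{0..t}|lborel. V (X s w)))) * indicator B (X t w) \<partial>M)
       = (\<integral>\<^sup>+w. ennreal (exp (- (LINT s:{0..t}|lborel. V (Y s w)))) * indicator B (Y t w) \<partial>M)"
proof -
  interpret prob_space M by fact
  define Vp Vm where "Vp x = max (V x) 0" and "Vm x = max (- V x) 0" for x
  have [measurable]: "Vp \<in> borel_measurable borel" "Vm \<in> borel_measurable borel"
    unfolding Vp_def Vm_def by measurable
  define p q where "p Z w = exp_neg (occ Z t Vp w)" and "q Z w = exp_neg (occ Z t Vm w)"
    for Z :: "real \<Rightarrow> 'w \<Rightarrow> 'a" and w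
  define F where "F Z w = (indicator B (Z t w) :: real)" for Z :: "real \<Rightarrow> 'w \<Rightarrow> 'a" and w
  have b01: "0 \<le> p Z w" "p Z w \<le> 1" "0 \<le> q Z w" "q Z w \<le> 1" "0 \<le> F Z w" "F Z w \<le> 1" for Z w
    by (auto simp: p_def q_def F_def exp_neg_bounds)
  have mon: "(\<integral>w. p X w ^ j * q X w ^ k * F X w \<partial>M) = (\<integral>w. p Y w ^ j * q Y w ^ k * F Y w \<partial>M)" for j k :: nat
  proof -
    let ?W = "\<lambda>x. real j * Vp x + real k * Vm x"
    have lin: "ennreal (real j * Vp x + real k * Vm x) = of_nat j * ennreal (Vp x) + of_nat k * ennreal (Vm x)" for x
      by (simp add: Vp_def Vm_def ennreal_mult ennreal_of_nat_eq_real_of_nat)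
    have e: "(\<integral>w. p Z w ^ j * q Z w ^ k * F Z w \<partial>M) = (\<integral>w. exp_neg (occ Z t ?W w) * indicator B (Z t w) \<partial>M)"
      if Z: "(\<lambda>(s, w). Z s w) \<in> borel_measurable (lborel \<Otimes>\<^sub>M M)" for Z :: "real \<Rightarrow> 'w \<Rightarrow> 'a"
    proof (rule Bochner_Integration.integral_cong[OF refl])
      fix w assume w: "w \<in> space M"
      have [measurable]: "(\<lambda>s. Z s w) \<in> borel_measurable borel" by (rule process_section_measurable(2)[OF Z w])
      have "occ Z t ?W w = (\<integral>\<^sup>+s. of_nat j * (ennreal (Vp (Z s w)) * indicator {0..t} s) + of_nat k * (ennreal (Vm (Z s w)) * indicator {0..t} s) \<partial>lborel)"
        unfolding occ_def
        by (intro nn_integral_cong) (simp add: lin distrib_right mult.assoc)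
      also have "\<dots> = of_nat j * occ Z t Vp w + of_nat k * occ Z t Vm w"
        unfolding occ_def by (simp add: nn_integral_add nn_integral_cmult)
      finally show "p Z w ^ j * q Z w ^ k * F Z w = exp_neg (occ Z t ?W w) * indicator B (Z t w)"
        by (simp add: p_def q_def F_def exp_neg_add exp_neg_of_nat_mult)
    qed
    show ?thesis unfolding e[OF X] e[OF Y]
      by (rule same_fdd_exp_neg[OF M XY X Y]) (use t B in \<open>auto simp: Vp_def Vm_def\<close>)
  qed
  have meas: "p Z \<in> borel_measurable M" "q Z \<in> borel_measurable M" "F Z \<in> borel_measurable M"
    if Z: "(\<lambda>(s, w). Z s w) \<in> borel_measurable (lborel \<Otimes>\<^sub>M M)" for Z :: "real \<Rightarrow> 'w \<Rightarrow> 'a"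
  proof -
    have [measurable]: "occ Z t Vp \<in> borel_measurable M" "occ Z t Vm \<in> borel_measurable M" "Z t \<in> borel_measurable M"
      using occ_measurable[OF Z] process_section_measurable[OF Z] by auto
    show "p Z \<in> borel_measurable M" "q Z \<in> borel_measurable M" "F Z \<in> borel_measurable M"
      unfolding p_def q_def F_def by measurable
  qed
  note [measurable] = meas[OF X] meas[OF Y]
  have Q: "(\<integral>w. (p X w * q X w) * (1 - q X w) ^ k * F X w \<partial>M) = (\<integral>w. (p Y w * q Y w) * (1 - q Y w) ^ k * F Y w \<partial>M)" for k
  proof -
    have "(\<integral>w. (p Z w * q Z w) * (1 - q Z w) ^ k * F Z w \<partial>M) = (\<Sum>i\<le>k. of_nat (k choose i) * (- 1) ^ i * (\<integral>w. p Z w ^ 1 * q Z w ^ Suc i * F Z w \<partial>M))"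
      if "Z = X \<or> Z = Y" for Z
      using that b01 by (subst binomial_expectation[OF M]) (auto simp: mult_ac intro!: mult_le_one)
    then show ?thesis by (simp only: mon simp_thms)
  qed
  have PQ: "(\<integral>w. (p X w * q X w) * (1 - p X w * q X w) ^ k * F X w \<partial>M) = (\<integral>w. (p Y w * q Y w) * (1 - p Y w * q Y w) ^ k * F Y w \<partial>M)" for k
  proof -
    have "(\<integral>w. (p Z w * q Z w) * (1 - p Z w * q Z w) ^ k * F Z w \<partial>M) = (\<Sum>i\<le>k. of_nat (k choose i) * (- 1) ^ i * (\<integral>w. p Z w ^ Suc i * q Z w ^ Suc i * F Z w \<partial>M))"
      if "Z = X \<or> Z = Y" for Z
      using that b01 by (subst binomial_expectation[OF M]) (auto simp: mult_ac power_mult_distrib intro!: mult_le_one)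
    then show ?thesis by (simp only: mon simp_thms)
  qed
  have nn: "(\<integral>\<^sup>+w. ennreal (f w) \<partial>M) = ennreal (\<integral>w. f w \<partial>M)"
    if "f \<in> borel_measurable M" "\<And>w. 0 \<le> f w" "\<And>w. f w \<le> c" for f c
    using that by (intro nn_integral_eq_integral integrable_const_bound[of _ c]) auto
  \<comment> \<open>\<open>A\<close> and \<open>N\<close> are the contributions to the weighted indicator of the paths along which the
    integral of \<open>V\<close> exists and of those along which it does not.\<close>
  define A where "A Z w = (if p Z w * q Z w = 0 then 0 else p Z w / q Z w * F Z w)" for Z w
  define N where "N Z w = (if p Z w * q Z w = 0 then F Z w else 0)" for Z w
  have A_series: "ennreal (A Z w) = (\<Sum>k. ennreal (real (Suc k)) * ennreal ((p Z w * q Z w) * (1 - q Z w) ^ k * F Z w))" for Z w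
  proof (cases "q Z w = 0")
    case False
    then have q: "0 < q Z w" "q Z w \<le> 1" using b01[of Z w] by auto
    have "(\<lambda>k. real (Suc k) * (1 - q Z w) ^ k) sums (1 / (1 - (1 - q Z w))\<^sup>2)"
      by (rule geometric_deriv_sums) (use q in auto)
    then have "(\<lambda>k. (real (Suc k) * (1 - q Z w) ^ k) * (p Z w * q Z w * F Z w)) sums (1 / (1 - (1 - q Z w))\<^sup>2 * (p Z w * q Z w * F Z w))"
      by (rule sums_mult2)
    moreover have "1 / (1 - (1 - q Z w))\<^sup>2 * (p Z w * q Z w * F Z w) = A Z w"
      using q by (simp add: A_def power2_eq_square)
    ultimately have "(\<lambda>k. real (Suc k) * ((p Z w * q Z w) * (1 - q Z w) ^ k * F Z w)) sums A Z w"
      by (simp add: mult_ac)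
    then have "(\<Sum>k. ennreal (real (Suc k) * ((p Z w * q Z w) * (1 - q Z w) ^ k * F Z w))) = ennreal (A Z w)"
      using b01[of Z w] by (intro suminf_ennreal_eq) auto
    then show ?thesis using b01[of Z w] by (simp add: ennreal_mult del: of_nat_Suc)
  qed (simp add: A_def)
  have N_series: "ennreal (F Z w - N Z w) = (\<Sum>k. ennreal ((p Z w * q Z w) * (1 - p Z w * q Z w) ^ k * F Z w))" for Z w
  proof (cases "p Z w * q Z w = 0")
    case False
    then have q: "0 < p Z w * q Z w" "p Z w * q Z w \<le> 1" using b01[of Z w] by (auto intro: mult_le_one simp: less_le)
    have "(\<lambda>k. (1 - p Z w * q Z w) ^ k) sums (1 / (1 - (1 - p Z w * q Z w)))"
      by (rule geometric_sums) (use q in auto)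
    then have "(\<lambda>k. (1 - p Z w * q Z w) ^ k * (p Z w * q Z w * F Z w)) sums (1 / (1 - (1 - p Z w * q Z w)) * (p Z w * q Z w * F Z w))"
      by (rule sums_mult2)
    moreover have "1 / (1 - (1 - p Z w * q Z w)) * (p Z w * q Z w * F Z w) = F Z w - N Z w"
      using q False by (simp add: N_def)
    ultimately have "(\<lambda>k. (p Z w * q Z w) * (1 - p Z w * q Z w) ^ k * F Z w) sums (F Z w - N Z w)"
      by (simp add: mult_ac)
    then show ?thesis using b01[of Z w] q by (intro suminf_ennreal_eq[symmetric]) auto
  qed (auto simp: N_def)
  have A_eq: "(\<integral>\<^sup>+w. ennreal (A X w) \<partial>M) = (\<integral>\<^sup>+w. ennreal (A Y w) \<partial>M)"
  proof -
    have "(\<integral>\<^sup>+w. ennreal (A Z w) \<partial>M) = (\<Sum>k. ennreal (real (Suc k)) * ennreal (\<integral>w. (p Z w * q Z w) * (1 - q Z w) ^ k * F Z w \<partial>M))"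
      if "Z = X \<or> Z = Y" for Z
    proof -
      have [measurable]: "p Z \<in> borel_measurable M" "q Z \<in> borel_measurable M" "F Z \<in> borel_measurable M"
        using that by auto
      have "(\<integral>\<^sup>+w. ennreal (A Z w) \<partial>M) = (\<Sum>k. \<integral>\<^sup>+w. ennreal (real (Suc k)) * ennreal ((p Z w * q Z w) * (1 - q Z w) ^ k * F Z w) \<partial>M)"
        unfolding A_series by (rule nn_integral_suminf) measurable
      also have "\<dots> = (\<Sum>k. ennreal (real (Suc k)) * ennreal (\<integral>w. (p Z w * q Z w) * (1 - q Z w) ^ k * F Z w \<partial>M))"
        by (subst nn_integral_cmult, measurable, subst nn[of _ 1]) (use b01[of Z] in \<open>auto intro!: mult_le_one power_le_one\<close>)
      finally show ?thesis .
    qed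
    then show ?thesis by (simp only: Q simp_thms)
  qed
  have FN_eq: "(\<integral>\<^sup>+w. ennreal (F X w - N X w) \<partial>M) = (\<integral>\<^sup>+w. ennreal (F Y w - N Y w) \<partial>M)"
  proof -
    have "(\<integral>\<^sup>+w. ennreal (F Z w - N Z w) \<partial>M) = (\<Sum>k. ennreal (\<integral>w. (p Z w * q Z w) * (1 - p Z w * q Z w) ^ k * F Z w \<partial>M))"
      if "Z = X \<or> Z = Y" for Z
    proof -
      have [measurable]: "p Z \<in> borel_measurable M" "q Z \<in> borel_measurable M" "F Z \<in> borel_measurable M"
        using that by auto
      have pq1: "p Z w * q Z w \<le> 1" for w using b01[of Z w] by (intro mult_le_one) auto
      have "(\<integral>\<^sup>+w. ennreal (F Z w - N Z w) \<partial>M) = (\<Sum>k. \<integral>\<^sup>+w. ennreal ((p Z w * q Z w) * (1 - p Z w * q Z w) ^ k * F Z w) \<partial>M)"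
        unfolding N_series by (rule nn_integral_suminf) measurable
      also have "\<dots> = (\<Sum>k. ennreal (\<integral>w. (p Z w * q Z w) * (1 - p Z w * q Z w) ^ k * F Z w \<partial>M))"
        by (subst nn[of _ 1]) (use b01[of Z] pq1 in \<open>auto intro!: mult_le_one power_le_one\<close>)
      finally show ?thesis .
    qed
    then show ?thesis by (simp only: PQ simp_thms)
  qed
  have N_eq: "(\<integral>\<^sup>+w. ennreal (N X w) \<partial>M) = (\<integral>\<^sup>+w. ennreal (N Y w) \<partial>M)"
  proof -
    have s: "(\<integral>\<^sup>+w. ennreal (F Z w - N Z w) \<partial>M) + (\<integral>\<^sup>+w. ennreal (N Z w) \<partial>M) = (\<integral>\<^sup>+w. ennreal (F Z w) \<partial>M)"
      if "Z = X \<or> Z = Y" for Z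
    proof -
      have [measurable]: "p Z \<in> borel_measurable M" "q Z \<in> borel_measurable M" "F Z \<in> borel_measurable M"
        using that by auto
      have [measurable]: "N Z \<in> borel_measurable M" unfolding N_def by measurable
      have "(\<integral>\<^sup>+w. ennreal (F Z w - N Z w) \<partial>M) + (\<integral>\<^sup>+w. ennreal (N Z w) \<partial>M) = (\<integral>\<^sup>+w. ennreal (F Z w - N Z w) + ennreal (N Z w) \<partial>M)"
        by (rule nn_integral_add[symmetric]) measurable
      also have "\<dots> = (\<integral>\<^sup>+w. ennreal (F Z w) \<partial>M)"
        using b01 by (intro nn_integral_cong) (auto simp: N_def)
      finally show ?thesis .
    qed
    have "(\<integral>\<^sup>+w. ennreal (F X w) \<partial>M) = (\<integral>\<^sup>+w. ennreal (F Y w) \<partial>M)"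
      using mon[of 0 0] b01 by (simp add: nn[of _ 1])
    then have "(\<integral>\<^sup>+w. ennreal (F Y w - N Y w) \<partial>M) + (\<integral>\<^sup>+w. ennreal (N X w) \<partial>M) = (\<integral>\<^sup>+w. ennreal (F Y w - N Y w) \<partial>M) + (\<integral>\<^sup>+w. ennreal (N Y w) \<partial>M)"
      using s[of X] s[of Y] FN_eq by simp
    moreover have "(\<integral>\<^sup>+w. ennreal (F Y w - N Y w) \<partial>M) \<noteq> \<infinity>"
    proof -
      have "(\<integral>\<^sup>+w. ennreal (F Y w - N Y w) \<partial>M) \<le> (\<integral>\<^sup>+w. 1 \<partial>M)"
        using b01 by (intro nn_integral_mono) (auto simp: N_def)
      then show ?thesis by (auto simp: emeasure_space_1 top_unique)
    qed
    ultimately show ?thesis by (auto simp: ennreal_add_left_cancel)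
  qed
  have split: "(\<integral>\<^sup>+w. ennreal (exp (- (LINT s:{0..t}|lborel. V (Z s w)))) * indicator B (Z t w) \<partial>M)
      = (\<integral>\<^sup>+w. ennreal (A Z w) \<partial>M) + (\<integral>\<^sup>+w. ennreal (N Z w) \<partial>M)"
    if ZZ: "Z = X \<or> Z = Y" and Z: "(\<lambda>(s, w). Z s w) \<in> borel_measurable (lborel \<Otimes>\<^sub>M M)" for Z
  proof -
    have [measurable]: "p Z \<in> borel_measurable M" "q Z \<in> borel_measurable M" "F Z \<in> borel_measurable M"
      using ZZ by auto
    have [measurable]: "A Z \<in> borel_measurable M" "N Z \<in> borel_measurable M"
      unfolding A_def N_def by measurable
    have "ennreal (exp (- (LINT s:{0..t}|lborel. V (Z s w)))) * indicator B (Z t w) = ennreal (A Z w) + ennreal (N Z w)"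
      if w: "w \<in> space M" for w
    proof -
      have [measurable]: "(\<lambda>s. Z s w) \<in> borel_measurable borel" by (rule process_section_measurable(2)[OF Z w])
      let ?g = "\<lambda>s. indicator {0..t} s *\<^sub>R V (Z s w)"
      have pos: "(\<integral>\<^sup>+s. ennreal (?g s) \<partial>lborel) = occ Z t Vp w"
        unfolding occ_def by (intro nn_integral_cong) (auto simp: Vp_def indicator_def max_def ennreal_neg)
      have neg: "(\<integral>\<^sup>+s. ennreal (- ?g s) \<partial>lborel) = occ Z t Vm w"
        unfolding occ_def by (intro nn_integral_cong) (auto simp: Vm_def indicator_def max_def ennreal_neg)
      have nrm: "(\<integral>\<^sup>+s. ennreal (norm (?g s)) \<partial>lborel) = occ Z t Vp w + occ Z t Vm w"
        unfolding occ_def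
        by (subst nn_integral_add[symmetric]) (auto simp: Vm_def Vp_def indicator_def max_def intro!: nn_integral_cong)
      show ?thesis
      proof (cases "p Z w * q Z w = 0")
        case True
        then have "occ Z t Vp w + occ Z t Vm w = \<infinity>" by (auto simp: p_def q_def exp_neg_eq_0_iff)
        then have "\<not> integrable lborel ?g" using nrm by (auto simp: integrable_iff_bounded)
        then have "(LINT s:{0..t}|lborel. V (Z s w)) = 0"
          unfolding set_lebesgue_integral_def by (rule not_integrable_integral_eq)
        then show ?thesis using True by (simp add: A_def N_def F_def indicator_def)
      next
        case False
        then have fin: "occ Z t Vp w \<noteq> \<infinity>" "occ Z t Vm w \<noteq> \<infinity>" by (auto simp: p_def q_def exp_neg_eq_0_iff)
        then have "integrable lborel ?g" using nrm by (auto simp: integrable_iff_bounded less_top ennreal_add_eq_top)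
        then have "(LINT s:{0..t}|lborel. V (Z s w)) = enn2real (occ Z t Vp w) - enn2real (occ Z t Vm w)"
          unfolding set_lebesgue_integral_def by (simp only: real_lebesgue_integral_def pos neg)
        then have "exp (- (LINT s:{0..t}|lborel. V (Z s w))) = p Z w / q Z w"
          using fin by (simp add: p_def q_def exp_neg_def exp_diff[symmetric])
        then show ?thesis using False by (simp add: A_def N_def F_def indicator_def)
      qed
    qed
    then have "(\<integral>\<^sup>+w. ennreal (exp (- (LINT s:{0..t}|lborel. V (Z s w)))) * indicator B (Z t w) \<partial>M) = (\<integral>\<^sup>+w. ennreal (A Z w) + ennreal (N Z w) \<partial>M)"
      by (rule nn_integral_cong)
    also have "\<dots> = (\<integral>\<^sup>+w. ennreal (A Z w) \<partial>M) + (\<integral>\<^sup>+w. ennreal (N Z w) \<partial>M)" by (rule nn_integral_add) measurable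
    finally show ?thesis .
  qed
  show ?thesis using split[of X] split[of Y] X Y A_eq N_eq by simp
qed
section \<open>Symmetry of the Feynman--Kac semigroup\<close>

definition fk_weight :: "(real \<Rightarrow> 'w \<Rightarrow> 'a::euclidean_space) \<Rightarrow> ('a \<Rightarrow> real) \<Rightarrow> real \<Rightarrow> 'a \<Rightarrow> 'w \<Rightarrow> real" where
  "fk_weight X V t x w = exp (- (LINT s:{0..t}|lborel. V (x + X s w)))"

lemma fk_weight_pos: "0 < fk_weight X V t x w"
  by (simp add: fk_weight_def)

lemma fk_weight_cong:
  assumes "\<And>s. 0 \<le> s \<Longrightarrow> s \<le> t \<Longrightarrow> X s w = Y s w"
  shows "fk_weight X V t x w = fk_weight Y V t x w"
  unfolding fk_weight_def set_lebesgue_integral_def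
  by (intro arg_cong[of _ _ exp] arg_cong[of _ _ uminus] Bochner_Integration.integral_cong refl)
    (use assms in \<open>auto simp: indicator_def\<close>)

lemma fk_weight_measurable:
  fixes X :: "real \<Rightarrow> 'w \<Rightarrow> 'a::euclidean_space"
  assumes X: "(\<lambda>(s, w). X s w) \<in> borel_measurable (lborel \<Otimes>\<^sub>M M)"
    and V[measurable]: "V \<in> borel_measurable borel"
  shows "(\<lambda>(x, w). fk_weight X V t x w) \<in> borel_measurable (borel \<Otimes>\<^sub>M M)"
proof -
  have "(\<lambda>p. (snd p, snd (fst p))) \<in> ((borel :: 'a measure) \<Otimes>\<^sub>M M) \<Otimes>\<^sub>M (lborel :: real measure) \<rightarrow>\<^sub>M lborel \<Otimes>\<^sub>M M"
    by measurable
  from measurable_compose[OF this X] have [measurable]: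
    "(\<lambda>p. X (snd p) (snd (fst p))) \<in> borel_measurable (((borel :: 'a measure) \<Otimes>\<^sub>M M) \<Otimes>\<^sub>M lborel)" by simp
  have "(\<lambda>p. \<integral>s. indicator {0..t} s *\<^sub>R V (fst p + X s (snd p)) \<partial>lborel) \<in> borel_measurable ((borel :: 'a measure) \<Otimes>\<^sub>M M)"
    by (rule lborel.borel_measurable_lebesgue_integral) (simp add: case_prod_beta', measurable)
  then show ?thesis unfolding fk_weight_def set_lebesgue_integral_def case_prod_beta' by measurable
qed

lemma same_fdd_cong:
  assumes "same_fdd M t X Y" "\<And>s w. 0 \<le> s \<Longrightarrow> s \<le> t \<Longrightarrow> X s w = X' s w" "\<And>s w. 0 \<le> s \<Longrightarrow> s \<le> t \<Longrightarrow> Y s w = Y' s w"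
  shows "same_fdd M t X' Y'"
  unfolding same_fdd_def
proof (intro allI impI)
  fix k :: nat and s :: "nat \<Rightarrow> real" and f :: "nat \<Rightarrow> 'b \<Rightarrow> ennreal"
  assume s: "\<forall>i<k. 0 \<le> s i \<and> s i \<le> t" and f: "\<forall>i<k. f i \<in> borel_measurable borel"
  have X: "(\<Prod>i<k. f i (X (s i) w)) = (\<Prod>i<k. f i (X' (s i) w))" and Y: "(\<Prod>i<k. f i (Y (s i) w)) = (\<Prod>i<k. f i (Y' (s i) w))" for w
    using s assms(2,3) by (auto intro!: prod.cong)
  have "(\<integral>\<^sup>+w. (\<Prod>i<k. f i (X (s i) w)) \<partial>M) = (\<integral>\<^sup>+w. (\<Prod>i<k. f i (Y (s i) w)) \<partial>M)"
    by (rule assms(1)[unfolded same_fdd_def, rule_format]) (use s f in auto)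
  then show "(\<integral>\<^sup>+w. (\<Prod>i<k. f i (X' (s i) w)) \<partial>M) = (\<integral>\<^sup>+w. (\<Prod>i<k. f i (Y' (s i) w)) \<partial>M)"
    unfolding X Y .
qed

text \<open>
  The previous lemma identifies the law of the endpoint under the weighted measure, and hence all
  integrals of nonnegative functions of it.
\<close>
lemma same_fdd_fk_expectation:
  fixes X Y :: "real \<Rightarrow> 'w \<Rightarrow> 'a::euclidean_space" and V :: "'a \<Rightarrow> real"
  assumes M: "prob_space M" and XY: "same_fdd M t X Y"
    and X: "(\<lambda>(s, w). X s w) \<in> borel_measurable (lborel \<Otimes>\<^sub>M M)"
    and Y: "(\<lambda>(s, w). Y s w) \<in> borel_measurable (lborel \<Otimes>\<^sub>M M)"
    and V[measurable]: "V \<in> borel_measurable borel"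
    and f[measurable]: "f \<in> borel_measurable borel" and t: "0 \<le> t"
  shows "(\<integral>\<^sup>+w. ennreal (fk_weight X V t x w) * f (x + X t w) \<partial>M)
       = (\<integral>\<^sup>+w. ennreal (fk_weight Y V t x w) * f (x + Y t w) \<partial>M)"
proof -
  let ?law = "\<lambda>Z. distr (density M (\<lambda>w. ennreal (fk_weight Z V t x w))) borel (Z t)"
  have wm: "fk_weight Z V t x \<in> borel_measurable M" if Z: "(\<lambda>(s, w). Z s w) \<in> borel_measurable (lborel \<Otimes>\<^sub>M M)" for Z :: "real \<Rightarrow> 'w \<Rightarrow> 'a"
    using measurable_Pair2[OF fk_weight_measurable[OF Z V], of x] by simp
  note [measurable] = wm[OF X] wm[OF Y] process_section_measurable(1)[OF X] process_section_measurable(1)[OF Y]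
  have nn: "(\<integral>\<^sup>+w. ennreal (fk_weight Z V t x w) * h (Z t w) \<partial>M) = (\<integral>\<^sup>+z. h z \<partial>?law Z)"
    if "Z = X \<or> Z = Y" and [measurable]: "h \<in> borel_measurable borel" for Z and h :: "'a \<Rightarrow> ennreal"
  proof -
    have [measurable]: "fk_weight Z V t x \<in> borel_measurable M" "Z t \<in> borel_measurable M" using that by auto
    show ?thesis by (simp add: nn_integral_distr nn_integral_density)
  qed
  have "?law X = ?law Y"
  proof (rule measure_eqI)
    fix B assume "B \<in> sets (?law X)"
    then have B[measurable]: "B \<in> sets borel" by simp
    have [measurable]: "(\<lambda>z. V (x + z)) \<in> borel_measurable borel" by measurable
    have "(\<integral>\<^sup>+z. indicator B z \<partial>?law X) = (\<integral>\<^sup>+w. ennreal (fk_weight X V t x w) * indicator B (X t w) \<partial>M)"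
      by (rule nn[symmetric]) auto
    also have "\<dots> = (\<integral>\<^sup>+w. ennreal (fk_weight Y V t x w) * indicator B (Y t w) \<partial>M)"
      unfolding fk_weight_def by (rule same_fdd_feynman_kac_weight[OF M XY X Y _ B t]) measurable
    also have "\<dots> = (\<integral>\<^sup>+z. indicator B z \<partial>?law Y)" by (rule nn) auto
    finally have "(\<integral>\<^sup>+z. indicator B z \<partial>?law X) = (\<integral>\<^sup>+z. indicator B z \<partial>?law Y)" .
    then show "emeasure (?law X) B = emeasure (?law Y) B" by simp
  qed simp
  then show ?thesis
    using nn[of X "\<lambda>z. f (x + z)"] nn[of Y "\<lambda>z. f (x + z)"] by simp
qed

lemma levy_jointly_measurable:
  fixes X :: "real \<Rightarrow> 'w \<Rightarrow> 'a::euclidean_space"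
  assumes "levy_process M X"
  shows "(\<lambda>(s, w). X (max 0 s) w) \<in> borel_measurable (lborel \<Otimes>\<^sub>M M)"
proof -
  have "{0..} \<inter> {t..} = {t..}" if "0 \<le> t" for t :: real using that by auto
  then have "(\<lambda>(s, w). X (max 0 s) w) \<in> borel_measurable (borel \<Otimes>\<^sub>M M)"
    using assms by (intro right_continuous_process_measurable) (auto simp: levy_process_def cadlag_on_def)
  then show ?thesis by (simp cong: measurable_cong_sets)
qed

text \<open>
  Substitute \<open>x = y - X\<^sub>t\<close> in the space integral. The path \<open>s \<mapsto> x + X\<^sub>s\<close> becomes
  \<open>s \<mapsto> y + (X\<^sub>s - X\<^sub>t)\<close>, which read backwards in time is \<open>s \<mapsto> y + (X\<^bsub>t-s\<^esub> - X\<^sub>t)\<close>. The integral of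
  \<open>V\<close> along the path does not see the direction of time, and the reversed process has the same
  finite-dimensional distributions as \<open>X\<close>.
\<close>
theorem feynman_kac_symmetric:
  fixes X :: "real \<Rightarrow> 'w \<Rightarrow> 'a::euclidean_space" and f g :: "'a \<Rightarrow> ennreal"
  assumes L: "levy_process M X"
    and sym: "\<And>r. 0 \<le> r \<Longrightarrow> distr M borel (\<lambda>w. - X r w) = distr M borel (X r)"
    and V[measurable]: "V \<in> borel_measurable borel"
    and f[measurable]: "f \<in> borel_measurable borel" and g[measurable]: "g \<in> borel_measurable borel" and t: "0 \<le> t"
  shows "(\<integral>\<^sup>+x. g x * (\<integral>\<^sup>+w. ennreal (fk_weight X V t x w) * f (x + X t w) \<partial>M) \<partial>lborel)
       = (\<integral>\<^sup>+x. f x * (\<integral>\<^sup>+w. ennreal (fk_weight X V t x w) * g (x + X t w) \<partial>M) \<partial>lborel)"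
proof -
  have M: "prob_space M" using L by (simp add: levy_process_def)
  interpret prob_space M by fact
  interpret p: pair_sigma_finite "lborel :: 'a measure" M ..
  \<comment> \<open>Freezing the process at negative times makes it jointly measurable on the whole line.\<close>
  define Z where "Z s = X (max 0 s)" for s
  define Y where "Y s w = Z (t - s) w - Z t w" for s w
  have Zm: "(\<lambda>(s, w). Z s w) \<in> borel_measurable (lborel \<Otimes>\<^sub>M M)"
    unfolding Z_def by (rule levy_jointly_measurable[OF L])
  have Ym: "(\<lambda>(s, w). Y s w) \<in> borel_measurable (lborel \<Otimes>\<^sub>M M)"
  proof -
    have "(\<lambda>p. (t - fst p, snd p)) \<in> (lborel :: real measure) \<Otimes>\<^sub>M M \<rightarrow>\<^sub>M lborel \<Otimes>\<^sub>M M" by measurable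
    from measurable_compose[OF this Zm] have [measurable]: "(\<lambda>p. Z (t - fst p) (snd p)) \<in> borel_measurable (lborel \<Otimes>\<^sub>M M)" by simp
    have [measurable]: "Z t \<in> borel_measurable M" by (rule process_section_measurable(1)[OF Zm])
    show ?thesis unfolding Y_def case_prod_beta' by measurable
  qed
  have fdd: "same_fdd M t Z Y"
  proof (rule same_fdd_cong)
    let ?Q = "\<lambda>r. distr M borel (X r)"
    have A: "additive_on M t X ?Q" by (rule levy_additive_on[OF L])
    have "distr (?Q r) borel uminus = ?Q r" if "0 \<le> r" for r
    proof -
      have [measurable]: "X r \<in> borel_measurable M" using L that by (simp add: levy_process_def)
      show ?thesis using sym[OF that] by (simp add: distr_distr comp_def)
    qed
    then have "additive_on M t (\<lambda>s w. X (t - s) w - X t w) ?Q"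
      by (intro time_reversal_additive[OF M A t])
    then show "same_fdd M t X (\<lambda>s w. X (t - s) w - X t w)"
      by (rule additive_same_fdd[OF M A _ t])
  qed (use t in \<open>auto simp: Z_def Y_def\<close>)
  have wZ: "fk_weight X V t x w = fk_weight Z V t x w" "X t w = Z t w" for x w
    using t by (auto simp: Z_def intro!: fk_weight_cong)
  have reflect: "fk_weight Z V t (y - Z t w) w = fk_weight Y V t y w" for y w
  proof -
    have "(LINT s:{0..t}|lborel. V (y - Z t w + Z s w)) = (\<integral>s. indicator {0..t} (t + (-1) * s) *\<^sub>R V (y - Z t w + Z (t + (-1) * s) w) \<partial>lborel)"
      unfolding set_lebesgue_integral_def by (subst lborel_integral_real_affine[of "-1" _ t]) auto
    also have "\<dots> = (LINT s:{0..t}|lborel. V (y + Y s w))"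
      unfolding set_lebesgue_integral_def Y_def
      by (intro Bochner_Integration.integral_cong refl) (auto simp: indicator_def algebra_simps)
    finally show ?thesis by (simp add: fk_weight_def)
  qed
  have [measurable]: "(\<lambda>(x, w). fk_weight Z V t x w) \<in> borel_measurable (borel \<Otimes>\<^sub>M M)"
    by (rule fk_weight_measurable[OF Zm V])
  have [measurable]: "(\<lambda>(x, w). fk_weight Z V t x w) \<in> borel_measurable (lborel \<Otimes>\<^sub>M M)"
    "(\<lambda>(x, w). fk_weight Y V t x w) \<in> borel_measurable (lborel \<Otimes>\<^sub>M M)"
    using fk_weight_measurable[OF Zm V] fk_weight_measurable[OF Ym V] by (simp_all cong: measurable_cong_sets)
  have [measurable]: "Z t \<in> borel_measurable M" "Y t \<in> borel_measurable M"
    using process_section_measurable(1)[OF Zm] process_section_measurable(1)[OF Ym] by auto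
  have wm[measurable]: "fk_weight Z V t x \<in> borel_measurable M" "fk_weight Y V t x \<in> borel_measurable M" for x
    using measurable_Pair2[OF fk_weight_measurable[OF Zm V], of x] measurable_Pair2[OF fk_weight_measurable[OF Ym V], of x] by simp_all
  have Y_t: "AE w in M. Y t w = - Z t w"
  proof -
    have "AE w in M. X 0 w = 0" using L by (simp add: levy_process_def)
    then show ?thesis by eventually_elim (simp add: Y_def Z_def)
  qed
  have "(\<integral>\<^sup>+x. g x * (\<integral>\<^sup>+w. ennreal (fk_weight X V t x w) * f (x + X t w) \<partial>M) \<partial>lborel)
     = (\<integral>\<^sup>+x. (\<integral>\<^sup>+w. g x * (ennreal (fk_weight Z V t x w) * f (x + Z t w)) \<partial>M) \<partial>lborel)"
    unfolding wZ by (intro nn_integral_cong nn_integral_cmult[symmetric]) measurable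
  also have "\<dots> = (\<integral>\<^sup>+w. (\<integral>\<^sup>+x. g x * (ennreal (fk_weight Z V t x w) * f (x + Z t w)) \<partial>lborel) \<partial>M)"
    by (rule p.Fubini'[symmetric]) measurable
  also have "\<dots> = (\<integral>\<^sup>+w. (\<integral>\<^sup>+y. f y * (ennreal (fk_weight Y V t y w) * g (y + (- Z t w))) \<partial>lborel) \<partial>M)"
  proof (rule nn_integral_cong)
    fix w assume w: "w \<in> space M"
    have [measurable]: "(\<lambda>x. fk_weight Z V t x w) \<in> borel_measurable borel"
      using measurable_Pair1[OF fk_weight_measurable[OF Zm V] w] by simp
    let ?h = "\<lambda>x. g x * (ennreal (fk_weight Z V t x w) * f (x + Z t w))"
    have "(\<integral>\<^sup>+x. ?h x \<partial>lborel) = (\<integral>\<^sup>+x. ?h x \<partial>distr lborel borel ((+) (- Z t w)))"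
      by (simp only: lborel_distr_plus)
    also have "\<dots> = (\<integral>\<^sup>+y. ?h (- Z t w + y) \<partial>lborel)" by (rule nn_integral_distr) measurable
    also have "\<dots> = (\<integral>\<^sup>+y. f y * (ennreal (fk_weight Y V t y w) * g (y + (- Z t w))) \<partial>lborel)"
      by (intro nn_integral_cong) (simp add: reflect[symmetric] mult_ac)
    finally show "(\<integral>\<^sup>+x. ?h x \<partial>lborel) = (\<integral>\<^sup>+y. f y * (ennreal (fk_weight Y V t y w) * g (y + (- Z t w))) \<partial>lborel)" .
  qed
  also have "\<dots> = (\<integral>\<^sup>+y. (\<integral>\<^sup>+w. f y * (ennreal (fk_weight Y V t y w) * g (y + (- Z t w))) \<partial>M) \<partial>lborel)"
    by (rule p.Fubini') measurable
  also have "\<dots> = (\<integral>\<^sup>+y. f y * (\<integral>\<^sup>+w. ennreal (fk_weight Y V t y w) * g (y + Y t w) \<partial>M) \<partial>lborel)"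
  proof (rule nn_integral_cong)
    fix y :: 'a
    have "(\<integral>\<^sup>+w. f y * (ennreal (fk_weight Y V t y w) * g (y + (- Z t w))) \<partial>M) = f y * (\<integral>\<^sup>+w. ennreal (fk_weight Y V t y w) * g (y + (- Z t w)) \<partial>M)"
      by (rule nn_integral_cmult) measurable
    also have "(\<integral>\<^sup>+w. ennreal (fk_weight Y V t y w) * g (y + (- Z t w)) \<partial>M) = (\<integral>\<^sup>+w. ennreal (fk_weight Y V t y w) * g (y + Y t w) \<partial>M)"
      using Y_t by (intro nn_integral_cong_AE) auto
    finally show "(\<integral>\<^sup>+w. f y * (ennreal (fk_weight Y V t y w) * g (y + (- Z t w))) \<partial>M) = f y * (\<integral>\<^sup>+w. ennreal (fk_weight Y V t y w) * g (y + Y t w) \<partial>M)" .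
  qed
  also have "\<dots> = (\<integral>\<^sup>+y. f y * (\<integral>\<^sup>+w. ennreal (fk_weight Z V t y w) * g (y + Z t w) \<partial>M) \<partial>lborel)"
    by (simp only: same_fdd_fk_expectation[OF M fdd Zm Ym V g t])
  finally show ?thesis unfolding wZ .
qed
section \<open>Symmetric Levy processes\<close>

lemma one_minus_cos_le: "1 - cos t \<le> t\<^sup>2 / 2" for t :: real
proof -
  have "(sin (t / 2))\<^sup>2 \<le> (t / 2)\<^sup>2"
  proof (rule abs_le_square_iff[THEN iffD1])
    show "\<bar>sin (t / 2)\<bar> \<le> \<bar>t / 2\<bar>"
      using sin_x_le_x[of "\<bar>t / 2\<bar>"] sin_x_le_x[of "\<bar>t / 2\<bar>"] sin_ge_zero[of "\<bar>t / 2\<bar>"]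
      by (smt (verit, ccfv_threshold) abs_sin_le_one sin_minus sin_x_ge_neg_x sin_x_le_x)
  qed
  moreover have "cos t = 1 - 2 * (sin (t / 2))\<^sup>2" using cos_double_sin[of "t / 2"] by simp
  ultimately show ?thesis by (simp add: power_divide)
qed

text \<open>
  The characteristic function is real, so the expectation of the sine vanishes and the addition
  theorem leaves the cosine part, for \<open>X\<close> and for \<open>- X\<close> alike.
\<close>
lemma levy_cos_transform:
  fixes X :: "real \<Rightarrow> 'w \<Rightarrow> 'a::euclidean_space"
  assumes L: "levy_process M X" and E: "has_levy_exponent M X \<psi>" and t: "0 \<le> t"
  shows "(\<integral>w. cos (\<xi> \<bullet> (y - X t w)) \<partial>M) = exp (- t * \<psi> \<xi>) * cos (\<xi> \<bullet> y)"
    and "(\<integral>w. cos (\<xi> \<bullet> (y - (- X t w))) \<partial>M) = exp (- t * \<psi> \<xi>) * cos (\<xi> \<bullet> y)"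
proof -
  interpret prob_space M using L by (simp add: levy_process_def)
  have [measurable]: "X t \<in> borel_measurable M" using L t by (simp add: levy_process_def)
  have ch: "(\<integral>w. exp (\<i> * complex_of_real (\<xi> \<bullet> X t w)) \<partial>M) = complex_of_real (exp (- t * \<psi> \<xi>))"
    using E t by (simp add: has_levy_exponent_def)
  have int: "integrable M (\<lambda>w. exp (\<i> * complex_of_real (\<xi> \<bullet> X t w)))"
    by (rule integrable_const_bound[of _ 1]) auto
  have c: "(\<integral>w. cos (\<xi> \<bullet> X t w) \<partial>M) = exp (- t * \<psi> \<xi>)"
    using integral_Re[OF int] ch by (simp add: Re_exp)
  have s: "(\<integral>w. sin (\<xi> \<bullet> X t w) \<partial>M) = 0"
    using integral_Im[OF int] ch by (simp add: Im_exp)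
  have ic: "integrable M (\<lambda>w. cos (\<xi> \<bullet> X t w))" and si: "integrable M (\<lambda>w. sin (\<xi> \<bullet> X t w))"
    by (rule integrable_const_bound[of _ 1]; auto)+
  have "(\<integral>w. cos (\<xi> \<bullet> (y - X t w)) \<partial>M) = (\<integral>w. cos (\<xi> \<bullet> y) * cos (\<xi> \<bullet> X t w) + sin (\<xi> \<bullet> y) * sin (\<xi> \<bullet> X t w) \<partial>M)"
    by (simp add: inner_diff_right cos_diff)
  then show "(\<integral>w. cos (\<xi> \<bullet> (y - X t w)) \<partial>M) = exp (- t * \<psi> \<xi>) * cos (\<xi> \<bullet> y)"
    using ic si c s by simp
  have "(\<integral>w. cos (\<xi> \<bullet> (y - (- X t w))) \<partial>M) = (\<integral>w. cos (\<xi> \<bullet> y) * cos (\<xi> \<bullet> X t w) - sin (\<xi> \<bullet> y) * sin (\<xi> \<bullet> X t w) \<partial>M)"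
    by (simp add: inner_add_right cos_add)
  then show "(\<integral>w. cos (\<xi> \<bullet> (y - (- X t w))) \<partial>M) = exp (- t * \<psi> \<xi>) * cos (\<xi> \<bullet> y)"
    using ic si c s by simp
qed

lemma levy_law_symmetric:
  fixes X :: "real \<Rightarrow> 'w \<Rightarrow> 'a::euclidean_space"
  assumes L: "levy_process M X" and E: "has_levy_exponent M X \<psi>" and t: "0 \<le> t"
  shows "distr M borel (\<lambda>w. - X t w) = distr M borel (X t)"
proof -
  interpret prob_space M using L by (simp add: levy_process_def)
  have [measurable]: "X t \<in> borel_measurable M" using L t by (simp add: levy_process_def)
  show ?thesis
  proof (rule measure_eq_of_cos_transform_eq)
    show "(\<integral>x. cos (\<xi> \<bullet> (y - x)) \<partial>distr M borel (\<lambda>w. - X t w)) = exp (- t * \<psi> \<xi>) * cos (\<xi> \<bullet> y)" for \<xi> y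
      by (subst integral_distr) (simp_all only: levy_cos_transform(2)[OF L E t], measurable)
    show "(\<integral>x. cos (\<xi> \<bullet> (y - x)) \<partial>distr M borel (X t)) = exp (- t * \<psi> \<xi>) * cos (\<xi> \<bullet> y)" for \<xi> y
      by (subst integral_distr) (simp_all only: levy_cos_transform(1)[OF L E t], measurable)
  qed (auto intro: prob_space_distr)
qed

lemma levy_exponent_tendsto_0:
  fixes X :: "real \<Rightarrow> 'w \<Rightarrow> 'a::euclidean_space"
  assumes L: "levy_process M X" and E: "has_levy_exponent M X \<psi>"
  shows "(\<psi> \<longlongrightarrow> 0) (at 0)"
proof -
  interpret prob_space M using L by (simp add: levy_process_def)
  have [measurable]: "X 1 \<in> borel_measurable M" using L by (simp add: levy_process_def)
  have eq: "exp (- \<psi> \<xi>) = (\<integral>w. cos (\<xi> \<bullet> X 1 w) \<partial>M)" for \<xi>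
    using levy_cos_transform(1)[OF L E, of 1 \<xi> 0] by simp
  have "continuous_on UNIV (\<lambda>\<xi>. \<integral>w. cos (\<xi> \<bullet> X 1 w) \<partial>M)"
  proof (rule continuous_on_sequentiallyI)
    fix u and a :: 'a assume u: "u \<longlonglongrightarrow> a"
    show "(\<lambda>n. \<integral>w. cos (u n \<bullet> X 1 w) \<partial>M) \<longlonglongrightarrow> (\<integral>w. cos (a \<bullet> X 1 w) \<partial>M)"
      by (rule integral_dominated_convergence[where w="\<lambda>_. 1"]) (auto intro!: tendsto_intros u)
  qed
  then have "isCont (\<lambda>\<xi>. \<integral>w. cos (\<xi> \<bullet> X 1 w) \<partial>M) 0" by (simp add: continuous_on_eq_continuous_at)
  then have "((\<lambda>\<xi>. exp (- \<psi> \<xi>)) \<longlongrightarrow> 1) (at 0)" unfolding eq isCont_def by (simp add: prob_space)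
  then have "((\<lambda>\<xi>. - ln (exp (- \<psi> \<xi>))) \<longlongrightarrow> - ln 1) (at 0)" by (intro tendsto_intros) auto
  then show ?thesis by simp
qed

text \<open>
  The positive density exceeds some \<open>1/(k + 1)\<close> on a bounded set \<open>S k\<close> of positive volume. Dropping
  the rest of \<open>\<nu>\<close> and the Gaussian part bounds the exponent below by a multiple of
  \<open>\<integral>\<^sub>S (1 - cos (\<xi> \<bullet> z)) dz\<close>, to which lemma \<open>cos_transform_gap\<close> applies.
\<close>
lemma levy_exponent_gap:
  fixes A :: "real ^ 'n ^ 'n" and nud :: "real ^ 'n \<Rightarrow> real"
  assumes A: "\<forall>\<xi>. 0 \<le> (A *v \<xi>) \<bullet> \<xi>" and \<nu>: "symmetric_levy_measure \<nu>"
    and nud[measurable]: "nud \<in> borel_measurable borel" and pos: "\<forall>z. z \<noteq> 0 \<longrightarrow> 0 < nud z"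
    and dens: "\<nu> = density lborel (\<lambda>z. ennreal (nud z))" and \<delta>: "0 < \<delta>"
  shows "\<exists>\<kappa>>0. \<forall>\<xi>. \<delta> \<le> norm \<xi> \<longrightarrow> \<kappa> \<le> levy_exponent A \<nu> \<xi>"
proof -
  have ae: "AE z in lborel. 0 < nud z"
  proof -
    have "AE z in lborel. z \<noteq> (0 :: real ^ 'n)" by (rule AE_lborel_singleton)
    then show ?thesis by eventually_elim (use pos in auto)
  qed
  define S where "S k = {z\<in>cball 0 1. 1 / real (Suc k) < nud z}" for k
  have S[measurable]: "S k \<in> sets borel" for k unfolding S_def by measurable
  have bS: "bounded (S k)" for k by (rule bounded_subset[of "cball 0 1"]) (auto simp: S_def)
  have "\<exists>k. emeasure lborel (S k) \<noteq> 0"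
  proof (rule ccontr)
    assume "\<not> ?thesis"
    then have "S k \<in> null_sets lborel" for k by auto
    then have "(\<Union>k. S k) \<in> null_sets lborel" by (intro null_sets_UN)
    moreover have "cball 0 1 - {0} \<subseteq> (\<Union>k. S k)"
    proof
      fix z :: "real ^ 'n" assume z: "z \<in> cball 0 1 - {0}"
      then obtain k where "inverse (real (Suc k)) < nud z" using pos reals_Archimedean[of "nud z"] by auto
      then show "z \<in> (\<Union>k. S k)" using z by (auto simp: S_def divide_inverse)
    qed
    ultimately have "cball (0 :: real ^ 'n) 1 - {0} \<in> null_sets lborel"
      using null_sets_subset[of "\<Union>k. S k" lborel "cball 0 1 - {0}"] by auto
    then have "cball (0 :: real ^ 'n) 1 - {0} \<union> {0} \<in> null_sets lborel" by (intro null_sets.Un) auto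
    moreover have "cball (0 :: real ^ 'n) 1 - {0} \<union> {0} = cball 0 1" by auto
    ultimately have "measure lborel (cball (0 :: real ^ 'n) 1) = 0" by (auto simp: measure_def)
    then show False using content_cball_pos[of 1 "0 :: real ^ 'n"] by simp
  qed
  then obtain k where k: "emeasure lborel (S k) \<noteq> 0" by blast
  have mS: "0 < measure lborel (S k)"
    using k emeasure_bounded_finite[OF bS[of k]] by (simp add: measure_def enn2real_positive_iff zero_less_iff_neq_zero)
  have lower: "1 / real (Suc k) * (measure lborel (S k) - cos_transform (S k) \<xi>) \<le> levy_exponent A \<nu> \<xi>" for \<xi>
  proof -
    let ?C = "2 * (1 + (norm \<xi>)\<^sup>2)"
    \<comment> \<open>Integrability of \<open>1 - cos\<close> with respect to \<open>\<nu>\<close>: quadratic near the origin, bounded away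
      from it.\<close>
    have bd: "1 - cos (\<xi> \<bullet> z) \<le> ?C * min 1 ((norm z)\<^sup>2)" for z
    proof (cases "norm z \<le> 1")
      case True
      then have "(norm z)\<^sup>2 \<le> 1" by (simp add: power_le_one)
      moreover have "1 - cos (\<xi> \<bullet> z) \<le> (\<xi> \<bullet> z)\<^sup>2 / 2" by (rule one_minus_cos_le)
      moreover have "(\<xi> \<bullet> z)\<^sup>2 \<le> (norm \<xi>)\<^sup>2 * (norm z)\<^sup>2"
        using Cauchy_Schwarz_ineq[of \<xi> z] by (simp add: power2_norm_eq_inner)
      moreover have "0 \<le> (norm \<xi>)\<^sup>2 * (norm z)\<^sup>2" "0 \<le> (norm z)\<^sup>2" by simp_all
      moreover have "?C * (norm z)\<^sup>2 = 2 * (norm z)\<^sup>2 + 2 * ((norm \<xi>)\<^sup>2 * (norm z)\<^sup>2)" by (simp add: algebra_simps)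
      ultimately have "1 - cos (\<xi> \<bullet> z) \<le> ?C * (norm z)\<^sup>2" by linarith
      then show ?thesis using \<open>(norm z)\<^sup>2 \<le> 1\<close> by (simp add: min_def)
    next
      case False
      then have "1 \<le> (norm z)\<^sup>2" by simp
      have "1 - cos (\<xi> \<bullet> z) \<le> 2" using cos_ge_minus_one[of "\<xi> \<bullet> z"] by linarith
      also have "\<dots> \<le> ?C" by simp
      finally show ?thesis using \<open>1 \<le> (norm z)\<^sup>2\<close> by simp
    qed
    have s\<nu>[measurable_cong]: "sets \<nu> = sets borel" using \<nu> by (simp add: symmetric_levy_measure_def)
    have int\<nu>: "integrable \<nu> (\<lambda>z. 1 - cos (\<xi> \<bullet> z))"
    proof (rule Bochner_Integration.integrable_bound)
      have "integrable \<nu> (\<lambda>z. min 1 ((norm z)\<^sup>2))"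
        by (rule integrableI_nonneg) (use \<nu> in \<open>auto simp: symmetric_levy_measure_def\<close>)
      then show "integrable \<nu> (\<lambda>z. ?C * min 1 ((norm z)\<^sup>2))" by (rule integrable_mult_right)
      show "AE z in \<nu>. norm (1 - cos (\<xi> \<bullet> z)) \<le> norm (?C * min 1 ((norm z)\<^sup>2))"
        using bd by (intro AE_I2) (simp add: abs_mult)
    qed measurable
    have intl: "integrable lborel (\<lambda>z. nud z * (1 - cos (\<xi> \<bullet> z)))"
      using int\<nu> ae unfolding dens by (subst (asm) integrable_density) (auto elim!: eventually_mono)
    have "(\<integral>z. (1 - cos (\<xi> \<bullet> z)) \<partial>\<nu>) = (\<integral>z. nud z * (1 - cos (\<xi> \<bullet> z)) \<partial>lborel)"
      using ae unfolding dens by (subst integral_density) (auto elim!: eventually_mono)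
    moreover have "(\<integral>z. 1 / real (Suc k) * (indicator (S k) z - cos (\<xi> \<bullet> z) * indicator (S k) z) \<partial>lborel) \<le> \<dots>"
    proof (rule integral_mono_AE)
      show "integrable lborel (\<lambda>z. 1 / real (Suc k) * (indicator (S k) z - cos (\<xi> \<bullet> z) * indicator (S k) z))"
        by (intro integrable_mult_right Bochner_Integration.integrable_diff integrable_indicator_bounded trig_coeff_integrable bS S)
      show "AE z in lborel. 1 / real (Suc k) * (indicator (S k) z - cos (\<xi> \<bullet> z) * indicator (S k) z) \<le> nud z * (1 - cos (\<xi> \<bullet> z))"
        using ae
      proof eventually_elim
        case (elim z)
        have c: "0 \<le> 1 - cos (\<xi> \<bullet> z)" by simp
        show ?case
        proof (cases "z \<in> S k")
          case True
          then have "1 / real (Suc k) \<le> nud z" by (simp add: S_def)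
          from mult_right_mono[OF this c] show ?thesis using True by simp
        next
          case False
          then show ?thesis using elim c by (simp add: mult_nonneg_nonneg)
        qed
      qed
    qed (rule intl)
    moreover have "(\<integral>z. 1 / real (Suc k) * (indicator (S k) z - cos (\<xi> \<bullet> z) * indicator (S k) z) \<partial>lborel)
       = 1 / real (Suc k) * (measure lborel (S k) - cos_transform (S k) \<xi>)"
      using integrable_indicator_bounded[OF bS S] trig_coeff_integrable(1)[OF bS S] by (simp add: cos_transform_def)
    moreover have "0 \<le> (A *v \<xi>) \<bullet> \<xi>" using A by simp
    ultimately show ?thesis by (simp add: levy_exponent_def)
  qed
  obtain \<kappa> where \<kappa>: "0 < \<kappa>" "\<And>\<xi>. \<delta> \<le> norm \<xi> \<Longrightarrow> \<kappa> \<le> measure lborel (S k) - cos_transform (S k) \<xi>"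
    using cos_transform_gap[OF S bS mS \<delta>] by blast
  show ?thesis
  proof (intro exI[of _ "1 / real (Suc k) * \<kappa>"] conjI allI impI)
    fix \<xi> :: "real ^ 'n" assume "\<delta> \<le> norm \<xi>"
    then have "1 / real (Suc k) * \<kappa> \<le> 1 / real (Suc k) * (measure lborel (S k) - cos_transform (S k) \<xi>)"
      using \<kappa>(2) by (intro mult_left_mono) auto
    then show "1 / real (Suc k) * \<kappa> \<le> levy_exponent A \<nu> \<xi>" using lower[of \<xi>] by linarith
  qed (use \<kappa> in simp)
qed

text \<open>
  If \<open>A\<close> and its complement both had positive volume, lemma \<open>overlap_charged\<close> would give an integer
  time at which mass passes from a bounded part of \<open>A\<close> to a bounded part of its complement, in
  contradiction to the invariance of \<open>A\<close>.
\<close>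
lemma levy_no_invariant_set:
  fixes X :: "real \<Rightarrow> 'w \<Rightarrow> 'a::euclidean_space"
  assumes L: "levy_process M X" and E: "has_levy_exponent M X \<psi>"
    and gap: "\<And>\<delta>. 0 < \<delta> \<Longrightarrow> \<exists>\<kappa>>0. \<forall>\<xi>. \<delta> \<le> norm \<xi> \<longrightarrow> \<kappa> \<le> \<psi> \<xi>" and \<psi>0: "\<psi> 0 = 0"
    and A[measurable]: "A \<in> sets borel"
    and inv: "\<And>n::nat. AE x in lborel. x \<in> A \<longrightarrow> (AE w in M. x + X n w \<in> A)"
  shows "emeasure lborel A = 0 \<or> emeasure lborel (- A) = 0"
proof (rule ccontr)
  assume "\<not> ?thesis"
  then have nz: "emeasure lborel A \<noteq> 0" "emeasure lborel (- A) \<noteq> 0" by auto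
  interpret prob_space M using L by (simp add: levy_process_def)
  have ex: "\<exists>r::nat. emeasure lborel (S \<inter> ball 0 (real r)) \<noteq> 0" if S[measurable]: "S \<in> sets borel" and "emeasure lborel S \<noteq> 0" for S :: "'a set"
  proof (rule ccontr)
    assume "\<not> ?thesis"
    then have "\<And>r::nat. S \<inter> ball 0 (real r) \<in> null_sets lborel" by auto
    then have "(\<Union>r::nat. S \<inter> ball 0 (real r)) \<in> null_sets lborel" by (intro null_sets_UN)
    moreover have "(\<Union>r::nat. S \<inter> ball 0 (real r)) = S" using reals_Archimedean2 by auto
    ultimately show False using that by auto
  qed
  obtain r1 where r1: "emeasure lborel (A \<inter> ball 0 (real r1)) \<noteq> 0" using ex[OF A nz(1)] by blast
  obtain r2 where r2: "emeasure lborel (- A \<inter> ball 0 (real r2)) \<noteq> 0" using ex[of "- A"] nz(2) by auto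
  define S S' where "S = A \<inter> ball 0 (real r1)" and "S' = - A \<inter> ball 0 (real r2)"
  have [measurable]: "S \<in> sets borel" "S' \<in> sets borel" by (auto simp: S_def S'_def)
  have b: "bounded S" "bounded S'" unfolding S_def S'_def by (auto intro: bounded_subset[OF bounded_ball])
  have m: "0 < measure lborel S" "0 < measure lborel S'"
    using r1 r2 emeasure_bounded_finite[OF b(1)] emeasure_bounded_finite[OF b(2)]
    by (simp_all add: S_def S'_def measure_def enn2real_positive_iff zero_less_iff_neq_zero)
  have [measurable]: "X (real n) \<in> borel_measurable M" for n :: nat using L by (simp add: levy_process_def)
  have "\<exists>n. (\<integral>x. overlap S S' x \<partial>distr M borel (X (real n))) \<noteq> 0"
  proof (rule overlap_charged[where \<psi>=\<psi>])
    show "(\<integral>x. cos (\<xi> \<bullet> (y - x)) \<partial>distr M borel (X (real n))) = exp (- real n * \<psi> \<xi>) * cos (\<xi> \<bullet> y)" for n \<xi> y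
      by (subst integral_distr) (simp_all only: levy_cos_transform(1)[OF L E of_nat_0_le_iff], measurable)
  qed (use gap \<psi>0 b m levy_exponent_tendsto_0[OF L E] in \<open>auto intro: prob_space_distr\<close>)
  then obtain n where n: "(\<integral>x. overlap S S' x \<partial>distr M borel (X (real n))) \<noteq> 0" by blast
  have om: "overlap S S' \<in> borel_measurable borel"
    by (rule borel_measurable_continuous_onI[OF overlap_continuous]) (use b in auto)
  interpret p: pair_sigma_finite M "lborel :: 'a measure" ..
  have "(\<integral>\<^sup>+w. ennreal (overlap S S' (X n w)) \<partial>M) = (\<integral>\<^sup>+w. (\<integral>\<^sup>+x. indicator S x * indicator S' (x + X n w) \<partial>lborel) \<partial>M)"
  proof (rule nn_integral_cong)
    fix w
    have "S \<inter> {x. x + X n w \<in> S'} \<subseteq> S" by auto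
    then have "emeasure lborel (S \<inter> {x. x + X n w \<in> S'}) < \<infinity>"
      using emeasure_bounded_finite[OF bounded_subset[OF b(1)]] by blast
    then have "ennreal (overlap S S' (X n w)) = emeasure lborel (S \<inter> {x. x + X n w \<in> S'})"
      unfolding overlap_def by (simp add: emeasure_eq_ennreal_measure less_top)
    also have "\<dots> = (\<integral>\<^sup>+x. indicator (S \<inter> {x. x + X n w \<in> S'}) x \<partial>lborel)" by simp
    also have "\<dots> = (\<integral>\<^sup>+x. indicator S x * indicator S' (x + X n w) \<partial>lborel)"
      by (intro nn_integral_cong) (auto simp: indicator_def)
    finally show "ennreal (overlap S S' (X n w)) = (\<integral>\<^sup>+x. indicator S x * indicator S' (x + X n w) \<partial>lborel)" .
  qed
  also have "\<dots> = (\<integral>\<^sup>+x. (\<integral>\<^sup>+w. indicator S x * indicator S' (x + X n w) \<partial>M) \<partial>lborel)"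
    by (rule p.Fubini'[symmetric]) measurable
  also have "\<dots> = (\<integral>\<^sup>+x. 0 \<partial>(lborel :: 'a measure))"
  proof (rule nn_integral_cong_AE)
    show "AE x in lborel. (\<integral>\<^sup>+w. indicator S x * indicator S' (x + X n w) \<partial>M) = 0"
      using inv[of n]
    proof eventually_elim
      case (elim x)
      show ?case
      proof (cases "x \<in> A")
        case True
        then have "AE w in M. x + X n w \<in> A" using elim by simp
        then have "AE w in M. indicator S x * indicator S' (x + X n w) = (0::ennreal)"
          by eventually_elim (auto simp: S'_def indicator_def)
        then show ?thesis by (subst nn_integral_0_iff_AE) auto
      qed (simp add: S_def)
    qed
  qed
  finally have "(\<integral>\<^sup>+w. ennreal (overlap S S' (X n w)) \<partial>M) = 0" by simp
  moreover have "(\<integral>x. overlap S S' x \<partial>distr M borel (X n)) = enn2real (\<integral>\<^sup>+w. ennreal (overlap S S' (X n w)) \<partial>M)"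
    using om by (subst integral_distr) (auto intro!: integral_eq_nn_integral simp: overlap_def)
  ultimately show False using n by simp
qed
section \<open>The stationary process and its transition kernels\<close>

text \<open>
  The constant is the infimum of the levels \<open>c\<close> with \<open>f \<le> c\<close> almost everywhere.
\<close>
lemma AE_const_of_zero_one:
  fixes f :: "'a \<Rightarrow> real"
  assumes "prob_space N" and [measurable]: "f \<in> borel_measurable N"
    and zo: "\<And>c. (AE x in N. f x \<le> c) \<or> (AE x in N. c < f x)"
  shows "\<exists>c. AE x in N. f x = c"
proof -
  interpret prob_space N by fact
  define S where "S = {c. AE x in N. f x \<le> c}"
  have up: "\<exists>n::nat. real n \<in> S"
  proof (rule ccontr)
    assume "\<not> ?thesis"
    then have "AE x in N. real n < f x" for n :: nat using zo[of "real n"] by (auto simp: S_def)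
    then have "AE x in N. \<forall>n::nat. real n < f x" by (simp add: AE_all_countable)
    then have "AE x in N. False"
    proof eventually_elim
      case (elim x)
      obtain n :: nat where "f x < real n" using reals_Archimedean2 by blast
      then show False using elim[rule_format, of n] by simp
    qed
    then show False by simp
  qed
  have low: "\<exists>n::nat. AE x in N. - real n < f x"
  proof (rule ccontr)
    assume "\<not> ?thesis"
    then have "AE x in N. f x \<le> - real n" for n :: nat using zo[of "- real n"] by auto
    then have "AE x in N. \<forall>n::nat. f x \<le> - real n" by (simp add: AE_all_countable)
    then have "AE x in N. False"
    proof eventually_elim
      case (elim x)
      obtain n :: nat where "- f x < real n" using reals_Archimedean2 by blast
      then show False using elim[rule_format, of n] by simp
    qed
    then show False by simp
  qed
  then obtain n0 :: nat where n0: "AE x in N. - real n0 < f x" by blast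
  have bdd: "bdd_below S"
  proof (rule bdd_belowI)
    fix c assume "c \<in> S"
    then have "AE x in N. f x \<le> c" by (simp add: S_def)
    with n0 have "AE x in N. - real n0 \<le> c" by eventually_elim simp
    then show "- real n0 \<le> c" by simp
  qed
  define c where "c = Inf S"
  have a: "AE x in N. f x < c + 1 / real (Suc k)" for k
  proof -
    have "c < c + 1 / real (Suc k)" by simp
    then obtain s where "s \<in> S" "s < c + 1 / real (Suc k)"
      using up bdd by (metis c_def cInf_less_iff empty_iff)
    then show ?thesis unfolding S_def by (auto elim!: eventually_mono)
  qed
  have b: "AE x in N. c - 1 / real (Suc k) < f x" for k
  proof -
    have "c - 1 / real (Suc k) \<notin> S"
    proof
      assume "c - 1 / real (Suc k) \<in> S"
      then have "c \<le> c - 1 / real (Suc k)" unfolding c_def by (rule cInf_lower[OF _ bdd])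
      then show False by simp
    qed
    then show ?thesis using zo[of "c - 1 / real (Suc k)"] by (auto simp: S_def)
  qed
  have "AE x in N. \<forall>k. f x < c + 1 / real (Suc k) \<and> c - 1 / real (Suc k) < f x"
    using a b by (simp add: AE_all_countable)
  then have "AE x in N. f x = c"
  proof eventually_elim
    case (elim x)
    show "f x = c"
    proof (rule ccontr)
      assume "f x \<noteq> c"
      then obtain k where "inverse (real (Suc k)) < \<bar>f x - c\<bar>" using reals_Archimedean[of "\<bar>f x - c\<bar>"] by auto
      then show False using elim[rule_format, of k] by (auto simp: divide_inverse abs_if split: if_splits)
    qed
  qed
  then show ?thesis ..
qed

text \<open>
  Everything about the transformed process except irreducibility is derived from these data:
  symmetry of its semigroup from the reflection symmetry of the Levy process, \<open>T\<^sub>t 1 = 1\<close> from the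
  formula for the path measure.
\<close>
locale gst_setting =
  fixes M :: "'w measure" and X :: "real \<Rightarrow> 'w \<Rightarrow> 'a::euclidean_space" and V \<phi> :: "'a \<Rightarrow> real"
    and lam0 :: real and P :: "'a \<Rightarrow> (real \<Rightarrow> 'a) measure"
  assumes L: "levy_process M X"
    and law_sym: "\<And>r. 0 \<le> r \<Longrightarrow> distr M borel (\<lambda>w. - X r w) = distr M borel (X r)"
    and V[measurable]: "V \<in> borel_measurable borel"
    and \<phi>[measurable]: "\<phi> \<in> borel_measurable borel" and \<phi>_pos: "\<And>x. 0 < \<phi> x"
    and \<phi>_norm: "L2_norm lborel \<phi> = 1"
    and gst: "gst_process M X V lam0 \<phi> P"
begin

abbreviation "\<mu> \<equiv> gs_measure \<phi>"
abbreviation "Pm \<equiv> path_measure \<phi> P"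
abbreviation "T \<equiv> gst_semigroup M X V lam0 \<phi>"

lemma prob_M: "prob_space M" using L by (simp add: levy_process_def)

sublocale M: prob_space M by (rule prob_M)

lemma sets_\<mu>[measurable_cong, simp]: "sets \<mu> = sets borel" by (simp add: gs_measure_def)
lemma space_\<mu>[simp]: "space \<mu> = UNIV" by (simp add: gs_measure_def)

lemma \<phi>2_integrable: "integrable lborel (\<lambda>x. (\<phi> x)\<^sup>2)" and \<phi>2_integral: "(\<integral>x. (\<phi> x)\<^sup>2 \<partial>lborel) = 1"
proof -
  show 1: "(\<integral>x. (\<phi> x)\<^sup>2 \<partial>lborel) = 1" using \<phi>_norm by (simp add: L2_norm_def)
  show "integrable lborel (\<lambda>x. (\<phi> x)\<^sup>2)" using 1 not_integrable_integral_eq by fastforce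
qed

lemma prob_\<mu>: "prob_space \<mu>"
proof
  have "emeasure \<mu> (space \<mu>) = (\<integral>\<^sup>+x. ennreal ((\<phi> x)\<^sup>2) \<partial>lborel)"
    by (simp add: gs_measure_def emeasure_density)
  also have "\<dots> = 1" using \<phi>2_integrable \<phi>2_integral by (simp add: nn_integral_eq_integral)
  finally show "emeasure \<mu> (space \<mu>) = 1" .
qed

sublocale \<mu>: prob_space \<mu> by (rule prob_\<mu>)

lemma AE_\<mu>_iff: "(AE x in \<mu>. Q x) \<longleftrightarrow> (AE x in lborel. Q x)"
proof -
  have "(AE x in \<mu>. Q x) \<longleftrightarrow> (AE x in lborel. 0 < ennreal ((\<phi> x)\<^sup>2) \<longrightarrow> Q x)"
    unfolding gs_measure_def by (rule AE_density) measurable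
  then show ?thesis using \<phi>_pos by (simp add: less_imp_neq[THEN not_sym] ennreal_less_zero_iff)
qed

lemma nn_integral_\<mu>:
  assumes [measurable]: "f \<in> borel_measurable borel"
  shows "(\<integral>\<^sup>+x. f x \<partial>\<mu>) = (\<integral>\<^sup>+x. ennreal ((\<phi> x)\<^sup>2) * f x \<partial>lborel)"
  unfolding gs_measure_def by (rule nn_integral_density) measurable

lemma P_measurable: "P \<in> measurable \<mu> (subprob_algebra cadlag_space)"
  using gst by (auto simp: gst_process_def intro!: measurable_prob_algebraD cong: measurable_cong_sets)

lemma P_space: "prob_space (P x)" "sets (P x) = sets cadlag_space"
proof -
  have "P x \<in> space (prob_algebra cadlag_space)"
    using gst by (auto simp: gst_process_def intro: measurable_space)
  then show "prob_space (P x)" "sets (P x) = sets cadlag_space" by (auto simp: space_prob_algebra)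
qed

lemma prob_Pm: "prob_space Pm"
  unfolding path_measure_def
  by (rule \<mu>.prob_space_bind[OF _ P_measurable]) (simp add: P_space)

lemma sets_Pm[measurable_cong]: "sets Pm = sets cadlag_space"
  unfolding path_measure_def by (rule sets_bind) (auto simp: P_space)

sublocale Pm: prob_space Pm by (rule prob_Pm)

lemma coord_measurable: "(\<lambda>w. w t) \<in> borel_measurable Pm"
proof -
  have "(\<lambda>w. w t) \<in> borel_measurable (cadlag_space :: (real \<Rightarrow> 'a) measure)"
    unfolding cadlag_space_def by (intro measurable_restrict_space1 measurable_component_singleton) simp
  then show ?thesis by (simp cong: measurable_cong_sets add: sets_Pm)
qed

lemma fdd:
  assumes "\<forall>i<n. t i \<le> t (Suc i)" "\<forall>j\<le>n. f j \<in> borel_measurable borel" "f 0 \<in> L2 \<mu>" "f n \<in> L2 \<mu>"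
    "\<forall>j. 0 < j \<and> j < n \<longrightarrow> bounded (range (f j))"
  shows "(\<integral>w. (\<Prod>j\<le>n. f j (w (t j))) \<partial>Pm) = (\<integral>x. nested T t f n x \<partial>\<mu>)"
  using gst assms unfolding gst_process_def by blast

lemma L2_borel: "f \<in> L2 \<mu> \<Longrightarrow> f \<in> borel_measurable borel"
  by (simp add: L2_def cong: measurable_cong_sets)

lemma fdd1:
  fixes f :: "'a \<Rightarrow> real"
  shows "f \<in> L2 \<mu> \<Longrightarrow> (\<integral>w. f (w t) \<partial>Pm) = (\<integral>x. f x \<partial>\<mu>)"
  using fdd[of 0 "\<lambda>_. t" "\<lambda>_. f"] by (simp add: L2_borel)

lemma fdd2:
  fixes f g :: "'a \<Rightarrow> real"
  assumes "f \<in> L2 \<mu>" "g \<in> L2 \<mu>" "s \<le> t"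
  shows "(\<integral>w. f (w s) * g (w t) \<partial>Pm) = (\<integral>x. f x * T (t - s) g x \<partial>\<mu>)"
  using fdd[of 1 "\<lambda>i. if i = 0 then s else t" "\<lambda>i. if i = 0 then f else g"] assms
  by (simp add: L2_borel atMost_Suc numeral_2_eq_2 mult.commute)

text \<open>
  Inserting the constant 1 at the intermediate time \<open>s\<close> produces \<open>T s (T t g)\<close>; compared with the
  two-time formula this is the semigroup law in weak form.
\<close>
lemma fdd3:
  fixes f g :: "'a \<Rightarrow> real"
  assumes "f \<in> L2 \<mu>" "g \<in> L2 \<mu>" "0 \<le> s" "0 \<le> t"
  shows "(\<integral>w. f (w 0) * g (w (s + t)) \<partial>Pm) = (\<integral>x. f x * T s (T t g) x \<partial>\<mu>)"
  using fdd[of 2 "\<lambda>i. if i = 0 then 0 else if i = 1 then s else s + t" "\<lambda>i. if i = 0 then f else if i = 1 then (\<lambda>_. 1) else g"] assms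
  by (simp add: L2_borel atMost_Suc numeral_2_eq_2 mult.commute less_Suc_eq)

lemma L2_indicator: "B \<in> sets borel \<Longrightarrow> (indicator B :: 'a \<Rightarrow> real) \<in> L2 \<mu>"
proof -
  assume [measurable]: "B \<in> sets borel"
  have "(\<lambda>x. (norm (indicator B x :: real))\<^sup>2) = indicator B" by (auto simp: indicator_def)
  moreover have "(indicator B :: 'a \<Rightarrow> real) \<in> borel_measurable \<mu>" by measurable
  ultimately show ?thesis by (simp add: L2_def \<mu>.emeasure_eq_measure)
qed

lemma L2_one: "(\<lambda>_. 1::real) \<in> L2 \<mu>" by (simp add: L2_def)

lemma distr_coord: "distr Pm borel (\<lambda>w. w t) = \<mu>"
proof (rule measure_eqI)
  fix B assume "B \<in> sets (distr Pm borel (\<lambda>w. w t))"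
  then have B[measurable]: "B \<in> sets borel" by simp
  from fdd1[OF L2_indicator[OF B], of t] have "(\<integral>w. indicator B (w t) \<partial>Pm) = measure \<mu> B" by simp
  moreover have "(\<integral>w. indicator B (w t) \<partial>Pm) = (\<integral>x. indicator B x \<partial>distr Pm borel (\<lambda>w. w t) :: real)"
    by (rule integral_distr[OF coord_measurable, symmetric]) simp
  ultimately have "measure (distr Pm borel (\<lambda>w. w t)) B = measure \<mu> B" by simp
  moreover have "prob_space (distr Pm borel (\<lambda>w. w t))" by (rule Pm.prob_space_distr) (rule coord_measurable)
  ultimately show "emeasure (distr Pm borel (\<lambda>w. w t)) B = emeasure \<mu> B"
    by (simp add: prob_space.finite_measure[THEN finite_measure.emeasure_eq_measure] \<mu>.emeasure_eq_measure)
qed simp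

text \<open>
  The transformed semigroup on nonnegative functions with values in \<open>[0, \<infinity>]\<close>, where Fubini's theorem
  and the symmetry of the Feynman--Kac semigroup apply without integrability conditions.
\<close>
definition K :: "real \<Rightarrow> ('a \<Rightarrow> ennreal) \<Rightarrow> 'a \<Rightarrow> ennreal" where
  "K t f x = ennreal (exp (lam0 * t) / \<phi> x) * (\<integral>\<^sup>+w. ennreal (fk_weight X V t x w) * (ennreal (\<phi> (x + X t w)) * f (x + X t w)) \<partial>M)"

lemma X_m: "0 \<le> t \<Longrightarrow> X t \<in> borel_measurable M" using L by (simp add: levy_process_def)

lemma weight_joint:
  assumes t: "0 \<le> t"
  shows "(\<lambda>(x, w). fk_weight X V t x w) \<in> borel_measurable (borel \<Otimes>\<^sub>M M)"
proof -
  have "fk_weight X V t x w = fk_weight (\<lambda>s. X (max 0 s)) V t x w" for x w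
    by (rule fk_weight_cong) auto
  then show ?thesis using fk_weight_measurable[OF levy_jointly_measurable[OF L] V, of t] by simp
qed

lemma weight_m: "0 \<le> t \<Longrightarrow> fk_weight X V t x \<in> borel_measurable M"
  using measurable_Pair2[OF weight_joint, of t x] by simp

lemma K_measurable:
  assumes t: "0 \<le> t" and [measurable]: "f \<in> borel_measurable borel"
  shows "K t f \<in> borel_measurable borel"
proof -
  note [measurable] = weight_joint[OF t] X_m[OF t]
  show ?thesis unfolding K_def by measurable
qed

lemma T_measurable:
  fixes f :: "'a \<Rightarrow> real"
  assumes t: "0 \<le> t" and [measurable]: "f \<in> borel_measurable borel"
  shows "T t f \<in> borel_measurable borel"
proof -
  note [measurable] = weight_joint[OF t] X_m[OF t]
  have "(\<lambda>x. \<integral>w. fk_weight X V t x w *\<^sub>R (\<phi> (x + X t w) * f (x + X t w)) \<partial>M) \<in> borel_measurable borel"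
    by measurable
  then show ?thesis unfolding gst_semigroup_def feynman_kac_def fk_weight_def[symmetric] by measurable
qed

lemma T_eq_K:
  fixes f :: "'a \<Rightarrow> real"
  assumes t: "0 \<le> t" and [measurable]: "f \<in> borel_measurable borel" and f0: "\<And>x. 0 \<le> f x"
  shows "T t f x = enn2real (K t (\<lambda>y. ennreal (f y)) x)"
proof -
  note [measurable] = weight_m[OF t] X_m[OF t]
  have "feynman_kac M X V t (\<lambda>y. \<phi> y * f y) x = enn2real (\<integral>\<^sup>+w. ennreal (fk_weight X V t x w *\<^sub>R (\<phi> (x + X t w) * f (x + X t w))) \<partial>M)"
    unfolding feynman_kac_def fk_weight_def[symmetric]
    by (rule integral_eq_nn_integral) (auto intro!: AE_I2 mult_nonneg_nonneg f0 less_imp_le[OF \<phi>_pos] less_imp_le[OF fk_weight_pos])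
  also have "(\<integral>\<^sup>+w. ennreal (fk_weight X V t x w *\<^sub>R (\<phi> (x + X t w) * f (x + X t w))) \<partial>M)
     = (\<integral>\<^sup>+w. ennreal (fk_weight X V t x w) * (ennreal (\<phi> (x + X t w)) * ennreal (f (x + X t w))) \<partial>M)"
    by (intro nn_integral_cong) (simp add: ennreal_mult f0 less_imp_le[OF \<phi>_pos] less_imp_le[OF fk_weight_pos])
  finally show ?thesis
    using \<phi>_pos[of x] by (simp add: gst_semigroup_def K_def enn2real_mult less_imp_le)
qed

lemma K_symmetric:
  assumes t: "0 \<le> t" and [measurable]: "f \<in> borel_measurable borel" "g \<in> borel_measurable borel"
  shows "(\<integral>\<^sup>+x. g x * K t f x \<partial>\<mu>) = (\<integral>\<^sup>+x. f x * K t g x \<partial>\<mu>)"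
proof -
  have rewrite: "(\<integral>\<^sup>+x. g x * K t f x \<partial>\<mu>) = ennreal (exp (lam0 * t)) *
     (\<integral>\<^sup>+x. (ennreal (\<phi> x) * g x) * (\<integral>\<^sup>+w. ennreal (fk_weight X V t x w) * (ennreal (\<phi> (x + X t w)) * f (x + X t w)) \<partial>M) \<partial>lborel)"
    if fg: "f \<in> borel_measurable borel" "g \<in> borel_measurable borel" for f g
  proof -
    note [measurable] = weight_joint[OF t] X_m[OF t] fg K_measurable[OF t fg(1)]
    have im[measurable]: "(\<lambda>x. \<integral>\<^sup>+w. ennreal (fk_weight X V t x w) * (ennreal (\<phi> (x + X t w)) * f (x + X t w)) \<partial>M) \<in> borel_measurable borel"
      by measurable
    have "ennreal ((\<phi> x)\<^sup>2) * ennreal (exp (lam0 * t) / \<phi> x) = ennreal (exp (lam0 * t)) * ennreal (\<phi> x)" for x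
      using \<phi>_pos[of x] by (simp add: ennreal_mult[symmetric] power2_eq_square)
    then have "ennreal ((\<phi> x)\<^sup>2) * (g x * (ennreal (exp (lam0 * t) / \<phi> x) * k)) = ennreal (exp (lam0 * t)) * ((ennreal (\<phi> x) * g x) * k)" for x k
      by (metis (no_types, lifting) mult.assoc mult.left_commute)
    then have "(\<integral>\<^sup>+x. g x * K t f x \<partial>\<mu>) = (\<integral>\<^sup>+x. ennreal (exp (lam0 * t)) * ((ennreal (\<phi> x) * g x) * (\<integral>\<^sup>+w. ennreal (fk_weight X V t x w) * (ennreal (\<phi> (x + X t w)) * f (x + X t w)) \<partial>M)) \<partial>lborel)"
      by (subst nn_integral_\<mu>) (simp_all add: K_def)
    also have "\<dots> = ennreal (exp (lam0 * t)) * (\<integral>\<^sup>+x. (ennreal (\<phi> x) * g x) * (\<integral>\<^sup>+w. ennreal (fk_weight X V t x w) * (ennreal (\<phi> (x + X t w)) * f (x + X t w)) \<partial>M) \<partial>lborel)"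
      by (rule nn_integral_cmult) measurable
    finally show ?thesis .
  qed
  have "(\<integral>\<^sup>+x. (ennreal (\<phi> x) * g x) * (\<integral>\<^sup>+w. ennreal (fk_weight X V t x w) * (ennreal (\<phi> (x + X t w)) * f (x + X t w)) \<partial>M) \<partial>lborel)
     = (\<integral>\<^sup>+x. (ennreal (\<phi> x) * f x) * (\<integral>\<^sup>+w. ennreal (fk_weight X V t x w) * (ennreal (\<phi> (x + X t w)) * g (x + X t w)) \<partial>M) \<partial>lborel)"
    using feynman_kac_symmetric[OF L law_sym V _ _ t, of "\<lambda>x. ennreal (\<phi> x) * f x" "\<lambda>x. ennreal (\<phi> x) * g x"] by simp
  then show ?thesis using rewrite[of f g] rewrite[of g f] assms by simp
qed

text \<open>
  The one-time and the two-time formula for the path measure give the same value to \<open>\<integral>\<^sub>B T\<^sub>t 1 d\<mu>\<close>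
  and \<open>\<mu>(B)\<close> for every \<open>B\<close>.
\<close>
lemma T_one_AE: "0 \<le> t \<Longrightarrow> AE x in \<mu>. T t (\<lambda>_. 1) x = 1"
proof -
  assume t: "0 \<le> t"
  have B: "(\<integral>x. indicator B x * T t (\<lambda>_. 1) x \<partial>\<mu>) = measure \<mu> B" if [measurable]: "B \<in> sets borel" for B
    using fdd2[OF L2_indicator[OF that] L2_one, of 0 t] fdd1[OF L2_indicator[OF that], of 0] t by simp
  have "(\<integral>x. T t (\<lambda>_. 1) x \<partial>\<mu>) = 1" using B[of UNIV] \<mu>.prob_space by simp
  then have int: "integrable \<mu> (T t (\<lambda>_. 1))" using not_integrable_integral_eq by fastforce
  show ?thesis
    by (rule density_unique_real[OF int]) (use B in \<open>auto simp: set_lebesgue_integral_def\<close>)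
qed

lemma K_one_AE: "0 \<le> t \<Longrightarrow> AE x in \<mu>. K t (\<lambda>_. 1) x = 1"
proof -
  assume t: "0 \<le> t"
  show ?thesis using T_one_AE[OF t]
  proof eventually_elim
    case (elim x)
    then have "enn2real (K t (\<lambda>_. 1) x) = 1" using T_eq_K[OF t, of "\<lambda>_. 1" x] by simp
    \<comment> \<open>The conversion to reals sends \<open>\<infinity>\<close> to 0, so the value 1 excludes \<open>\<infinity>\<close>.\<close>
    then show ?case by (metis enn2real_1 ennreal_1 ennreal_enn2real_if zero_neq_one enn2real_top)
  qed
qed

end
section \<open>The transition operators as a symmetric semigroup\<close>

context gst_setting begin

text \<open>
  The transition kernel as a reweighting of the underlying probability space: \<open>T t f x\<close> is the
  integral of \<open>f (x + X t)\<close> with respect to this measure.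
\<close>
definition kern :: "real \<Rightarrow> 'a \<Rightarrow> 'w measure" where
  "kern t x = density M (\<lambda>w. ennreal (exp (lam0 * t) / \<phi> x * (fk_weight X V t x w * \<phi> (x + X t w))))"

lemma kern_density_pos: "0 < exp (lam0 * t) / \<phi> x * (fk_weight X V t x w * \<phi> (x + X t w))"
  by (simp add: \<phi>_pos fk_weight_pos)

lemma sets_kern[measurable_cong, simp]: "sets (kern t x) = sets M"
  by (simp add: kern_def)

lemma K_eq_kern:
  assumes t: "0 \<le> t" and [measurable]: "f \<in> borel_measurable borel"
  shows "K t f x = (\<integral>\<^sup>+w. f (x + X t w) \<partial>kern t x)"
proof -
  note [measurable] = weight_m[OF t] X_m[OF t]
  have "(\<integral>\<^sup>+w. f (x + X t w) \<partial>kern t x) = (\<integral>\<^sup>+w. ennreal (exp (lam0 * t) / \<phi> x * (fk_weight X V t x w * \<phi> (x + X t w))) * f (x + X t w) \<partial>M)"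
    unfolding kern_def by (rule nn_integral_density) measurable
  also have "\<dots> = (\<integral>\<^sup>+w. ennreal (exp (lam0 * t) / \<phi> x) * (ennreal (fk_weight X V t x w) * (ennreal (\<phi> (x + X t w)) * f (x + X t w))) \<partial>M)"
  proof (rule nn_integral_cong)
    fix w
    have "ennreal (exp (lam0 * t) / \<phi> x * (fk_weight X V t x w * \<phi> (x + X t w)))
        = ennreal (exp (lam0 * t) / \<phi> x) * (ennreal (fk_weight X V t x w) * ennreal (\<phi> (x + X t w)))"
      by (simp only: ennreal_mult divide_nonneg_nonneg exp_ge_zero mult_nonneg_nonneg less_imp_le[OF \<phi>_pos] less_imp_le[OF fk_weight_pos])
    then show "ennreal (exp (lam0 * t) / \<phi> x * (fk_weight X V t x w * \<phi> (x + X t w))) * f (x + X t w)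
        = ennreal (exp (lam0 * t) / \<phi> x) * (ennreal (fk_weight X V t x w) * (ennreal (\<phi> (x + X t w)) * f (x + X t w)))"
      by (simp only: mult.assoc)
  qed
  also have "\<dots> = K t f x" unfolding K_def by (rule nn_integral_cmult) measurable
  finally show ?thesis by simp
qed

lemma T_eq_kern:
  fixes f :: "'a \<Rightarrow> real"
  assumes t: "0 \<le> t" and [measurable]: "f \<in> borel_measurable borel"
  shows "T t f x = (\<integral>w. f (x + X t w) \<partial>kern t x)"
proof -
  note [measurable] = weight_m[OF t] X_m[OF t]
  have "(\<integral>w. f (x + X t w) \<partial>kern t x) = (\<integral>w. exp (lam0 * t) / \<phi> x * (fk_weight X V t x w *\<^sub>R (\<phi> (x + X t w) * f (x + X t w))) \<partial>M)"
    unfolding kern_def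
  proof (rule trans[OF integral_density])
    show "AE w in M. 0 \<le> exp (lam0 * t) / \<phi> x * (fk_weight X V t x w * \<phi> (x + X t w))"
      by (intro AE_I2 less_imp_le[OF kern_density_pos])
  qed (measurable, simp add: mult_ac)
  also have "\<dots> = exp (lam0 * t) / \<phi> x * (\<integral>w. fk_weight X V t x w *\<^sub>R (\<phi> (x + X t w) * f (x + X t w)) \<partial>M)"
    by (rule integral_mult_right_zero)
  finally show ?thesis by (simp add: gst_semigroup_def feynman_kac_def fk_weight_def)
qed

text \<open>
  The starting points at which \<open>T t f x\<close> is the expectation of a square integrable variable under a
  probability measure. Almost every point qualifies if \<open>f\<close> is in \<open>L\<^sup>2(\<mu>)\<close>; elsewhere the defining
  integrals may take default values.
\<close>
definition square_integrable_at :: "real \<Rightarrow> ('a \<Rightarrow> real) \<Rightarrow> 'a \<Rightarrow> bool" where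
  "square_integrable_at t f x \<longleftrightarrow> prob_space (kern t x) \<and> integrable (kern t x) (\<lambda>w. f (x + X t w)) \<and>
     integrable (kern t x) (\<lambda>w. (f (x + X t w))\<^sup>2)"

text \<open>
  Symmetry together with \<open>T\<^sub>t 1 = 1\<close> makes \<open>\<mu>\<close> invariant.
\<close>
lemma K_square_integral:
  fixes f :: "'a \<Rightarrow> real"
  assumes t: "0 \<le> t" and f: "f \<in> L2 \<mu>"
  shows "(\<integral>\<^sup>+x. K t (\<lambda>y. ennreal ((f y)\<^sup>2)) x \<partial>\<mu>) = ennreal (ip \<mu> f f)"
proof -
  have [measurable]: "f \<in> borel_measurable borel" by (rule L2_borel[OF f])
  have "(\<integral>\<^sup>+x. K t (\<lambda>y. ennreal ((f y)\<^sup>2)) x \<partial>\<mu>) = (\<integral>\<^sup>+x. 1 * K t (\<lambda>y. ennreal ((f y)\<^sup>2)) x \<partial>\<mu>)" by simp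
  also have "\<dots> = (\<integral>\<^sup>+x. ennreal ((f x)\<^sup>2) * K t (\<lambda>_. 1) x \<partial>\<mu>)" by (rule K_symmetric[OF t]) measurable
  also have "\<dots> = (\<integral>\<^sup>+x. ennreal ((f x)\<^sup>2) \<partial>\<mu>)"
    using K_one_AE[OF t] by (intro nn_integral_cong_AE) (auto elim!: eventually_mono)
  also have "\<dots> = ennreal (ip \<mu> f f)"
    using f by (simp add: ip_def L2_def nn_integral_eq_integral power2_eq_square)
  finally show ?thesis .
qed

lemma AE_square_integrable_at:
  assumes t: "0 \<le> t" and f: "f \<in> L2 \<mu>"
  shows "AE x in \<mu>. square_integrable_at t f x"
proof -
  note [measurable] = L2_borel[OF f] X_m[OF t] weight_m[OF t]
  have [measurable]: "K t (\<lambda>y. ennreal ((f y)\<^sup>2)) \<in> borel_measurable borel" by (rule K_measurable[OF t]) measurable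
  have "AE x in \<mu>. K t (\<lambda>y. ennreal ((f y)\<^sup>2)) x \<noteq> \<infinity>"
    by (rule nn_integral_noteq_infinite) (use K_square_integral[OF t f] in auto)
  then show ?thesis using K_one_AE[OF t]
  proof eventually_elim
    case (elim x)
    have "emeasure (kern t x) (space (kern t x)) = 1"
      using elim(2) K_eq_kern[OF t, of "\<lambda>_. 1" x] by simp
    then interpret k: prob_space "kern t x" by (rule prob_spaceI)
    have sq: "integrable (kern t x) (\<lambda>w. (f (x + X t w))\<^sup>2)"
      using elim(1) by (intro integrableI_nonneg) (auto simp: K_eq_kern[OF t] less_top)
    moreover have "integrable (kern t x) (\<lambda>w. f (x + X t w))"
    proof (rule Bochner_Integration.integrable_bound)
      show "integrable (kern t x) (\<lambda>w. 1 + (f (x + X t w))\<^sup>2)" using sq by simp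
      have "\<bar>y\<bar> \<le> 1 + y\<^sup>2" for y :: real
      proof -
        have "0 \<le> (\<bar>y\<bar> - 1)\<^sup>2" by simp
        then have "2 * \<bar>y\<bar> \<le> y\<^sup>2 + 1" by (simp add: power2_diff)
        then show ?thesis using abs_ge_zero[of y] by linarith
      qed
      then show "AE w in kern t x. norm (f (x + X t w)) \<le> norm (1 + (f (x + X t w))\<^sup>2)"
        by (intro AE_I2) (simp add: abs_of_nonneg add_nonneg_nonneg)
    qed measurable
    ultimately show ?case using k.prob_space_axioms by (simp add: square_integrable_at_def)
  qed
qed

text \<open>
  Jensen's inequality, in the form that variances are nonnegative.
\<close>
lemma T_square_le:
  assumes t: "0 \<le> t" and f: "f \<in> L2 \<mu>" and g: "square_integrable_at t f x"
  shows "ennreal ((T t f x)\<^sup>2) \<le> K t (\<lambda>y. ennreal ((f y)\<^sup>2)) x"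
proof -
  note [measurable] = L2_borel[OF f]
  interpret k: prob_space "kern t x" using g by (simp add: square_integrable_at_def)
  have "k.variance (\<lambda>w. f (x + X t w)) = (\<integral>w. (f (x + X t w))\<^sup>2 \<partial>kern t x) - (\<integral>w. f (x + X t w) \<partial>kern t x)\<^sup>2"
    by (rule k.variance_eq) (use g in \<open>auto simp: square_integrable_at_def\<close>)
  moreover have "0 \<le> k.variance (\<lambda>w. f (x + X t w))" by (rule k.variance_positive)
  ultimately have "(T t f x)\<^sup>2 \<le> (\<integral>w. (f (x + X t w))\<^sup>2 \<partial>kern t x)"
    by (simp add: T_eq_kern[OF t])
  then have "ennreal ((T t f x)\<^sup>2) \<le> ennreal (\<integral>w. (f (x + X t w))\<^sup>2 \<partial>kern t x)" by (rule ennreal_leI)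
  also have "\<dots> = (\<integral>\<^sup>+w. ennreal ((f (x + X t w))\<^sup>2) \<partial>kern t x)"
    using g by (intro nn_integral_eq_integral[symmetric]) (auto simp: square_integrable_at_def)
  also have "\<dots> = K t (\<lambda>y. ennreal ((f y)\<^sup>2)) x" by (rule K_eq_kern[OF t, symmetric]) measurable
  finally show ?thesis .
qed

lemma T_square_integral_le:
  assumes t: "0 \<le> t" and f: "f \<in> L2 \<mu>"
  shows "(\<integral>\<^sup>+x. ennreal ((T t f x)\<^sup>2) \<partial>\<mu>) \<le> ennreal (ip \<mu> f f)"
  unfolding K_square_integral[OF assms, symmetric]
  using AE_square_integrable_at[OF assms] by (intro nn_integral_mono_AE) (auto elim!: eventually_mono intro: T_square_le[OF t f])

lemma T_in_L2:
  assumes t: "0 \<le> t" and f: "f \<in> L2 \<mu>"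
  shows "T t f \<in> L2 \<mu>"
  unfolding L2_real_iff
proof
  have [measurable]: "T t f \<in> borel_measurable borel" by (rule T_measurable[OF t L2_borel[OF f]])
  show "T t f \<in> borel_measurable \<mu>" by measurable
  show "integrable \<mu> (\<lambda>x. (T t f x)\<^sup>2)"
    by (rule integrableI_nonneg) (use le_less_trans[OF T_square_integral_le[OF assms] ennreal_less_top] in auto)
qed

lemma T_nonneg_ip:
  assumes t: "0 \<le> t" and f: "f \<in> L2 \<mu>" and g: "g \<in> L2 \<mu>" and f0: "\<And>x. 0 \<le> f x" and g0: "\<And>x. 0 \<le> g x"
  shows "ip \<mu> (T t f) g = enn2real (\<integral>\<^sup>+x. ennreal (g x) * K t (\<lambda>y. ennreal (f y)) x \<partial>\<mu>)"
proof -
  note [measurable] = L2_borel[OF f] L2_borel[OF g] T_measurable[OF t L2_borel[OF f]]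
  have T0: "0 \<le> T t f x" for x by (simp add: T_eq_K[OF t _ f0])
  have "ip \<mu> (T t f) g = enn2real (\<integral>\<^sup>+x. ennreal (T t f x * g x) \<partial>\<mu>)"
    unfolding ip_def by (rule integral_eq_nn_integral) (use T0 g0 in auto)
  also have "(\<integral>\<^sup>+x. ennreal (T t f x * g x) \<partial>\<mu>) = (\<integral>\<^sup>+x. ennreal (g x) * K t (\<lambda>y. ennreal (f y)) x \<partial>\<mu>)"
  proof (rule nn_integral_cong_AE)
    show "AE x in \<mu>. ennreal (T t f x * g x) = ennreal (g x) * K t (\<lambda>y. ennreal (f y)) x"
      using AE_square_integrable_at[OF t f]
    proof eventually_elim
      case (elim x)
      have "K t (\<lambda>y. ennreal (f y)) x = ennreal (\<integral>w. f (x + X t w) \<partial>kern t x)"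
        using elim f0 by (subst K_eq_kern[OF t]) (auto simp: square_integrable_at_def nn_integral_eq_integral)
      then have "ennreal (T t f x) = K t (\<lambda>y. ennreal (f y)) x" by (simp add: T_eq_kern[OF t])
      then show ?case using T0 g0 by (simp add: ennreal_mult mult.commute)
    qed
  qed
  finally show ?thesis .
qed

lemma T_ip_lincomb:
  assumes t: "0 \<le> t" and f: "f \<in> L2 \<mu>" and g: "g \<in> L2 \<mu>" and k: "k \<in> L2 \<mu>"
  shows "ip \<mu> (T t (\<lambda>x. a * f x + b * g x)) k = a * ip \<mu> (T t f) k + b * ip \<mu> (T t g) k"
proof -
  note [measurable] = L2_borel[OF f] L2_borel[OF g] L2_borel[OF k]
  have [measurable]: "T t (\<lambda>x. a * f x + b * g x) \<in> borel_measurable borel" "T t f \<in> borel_measurable borel" "T t g \<in> borel_measurable borel"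
    by (rule T_measurable[OF t]; measurable)+
  have "AE x in \<mu>. T t (\<lambda>x. a * f x + b * g x) x = a * T t f x + b * T t g x"
    using AE_square_integrable_at[OF t f] AE_square_integrable_at[OF t g]
    by eventually_elim (simp add: T_eq_kern[OF t] square_integrable_at_def)
  then have "ip \<mu> (T t (\<lambda>x. a * f x + b * g x)) k = ip \<mu> (\<lambda>x. a * T t f x + b * T t g x) k"
    unfolding ip_def by (intro integral_cong_AE) (auto elim!: eventually_mono)
  also have "\<dots> = a * ip \<mu> (T t f) k + b * ip \<mu> (T t g) k"
    by (rule ip_lincomb_left[OF T_in_L2[OF t f] T_in_L2[OF t g] k])
  finally show ?thesis .
qed

text \<open>
  Decomposition into positive and negative parts reduces the claim to the symmetry of \<open>K\<close> on
  nonnegative functions.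
\<close>
lemma T_ip_symmetric:
  assumes t: "0 \<le> t" and f: "f \<in> L2 \<mu>" and g: "g \<in> L2 \<mu>"
  shows "ip \<mu> (T t f) g = ip \<mu> f (T t g)"
proof -
  have pos: "ip \<mu> (T t u) v = ip \<mu> (T t v) u" if "u \<in> L2 \<mu>" "v \<in> L2 \<mu>" "\<And>x. 0 \<le> u x" "\<And>x. 0 \<le> v x" for u v
  proof -
    note [measurable] = L2_borel[OF that(1)] L2_borel[OF that(2)]
    have "(\<integral>\<^sup>+x. ennreal (v x) * K t (\<lambda>y. ennreal (u y)) x \<partial>\<mu>) = (\<integral>\<^sup>+x. ennreal (u x) * K t (\<lambda>y. ennreal (v y)) x \<partial>\<mu>)"
      by (rule K_symmetric[OF t]) measurable
    then show ?thesis using that by (simp add: T_nonneg_ip[OF t])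
  qed
  define pp mm where "pp u = (\<lambda>x. max (u x) 0)" and "mm u = (\<lambda>x. max (- u x) 0)" for u :: "'a \<Rightarrow> real"
  have parts: "pp u \<in> L2 \<mu>" "mm u \<in> L2 \<mu>" if u: "u \<in> L2 \<mu>" for u
  proof -
    note [measurable] = L2_borel[OF u]
    have i: "integrable \<mu> (\<lambda>x. (u x)\<^sup>2)" using u by (simp add: L2_real_iff)
    have "integrable \<mu> (\<lambda>x. (pp u x)\<^sup>2)" "integrable \<mu> (\<lambda>x. (mm u x)\<^sup>2)"
      by (rule Bochner_Integration.integrable_bound[OF i]; auto simp: pp_def mm_def max_def)+
    then show "pp u \<in> L2 \<mu>" "mm u \<in> L2 \<mu>" unfolding L2_real_iff by (auto simp: pp_def mm_def)
  qed
  have split: "u = (\<lambda>x. 1 * pp u x + (- 1) * mm u x)" for u by (auto simp: pp_def mm_def max_def)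
  have nn: "0 \<le> pp u x" "0 \<le> mm u x" for u x by (auto simp: pp_def mm_def)
  have expand: "ip \<mu> (T t u) v = ip \<mu> (T t (pp u)) (pp v) - ip \<mu> (T t (pp u)) (mm v) - ip \<mu> (T t (mm u)) (pp v) + ip \<mu> (T t (mm u)) (mm v)"
    if u: "u \<in> L2 \<mu>" and v: "v \<in> L2 \<mu>" for u v
  proof -
    have "ip \<mu> (T t u) v = 1 * ip \<mu> (T t (pp u)) v + (- 1) * ip \<mu> (T t (mm u)) v"
      by (subst split[of u], rule T_ip_lincomb[OF t parts[OF u] v])
    moreover have "ip \<mu> k v = 1 * ip \<mu> k (pp v) + (- 1) * ip \<mu> k (mm v)" if "k \<in> L2 \<mu>" for k
      by (subst split[of v], rule ip_lincomb_right[OF parts[OF v] that])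
    ultimately show ?thesis using T_in_L2[OF t parts(1)[OF u]] T_in_L2[OF t parts(2)[OF u]] by simp
  qed
  have "ip \<mu> (T t f) g = ip \<mu> (T t g) f"
    unfolding expand[OF f g] expand[OF g f]
    using pos[OF parts(1)[OF f] parts(1)[OF g] nn(1) nn(1)] pos[OF parts(1)[OF f] parts(2)[OF g] nn(1) nn(2)]
      pos[OF parts(2)[OF f] parts(1)[OF g] nn(2) nn(1)] pos[OF parts(2)[OF f] parts(2)[OF g] nn(2) nn(2)]
    by simp
  then show ?thesis by (simp add: ip_commute)
qed

lemma T_contraction:
  assumes t: "0 \<le> t" and f: "f \<in> L2 \<mu>"
  shows "ip \<mu> (T t f) (T t f) \<le> ip \<mu> f f"
proof -
  have "ennreal (ip \<mu> (T t f) (T t f)) = (\<integral>\<^sup>+x. ennreal ((T t f x)\<^sup>2) \<partial>\<mu>)"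
    using T_in_L2[OF assms] by (simp add: ip_def L2_def nn_integral_eq_integral power2_eq_square)
  also have "\<dots> \<le> ennreal (ip \<mu> f f)" by (rule T_square_integral_le[OF assms])
  finally show ?thesis by (simp add: ip_nonneg)
qed

sublocale S: symmetric_semigroup \<mu> T
proof
  show "ip \<mu> (T s (T t f)) g = ip \<mu> (T (s + t) f) g"
    if "0 \<le> s" "0 \<le> t" "f \<in> L2 \<mu>" "g \<in> L2 \<mu>" for s t f g
    using fdd3[OF that(4,3,1,2)] fdd2[OF that(4,3), of 0 "s + t"] that by (simp add: ip_def mult.commute)
  show "ip \<mu> (T 0 f) g = ip \<mu> f g" if f: "f \<in> L2 \<mu>" and g: "g \<in> L2 \<mu>" for f g
  proof -
    have [measurable]: "f \<in> borel_measurable borel" "g \<in> borel_measurable borel" using f g L2_borel by auto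
    have "ip \<mu> (T 0 f) g = (\<integral>w. g (w 0) * f (w 0) \<partial>Pm)"
      using fdd2[OF g f, of 0 0] by (simp add: ip_def mult.commute)
    also have "\<dots> = (\<integral>x. g x * f x \<partial>distr Pm borel (\<lambda>w. w 0))"
      by (rule integral_distr[OF coord_measurable, symmetric]) measurable
    finally show ?thesis by (simp add: distr_coord ip_def mult.commute)
  qed
qed (fact T_in_L2 T_ip_symmetric T_ip_lincomb T_contraction)+

end
section \<open>Resolvent and irreducibility of the transformed semigroup\<close>

context gst_setting begin

lemma L2_\<mu>_iff:
  fixes f :: "'a \<Rightarrow> real"
  shows "f \<in> L2 \<mu> \<longleftrightarrow> (\<lambda>x. \<phi> x * f x) \<in> L2 lborel"
proof -
  have "f \<in> borel_measurable borel" if "(\<lambda>x. \<phi> x * f x) \<in> borel_measurable borel"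
  proof -
    have "(\<lambda>x. (\<phi> x * f x) / \<phi> x) \<in> borel_measurable borel" using that by measurable
    then show ?thesis using \<phi>_pos by (simp add: less_imp_neq[THEN not_sym])
  qed
  moreover have "integrable \<mu> (\<lambda>x. (f x)\<^sup>2) \<longleftrightarrow> integrable lborel (\<lambda>x. (\<phi> x * f x)\<^sup>2)" if "f \<in> borel_measurable borel"
    unfolding gs_measure_def using that by (subst integrable_density) (auto simp: power_mult_distrib)
  moreover have "(\<lambda>x. \<phi> x * f x) \<in> borel_measurable borel" if "f \<in> borel_measurable borel"
    using that by measurable
  moreover have "f \<in> borel_measurable \<mu> \<longleftrightarrow> f \<in> borel_measurable borel"
    using measurable_cong_sets[of \<mu> borel "borel :: real measure" borel] by simp
  ultimately show ?thesis unfolding L2_real_iff measurable_lborel2 by blast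
qed

lemma nn_integral_square_ip:
  assumes f: "f \<in> L2 \<mu>"
  shows "(\<integral>\<^sup>+x. ennreal ((\<phi> x * f x)\<^sup>2) \<partial>lborel) = ennreal (ip \<mu> f f)"
proof -
  have [measurable]: "f \<in> borel_measurable borel" by (rule L2_borel[OF f])
  have "(\<integral>\<^sup>+x. ennreal ((\<phi> x * f x)\<^sup>2) \<partial>lborel) = (\<integral>\<^sup>+x. ennreal ((f x)\<^sup>2) \<partial>\<mu>)"
    by (subst nn_integral_\<mu>) (auto simp: power_mult_distrib ennreal_mult)
  then show ?thesis by (simp add: S.nn_integral_square_eq_ip[OF f])
qed

definition diffquot :: "real \<Rightarrow> ('a \<Rightarrow> real) \<Rightarrow> ('a \<Rightarrow> real) \<Rightarrow> 'a \<Rightarrow> real" where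
  "diffquot s F G x = (1 / s) * (F x - feynman_kac M X V s F x) - G x"

lemma exp_diffquot_tendsto: "((\<lambda>s. (1 - exp (- lam0 * s)) / s - lam0) \<longlongrightarrow> 0) (at_right 0)"
proof -
  have "((\<lambda>s. exp (- lam0 * s)) has_real_derivative - lam0) (at 0)"
    by (auto intro!: derivative_eq_intros)
  then have "((\<lambda>s. (exp (- lam0 * s) - 1) / s) \<longlongrightarrow> - lam0) (at 0)"
    by (simp add: has_field_derivative_iff)
  then have "((\<lambda>s. (exp (- lam0 * s) - 1) / s) \<longlongrightarrow> - lam0) (at_right 0)"
    by (rule filterlim_mono[OF _ order_refl at_le]) simp
  then have "((\<lambda>s. - ((exp (- lam0 * s) - 1) / s) - lam0) \<longlongrightarrow> - (- lam0) - lam0) (at_right 0)"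
    by (intro tendsto_intros)
  moreover have "- ((exp (- lam0 * s) - 1) / s) - lam0 = (1 - exp (- lam0 * s)) / s - lam0" for s
    by (simp add: minus_divide_left)
  ultimately show ?thesis by simp
qed

text \<open>
  Multiplication by \<open>\<phi>\<close> is an isometry from \<open>L\<^sup>2(\<mu>)\<close> onto \<open>L\<^sup>2(dx)\<close> that takes \<open>T\<^sub>s\<close> to \<open>e\<^bsup>\<lambda>\<^sub>0 s\<^esup>\<close>
  times the Feynman--Kac operator. The two difference quotients thus differ by the factor
  \<open>e\<^bsup>-\<lambda>\<^sub>0 s\<^esup> \<rightarrow> 1\<close> and by a combination of \<open>f\<close> and \<open>h\<close> with coefficients tending to 0.
\<close>
lemma gen_iff_diffquot:
  assumes f: "f \<in> L2 \<mu>" and h: "h \<in> L2 \<mu>"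
  shows "S.gen f h \<longleftrightarrow>
    ((\<lambda>s. \<integral>\<^sup>+x. ennreal ((diffquot s (\<lambda>x. \<phi> x * f x) (\<lambda>x. \<phi> x * (h x + lam0 * f x)) x)\<^sup>2) \<partial>lborel) \<longlongrightarrow> 0) (at_right 0)"
proof -
  define R where "R s = (\<lambda>x. (f x - T s f x) / s - h x)" for s
  define e \<alpha> \<beta> where "e s = exp (- lam0 * s)" and "\<alpha> s = (1 - exp (- lam0 * s)) / s - lam0" and "\<beta> s = exp (- lam0 * s) - 1" for s
  define c where "c s = (\<lambda>x. \<alpha> s * f x + \<beta> s * h x)" for s
  \<comment> \<open>\<open>W\<close> and \<open>R\<close> are the errors of the difference quotients of the Feynman--Kac and of the
    transformed semigroup.\<close>
  define W where "W s = (\<lambda>x. e s * R s x + 1 * c s x)" for s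
  have RL: "R s \<in> L2 \<mu>" if "0 < s" for s unfolding R_def by (rule S.diff_quot_L2[OF that f h])
  have cL: "c s \<in> L2 \<mu>" for s unfolding c_def by (rule L2_lincomb[OF f h])
  have WL: "W s \<in> L2 \<mu>" if "0 < s" for s unfolding W_def by (rule L2_lincomb[OF RL[OF that] cL])
  have \<alpha>: "(\<alpha> \<longlongrightarrow> 0) (at_right 0)" unfolding \<alpha>_def by (rule exp_diffquot_tendsto)
  have e1: "(e \<longlongrightarrow> 1) (at_right 0)"
  proof -
    have "(e \<longlongrightarrow> exp (- lam0 * 0)) (at_right 0)" unfolding e_def by (intro tendsto_intros)
    then show ?thesis by simp
  qed
  have \<beta>: "(\<beta> \<longlongrightarrow> 0) (at_right 0)"
    using tendsto_diff[OF e1 tendsto_const[of 1]] by (simp add: \<beta>_def[abs_def] e_def)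
  have c0: "((\<lambda>s. ip \<mu> (c s) (c s)) \<longlongrightarrow> 0) (at_right 0)"
  proof -
    have "((\<lambda>s. (\<alpha> s)\<^sup>2 * ip \<mu> f f + 2 * \<alpha> s * \<beta> s * ip \<mu> f h + (\<beta> s)\<^sup>2 * ip \<mu> h h)
       \<longlongrightarrow> 0\<^sup>2 * ip \<mu> f f + 2 * 0 * 0 * ip \<mu> f h + 0\<^sup>2 * ip \<mu> h h) (at_right 0)"
      by (intro tendsto_intros \<alpha> \<beta>)
    then show ?thesis unfolding c_def ip_lincomb_self[OF f h] by simp
  qed
  have dq: "diffquot s (\<lambda>x. \<phi> x * f x) (\<lambda>x. \<phi> x * (h x + lam0 * f x)) x = \<phi> x * W s x" if s: "0 < s" for s x
  proof -
    have "feynman_kac M X V s (\<lambda>x. \<phi> x * f x) x = \<phi> x * (e s * T s f x)"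
      using \<phi>_pos[of x] by (simp add: gst_semigroup_def e_def exp_minus field_simps)
    then have "diffquot s (\<lambda>x. \<phi> x * f x) (\<lambda>x. \<phi> x * (h x + lam0 * f x)) x
      = \<phi> x * ((1 / s) * (f x - e s * T s f x) - h x - lam0 * f x)"
      by (simp add: diffquot_def algebra_simps)
    also have "(1 / s) * (f x - e s * T s f x) - h x - lam0 * f x = W s x"
      using s by (simp add: W_def R_def c_def \<alpha>_def \<beta>_def e_def field_simps)
    finally show ?thesis .
  qed
  have nn: "(\<integral>\<^sup>+x. ennreal ((diffquot s (\<lambda>x. \<phi> x * f x) (\<lambda>x. \<phi> x * (h x + lam0 * f x)) x)\<^sup>2) \<partial>lborel) = ennreal (ip \<mu> (W s) (W s))"
    if s: "0 < s" for s
    by (simp add: dq[OF s] nn_integral_square_ip[OF WL[OF s]])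
  have "((\<lambda>s. \<integral>\<^sup>+x. ennreal ((diffquot s (\<lambda>x. \<phi> x * f x) (\<lambda>x. \<phi> x * (h x + lam0 * f x)) x)\<^sup>2) \<partial>lborel) \<longlongrightarrow> 0) (at_right 0)
      \<longleftrightarrow> ((\<lambda>s. ennreal (ip \<mu> (W s) (W s))) \<longlongrightarrow> ennreal 0) (at_right 0)"
    unfolding ennreal_0
    by (rule tendsto_cong) (use nn in \<open>auto intro: eventually_mono[OF eventually_at_right_less[of 0]]\<close>)
  also have "\<dots> \<longleftrightarrow> ((\<lambda>s. ip \<mu> (W s) (W s)) \<longlongrightarrow> 0) (at_right 0)"
    by (rule tendsto_ennreal_iff) (auto simp: ip_nonneg)
  also have "\<dots> \<longleftrightarrow> ((\<lambda>s. ip \<mu> (R s) (R s)) \<longlongrightarrow> 0) (at_right 0)"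
  proof
    assume R0: "((\<lambda>s. ip \<mu> (R s) (R s)) \<longlongrightarrow> 0) (at_right 0)"
    show "((\<lambda>s. ip \<mu> (W s) (W s)) \<longlongrightarrow> 0) (at_right 0)"
    proof (rule Lim_null_comparison)
      show "\<forall>\<^sub>F s in at_right 0. norm (ip \<mu> (W s) (W s)) \<le> 2 * (e s)\<^sup>2 * ip \<mu> (R s) (R s) + 2 * 1\<^sup>2 * ip \<mu> (c s) (c s)"
        using eventually_at_right_less[of 0]
      proof eventually_elim
        case (elim s)
        have "ip \<mu> (W s) (W s) \<le> 2 * (e s)\<^sup>2 * ip \<mu> (R s) (R s) + 2 * 1\<^sup>2 * ip \<mu> (c s) (c s)"
          unfolding W_def by (rule ip_lincomb_le[OF RL[OF elim] cL])
        then show ?case using ip_nonneg[of \<mu> "W s"] by simp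
      qed
      have "((\<lambda>s. 2 * (e s)\<^sup>2 * ip \<mu> (R s) (R s) + 2 * 1\<^sup>2 * ip \<mu> (c s) (c s)) \<longlongrightarrow> 2 * 1\<^sup>2 * 0 + 2 * 1\<^sup>2 * 0) (at_right 0)"
        by (intro tendsto_intros e1 R0 c0)
      then show "((\<lambda>s. 2 * (e s)\<^sup>2 * ip \<mu> (R s) (R s) + 2 * 1\<^sup>2 * ip \<mu> (c s) (c s)) \<longlongrightarrow> 0) (at_right 0)" by simp
    qed
  next
    assume W0: "((\<lambda>s. ip \<mu> (W s) (W s)) \<longlongrightarrow> 0) (at_right 0)"
    show "((\<lambda>s. ip \<mu> (R s) (R s)) \<longlongrightarrow> 0) (at_right 0)"
    proof (rule Lim_null_comparison)
      show "\<forall>\<^sub>F s in at_right 0. norm (ip \<mu> (R s) (R s)) \<le> 2 * (inverse (e s))\<^sup>2 * ip \<mu> (W s) (W s) + 2 * (- inverse (e s))\<^sup>2 * ip \<mu> (c s) (c s)"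
        using eventually_at_right_less[of 0]
      proof eventually_elim
        case (elim s)
        have "e s \<noteq> 0" by (simp add: e_def)
        then have "R s = (\<lambda>x. inverse (e s) * W s x + (- inverse (e s)) * c s x)" by (auto simp: W_def field_simps)
        then have "ip \<mu> (R s) (R s) \<le> 2 * (inverse (e s))\<^sup>2 * ip \<mu> (W s) (W s) + 2 * (- inverse (e s))\<^sup>2 * ip \<mu> (c s) (c s)"
          using ip_lincomb_le[OF WL[OF elim] cL[of s], of "inverse (e s)" "- inverse (e s)"] by simp
        then show ?case using ip_nonneg[of \<mu> "R s"] by simp
      qed
      have "((\<lambda>s. 2 * (inverse (e s))\<^sup>2 * ip \<mu> (W s) (W s) + 2 * (- inverse (e s))\<^sup>2 * ip \<mu> (c s) (c s))
          \<longlongrightarrow> 2 * (inverse 1)\<^sup>2 * 0 + 2 * (- inverse 1)\<^sup>2 * 0) (at_right 0)"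
        by (intro tendsto_intros e1 W0 c0) simp_all
      then show "((\<lambda>s. 2 * (inverse (e s))\<^sup>2 * ip \<mu> (W s) (W s) + 2 * (- inverse (e s))\<^sup>2 * ip \<mu> (c s) (c s)) \<longlongrightarrow> 0) (at_right 0)"
        by simp
    qed
  qed
  also have "\<dots> \<longleftrightarrow> S.gen f h" using f h by (simp add: S.gen_def R_def)
  finally show ?thesis by simp
qed

lemma feynman_kac_of_real:
  "feynman_kac M X V t (\<lambda>x. complex_of_real (F x)) x = complex_of_real (feynman_kac M X V t F x)"
  unfolding feynman_kac_def by (simp add: scaleR_conv_of_real flip: of_real_mult)

lemma integrable_weight_L2:
  fixes f :: "'a \<Rightarrow> real"
  assumes t: "0 \<le> t" and f: "f \<in> L2 \<mu>" and g: "square_integrable_at t f x"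
  shows "integrable M (\<lambda>w. fk_weight X V t x w * (\<phi> (x + X t w) * f (x + X t w)))"
proof -
  note [measurable] = L2_borel[OF f] X_m[OF t] weight_m[OF t]
  have "integrable (kern t x) (\<lambda>w. f (x + X t w))" using g by (simp add: square_integrable_at_def)
  then have "integrable M (\<lambda>w. (exp (lam0 * t) / \<phi> x * (fk_weight X V t x w * \<phi> (x + X t w))) *\<^sub>R f (x + X t w))"
    unfolding kern_def
    by (subst (asm) integrable_density) (use less_imp_le[OF kern_density_pos] in \<open>auto simp del: times_divide_eq_left\<close>)
  moreover have "(\<lambda>w. (exp (lam0 * t) / \<phi> x * (fk_weight X V t x w * \<phi> (x + X t w))) *\<^sub>R f (x + X t w))
     = (\<lambda>w. exp (lam0 * t) / \<phi> x * (fk_weight X V t x w * (\<phi> (x + X t w) * f (x + X t w))))"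
    by (simp add: mult.assoc)
  ultimately have i: "integrable M (\<lambda>w. exp (lam0 * t) / \<phi> x * (fk_weight X V t x w * (\<phi> (x + X t w) * f (x + X t w))))" by simp
  have "\<phi> x / exp (lam0 * t) * (exp (lam0 * t) / \<phi> x * y) = y" for y using \<phi>_pos[of x] by simp
  then show ?thesis using integrable_mult_right[OF i, of "\<phi> x / exp (lam0 * t)"] by (simp only:)
qed

text \<open>
  The real part of the difference quotient is the difference quotient of the real part at almost
  every point, since there the Feynman--Kac expectation converges absolutely; taking real parts
  decreases distances.
\<close>
lemma schroedinger_imp_gen:
  fixes F G :: "'a \<Rightarrow> complex"
  assumes H: "schroedinger_op M X V F G"
  defines "f \<equiv> \<lambda>x. Re (F x) / \<phi> x"
  defines "h \<equiv> \<lambda>x. Re (G x) / \<phi> x - lam0 * f x"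
  shows "f \<in> L2 \<mu>" "h \<in> L2 \<mu>" "S.gen f h"
proof -
  have FL: "F \<in> L2 lborel" and GL: "G \<in> L2 lborel"
    and lim: "((\<lambda>t. \<integral>\<^sup>+x. ennreal ((norm ((1 / t) *\<^sub>R (F x - feynman_kac M X V t F x) - G x))\<^sup>2) \<partial>lborel) \<longlongrightarrow> 0) (at_right 0)"
    using H by (auto simp: schroedinger_op_def)
  have part: "(\<lambda>x. Re (F x) / \<phi> x) \<in> L2 \<mu> \<and> (\<lambda>x. Im (F x) / \<phi> x) \<in> L2 \<mu>" if FL: "F \<in> L2 lborel" for F :: "'a \<Rightarrow> complex"
  proof -
    have [measurable]: "F \<in> borel_measurable borel" and i: "integrable lborel (\<lambda>x. (norm (F x))\<^sup>2)"
      using FL by (auto simp: L2_def)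
    have "integrable lborel (\<lambda>x. (Re (F x))\<^sup>2)" "integrable lborel (\<lambda>x. (Im (F x))\<^sup>2)"
      by (rule Bochner_Integration.integrable_bound[OF i]; simp add: cmod_power2)+
    moreover have "(\<lambda>x. \<phi> x * (Re (F x) / \<phi> x)) = (\<lambda>x. Re (F x))" "(\<lambda>x. \<phi> x * (Im (F x) / \<phi> x)) = (\<lambda>x. Im (F x))"
      using \<phi>_pos by (auto simp: less_imp_neq[THEN not_sym])
    ultimately show ?thesis unfolding L2_\<mu>_iff by (simp add: L2_real_iff)
  qed
  show f: "f \<in> L2 \<mu>" using part[OF FL] by (simp add: f_def)
  have "(\<lambda>x. 1 * (Re (G x) / \<phi> x) + (- lam0) * f x) \<in> L2 \<mu>"
    by (rule L2_lincomb) (use part[OF GL] f in auto)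
  then show h: "h \<in> L2 \<mu>" by (simp add: h_def)
  have \<phi>f: "\<phi> x * f x = Re (F x)" "\<phi> x * (h x + lam0 * f x) = Re (G x)" for x
    using \<phi>_pos[of x] by (simp_all add: f_def h_def)
  have Re_fk: "AE x in lborel. Re (feynman_kac M X V s F x) = feynman_kac M X V s (\<lambda>x. Re (F x)) x" if s: "0 < s" for s
  proof -
    have s': "0 \<le> s" using s by simp
    have "AE x in \<mu>. square_integrable_at s (\<lambda>x. Re (F x) / \<phi> x) x \<and> square_integrable_at s (\<lambda>x. Im (F x) / \<phi> x) x"
      using AE_square_integrable_at[OF s'] part[OF FL] by (auto intro: eventually_conj)
    then have "AE x in lborel. square_integrable_at s (\<lambda>x. Re (F x) / \<phi> x) x \<and> square_integrable_at s (\<lambda>x. Im (F x) / \<phi> x) x"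
      by (simp only: AE_\<mu>_iff)
    then show ?thesis
    proof eventually_elim
      case (elim x)
      have nz: "\<phi> y \<noteq> 0" for y using \<phi>_pos[of y] by simp
      have "integrable M (\<lambda>w. fk_weight X V s x w * Re (F (x + X s w)))"
        using integrable_weight_L2[OF s' conjunct1[OF part[OF FL]] conjunct1[OF elim]] nz by simp
      moreover have "integrable M (\<lambda>w. fk_weight X V s x w * Im (F (x + X s w)))"
        using integrable_weight_L2[OF s' conjunct2[OF part[OF FL]] conjunct2[OF elim]] nz by simp
      ultimately have "integrable M (\<lambda>w. complex_of_real (fk_weight X V s x w * Re (F (x + X s w))) + \<i> * complex_of_real (fk_weight X V s x w * Im (F (x + X s w))))"
        by (intro Bochner_Integration.integrable_add integrable_mult_right integrable_of_real)
      moreover have "complex_of_real (fk_weight X V s x w * Re (F (x + X s w))) + \<i> * complex_of_real (fk_weight X V s x w * Im (F (x + X s w))) = fk_weight X V s x w *\<^sub>R F (x + X s w)" for w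
        by (simp add: complex_eq_iff)
      ultimately have "integrable M (\<lambda>w. fk_weight X V s x w *\<^sub>R F (x + X s w))" by simp
      from integral_Re[OF this] show ?case
        by (simp add: feynman_kac_def fk_weight_def)
    qed
  qed
  have "((\<lambda>s. \<integral>\<^sup>+x. ennreal ((diffquot s (\<lambda>x. \<phi> x * f x) (\<lambda>x. \<phi> x * (h x + lam0 * f x)) x)\<^sup>2) \<partial>lborel) \<longlongrightarrow> 0) (at_right 0)"
  proof (rule tendsto_sandwich[OF _ _ tendsto_const lim])
    show "\<forall>\<^sub>F s in at_right 0. (\<integral>\<^sup>+x. ennreal ((diffquot s (\<lambda>x. \<phi> x * f x) (\<lambda>x. \<phi> x * (h x + lam0 * f x)) x)\<^sup>2) \<partial>lborel)
       \<le> (\<integral>\<^sup>+x. ennreal ((norm ((1 / s) *\<^sub>R (F x - feynman_kac M X V s F x) - G x))\<^sup>2) \<partial>lborel)"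
      using eventually_at_right_less[of 0]
    proof eventually_elim
      case (elim s)
      show ?case
      proof (rule nn_integral_mono_AE)
        show "AE x in lborel. ennreal ((diffquot s (\<lambda>x. \<phi> x * f x) (\<lambda>x. \<phi> x * (h x + lam0 * f x)) x)\<^sup>2) \<le> ennreal ((norm ((1 / s) *\<^sub>R (F x - feynman_kac M X V s F x) - G x))\<^sup>2)"
          using Re_fk[OF elim]
        proof eventually_elim
          case (elim x)
          have "diffquot s (\<lambda>x. \<phi> x * f x) (\<lambda>x. \<phi> x * (h x + lam0 * f x)) x = Re ((1 / s) *\<^sub>R (F x - feynman_kac M X V s F x) - G x)"
            unfolding diffquot_def \<phi>f using elim by simp
          then show ?case
            using abs_Re_le_cmod[of "(1 / s) *\<^sub>R (F x - feynman_kac M X V s F x) - G x"]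
            by (intro ennreal_leI) (simp add: abs_le_square_iff[symmetric])
        qed
      qed
    qed
  qed simp
  then show "S.gen f h" using gen_iff_diffquot[OF f h] by simp
qed

lemma gen_imp_schroedinger:
  assumes g: "S.gen f h"
  shows "schroedinger_op M X V (\<lambda>x. complex_of_real (\<phi> x * f x)) (\<lambda>x. complex_of_real (\<phi> x * (h x + lam0 * f x)))"
proof -
  note L = S.gen_L2[OF g]
  have "(\<lambda>x. 1 * h x + lam0 * f x) \<in> L2 \<mu>" by (rule L2_lincomb[OF L(2,1)])
  then have hL: "(\<lambda>x. h x + lam0 * f x) \<in> L2 \<mu>" by simp
  have cL: "(\<lambda>x. complex_of_real (\<phi> x * k x)) \<in> L2 lborel" if "k \<in> L2 \<mu>" for k
    using that unfolding L2_\<mu>_iff by (auto simp: L2_def norm_mult power_mult_distrib simp flip: of_real_mult)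
  have "(norm ((1 / s) *\<^sub>R (complex_of_real (\<phi> x * f x) - feynman_kac M X V s (\<lambda>x. complex_of_real (\<phi> x * f x)) x) - complex_of_real (\<phi> x * (h x + lam0 * f x))))\<^sup>2
     = (diffquot s (\<lambda>x. \<phi> x * f x) (\<lambda>x. \<phi> x * (h x + lam0 * f x)) x)\<^sup>2" for s x
  proof -
    have "(1 / s) *\<^sub>R (complex_of_real (\<phi> x * f x) - feynman_kac M X V s (\<lambda>x. complex_of_real (\<phi> x * f x)) x) - complex_of_real (\<phi> x * (h x + lam0 * f x))
       = complex_of_real (diffquot s (\<lambda>x. \<phi> x * f x) (\<lambda>x. \<phi> x * (h x + lam0 * f x)) x)"
      unfolding feynman_kac_of_real diffquot_def by (simp add: scaleR_conv_of_real)
    then show ?thesis by (simp only: norm_of_real power2_abs)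
  qed
  then show ?thesis
    unfolding schroedinger_op_def
    using cL[OF L(1)] cL[OF hL] gen_iff_diffquot[OF L] g by (simp del: of_real_mult of_real_add)
qed

text \<open>
  \<open>G - p\<close> corresponds to \<open>H - (\<lambda>\<^sub>0 + p)\<close> under multiplication by \<open>\<phi>\<close>. The real part of a complex
  solution solves the real equation, because \<open>p\<close> and the data are real.
\<close>
lemma resolvent_surjective:
  assumes z: "complex_of_real (lam0 + p) \<in> resolvent_set (schroedinger_op M X V)" and g: "g \<in> L2 \<mu>"
  shows "\<exists>f h. S.gen f h \<and> (\<forall>k\<in>L2 \<mu>. ip \<mu> (S.shift p f h) k = ip \<mu> g k)"
proof -
  have "(\<lambda>x. complex_of_real (\<phi> x * g x)) \<in> L2 lborel"
    using g unfolding L2_\<mu>_iff by (auto simp: L2_def simp flip: of_real_mult)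
  then obtain F G where H: "schroedinger_op M X V F G"
    and eq: "AE x in lborel. G x - complex_of_real (lam0 + p) * F x = complex_of_real (\<phi> x * g x)"
  proof -
    from z have "\<forall>g\<in>L2 lborel. \<exists>F G. schroedinger_op M X V F G \<and> (AE x in lborel. G x - complex_of_real (lam0 + p) * F x = g x)"
      unfolding resolvent_set_def mem_Collect_eq by (rule conjunct1)
    from bspec[OF this \<open>(\<lambda>x. complex_of_real (\<phi> x * g x)) \<in> L2 lborel\<close>] that show thesis by blast
  qed
  define f where "f = (\<lambda>x. Re (F x) / \<phi> x)"
  define h where "h = (\<lambda>x. Re (G x) / \<phi> x - lam0 * f x)"
  have gen: "S.gen f h" and f: "f \<in> L2 \<mu>" and h: "h \<in> L2 \<mu>"
    using schroedinger_imp_gen[OF H] by (auto simp: f_def h_def)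
  have "AE x in lborel. S.shift p f h x = g x"
    using eq
  proof eventually_elim
    case (elim x)
    from arg_cong[OF this, of Re] have "Re (G x) - (lam0 + p) * Re (F x) = \<phi> x * g x" by simp
    then show ?case using \<phi>_pos[of x] by (simp add: S.shift_def f_def h_def field_simps)
  qed
  then have ae: "AE x in \<mu>. S.shift p f h x = g x" by (simp add: AE_\<mu>_iff)
  have "ip \<mu> (S.shift p f h) k = ip \<mu> g k" if k: "k \<in> L2 \<mu>" for k
    unfolding ip_def
  proof (rule integral_cong_AE)
    note [measurable] = L2_borel[OF S.shift_L2[OF gen]] L2_borel[OF g] L2_borel[OF k]
    show "(\<lambda>x. S.shift p f h x * k x) \<in> borel_measurable \<mu>" "(\<lambda>x. g x * k x) \<in> borel_measurable \<mu>"
      by measurable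
    show "AE x in \<mu>. S.shift p f h x * k x = g x * k x" using ae by eventually_elim simp
  qed
  then show ?thesis using gen by blast
qed

lemma resolvent_bounded:
  assumes z: "complex_of_real (lam0 + p) \<in> resolvent_set (schroedinger_op M X V)"
  shows "\<exists>C. \<forall>f h. S.gen f h \<longrightarrow> ip \<mu> f f \<le> C * ip \<mu> (S.shift p f h) (S.shift p f h)"
proof -
  obtain C where C: "\<And>F G. schroedinger_op M X V F G \<Longrightarrow> L2_norm lborel F \<le> C * L2_norm lborel (\<lambda>x. G x - complex_of_real (lam0 + p) * F x)"
    using z unfolding resolvent_set_def by blast
  have norm_eq: "L2_norm lborel (\<lambda>x. complex_of_real (\<phi> x * k x)) = sqrt (ip \<mu> k k)" if k: "k \<in> L2 \<mu>" for k
  proof -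
    have [measurable]: "k \<in> borel_measurable borel" by (rule L2_borel[OF k])
    have "(\<integral>x. (norm (complex_of_real (\<phi> x * k x)))\<^sup>2 \<partial>lborel) = (\<integral>x. (\<phi> x)\<^sup>2 *\<^sub>R (k x)\<^sup>2 \<partial>lborel)"
      by (intro Bochner_Integration.integral_cong refl) (simp only: norm_of_real power2_abs real_scaleR_def power_mult_distrib)
    also have "\<dots> = (\<integral>x. (k x)\<^sup>2 \<partial>\<mu>)"
      unfolding gs_measure_def by (rule integral_density[symmetric]) auto
    also have "\<dots> = ip \<mu> k k" by (simp add: ip_def power2_eq_square)
    finally show ?thesis by (simp add: L2_norm_def)
  qed
  show ?thesis
  proof (intro exI[of _ "C\<^sup>2"] allI impI)
    fix f h assume g: "S.gen f h"
    have sL: "S.shift p f h \<in> L2 \<mu>" by (rule S.shift_L2[OF g])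
    have "(\<lambda>x. complex_of_real (\<phi> x * (h x + lam0 * f x)) - complex_of_real (lam0 + p) * complex_of_real (\<phi> x * f x))
       = (\<lambda>x. complex_of_real (\<phi> x * S.shift p f h x))"
      by (auto simp: S.shift_def algebra_simps)
    with C[OF gen_imp_schroedinger[OF g]] have "sqrt (ip \<mu> f f) \<le> C * sqrt (ip \<mu> (S.shift p f h) (S.shift p f h))"
      using norm_eq[OF S.gen_L2(1)[OF g]] norm_eq[OF sL] by simp
    then have "(sqrt (ip \<mu> f f))\<^sup>2 \<le> (C * sqrt (ip \<mu> (S.shift p f h) (S.shift p f h)))\<^sup>2"
      by (intro power_mono) (auto simp: ip_nonneg)
    then show "ip \<mu> f f \<le> C\<^sup>2 * ip \<mu> (S.shift p f h) (S.shift p f h)"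
      by (simp add: power_mult_distrib ip_nonneg)
  qed
qed

text \<open>
  \<open>(T\<^sub>n f, f) = (f, f)\<close> says that \<open>f (w 0) - f (w n)\<close> has second moment 0 under the stationary path
  measure. Hence a path in the level set \<open>A = {f > c}\<close> at time 0 is there at time \<open>n\<close>. Since the
  transition kernel has a strictly positive density with respect to the underlying measure, the same
  holds for \<open>x + X\<close>. So each level set is null or conull.
\<close>
lemma invariant_imp_const:
  assumes f: "f \<in> L2 \<mu>" and inv: "\<And>n::nat. ip \<mu> (T n f) f = ip \<mu> f f"
    and irred: "\<And>A. A \<in> sets borel \<Longrightarrow> (\<And>n::nat. AE x in lborel. x \<in> A \<longrightarrow> (AE w in M. x + X n w \<in> A)) \<Longrightarrow>
       emeasure lborel A = 0 \<or> emeasure lborel (- A) = 0"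
  shows "\<exists>c. AE x in \<mu>. f x = c"
proof (rule AE_const_of_zero_one[OF prob_\<mu>])
  have [measurable]: "f \<in> borel_measurable borel" by (rule L2_borel[OF f])
  then show "f \<in> borel_measurable \<mu>" by measurable
  fix c
  define A where "A = {x. c < f x}"
  have A[measurable]: "A \<in> sets borel" unfolding A_def by measurable
  have "AE x in lborel. x \<in> A \<longrightarrow> (AE w in M. x + X n w \<in> A)" for n :: nat
  proof -
    have n0: "0 \<le> real n" by simp
    note [measurable] = X_m[OF n0] weight_m[OF n0]
    have sq: "(\<integral>w. (f (w t))\<^sup>2 \<partial>Pm) = ip \<mu> f f" "integrable Pm (\<lambda>w. (f (w t))\<^sup>2)" for t
    proof -
      have "(\<integral>w. (f (w t))\<^sup>2 \<partial>Pm) = (\<integral>x. (f x)\<^sup>2 \<partial>distr Pm borel (\<lambda>w. w t))"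
        by (rule integral_distr[OF coord_measurable, symmetric]) measurable
      then show "(\<integral>w. (f (w t))\<^sup>2 \<partial>Pm) = ip \<mu> f f" by (simp add: distr_coord ip_def power2_eq_square)
      have "integrable (distr Pm borel (\<lambda>w. w t)) (\<lambda>x. (f x)\<^sup>2)"
        using f by (simp add: distr_coord L2_real_iff)
      then show "integrable Pm (\<lambda>w. (f (w t))\<^sup>2)"
        by (subst (asm) integrable_distr_eq[OF coord_measurable]) auto
    qed
    have fm: "(\<lambda>w. f (w t)) \<in> borel_measurable Pm" for t
      by (rule measurable_compose[OF coord_measurable]) measurable
    have L: "(\<lambda>w. f (w t)) \<in> L2 Pm" for t using sq(2) fm by (simp add: L2_real_iff)
    have cross: "(\<integral>w. f (w 0) * f (w (real n)) \<partial>Pm) = ip \<mu> f f"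
      using fdd2[OF f f n0] inv[of n] by (simp add: ip_def mult.commute)
    have "(\<integral>w. (f (w 0) - f (w (real n)))\<^sup>2 \<partial>Pm) = 0"
    proof -
      have "ip Pm (\<lambda>w. 1 * f (w 0) + (- 1) * f (w (real n))) (\<lambda>w. 1 * f (w 0) + (- 1) * f (w (real n))) = 0"
        unfolding ip_lincomb_self[OF L L] using sq(1) cross by (simp add: ip_def power2_eq_square)
      then show ?thesis by (simp add: ip_def power2_eq_square)
    qed
    moreover have "integrable Pm (\<lambda>w. (f (w 0) - f (w (real n)))\<^sup>2)"
      using L2_lincomb[OF L L, of 1 0 "- 1" "real n"] by (simp add: L2_real_iff)
    ultimately have eq: "AE w in Pm. f (w 0) = f (w (real n))"
      by (subst (asm) integral_nonneg_eq_0_iff_AE) (auto elim!: eventually_mono)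
    have cA: "- A \<in> sets borel" by simp
    have "(\<integral>w. indicator A (w 0) * indicator (- A) (w (real n)) \<partial>Pm) = (0::real)"
    proof -
      have "(\<integral>w. indicator A (w 0) * indicator (- A) (w (real n)) \<partial>Pm) = (\<integral>w. 0 \<partial>Pm :: real)"
      proof (rule integral_cong_AE)
        have "(\<lambda>w. indicator A (w 0) :: real) \<in> borel_measurable Pm"
          by (rule measurable_compose[OF coord_measurable]) measurable
        moreover have "(\<lambda>w. indicator (- A) (w (real n)) :: real) \<in> borel_measurable Pm"
          by (rule measurable_compose[OF coord_measurable]) measurable
        ultimately show "(\<lambda>w. indicator A (w 0) * indicator (- A) (w (real n)) :: real) \<in> borel_measurable Pm" by measurable
        show "AE w in Pm. indicator A (w 0) * indicator (- A) (w (real n)) = (0::real)"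
          using eq by eventually_elim (auto simp: A_def indicator_def)
      qed simp
      then show ?thesis by simp
    qed
    then have int0: "(\<integral>x. indicator A x * T n (indicator (- A)) x \<partial>\<mu>) = 0"
      using fdd2[OF L2_indicator[OF A] L2_indicator[OF cA] n0] by simp
    have TL: "T n (indicator (- A)) \<in> L2 \<mu>" by (rule T_in_L2[OF n0 L2_indicator[OF cA]])
    have T0: "0 \<le> T n (indicator (- A)) x" for x by (simp add: T_eq_K[OF n0])
    have "AE x in \<mu>. indicator A x * T n (indicator (- A)) x = 0"
      using int0 integrable_mult_L2[OF L2_indicator[OF A] TL] T0
      by (subst (asm) integral_nonneg_eq_0_iff_AE) auto
    then have "AE x in \<mu>. x \<in> A \<longrightarrow> (AE w in M. x + X n w \<in> A)"
      using AE_square_integrable_at[OF n0 L2_indicator[OF cA]]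
    proof eventually_elim
      case (elim x)
      show ?case
      proof
        assume "x \<in> A"
        then have "(\<integral>w. indicator (- A) (x + X n w) \<partial>kern n x) = (0::real)"
          using elim(1) by (simp add: T_eq_kern[OF n0])
        then have "AE w in kern n x. indicator (- A) (x + X n w) = (0::real)"
          using elim(2) by (subst (asm) integral_nonneg_eq_0_iff_AE) (auto simp: square_integrable_at_def)
        then have "AE w in M. indicator (- A) (x + X n w) = (0::real)"
          unfolding kern_def
          by (subst (asm) AE_density) (use kern_density_pos[of n x] in \<open>auto simp: ennreal_less_zero_iff simp del: times_divide_eq_left elim!: eventually_mono\<close>)
        then show "AE w in M. x + X n w \<in> A" by eventually_elim (auto simp: indicator_def split: if_splits)
      qed
    qed
    then show ?thesis by (simp only: AE_\<mu>_iff)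
  qed
  then have "emeasure lborel A = 0 \<or> emeasure lborel (- A) = 0" by (rule irred[OF A])
  then have "(AE x in lborel. x \<notin> A) \<or> (AE x in lborel. x \<notin> - A)"
    using AE_iff_null_sets[of A lborel] AE_iff_null_sets[of "- A" lborel] by auto
  then have "(AE x in lborel. f x \<le> c) \<or> (AE x in lborel. c < f x)" by (simp add: A_def not_less not_le)
  then show "(AE x in \<mu>. f x \<le> c) \<or> (AE x in \<mu>. c < f x)" by (simp only: AE_\<mu>_iff)
qed

end
section \<open>The zero-one law\<close>

lemma (in gst_setting) sets_path_norm: "{w \<in> space Pm. c \<le> norm (w t)} \<in> sets Pm"
proof -
  have "(\<lambda>w. norm (w t)) \<in> borel_measurable Pm"
    by (rule measurable_compose[OF coord_measurable]) measurable
  then show ?thesis by measurable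
qed

lemma (in gst_setting) prob_path_norm:
  "Pm.prob {w \<in> space Pm. c \<le> norm (w t)} = \<mu>.prob {x. c \<le> norm x}"
proof -
  have "\<mu>.prob {x. c \<le> norm x} = measure (distr Pm borel (\<lambda>w. w t)) {x. c \<le> norm x}" by (simp add: distr_coord)
  also have "\<dots> = Pm.prob ((\<lambda>w. w t) -` {x. c \<le> norm x} \<inter> space Pm)"
    by (rule measure_distr[OF coord_measurable]) measurable
  also have "(\<lambda>w. w t) -` {x. c \<le> norm x} \<inter> space Pm = {w \<in> space Pm. c \<le> norm (w t)}" by auto
  finally show ?thesis by simp
qed

lemma (in gst_setting) path_correlation:
  assumes B[measurable]: "B \<in> sets borel" "C \<in> sets borel" and st: "s \<le> t"
  shows "Pm.prob ({w \<in> space Pm. w s \<in> B} \<inter> {w \<in> space Pm. w t \<in> C}) = ip \<mu> (T (t - s) (indicator C)) (indicator B)"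
proof -
  let ?E = "{w \<in> space Pm. w s \<in> B} \<inter> {w \<in> space Pm. w t \<in> C}"
  have "?E = ((\<lambda>w. w s) -` B \<inter> space Pm) \<inter> ((\<lambda>w. w t) -` C \<inter> space Pm)" by auto
  then have E: "?E \<in> sets Pm" by (simp only:) (intro sets.Int measurable_sets[OF coord_measurable] B)
  have "Pm.prob ?E = (\<integral>w. indicator ?E w \<partial>Pm)" using sets.sets_into_space[OF E] by (simp add: Int_absorb2)
  also have "\<dots> = (\<integral>w. indicator B (w s) * indicator C (w t) \<partial>Pm)"
    by (intro Bochner_Integration.integral_cong refl) (auto simp: indicator_def)
  also have "\<dots> = ip \<mu> (T (t - s) (indicator C)) (indicator B)"
    using fdd2[OF L2_indicator[OF B(1)] L2_indicator[OF B(2)] st] by (simp add: ip_def mult.commute)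
  finally show ?thesis .
qed

lemma (in gst_setting) integral_test_iff:
  assumes mono: "mono_on {0..} \<tau>"
  shows "integral_test \<phi> 1 \<tau> < \<infinity> \<longleftrightarrow> summable (\<lambda>n. \<mu>.prob {x. \<tau> (real n) \<le> norm x})"
proof -
  let ?g = "\<lambda>r. ennreal (\<mu>.prob {x. \<tau> r \<le> norm x})"
  have g: "(\<integral>\<^sup>+x\<in>{x. c \<le> norm x}. ennreal ((\<phi> (1 *\<^sub>R x))\<^sup>2) \<partial>lborel) = ennreal (\<mu>.prob {x. c \<le> norm x})" for c
  proof -
    have "(\<integral>\<^sup>+x\<in>{x. c \<le> norm x}. ennreal ((\<phi> (1 *\<^sub>R x))\<^sup>2) \<partial>lborel) = emeasure \<mu> {x. c \<le> norm x}"
      unfolding gs_measure_def by (subst emeasure_density) auto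
    then show ?thesis by (simp add: \<mu>.emeasure_eq_measure)
  qed
  have anti: "?g s \<le> ?g r" if "1 \<le> r" "r \<le> s" for r s
  proof (intro ennreal_leI \<mu>.finite_measure_mono)
    have "\<tau> r \<le> \<tau> s" using mono_onD[OF mono, of r s] that by simp
    then show "{x. \<tau> s \<le> norm x} \<subseteq> {x. \<tau> r \<le> norm x}" by auto
  qed (simp, measurable)
  have "integral_test \<phi> 1 \<tau> < \<infinity> \<longleftrightarrow> (\<Sum>n. ?g (real (Suc n))) < \<infinity>"
    unfolding integral_test_def g by (rule nn_integral_antimono_less_top_iff[OF anti]) auto
  also have "\<dots> \<longleftrightarrow> summable (\<lambda>n. \<mu>.prob {x. \<tau> (real (Suc n)) \<le> norm x})"
  proof
    assume "(\<Sum>n. ?g (real (Suc n))) < \<infinity>"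
    then show "summable (\<lambda>n. \<mu>.prob {x. \<tau> (real (Suc n)) \<le> norm x})"
      by (intro summable_suminf_not_top) (auto simp: less_top)
  next
    assume "summable (\<lambda>n. \<mu>.prob {x. \<tau> (real (Suc n)) \<le> norm x})"
    then have "(\<Sum>n. ?g (real (Suc n))) = ennreal (\<Sum>n. \<mu>.prob {x. \<tau> (real (Suc n)) \<le> norm x})"
      by (intro suminf_ennreal2) auto
    then show "(\<Sum>n. ?g (real (Suc n))) < \<infinity>" by simp
  qed
  also have "\<dots> \<longleftrightarrow> summable (\<lambda>n. \<mu>.prob {x. \<tau> (real n) \<le> norm x})"
    by (rule summable_Suc_iff)
  finally show ?thesis .
qed

theorem theorem3p1:
  fixes M :: "'w measure"
    and X :: "real \<Rightarrow> 'w \<Rightarrow> real ^ 'n"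
    and A :: "real ^ 'n ^ 'n"
    and \<nu> :: "(real ^ 'n) measure"
    and nud V phi0 :: "real ^ 'n \<Rightarrow> real"
    and lam0 :: real
    and P :: "real ^ 'n \<Rightarrow> (real \<Rightarrow> real ^ 'n) measure"
    and \<tau> :: "real \<Rightarrow> real"
  assumes "transpose A = A" and "\<forall>\<xi>. 0 \<le> (A *v \<xi>) \<bullet> \<xi>"
    and "symmetric_levy_measure \<nu>" and "emeasure \<nu> (UNIV - {0}) = \<infinity>"
    and "nud \<in> borel_measurable borel" and "\<forall>z. z \<noteq> 0 \<longrightarrow> 0 < nud z"
    and "\<nu> = density lborel (\<lambda>z. ennreal (nud z))"
    and "levy_process M X" and "has_levy_exponent M X (levy_exponent A \<nu>)"
    and "X_kato_potential M X V"
    and "lam0 = Inf (Re ` spectrum (schroedinger_op M X V))"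
    and "isolated_eigenvalue (schroedinger_op M X V) (complex_of_real lam0)"
    and "ground_state (schroedinger_op M X V) lam0 phi0"
    and "gst_process M X V lam0 phi0 P"
    and "mono_on {0..} \<tau>" and "\<forall>r\<ge>0. 0 < \<tau> r"
  shows "measure (path_measure phi0 P)
           {w \<in> space (path_measure phi0 P). \<exists>\<^sub>\<infinity>n::nat. \<tau> (real n) \<le> norm (w (real n))}
         = (if integral_test phi0 1 \<tau> < \<infinity> then 0 else 1)"
proof -
  note A = assms(2) and \<nu> = assms(3) and nud = assms(5,6,7) and L = assms(8) and E = assms(9)
  interpret gst_setting M X V phi0 lam0 P
  proof
    show "distr M borel (\<lambda>w. - X r w) = distr M borel (X r)" if "0 \<le> r" for r
      by (rule levy_law_symmetric[OF L E that])
  qed (use assms in \<open>auto simp: X_kato_potential_def ground_state_def\<close>)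
  define B where "B n = {x :: real ^ 'n. \<tau> (real n) \<le> norm x}" for n :: nat
  define Ev where "Ev n = {w \<in> space Pm. \<tau> (real n) \<le> norm (w (real n))}" for n :: nat
  have B[measurable]: "B n \<in> sets borel" for n unfolding B_def by measurable
  have Ev[measurable]: "Ev n \<in> Pm.events" for n unfolding Ev_def by (rule sets_path_norm)
  have pEv: "Pm.prob (Ev n) = \<mu>.prob (B n)" for n unfolding Ev_def B_def by (rule prob_path_norm)
  have event: "{w \<in> space Pm. \<exists>\<^sub>\<infinity>n::nat. \<tau> (real n) \<le> norm (w (real n))} = {w \<in> space Pm. \<exists>\<^sub>\<infinity>n. w \<in> Ev n}"
    by (auto simp: Ev_def)
  have test: "integral_test phi0 1 \<tau> < \<infinity> \<longleftrightarrow> summable (\<lambda>n. Pm.prob (Ev n))"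
    using integral_test_iff[OF assms(15)] by (simp add: pEv B_def)
  show ?thesis
  proof (cases "integral_test phi0 1 \<tau> < \<infinity>")
    case True
    then have s: "summable (\<lambda>n. Pm.prob (Ev n))" using test by simp
    have "AE w in Pm. eventually (\<lambda>n. w \<in> space Pm - Ev n) sequentially"
      by (rule borel_cantelli_AE1[OF Ev _ s]) (simp add: Pm.emeasure_eq_measure)
    then have "AE w in Pm. \<not> (\<exists>\<^sub>\<infinity>n. w \<in> Ev n)"
      by eventually_elim (auto simp: frequently_def cofinite_eq_sequentially elim!: eventually_mono)
    then have "Pm.prob {w \<in> space Pm. \<exists>\<^sub>\<infinity>n. w \<in> Ev n} = 0"
      by (subst Pm.prob_eq_0) (auto simp: INFM_nat_le)
    then show ?thesis using True by (simp add: event)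
  next
    case False
    then have ns: "\<not> summable (\<lambda>n. Pm.prob (Ev n))" using test by simp
    from assms(12) obtain U where U: "open U" "U \<inter> spectrum (schroedinger_op M X V) = {complex_of_real lam0}"
      by (auto simp: isolated_eigenvalue_def isolated_in_def)
    then have "complex_of_real lam0 \<in> U" by auto
    then obtain e where e: "0 < e" "ball (complex_of_real lam0) e \<subseteq> U"
      using U(1) open_contains_ball by blast
    have res: "complex_of_real (lam0 + p) \<in> resolvent_set (schroedinger_op M X V)" if "0 < p" "p < e" for p
    proof -
      have "complex_of_real (lam0 + p) \<in> U" using e that by (auto simp: subset_iff dist_norm)
      moreover have "complex_of_real (lam0 + p) \<noteq> complex_of_real lam0" using that by simp
      ultimately have "complex_of_real (lam0 + p) \<notin> spectrum (schroedinger_op M X V)" using U(2) by blast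
      then show ?thesis by (simp add: spectrum_def)
    qed
    have irred: "\<exists>c. AE x in \<mu>. f x = c" if f: "f \<in> L2 \<mu>" and inv: "\<And>n::nat. ip \<mu> (T n f) f = ip \<mu> f f" for f
    proof (rule invariant_imp_const[OF f inv])
      show "emeasure lborel D = 0 \<or> emeasure lborel (- D) = 0"
        if "D \<in> sets borel" "\<And>n::nat. AE x in lborel. x \<in> D \<longrightarrow> (AE w in M. x + X n w \<in> D)" for D
      proof (rule levy_no_invariant_set[OF L E levy_exponent_gap[OF A \<nu> nud] _ that])
        show "levy_exponent A \<nu> 0 = 0" by (simp add: levy_exponent_def)
      qed
    qed
    have one: "ip \<mu> (T t (\<lambda>_. 1)) f = ip \<mu> (\<lambda>_. 1) f" if t: "0 \<le> t" and f: "f \<in> L2 \<mu>" for t f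
      unfolding ip_def
    proof (rule integral_cong_AE)
      note [measurable] = L2_borel[OF f] L2_borel[OF T_in_L2[OF t L2_one]]
      show "(\<lambda>x. T t (\<lambda>_. 1) x * f x) \<in> borel_measurable \<mu>" "(\<lambda>x. 1 * f x) \<in> borel_measurable \<mu>"
        by measurable
      show "AE x in \<mu>. T t (\<lambda>_. 1) x * f x = 1 * f x" using T_one_AE[OF t] by eventually_elim simp
    qed
    have "\<exists>r. 0 < r \<and> r < 1 \<and> (\<forall>n::nat. \<forall>a\<in>L2 \<mu>. \<forall>b\<in>L2 \<mu>. ip \<mu> b (\<lambda>_. 1) = 0 \<longrightarrow>
           \<bar>ip \<mu> (T n a) b\<bar> \<le> r ^ n * sqrt (ip \<mu> a a) * sqrt (ip \<mu> b b))"
      by (rule S.spectral_gap[OF e(1) resolvent_surjective[OF res] resolvent_bounded[OF res] one irred])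
    then obtain r where r: "0 < r" "r < 1" and
      gap: "\<And>n a b. a \<in> L2 \<mu> \<Longrightarrow> b \<in> L2 \<mu> \<Longrightarrow> ip \<mu> b (\<lambda>_. 1) = 0 \<Longrightarrow>
           \<bar>ip \<mu> (T (real n) a) b\<bar> \<le> r ^ n * sqrt (ip \<mu> a a) * sqrt (ip \<mu> b b)"
      by blast
    have corr: "Pm.prob (Ev i \<inter> Ev j) - Pm.prob (Ev i) * Pm.prob (Ev j) \<le> r ^ (j - i) * sqrt (Pm.prob (Ev i)) * sqrt (Pm.prob (Ev j))"
      if ij: "i \<le> j" for i j
    proof -
      define p where "p n = \<mu>.prob (B n)" for n
      let ?a = "indicator (B j) :: real ^ 'n \<Rightarrow> real" and ?c = "indicator (B i) :: real ^ 'n \<Rightarrow> real"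
      \<comment> \<open>The covariance of the two events is \<open>(T\<^bsub>j-i\<^esub> 1\<^bsub>B j\<^esub>, 1\<^bsub>B i\<^esub> - p i)\<close>, and the centred
        indicator is orthogonal to 1.\<close>
      let ?b = "\<lambda>x. 1 * ?c x + (- p i) * 1"
      have aL: "?a \<in> L2 \<mu>" and cL: "?c \<in> L2 \<mu>" by (auto intro: L2_indicator B)
      have bL: "?b \<in> L2 \<mu>" by (rule L2_lincomb[OF cL L2_one])
      have ind1: "ip \<mu> (indicator (B n)) (\<lambda>_. 1) = p n" "ip \<mu> (indicator (B n)) (indicator (B n)) = p n" for n
      proof -
        have "(\<lambda>x. indicator (B n) x * indicator (B n) x :: real) = indicator (B n)" by (auto simp: indicator_def)
        then show "ip \<mu> (indicator (B n)) (\<lambda>_. 1) = p n" "ip \<mu> (indicator (B n)) (indicator (B n)) = p n"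
          by (simp_all add: ip_def p_def)
      qed
      have ip11: "ip \<mu> (\<lambda>_. 1) (\<lambda>_. 1) = 1" using \<mu>.prob_space by (simp add: ip_def)
      have b1: "ip \<mu> ?b (\<lambda>_. 1) = 0"
        by (simp only: ip_lincomb_left[OF cL L2_one L2_one] ind1 ip11)
      have bb: "ip \<mu> ?b ?b \<le> p i"
        unfolding ip_lincomb_self[OF cL L2_one] ind1 ip11 by (simp add: power2_eq_square p_def)
      have dj: "0 \<le> real (j - i)" by simp
      have "ip \<mu> (T (real (j - i)) ?a) ?b = ip \<mu> (T (real (j - i)) ?a) ?c - p i * ip \<mu> (T (real (j - i)) ?a) (\<lambda>_. 1)"
        using ip_lincomb_right[OF cL L2_one T_in_L2[OF dj aL], of 1 "- p i"] by simp
      also have "ip \<mu> (T (real (j - i)) ?a) (\<lambda>_. 1) = p j"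
        using T_ip_symmetric[OF dj aL L2_one] one[OF dj aL] ind1(1)[of j] by (simp add: ip_commute)
      also have "ip \<mu> (T (real (j - i)) ?a) ?c = Pm.prob (Ev i \<inter> Ev j)"
        using path_correlation[OF B[of i] B[of j], of "real i" "real j"] ij
        by (simp add: B_def Ev_def of_nat_diff)
      finally have "Pm.prob (Ev i \<inter> Ev j) - p i * p j \<le> r ^ (j - i) * sqrt (p j) * sqrt (ip \<mu> ?b ?b)"
        using gap[OF aL bL b1, of "j - i"] by (simp add: ind1)
      also have "\<dots> \<le> r ^ (j - i) * sqrt (p j) * sqrt (p i)"
        using bb r by (intro mult_left_mono) (auto simp: p_def)
      finally show ?thesis by (simp add: pEv p_def mult_ac)
    qed
    have "Pm.prob {w \<in> space Pm. \<exists>\<^sub>\<infinity>n. w \<in> Ev n} = 1"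
      by (rule Pm.borel_cantelli_decaying_correlations[OF Ev r corr ns])
    then show ?thesis using False by (simp add: event)
  qed
qed

end
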